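(* Let $G$, $H_0$, $V$, $H=H_0+V$, $R(\kappa)=(H+\kappa^2)^{-1}$ be as in the context, and assume that $V$ satisfies the assumption $(\mathrm A_\beta)$ of the context for some integer $\beta\ge 3$. Assume that the threshold $0$ is an exceptional point of the first kind, i.e. $\mathcal E\supsetneq\mathsf E=\{0\}$. Then, as $\kappa\to0$ with $\mathop{\mathrm{Re}}\kappa>0$, $$R(\kappa)=\sum_{j=-1}^{\beta-4}\kappa^jG_j+\mathcal O(\kappa^{\beta-3})\quad\text{in }\mathcal B^{\beta-1},$$ with $G_j\in\mathcal B^{j+3}$ for $j$ even and $G_j\in\mathcal B^{j+2}$ for $j$ odd. In particular, the coefficients $G_{-2}$ and $G_{-1}$ of $\kappa^{-2}$ and $\kappa^{-1}$ satisfy $G_{-2}=\mathsf P=0$ and $G_{-1}=\mathcal P\ne0$.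
   Context: Graph. Let $(K,E_0)$ be a connected, finite, undirected, simple graph (no loops, no multiple edges), and for $\alpha=1,\dots,N$ let $(L_\alpha,E_\alpha)$ be a copy of the discrete half-line, $L_\alpha=\{1,2,\dots\}$, $E_\alpha=\{\{n,n+1\}: n\in L_\alpha\}$. Fix vertices $x_1,\dots,x_N\in K$ (not necessarily distinct). Let $G=K\cup L_1\cup\dots\cup L_N$ (disjoint union), with edges those of $E_0,E_1,\dots,E_N$ together with $\{x_\alpha,1^{(\alpha)}\}$, $\alpha=1,\dots,N$, where $1^{(\alpha)}$ is the point $1\in L_\alpha$. Free operator. For $u\colon K\to\mathbb C$ set $(h_0u)[x]=\sum_{y\in K,\{x,y\}\in E_0}(u[x]-u[y])+\sum_{\alpha=1}^Ns_\alpha[x]u[x]$, where $s_\alpha[x]=1$ if $x=x_\alpha$ and $0$ otherwise. For $u\colon L_\alpha\to\mathbb C$ set $(h_\alpha u)[1]=2u[1]-u[2]$ and $(h_\alpha u)[n]=2u[n]-u[n+1]-u[n-1]$ for $n\ge2$. Let $H_0=h_0\oplus h_1\oplus\dots\oplus h_N$, acting on all functions on $G$ decomposed as functions on $K,L_1,\dots,L_N$; on $\mathcal H=\ell^2(G)$ it is bounded and self-adjoint. Spaces. For $s\in\mathbb R$, $\mathcal L^s=\ell^{1,s}(G)$ is the space of $u\colon G\to\mathbb C$ with $\sum_{x\in K}|u[x]|+\sum_{\alpha}\sum_{n\in L_\alpha}(1+n^2)^{s/2}|u[n]|<\infty$; its dual $(\mathcal L^s)^*=\ell^{\infty,-s}(G)$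 is the space of $u$ with $\sup_{x\in K}|u[x]|<\infty$ and $\sup_{n\in L_\alpha}(1+n^2)^{-s/2}|u[n]|<\infty$ for all $\alpha$. Put $\mathcal B^s=\mathcal B(\mathcal L^s,(\mathcal L^s)^* )$. $\langle u,w\rangle=\sum_{x\in G}\overline{u[x]}w[x]$ whenever this converges absolutely, and $|\Psi\rangle\langle\Phi|$ is the operator $u\mapsto\langle\Phi,u\rangle\Psi$. $(\Phi\cdot\Psi)[x]=\Phi[x]\Psi[x]$ is the pointwise product. Assumption $(\mathrm A_\beta)$, $\beta\ge1$: $V\in\mathcal B(\mathcal H)$ is self-adjoint, and there exist a Hilbert space $\mathcal K$, an injective operator $v\in\mathcal B(\mathcal K,\mathcal L^\beta)$ and a self-adjoint unitary operator $U\in\mathcal B(\mathcal K)$ such that $V=vUv^*\in\mathcal B((\mathcal L^\beta)^*,\mathcal L^\beta)$. Put $H=H_0+V$ and $R(\kappa)=(H+\kappa^2)^{-1}$ for $-\kappa^2\notin\sigma(H)$. Eigenspaces. Let $\mathbf n^{(\alpha)}[x]=m$ if $x=m\in L_\alpha$ and $0$ otherwise; $\mathbf 1^{(\alpha)}[x]=1$ if $x\in L_\alpha$ and $0$ otherwise; $\mathbb C\mathbf n=\bigoplus_\alpha\mathbb C\mathbf n^{(\alpha)}$, $\mathbb C\mathbf 1=\bigoplus_\alpha\mathbb C\mathbf 1^{(\alpha)}$. Define $\widetilde{\mathcal E}=\{\Psi\in(\mathcal L^\beta)^*: H\Psi=0\}$, $\mathcal E=\widetilde{\mathcal E}\cap(\mathbb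 C\mathbf 1\oplus\mathcal L^{\beta-2})$, $\mathsf E=\widetilde{\mathcal E}\cap\mathcal L^{\beta-2}$. Projections. A set $\{\Psi_\gamma\}\subset\mathcal E$ is an orthonormal resonance basis if the classes $[\Psi_\gamma]$ form a basis of $\mathcal E/\mathsf E$, for every $\gamma$ and $\Psi\in\mathsf E$ one has $\overline\Psi\cdot\Psi_\gamma\in\mathcal L^0$ and $\langle\Psi,\Psi_\gamma\rangle=0$, and there is an orthonormal system $\{c^{(\gamma)}\}\subset\mathbb C^N$ with $\Psi_\gamma-\sum_\alpha c^{(\gamma)}_\alpha\mathbf 1^{(\alpha)}\in\mathcal L^{\beta-2}$ for every $\gamma$. The orthogonal resonance projection is $\mathcal P=\sum_\gamma|\Psi_\gamma\rangle\langle\Psi_\gamma|$. A basis $\{\Psi_\gamma\}$ of $\mathsf E$ is an orthonormal bound basis if $\overline{\Psi_{\gamma'}}\cdot\Psi_\gamma\in\mathcal L^0$ and $\langle\Psi_{\gamma'},\Psi_\gamma\rangle=\delta_{\gamma\gamma'}$; the orthogonal bound projection is $\mathsf P=\sum_\gamma|\Psi_\gamma\rangle\langle\Psi_\gamma|$. Both are independent of the choice of bases (and are $0$ if the corresponding basis is empty). Coefficients of powers of $\kappa$ not occurring in the expansion are by convention $0$. *)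

theory Defs
  imports "HOL-Analysis.Analysis" "HOL-Library.Landau_Symbols"
begin

section \<open>Complex Hilbert spaces\<close>

text \<open>The inner product is antilinear in its first argument. Positive definiteness
  follows from the last axiom and the norm axioms, completeness is part of \<^class>\<open>banach\<close>.\<close>

class complex_hilbert = banach +
  fixes scaleC :: "complex \<Rightarrow> 'a \<Rightarrow> 'a" (infixr "*\<^sub>C" 75)
    and cinner :: "'a \<Rightarrow> 'a \<Rightarrow> complex"
  assumes scaleC_add_right: "c *\<^sub>C (x + y) = c *\<^sub>C x + c *\<^sub>C y"
    and scaleC_add_left: "(c + d) *\<^sub>C x = c *\<^sub>C x + d *\<^sub>C x"
    and scaleC_scaleC: "c *\<^sub>C (d *\<^sub>C x) = (c * d) *\<^sub>C x"
    and scaleC_of_real: "complex_of_real r *\<^sub>C x = r *\<^sub>R x"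
    and cinner_commute: "cinner x y = cnj (cinner y x)"
    and cinner_add_right: "cinner x (y + z) = cinner x y + cinner x z"
    and cinner_scaleC_right: "cinner x (c *\<^sub>C y) = c * cinner x y"
    and norm_eq_sqrt_cinner: "norm x = sqrt (Re (cinner x x))"

definition clinear_op :: "('h::complex_hilbert \<Rightarrow> 'h) \<Rightarrow> bool" where
  "clinear_op T \<longleftrightarrow>
     (\<forall>x y. T (x + y) = T x + T y) \<and> (\<forall>c x. T (c *\<^sub>C x) = c *\<^sub>C T x)"

definition selfadjoint_unitary :: "('h::complex_hilbert \<Rightarrow> 'h) \<Rightarrow> bool" where
  "selfadjoint_unitary U \<longleftrightarrow>
     clinear_op U \<and> (\<exists>C. \<forall>x. norm (U x) \<le> C * norm x) \<and>
     (\<forall>x y. cinner (U x) y = cinner x (U y)) \<and>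
     (\<forall>x y. cinner (U x) (U y) = cinner x y) \<and> surj U"

section \<open>Graphs with rays\<close>

definition simple_connected_graph :: "('k::finite \<Rightarrow> 'k \<Rightarrow> bool) \<Rightarrow> bool" where
  "simple_connected_graph E \<longleftrightarrow> symp E \<and> irreflp E \<and> (\<forall>x y. E\<^sup>*\<^sup>* x y)"

text \<open>\<open>Ray \<alpha> m\<close> is the point \<open>m + 1\<close> of the half-line \<open>L\<^sub>\<alpha> = {1, 2, \<dots>}\<close>, so that the
  type of vertices is exactly the vertex set of the graph.\<close>

datatype ('k, 'r) vertex = Core 'k | Ray 'r nat

type_synonym ('k, 'r) state = "('k, 'r) vertex \<Rightarrow> complex"

type_synonym ('k, 'r) oper = "('k, 'r) state \<Rightarrow> ('k, 'r) state"

text \<open>\<open>att \<alpha>\<close> is the vertex \<open>x\<^sub>\<alpha>\<close> to which the ray \<open>\<alpha>\<close> is attached.\<close>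

definition h_core ::
    "('k::finite \<Rightarrow> 'k \<Rightarrow> bool) \<Rightarrow> ('r::finite \<Rightarrow> 'k) \<Rightarrow> ('k \<Rightarrow> complex) \<Rightarrow> 'k \<Rightarrow> complex" where
  "h_core E att u x =
     (\<Sum>y | E x y. u x - u y) + (\<Sum>\<alpha>\<in>UNIV. (if x = att \<alpha> then 1 else 0) * u x)"

text \<open>With \<open>m\<close> standing for the point \<open>m + 1\<close>, the first equation is the boundary point.\<close>

fun h_ray :: "(nat \<Rightarrow> complex) \<Rightarrow> nat \<Rightarrow> complex" where
  "h_ray u 0 = 2 * u 0 - u 1"
| "h_ray u (Suc m) = 2 * u (Suc m) - u (Suc (Suc m)) - u m"

fun H0 ::
    "('k::finite \<Rightarrow> 'k \<Rightarrow> bool) \<Rightarrow> ('r::finite \<Rightarrow> 'k) \<Rightarrow> ('k, 'r) oper" where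
  "H0 E att u (Core x) = h_core E att (\<lambda>y. u (Core y)) x"
| "H0 E att u (Ray \<alpha> m) = h_ray (\<lambda>n. u (Ray \<alpha> n)) m"

section \<open>Function spaces and pairings\<close>

fun weight :: "real \<Rightarrow> ('k, 'r) vertex \<Rightarrow> real" where
  "weight s (Core x) = 1"
| "weight s (Ray \<alpha> m) = (1 + (real (m + 1))\<^sup>2) powr (s / 2)"

definition L1 :: "real \<Rightarrow> ('k, 'r) state set" where
  "L1 s = {u. (\<lambda>x. weight s x * norm (u x)) summable_on UNIV}"

definition L1_norm :: "real \<Rightarrow> ('k, 'r) state \<Rightarrow> real" where
  "L1_norm s u = (\<Sum>\<^sub>\<infinity>x. weight s x * norm (u x))"

text \<open>\<open>L1_dual s\<close> is the dual of \<open>L1 s\<close>, i.e. the weighted supremum space with exponent \<open>-s\<close>.\<close>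

definition L1_dual :: "real \<Rightarrow> ('k, 'r) state set" where
  "L1_dual s = {u. bdd_above (range (\<lambda>x. weight (- s) x * norm (u x)))}"

definition L1_dual_norm :: "real \<Rightarrow> ('k, 'r) state \<Rightarrow> real" where
  "L1_dual_norm s u = (SUP x. weight (- s) x * norm (u x))"

definition ell2 :: "('k, 'r) state set" where
  "ell2 = {u. (\<lambda>x. (norm (u x))\<^sup>2) summable_on UNIV}"

definition ell2_norm :: "('k, 'r) state \<Rightarrow> real" where
  "ell2_norm u = sqrt (\<Sum>\<^sub>\<infinity>x. (norm (u x))\<^sup>2)"

definition pairing :: "('k, 'r) state \<Rightarrow> ('k, 'r) state \<Rightarrow> complex" where
  "pairing u w = (\<Sum>\<^sub>\<infinity>x. cnj (u x) * w x)"

section \<open>Operators\<close>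

text \<open>Operators are total functions on states, of which only the values on the domain \<open>X\<close>
  under consideration are meaningful.\<close>

definition bounded_ops ::
    "('k, 'r) state set \<Rightarrow> (('k, 'r) state \<Rightarrow> real) \<Rightarrow>
     ('k, 'r) state set \<Rightarrow> (('k, 'r) state \<Rightarrow> real) \<Rightarrow> ('k, 'r) oper set" where
  "bounded_ops X nX Y nY = {T.
     (\<forall>u\<in>X. T u \<in> Y) \<and>
     (\<forall>u\<in>X. \<forall>w\<in>X. \<forall>a b. T (\<lambda>x. a * u x + b * w x) = (\<lambda>x. a * T u x + b * T w x)) \<and>
     (\<exists>C. \<forall>u\<in>X. nY (T u) \<le> C * nX u)}"

abbreviation ell2_ops :: "('k, 'r) oper set" where
  "ell2_ops \<equiv> bounded_ops ell2 ell2_norm ell2 ell2_norm"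

text \<open>The space \<open>\<B>\<^sup>s\<close> of bounded operators from \<open>L1 s\<close> to its dual, with its operator norm.\<close>

definition Bs :: "real \<Rightarrow> ('k, 'r) oper set" where
  "Bs s = bounded_ops (L1 s) (L1_norm s) (L1_dual s) (L1_dual_norm s)"

definition Bs_norm :: "real \<Rightarrow> ('k, 'r) oper \<Rightarrow> real" where
  "Bs_norm s T = (SUP u\<in>{u \<in> L1 s. L1_norm s u \<le> 1}. L1_dual_norm s (T u))"

definition ell2_spectrum :: "('k, 'r) oper \<Rightarrow> complex set" where
  "ell2_spectrum A = {z. \<not> (let B = (\<lambda>u x. A u x - z * u x)
     in bij_betw B ell2 ell2 \<and> inv_into ell2 B \<in> ell2_ops)}"

text \<open>\<open>resolvent A \<kappa>\<close> is \<open>(A + \<kappa>\<^sup>2)\<^sup>-\<^sup>1\<close> on \<open>ell2\<close>, meaningful if \<open>-\<kappa>\<^sup>2\<close> is not in the spectrum.\<close>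

definition resolvent :: "('k, 'r) oper \<Rightarrow> complex \<Rightarrow> ('k, 'r) oper" where
  "resolvent A \<kappa> = inv_into ell2 (\<lambda>u x. A u x + \<kappa>\<^sup>2 * u x)"

definition rank_sum :: "('k, 'r) state set \<Rightarrow> ('k, 'r) oper" where
  "rank_sum B u = (\<lambda>x. \<Sum>\<Psi>\<in>B. pairing \<Psi> u * \<Psi> x)"

section \<open>The perturbation\<close>

text \<open>The adjoint \<open>v\<^sup>*\<close>, from the dual of \<open>L1 \<beta>\<close> to the Hilbert space, of a bounded \<open>v\<close> into
  \<open>L1 \<beta>\<close>; the Hilbert space is identified with its (antilinear) dual by the Riesz theorem.\<close>

definition adjoint_op ::
    "('h::complex_hilbert \<Rightarrow> ('k, 'r) state) \<Rightarrow> ('k, 'r) state \<Rightarrow> 'h" where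
  "adjoint_op v u = (THE y. \<forall>k. cinner y k = pairing u (v k))"

definition selfadjoint_ell2 :: "('k, 'r) oper \<Rightarrow> bool" where
  "selfadjoint_ell2 V \<longleftrightarrow>
     V \<in> ell2_ops \<and> (\<forall>u\<in>ell2. \<forall>w\<in>ell2. pairing (V u) w = pairing u (V w))"

definition bounded_into_L1 :: "real \<Rightarrow> ('h::complex_hilbert \<Rightarrow> ('k, 'r) state) \<Rightarrow> bool" where
  "bounded_into_L1 s v \<longleftrightarrow>
     (\<forall>k. v k \<in> L1 s) \<and>
     (\<forall>k l x. v (k + l) x = v k x + v l x) \<and>
     (\<forall>c k x. v (c *\<^sub>C k) x = c * v k x) \<and>
     (\<exists>C. \<forall>k. L1_norm s (v k) \<le> C * norm k)"

text \<open>The Hilbert space is the type \<open>'h\<close>. Since \<open>ell2\<close> is contained in the dual of \<open>L1 \<beta>\<close>,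
  one function \<open>V\<close> serves both as the operator on \<open>ell2\<close> and as its extension \<open>v U v\<^sup>*\<close>.\<close>

definition assumption_A ::
    "real \<Rightarrow> ('k, 'r) oper \<Rightarrow> ('h::complex_hilbert \<Rightarrow> ('k, 'r) state) \<Rightarrow> ('h \<Rightarrow> 'h) \<Rightarrow> bool" where
  "assumption_A \<beta> V v U \<longleftrightarrow>
     \<beta> \<ge> 1 \<and> selfadjoint_ell2 V \<and>
     bounded_into_L1 \<beta> v \<and> inj v \<and> selfadjoint_unitary U \<and>
     V \<in> bounded_ops (L1_dual \<beta>) (L1_dual_norm \<beta>) (L1 \<beta>) (L1_norm \<beta>) \<and>
     (\<forall>u\<in>L1_dual \<beta>. V u = v (U (adjoint_op v u)))"

definition H_op ::
    "('k::finite \<Rightarrow> 'k \<Rightarrow> bool) \<Rightarrow> ('r::finite \<Rightarrow> 'k) \<Rightarrow> ('k, 'r) oper \<Rightarrow> ('k, 'r) oper" where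
  "H_op E att V u = (\<lambda>x. H0 E att u x + V u x)"

section \<open>Threshold eigenspaces\<close>

fun ray_indicator :: "'r \<Rightarrow> ('k, 'r) state" where
  "ray_indicator \<alpha> (Core x) = 0"
| "ray_indicator \<alpha> (Ray \<alpha>' m) = (if \<alpha>' = \<alpha> then 1 else 0)"

definition gen_eigenspace :: "real \<Rightarrow> ('k, 'r) oper \<Rightarrow> ('k, 'r) state set" where
  "gen_eigenspace \<beta> H = {\<Psi> \<in> L1_dual \<beta>. H \<Psi> = (\<lambda>x. 0)}"

definition resonance_space :: "real \<Rightarrow> ('k, 'r::finite) oper \<Rightarrow> ('k, 'r) state set" where
  "resonance_space \<beta> H = {\<Psi> \<in> gen_eigenspace \<beta> H.
     \<exists>c. (\<lambda>x. \<Psi> x - (\<Sum>\<alpha>\<in>UNIV. c \<alpha> * ray_indicator \<alpha> x)) \<in> L1 (\<beta> - 2)}"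

definition bound_space :: "real \<Rightarrow> ('k, 'r) oper \<Rightarrow> ('k, 'r) state set" where
  "bound_space \<beta> H = gen_eigenspace \<beta> H \<inter> L1 (\<beta> - 2)"

definition exceptional_first_kind :: "real \<Rightarrow> ('k, 'r::finite) oper \<Rightarrow> bool" where
  "exceptional_first_kind \<beta> H \<longleftrightarrow>
     bound_space \<beta> H \<subset> resonance_space \<beta> H \<and> bound_space \<beta> H = {\<lambda>x. 0}"

section \<open>Orthogonal projections\<close>

text \<open>Both notions of basis are finite: the classes of resonances number at most the rays,
  and the bound eigenspace is finite-dimensional.\<close>

definition orthonormal_resonance_basis ::
    "real \<Rightarrow> ('k, 'r::finite) oper \<Rightarrow> ('k, 'r) state set \<Rightarrow> bool" where
  "orthonormal_resonance_basis \<beta> H B \<longleftrightarrow>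
     finite B \<and> B \<subseteq> resonance_space \<beta> H \<and>
     \<comment> \<open>the classes modulo the bound eigenspace are linearly independent and spanning\<close>
     (\<forall>a. (\<lambda>x. \<Sum>\<Psi>\<in>B. a \<Psi> * \<Psi> x) \<in> bound_space \<beta> H \<longrightarrow> (\<forall>\<Psi>\<in>B. a \<Psi> = 0)) \<and>
     (\<forall>\<Phi>\<in>resonance_space \<beta> H. \<exists>a. (\<lambda>x. \<Phi> x - (\<Sum>\<Psi>\<in>B. a \<Psi> * \<Psi> x)) \<in> bound_space \<beta> H) \<and>
     (\<forall>\<Phi>\<in>B. \<forall>\<Psi>\<in>bound_space \<beta> H. (\<lambda>x. cnj (\<Psi> x) * \<Phi> x) \<in> L1 0 \<and> pairing \<Psi> \<Phi> = 0) \<and>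
     (\<exists>c :: ('k, 'r) state \<Rightarrow> 'r \<Rightarrow> complex.
        (\<forall>\<Phi>\<in>B. \<forall>\<Psi>\<in>B. (\<Sum>\<alpha>\<in>UNIV. cnj (c \<Phi> \<alpha>) * c \<Psi> \<alpha>) = (if \<Phi> = \<Psi> then 1 else 0)) \<and>
        (\<forall>\<Psi>\<in>B. (\<lambda>x. \<Psi> x - (\<Sum>\<alpha>\<in>UNIV. c \<Psi> \<alpha> * ray_indicator \<alpha> x)) \<in> L1 (\<beta> - 2)))"

definition orthonormal_bound_basis ::
    "real \<Rightarrow> ('k, 'r) oper \<Rightarrow> ('k, 'r) state set \<Rightarrow> bool" where
  "orthonormal_bound_basis \<beta> H B \<longleftrightarrow>
     finite B \<and> B \<subseteq> bound_space \<beta> H \<and>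
     (\<forall>a. (\<lambda>x. \<Sum>\<Psi>\<in>B. a \<Psi> * \<Psi> x) = (\<lambda>x. 0) \<longrightarrow> (\<forall>\<Psi>\<in>B. a \<Psi> = 0)) \<and>
     (\<forall>\<Phi>\<in>bound_space \<beta> H. \<exists>a. \<Phi> = (\<lambda>x. \<Sum>\<Psi>\<in>B. a \<Psi> * \<Psi> x)) \<and>
     (\<forall>\<Phi>\<in>B. \<forall>\<Psi>\<in>B. (\<lambda>x. cnj (\<Phi> x) * \<Psi> x) \<in> L1 0 \<and>
        pairing \<Phi> \<Psi> = (if \<Phi> = \<Psi> then 1 else 0))"

text \<open>The choice of basis is immaterial.\<close>

definition resonance_projection :: "real \<Rightarrow> ('k, 'r::finite) oper \<Rightarrow> ('k, 'r) oper" where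
  "resonance_projection \<beta> H = rank_sum (SOME B. orthonormal_resonance_basis \<beta> H B)"

definition bound_projection :: "real \<Rightarrow> ('k, 'r) oper \<Rightarrow> ('k, 'r) oper" where
  "bound_projection \<beta> H = rank_sum (SOME B. orthonormal_bound_basis \<beta> H B)"

section \<open>Resolvent expansions\<close>

text \<open>The remainder after subtracting the terms \<open>\<kappa>\<^sup>j G\<^sub>j\<close> for \<open>-1 \<le> j \<le> n\<close>.\<close>

definition expansion_remainder ::
    "('k, 'r) oper \<Rightarrow> (int \<Rightarrow> ('k, 'r) oper) \<Rightarrow> int \<Rightarrow> complex \<Rightarrow> ('k, 'r) oper" where
  "expansion_remainder H G n \<kappa> u =
     (\<lambda>x. resolvent H \<kappa> u x - (\<Sum>j\<in>{-1..n}. \<kappa> powi j * G j u x))"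

end

theory Submission
  imports Defs "HOL-Complex_Analysis.Laurent_Convergence"
begin

text \<open>
  With \<open>V = v U v\<^sup>*\<close>, the resolvent is \<open>R = R\<^sub>0 - R\<^sub>0 v M\<^sup>-\<^sup>1 v\<^sup>* R\<^sub>0\<close>, where
  \<open>M(\<kappa>) = U + v\<^sup>* R\<^sub>0(\<kappa>) v\<close> acts on the auxiliary Hilbert space. The kernel of \<open>R\<^sub>0\<close> is,
  on each half-line, a finite geometric sum of powers of the decaying solution, so it expands in \<open>\<kappa>\<close>
  with coefficients of polynomial growth; since the norm of \<open>\<B>\<^sup>s\<close> is a weighted supremum norm of
  kernels, every expansion can be done pointwise. Unconditional convergence in a Hilbert space makes
  \<open>M(0)\<close> a compact perturbation of the unitary \<open>U\<close>. Its kernel is isomorphic to the space of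
  resonances, and on it the coefficient \<open>M\<^sub>1\<close> is the form \<open>-\<Sum>|c\<^sub>\<alpha>|\<^sup>2\<close> in the asymptotic
  values \<open>c\<^sub>\<alpha>\<close> of the resonance, which is definite because there are no bound states. Hence
  \<open>M\<^sup>-\<^sup>1\<close> has a simple pole, and its residue turns into \<open>\<Sum>|\<Psi>\<^sub>\<gamma>\<rangle>\<langle>\<Psi>\<^sub>\<gamma>|\<close>.
  Injectivity of \<open>H + \<kappa>\<^sup>2\<close> on square-summable functions follows from symmetry and surjectivity at
  the conjugate parameter.
\<close>

section \<open>Complex Hilbert spaces\<close>

text \<open>The unperturbed operator decouples core and rays: a positive definite matrix on the
  core, a Dirichlet operator on each ray. It has no bounded zero-energy state and its kernel is
  regular at \<kappa> = 0, so every singularity of R comes from inverting M. Orders and weights are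
  tied together. Coefficient j of the free kernel grows like
  \<open>(vsize p * vsize q) ^ (j + 1)\<close>, and v only reaches L^\<beta>, so M expands with a
  remainder of order at most \<beta> - 1. Normalising M (T_0 + \<kappa> T_1) by 1/\<kappa> costs one
  order and the pole of the inverse a second one; what is left are the powers -1, ..., \<beta> - 4
  with remainder of order \<beta> - 3. At that stage the free expansions are cut at order \<beta> -
  2, whose weight exponent \<beta> - 1 is that of the final space. Coefficient j is in fact obtained
  with exponent j + 2 for every j; the statement for even j follows by monotonicity. Only a right
  inverse of M is constructed: it yields solutions of (H + \<kappa>^2) u = f, while uniqueness comes
  from the symmetry of H.\<close>

lemma cinner_add_left: "cinner (x + y) z = cinner x z + cinner y (z::'h::complex_hilbert)"
  by (metis cinner_add_right cinner_commute complex_cnj_add)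

lemma cinner_scaleC_left: "cinner (c *\<^sub>C x) y = cnj c * cinner x (y::'h::complex_hilbert)"
  by (metis cinner_scaleC_right cinner_commute complex_cnj_mult)

lemma cinner_zero_right [simp]: "cinner x (0::'h::complex_hilbert) = 0"
  using cinner_add_right[of x 0 0] by simp

lemma cinner_zero_left [simp]: "cinner (0::'h::complex_hilbert) x = 0"
  using cinner_add_left[of 0 0 x] by simp

lemma cinner_minus_right: "cinner x (- y) = - cinner x (y::'h::complex_hilbert)"
  using cinner_add_right[of x y "- y"] by (simp add: eq_neg_iff_add_eq_0 add.commute)

lemma cinner_minus_left: "cinner (- x) y = - cinner x (y::'h::complex_hilbert)"
  using cinner_add_left[of x "- x" y] by (simp add: eq_neg_iff_add_eq_0 add.commute)

lemma cinner_diff_left: "cinner (x - y) z = cinner x z - cinner y (z::'h::complex_hilbert)"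
  using cinner_add_left[of x "- y" z] by (simp add: cinner_minus_left)

lemma cinner_sum_right: "cinner x (\<Sum>i\<in>I. f i) = (\<Sum>i\<in>I. cinner x (f i :: 'h::complex_hilbert))"
  by (induction I rule: infinite_finite_induct) (auto simp: cinner_add_right)

lemma cinner_sum_left: "cinner (\<Sum>i\<in>I. f i) x = (\<Sum>i\<in>I. cinner (f i :: 'h::complex_hilbert) x)"
  by (induction I rule: infinite_finite_induct) (auto simp: cinner_add_left)

lemma scaleC_one [simp]: "1 *\<^sub>C (x::'h::complex_hilbert) = x"
  using scaleC_of_real[of 1 x] by simp

lemma scaleC_zero_left [simp]: "0 *\<^sub>C (x::'h::complex_hilbert) = 0"
  using scaleC_of_real[of 0 x] by simp

lemma scaleC_zero_right [simp]: "c *\<^sub>C (0::'h::complex_hilbert) = 0"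
  using scaleC_add_right[of c 0 0] by simp

lemma scaleC_minus_right: "c *\<^sub>C (- x) = - (c *\<^sub>C (x::'h::complex_hilbert))"
  using scaleC_add_right[of c x "- x"] by (simp add: eq_neg_iff_add_eq_0 add.commute)

lemma scaleC_minus_left: "(- c) *\<^sub>C x = - (c *\<^sub>C (x::'h::complex_hilbert))"
  using scaleC_add_left[of c "- c" x] by (simp add: eq_neg_iff_add_eq_0 add.commute)

lemma Re_cinner_self: "Re (cinner x x) = (norm (x::'h::complex_hilbert))\<^sup>2"
proof -
  have "Re (cinner x x) \<ge> 0"
    using norm_ge_zero[of x] by (simp add: norm_eq_sqrt_cinner real_sqrt_ge_0_iff)
  thus ?thesis by (simp add: norm_eq_sqrt_cinner)
qed

lemma cinner_self: "cinner x x = complex_of_real ((norm (x::'h::complex_hilbert))\<^sup>2)"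
proof -
  have "Im (cinner x x) = 0"
    using arg_cong[OF cinner_commute[of x x], of Im] by simp
  thus ?thesis by (simp add: complex_eq_iff Re_cinner_self)
qed

lemma norm_scaleC: "norm (c *\<^sub>C x) = norm c * norm (x::'h::complex_hilbert)"
proof -
  have "complex_of_real ((norm (c *\<^sub>C x))\<^sup>2) = (c * cnj c) * cinner x x"
    unfolding cinner_self[symmetric] by (simp add: cinner_scaleC_left cinner_scaleC_right)
  also have "\<dots> = complex_of_real ((norm c * norm x)\<^sup>2)"
    by (simp add: cinner_self complex_norm_square[symmetric] power_mult_distrib)
  finally have "(norm (c *\<^sub>C x))\<^sup>2 = (norm c * norm x)\<^sup>2"
    using of_real_eq_iff by blast
  thus ?thesis by (simp add: power2_eq_iff_nonneg)
qed

lemma Re_cinner_commute: "Re (cinner y x) = Re (cinner x (y::'h::complex_hilbert))"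
  by (subst cinner_commute) simp

lemma norm_add_sq:
  "(norm (x + y))\<^sup>2 = (norm x)\<^sup>2 + (norm y)\<^sup>2 + 2 * Re (cinner x (y::'h::complex_hilbert))"
  by (simp add: Re_cinner_self[symmetric] cinner_add_left cinner_add_right Re_cinner_commute[of y x])

lemma norm_diff_sq:
  "(norm (x - y))\<^sup>2 = (norm x)\<^sup>2 + (norm y)\<^sup>2 - 2 * Re (cinner x (y::'h::complex_hilbert))"
  using norm_add_sq[of x "- y"] by (simp add: cinner_minus_right)

lemma norm_cinner_le: "norm (cinner x y) \<le> norm x * norm (y::'h::complex_hilbert)"
proof (cases "y = 0")
  case False
  let ?a = "complex_of_real ((norm y)\<^sup>2) *\<^sub>C x" and ?b = "cinner y x *\<^sub>C y"
  have "Re (cinner ?a ?b) = (norm y)\<^sup>2 * Re (cinner y x * cinner x y)"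
    by (simp add: cinner_scaleC_left cinner_scaleC_right algebra_simps)
  also have "cinner y x * cinner x y = complex_of_real ((norm (cinner x y))\<^sup>2)"
    by (subst cinner_commute) (metis complex_norm_square mult.commute of_real_power)
  finally have r: "Re (cinner ?a ?b) = (norm y)\<^sup>2 * (norm (cinner x y))\<^sup>2" by simp
  have nn: "norm (cinner y x) = norm (cinner x y)"
    by (subst cinner_commute) simp
  have "0 \<le> (norm (?a - ?b))\<^sup>2" by simp
  also have "\<dots> = (norm y)\<^sup>2 * ((norm x * norm y)\<^sup>2 - (norm (cinner x y))\<^sup>2)"
    unfolding norm_diff_sq r norm_scaleC nn
    by (simp add: power_mult_distrib power2_eq_square algebra_simps norm_mult)
  finally have "(norm (cinner x y))\<^sup>2 \<le> (norm x * norm y)\<^sup>2"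
    using False by (simp add: zero_le_mult_iff)
  thus ?thesis by (rule power2_le_imp_le) simp
qed simp

lemma bounded_linear_cinner_right: "bounded_linear (cinner (x::'h::complex_hilbert))"
proof (rule bounded_linear_intro[where K = "norm x"])
  show "cinner x (r *\<^sub>R y) = r *\<^sub>R cinner x y" for r y
    by (metis cinner_scaleC_right scaleC_of_real scaleR_conv_of_real)
  show "norm (cinner x y) \<le> norm y * norm x" for y
    using norm_cinner_le[of x y] by (simp add: mult.commute)
qed (rule cinner_add_right)

lemma cinner_eqI:
  assumes "\<And>k. cinner x k = cinner y (k::'h::complex_hilbert)"
  shows "x = y"
proof -
  have "cinner (x - y) (x - y) = 0"
    using assms by (simp add: cinner_diff_left)
  thus ?thesis by (simp add: cinner_self)
qed

text \<open>The functional norm(x)^2 - 2 Re(\<phi> x) is bounded below by - C^2 and is minimised: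
  the parallelogram law makes a minimising sequence Cauchy, and the first variation at the limit is
  the real part of the required identity.\<close>

lemma riesz_representation:
  fixes \<phi> :: "'h::complex_hilbert \<Rightarrow> complex"
  assumes add: "\<And>x y. \<phi> (x + y) = \<phi> x + \<phi> y"
    and scale: "\<And>c x. \<phi> (c *\<^sub>C x) = c * \<phi> x"
    and bound: "\<And>x. norm (\<phi> x) \<le> C * norm x"
  shows "\<exists>y. \<forall>k. cinner y k = \<phi> k"
proof -
  define f where "f x = (norm x)\<^sup>2 - 2 * Re (\<phi> x)" for x
  have scaleR: "\<phi> (r *\<^sub>R x) = r *\<^sub>R \<phi> x" for r x
    by (metis scale scaleC_of_real scaleR_conv_of_real)
  have bl: "bounded_linear \<phi>"
    by (rule bounded_linear_intro[where K = C]) (auto simp: add scaleR bound mult.commute)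
  have lower: "f x \<ge> - C\<^sup>2" for x
  proof -
    have "Re (\<phi> x) \<le> C * norm x"
      using complex_Re_le_cmod[of "\<phi> x"] bound[of x] by linarith
    moreover have "(norm x - C)\<^sup>2 \<ge> 0" by simp
    ultimately show ?thesis
      unfolding f_def by (simp add: power2_eq_square algebra_simps)
  qed
  define m where "m = Inf (range f)"
  have bdd: "bdd_below (range f)"
    using lower by (auto intro!: bdd_belowI[where m = "- C\<^sup>2"])
  have mle: "m \<le> f x" for x
    unfolding m_def using bdd by (auto intro: cInf_lower)
  have "\<exists>x. f x < m + 1 / real (Suc n)" for n
    using cInf_lessD[of "range f" "m + 1 / real (Suc n)"] unfolding m_def by auto
  then obtain X where X: "\<And>n. f (X n) < m + 1 / real (Suc n)" by metis
  \<comment> \<open>The midpoint value is at least the infimum m, so this form of the parallelogram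
    law bounds the distance between two near-minimisers.\<close>
  have par: "(norm (x - y))\<^sup>2 = 2 * f x + 2 * f y - 4 * f ((1/2) *\<^sub>R (x + y))" for x y
    unfolding f_def scaleR norm_scaleR power_mult_distrib norm_diff_sq norm_add_sq
    by (simp add: add field_simps power2_eq_square)
  have dist: "(norm (X a - X b))\<^sup>2 \<le> 2 / real (Suc a) + 2 / real (Suc b)" for a b
  proof -
    have "2 / real (Suc a) = 2 * (1 / real (Suc a))" "2 / real (Suc b) = 2 * (1 / real (Suc b))" by auto
    thus ?thesis unfolding par using X[of a] X[of b] mle[of "(1/2) *\<^sub>R (X a + X b)"] by linarith
  qed
  have "Cauchy X"
  proof (rule CauchyI)
    fix e :: real assume e: "e > 0"
    obtain N where N: "4 / e\<^sup>2 < real N" using reals_Archimedean2 by blast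
    have "norm (X a - X b) < e" if "a \<ge> N" "b \<ge> N" for a b
    proof -
      have N0: "N > 0" using N e by (smt (verit) divide_pos_pos of_nat_0_less_iff zero_less_power)
      have "2 / real (Suc a) \<le> 2 / real N" "2 / real (Suc b) \<le> 2 / real N"
        using that N0 by (auto intro!: divide_left_mono)
      hence "(norm (X a - X b))\<^sup>2 \<le> 4 / real N" using dist[of a b] by simp
      also have "\<dots> < e\<^sup>2" using N e N0 by (simp add: field_simps)
      finally show ?thesis using e by (metis less_imp_le power_less_imp_less_base)
    qed
    thus "\<exists>M. \<forall>m\<ge>M. \<forall>n\<ge>M. norm (X m - X n) < e" by blast
  qed
  then obtain y where y: "X \<longlonglongrightarrow> y" using Cauchy_convergent convergentD by blast
  have "(\<lambda>n. f (X n)) \<longlonglongrightarrow> f y"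
    unfolding f_def by (intro tendsto_intros bounded_linear.tendsto[OF bl] y)
  moreover have "(\<lambda>n. m + 1 / real (Suc n)) \<longlonglongrightarrow> m + 0"
    by (intro tendsto_intros LIMSEQ_Suc lim_1_over_n)
  ultimately have "f y \<le> m"
    using X by (metis (no_types, lifting) LIMSEQ_le add.right_neutral less_imp_le)
  hence fy: "f y \<le> f z" for z using mle[of z] by linarith
  have re: "Re (cinner y k) = Re (\<phi> k)" for k
  proof -
    define a where "a = Re (cinner y k) - Re (\<phi> k)"
    have ineq: "0 \<le> t\<^sup>2 * (norm k)\<^sup>2 + 2 * t * a" for t :: real
    proof -
      have "Re (cinner y (t *\<^sub>R k)) = t * Re (cinner y k)"
        by (metis Re_complex_of_real cinner_scaleC_right scaleC_of_real Re_divide_of_real 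
              complex_Re_of_nat mult.commute scaleR_conv_of_real scaleR_complex.simps(1))
      thus ?thesis using fy[of "y + t *\<^sub>R k"] unfolding f_def
        by (simp add: norm_add_sq add scaleR a_def power_mult_distrib algebra_simps)
    qed
    have "a = 0"
    proof (cases "k = 0")
      case True thus ?thesis using add[of 0 0] by (simp add: a_def)
    next
      case False
      \<comment> \<open>The quadratic in \<open>ineq\<close> is evaluated at its minimiser t = - a /
        norm(k)^2.\<close>
      have "0 \<le> - a\<^sup>2 / (norm k)\<^sup>2"
        using ineq[of "- a / (norm k)\<^sup>2"] False by (simp add: field_simps power2_eq_square)
      hence "0 \<le> - a\<^sup>2" using False by (simp add: field_simps)
      thus ?thesis by simp
    qed
    thus ?thesis by (simp add: a_def)
  qed
  \<comment> \<open>The real identity at \<open>\<i> *\<^sub>C k\<close> supplies the imaginary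
    parts.\<close>
  have "cinner y k = \<phi> k" for k
    using re[of k] re[of "\<i> *\<^sub>C k"] by (simp add: cinner_scaleC_right scale complex_eq_iff)
  thus ?thesis by blast
qed

section \<open>Bounded operators\<close>

lemma blinfun_inverse_exists:
  fixes A :: "'a::real_normed_vector \<Rightarrow>\<^sub>L 'a"
  assumes "c > 0" and below: "\<And>x. c * norm x \<le> norm (blinfun_apply A x)"
    and surj: "surj (blinfun_apply A)"
  shows "\<exists>B. A o\<^sub>L B = id_blinfun \<and> B o\<^sub>L A = id_blinfun \<and> (\<forall>x. norm (blinfun_apply B x) \<le> norm x / c)"
proof -
  have inj: "inj (blinfun_apply A)"
  proof (rule injI)
    fix x y assume "blinfun_apply A x = blinfun_apply A y"
    hence "c * norm (x - y) \<le> 0" using below[of "x - y"] by (simp add: blinfun.diff_right)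
    thus "x = y" using \<open>c > 0\<close> by (simp add: mult_le_0_iff)
  qed
  let ?B = "inv (blinfun_apply A)"
  have AB: "blinfun_apply A (?B y) = y" for y using surj by (rule surj_f_inv_f)
  have BA: "?B (blinfun_apply A x) = x" for x using inj by (rule inv_f_f)
  have le: "norm (?B y) \<le> norm y * (1 / c)" for y
    using below[of "?B y"] \<open>c > 0\<close> by (simp add: AB field_simps)
  have bl: "bounded_linear ?B"
  proof (rule bounded_linear_intro[where K = "1 / c"])
    show "?B (x + y) = ?B x + ?B y" for x y
      by (metis AB BA blinfun.add_right)
    show "?B (r *\<^sub>R x) = r *\<^sub>R ?B x" for r x
      by (metis AB BA blinfun.scaleR_right)
  qed (rule le)
  have app: "blinfun_apply (Blinfun ?B) = ?B" by (rule bounded_linear_Blinfun_apply[OF bl])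
  show ?thesis
    by (rule exI[of _ "Blinfun ?B"]) (auto intro!: blinfun_eqI simp: app AB BA le[simplified])
qed

text \<open>Squaring makes the operator positive: by symmetry <z, A A z> = |A z|^2, which is at
  least c^2 |z|^2. Hence z - t A A z contracts for a suitable t, the affine map x - t (A A x - g)
  has a fixed point x, and A x is a preimage of g.\<close>

lemma selfadjoint_bounded_below_surj:
  fixes A :: "'h::complex_hilbert \<Rightarrow>\<^sub>L 'h"
  assumes "c > 0" and below: "\<And>x. c * norm x \<le> norm (blinfun_apply A x)"
    and sym: "\<And>x y. cinner (blinfun_apply A x) y = cinner x (blinfun_apply A y)"
  shows "surj (blinfun_apply A)"
proof -
  have "\<exists>x. blinfun_apply A x = g" for g
  proof -
  define C where "C = norm A + c"
  have C: "C > 0" "c \<le> C" using \<open>c > 0\<close> by (auto simp: C_def add_nonneg_pos)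
  have up: "norm (blinfun_apply A x) \<le> C * norm x" for x
  proof -
    have "norm (blinfun_apply A x) \<le> norm A * norm x" by (rule norm_blinfun)
    also have "\<dots> \<le> C * norm x" using \<open>c > 0\<close> by (intro mult_right_mono) (auto simp: C_def)
    finally show ?thesis .
  qed
  \<comment> \<open>This t minimises 1 - 2 t c^2 + t^2 C^4, the bound for the squared contraction
    factor; the minimum is 1 - c^4 / C^4. Including c in C ensures c \<le> C and C > 0.\<close>
  define t where "t = c\<^sup>2 / C ^ 4"
  define T where "T x = x - t *\<^sub>R (blinfun_apply A (blinfun_apply A x) - g)" for x
  define q where "q = sqrt (1 - c ^ 4 / C ^ 4)"
  have q: "0 \<le> q" "q < 1" and q2: "q\<^sup>2 = 1 - c ^ 4 / C ^ 4"
  proof -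
    have "c ^ 4 \<le> C ^ 4" using C \<open>c > 0\<close> by (intro power_mono) auto
    thus "0 \<le> q" "q\<^sup>2 = 1 - c ^ 4 / C ^ 4" "q < 1" using C \<open>c > 0\<close> by (auto simp: q_def)
  qed
  have con: "norm (z - t *\<^sub>R blinfun_apply A (blinfun_apply A z)) \<le> q * norm z" for z
  proof -
    let ?w = "blinfun_apply A (blinfun_apply A z)"
    have "Re (cinner z (t *\<^sub>R ?w)) = t * Re (cinner z ?w)"
      by (simp flip: scaleC_of_real add: cinner_scaleC_right)
    also have "cinner z ?w = cinner (blinfun_apply A z) (blinfun_apply A z)" by (simp add: sym)
    also have "Re \<dots> = (norm (blinfun_apply A z))\<^sup>2" by (rule Re_cinner_self)
    finally have r: "Re (cinner z (t *\<^sub>R ?w)) = t * (norm (blinfun_apply A z))\<^sup>2" .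
    have t0: "t \<ge> 0" using C by (simp add: t_def)
    have l: "(c * norm z)\<^sup>2 \<le> (norm (blinfun_apply A z))\<^sup>2"
      using below[of z] \<open>c > 0\<close> by (intro power_mono) auto
    have "norm ?w \<le> C * (C * norm z)"
      using up[of "blinfun_apply A z"] up[of z] C by (meson mult_left_mono order_trans less_imp_le)
    hence w: "(norm ?w)\<^sup>2 \<le> (C * (C * norm z))\<^sup>2" by (intro power_mono) auto
    have "(norm (z - t *\<^sub>R ?w))\<^sup>2 = (norm z)\<^sup>2 + t\<^sup>2 * (norm ?w)\<^sup>2 - 2 * t * (norm (blinfun_apply A z))\<^sup>2"
      by (simp add: norm_diff_sq r power_mult_distrib)
    also have "\<dots> \<le> (norm z)\<^sup>2 + t\<^sup>2 * (C * (C * norm z))\<^sup>2 - 2 * t * (c * norm z)\<^sup>2"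
      using mult_left_mono[OF l, of "2 * t"] mult_left_mono[OF w, of "t\<^sup>2"] t0 by simp
    also have "\<dots> = (1 - c ^ 4 / C ^ 4) * (norm z)\<^sup>2"
      using C by (simp add: t_def field_simps power2_eq_square eval_nat_numeral)
    also have "\<dots> = (q * norm z)\<^sup>2" by (simp add: q2 power_mult_distrib)
    finally show ?thesis using q by (metis norm_ge_zero power2_le_imp_le zero_le_mult_iff)
  qed
  have "\<exists>!x. T x = x"
  proof (rule banach_fix_type[OF q], intro allI)
    show "dist (T x) (T y) \<le> q * dist x y" for x y
    proof -
      have "T x - T y = (x - y) - t *\<^sub>R blinfun_apply A (blinfun_apply A (x - y))"
        by (simp add: T_def blinfun.diff_right algebra_simps)
      thus ?thesis using con[of "x - y"] by (simp add: dist_norm)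
    qed
  qed
  then obtain x where "T x = x" by blast
  moreover have "t > 0" using C \<open>c > 0\<close> by (simp add: t_def)
  ultimately have "blinfun_apply A (blinfun_apply A x) = g" by (simp add: T_def)
  thus ?thesis by blast
  qed
  thus ?thesis by (metis surjI)
qed

lemma common_convergent_subseq:
  fixes z :: "'i \<Rightarrow> nat \<Rightarrow> complex"
  assumes "finite I" and "\<And>i. i \<in> I \<Longrightarrow> bounded (range (z i))"
  shows "\<exists>r. strict_mono r \<and> (\<forall>i\<in>I. convergent (z i \<circ> r))"
  using assms
proof (induction I)
  case empty
  thus ?case by (auto intro!: exI[of _ id] strict_monoI)
next
  case (insert i I)
  then obtain r where r: "strict_mono r" "\<forall>j\<in>I. convergent (z j \<circ> r)"
    using insert.IH insert.prems by blast
  have "bounded (range (z i \<circ> r))"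
    using insert.prems[of i] by (rule bounded_subset) auto
  then obtain l s where s: "strict_mono s" "((z i \<circ> r) \<circ> s) \<longlonglongrightarrow> l"
    using bounded_imp_convergent_subsequence by blast
  have "convergent (z j \<circ> (r \<circ> s))" if "j \<in> insert i I" for j
  proof (cases "j = i")
    case True
    thus ?thesis using s(2) by (auto simp: o_assoc convergent_def)
  next
    case False
    hence "convergent (z j \<circ> r)" using r that by auto
    thus ?thesis using convergent_subseq_convergent s(1) by (metis o_assoc)
  qed
  thus ?case using strict_mono_o[OF r(1) s(1)] by blast
qed

text \<open>Otherwise there are unit vectors k_n with D k_n tending to 0. Along a subsequence the
  finitely many numbers \<phi> i k_n converge, hence so does X k_n, and the lower bound for X makes
  k_n Cauchy. The limit is a unit vector in the kernel of D, contradicting injectivity.\<close>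

lemma finite_rank_perturbation_bounded_below:
  fixes D X :: "'h::complex_hilbert \<Rightarrow>\<^sub>L 'h" and \<phi> :: "'i \<Rightarrow> 'h \<Rightarrow> complex"
  assumes "finite I" and "a > 0" and below: "\<And>k. a * norm k \<le> norm (blinfun_apply X k)"
    and D: "\<And>k. blinfun_apply D k = blinfun_apply X k + (\<Sum>i\<in>I. \<phi> i k *\<^sub>C e i)"
    and \<phi>: "\<And>i k. i \<in> I \<Longrightarrow> norm (\<phi> i k) \<le> C i * norm k"
    and inj: "\<And>k. blinfun_apply D k = 0 \<Longrightarrow> k = 0"
  shows "\<exists>c>0. \<forall>k. c * norm k \<le> norm (blinfun_apply D k)"
proof (rule ccontr)
  assume "\<not> ?thesis"
  hence neg: "\<And>c. c > 0 \<Longrightarrow> \<exists>k. norm (blinfun_apply D k) < c * norm k" by (meson not_less)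
  have "\<exists>k. norm k = 1 \<and> norm (blinfun_apply D k) < 1 / real (Suc n)" for n
  proof -
    obtain k where k: "norm (blinfun_apply D k) < 1 / real (Suc n) * norm k"
      using neg[of "1 / real (Suc n)"] by auto
    hence "k \<noteq> 0" by auto
    thus ?thesis using k
      by (intro exI[of _ "k /\<^sub>R norm k"]) (simp add: blinfun.scaleR_right field_simps)
  qed
  then obtain k where k: "\<And>n. norm (k n) = 1" "\<And>n. norm (blinfun_apply D (k n)) < 1 / real (Suc n)"
    by metis
  have "bounded (range (\<lambda>n. \<phi> i (k n)))" if "i \<in> I" for i
    using \<phi>[OF that, of "k _"] k(1) by (auto intro!: boundedI[of _ "C i"])
  then obtain r where r: "strict_mono r" "\<And>i. i \<in> I \<Longrightarrow> convergent (\<lambda>n. \<phi> i (k (r n)))"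
    using common_convergent_subseq[OF \<open>finite I\<close>, of "\<lambda>i n. \<phi> i (k n)"]
    unfolding o_def by blast
  obtain l where l: "\<And>i. i \<in> I \<Longrightarrow> (\<lambda>n. \<phi> i (k (r n))) \<longlonglongrightarrow> l i"
    using r(2) unfolding convergent_def by metis
  have blC: "bounded_linear (\<lambda>c. c *\<^sub>C x)" for x :: 'h
    by (rule bounded_linear_intro[where K = "norm x"])
      (auto simp: scaleC_add_left norm_scaleC scaleR_conv_of_real scaleC_scaleC[symmetric] scaleC_of_real)
  have D0: "(\<lambda>n. blinfun_apply D (k (r n))) \<longlonglongrightarrow> 0"
  proof (rule Lim_null_comparison)
    show "\<forall>\<^sub>F n in sequentially. norm (blinfun_apply D (k (r n))) \<le> 1 / real (Suc (r n))"
      using k(2) less_imp_le by (auto intro!: always_eventually)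
    show "(\<lambda>n. 1 / real (Suc (r n))) \<longlonglongrightarrow> 0"
      using LIMSEQ_subseq_LIMSEQ[OF LIMSEQ_Suc[OF lim_inverse_n'] r(1)]
      by (simp add: o_def)
  qed
  have "(\<lambda>n. blinfun_apply D (k (r n)) - (\<Sum>i\<in>I. \<phi> i (k (r n)) *\<^sub>C e i))
      \<longlonglongrightarrow> 0 - (\<Sum>i\<in>I. l i *\<^sub>C e i)"
    by (intro tendsto_intros D0 tendsto_sum bounded_linear.tendsto[OF blC] l)
  moreover have "(\<lambda>n. blinfun_apply D (k (r n)) - (\<Sum>i\<in>I. \<phi> i (k (r n)) *\<^sub>C e i))
      = (\<lambda>n. blinfun_apply X (k (r n)))" by (simp add: D)
  ultimately have CX: "Cauchy (\<lambda>n. blinfun_apply X (k (r n)))"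
    by (metis LIMSEQ_imp_Cauchy)
  have "Cauchy (\<lambda>n. k (r n))"
  proof (rule CauchyI)
    fix \<epsilon> :: real assume "\<epsilon> > 0"
    then obtain M where M: "\<And>m n. m \<ge> M \<Longrightarrow> n \<ge> M \<Longrightarrow>
        norm (blinfun_apply X (k (r m)) - blinfun_apply X (k (r n))) < a * \<epsilon>"
      using CauchyD[OF CX, of "a * \<epsilon>"] \<open>a > 0\<close> by auto
    have "norm (k (r m) - k (r n)) < \<epsilon>" if "m \<ge> M" "n \<ge> M" for m n
      using M[OF that] below[of "k (r m) - k (r n)"] \<open>a > 0\<close>
      by (simp add: blinfun.diff_right) (metis le_less_trans mult_less_cancel_left_pos)
    thus "\<exists>M. \<forall>m\<ge>M. \<forall>n\<ge>M. norm (k (r m) - k (r n)) < \<epsilon>" by blast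
  qed
  then obtain y where y: "(\<lambda>n. k (r n)) \<longlonglongrightarrow> y" using Cauchy_convergent convergentD by blast
  have "(\<lambda>n. blinfun_apply D (k (r n))) \<longlonglongrightarrow> blinfun_apply D y"
    by (intro tendsto_intros y)
  hence "blinfun_apply D y = 0" using D0 LIMSEQ_unique by blast
  hence "y = 0" by (rule inj)
  moreover have "norm y = 1"
    using tendsto_norm[OF y] k(1) LIMSEQ_unique[of "\<lambda>_. 1::real" "norm y" 1] by simp
  ultimately show False by simp
qed

text \<open>The operator type consists of real-linear bounded maps. Complex multiples are therefore
  a separate operation, and complex linearity is carried as the predicate
  \<open>clin\<close>.\<close>

definition scaleB :: "complex \<Rightarrow> ('h::complex_hilbert \<Rightarrow>\<^sub>L 'h) \<Rightarrow> ('h \<Rightarrow>\<^sub>L 'h)" where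
  "scaleB c A = Blinfun (\<lambda>x. c *\<^sub>C blinfun_apply A x)"

lemma scaleB_apply: "blinfun_apply (scaleB c A) x = c *\<^sub>C blinfun_apply A x"
proof -
  have "bounded_linear (\<lambda>x. c *\<^sub>C blinfun_apply A x)"
  proof (rule bounded_linear_intro[where K = "norm c * norm A"])
    fix r :: real and x :: 'a
    show "c *\<^sub>C blinfun_apply A (r *\<^sub>R x) = r *\<^sub>R c *\<^sub>C blinfun_apply A x"
      unfolding blinfun.scaleR_right by (simp add: scaleC_scaleC mult.commute flip: scaleC_of_real)
    show "norm (c *\<^sub>C blinfun_apply A x) \<le> norm x * (norm c * norm A)"
      using mult_left_mono[OF norm_blinfun[of A x], of "norm c"]
      by (simp add: norm_scaleC mult_ac)
  qed (simp add: blinfun.add_right scaleC_add_right)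
  thus ?thesis by (simp add: scaleB_def bounded_linear_Blinfun_apply)
qed

definition clin :: "('h::complex_hilbert \<Rightarrow>\<^sub>L 'h) \<Rightarrow> bool" where
  "clin A \<longleftrightarrow> (\<forall>c x. blinfun_apply A (c *\<^sub>C x) = c *\<^sub>C blinfun_apply A x)"

section \<open>Uniform asymptotic expansions\<close>

definition rhp :: "complex filter" where
  "rhp = at 0 within {\<kappa>. Re \<kappa> > 0}"

lemma eventually_rhp_iff:
  "eventually P rhp \<longleftrightarrow> (\<exists>d>0. \<forall>\<kappa>. Re \<kappa> > 0 \<longrightarrow> norm \<kappa> < d \<longrightarrow> P \<kappa>)"
proof -
  have "Re \<kappa> > 0 \<Longrightarrow> \<kappa> \<noteq> 0" for \<kappa> by auto
  thus ?thesis unfolding rhp_def eventually_at dist_norm by (simp add: Ball_def)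
qed

lemma eventually_rhp: "\<forall>\<^sub>F \<kappa> in rhp. Re \<kappa> > 0"
  by (auto simp: eventually_rhp_iff intro: exI[of _ 1])

lemma eventually_rhp_small: "d > 0 \<Longrightarrow> \<forall>\<^sub>F \<kappa> in rhp. Re \<kappa> > 0 \<and> norm \<kappa> < d"
  by (auto simp: eventually_rhp_iff)

text \<open>Abstracts multiplication by complex numbers on a real normed space, so that one
  expansion calculus serves scalars, vectors and operators. Conjugate scaling is an instance as
  well, as required by the antilinear slot of the inner product.\<close>

definition cscaling :: "(complex \<Rightarrow> 'b::real_normed_vector \<Rightarrow> 'b) \<Rightarrow> bool" where
  "cscaling sc \<longleftrightarrow> (\<forall>z x y. sc z (x + y) = sc z x + sc z y) \<and>
     (\<forall>z x. norm (sc z x) = norm z * norm x) \<and>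
     (\<forall>z w x. sc z (sc w x) = sc (z * w) x) \<and> (\<forall>x. sc 1 x = x)"

lemma cscalingD:
  assumes "cscaling sc"
  shows "sc z (x + y) = sc z x + sc z y" "norm (sc z x) = norm z * norm x"
    "sc z (sc w x) = sc (z * w) x" "sc 1 x = x" "sc z 0 = 0" "sc z (- x) = - sc z x"
    "sc z (x - y) = sc z x - sc z y" "sc z (\<Sum>i\<in>I. h i) = (\<Sum>i\<in>I. sc z (h i))"
proof -
  show add: "sc z (x + y) = sc z x + sc z y" for z x y using assms by (simp add: cscaling_def)
  show 0: "sc z 0 = 0" for z using add[of z 0 0] by simp
  show minus: "sc z (- x) = - sc z x" for z x
    using add[of z x "- x"] 0 by (simp add: eq_neg_iff_add_eq_0 add.commute)
  show "sc z (x - y) = sc z x - sc z y" using add[of z x "- y"] minus by simp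
  show "sc z (\<Sum>i\<in>I. h i) = (\<Sum>i\<in>I. sc z (h i))"
    by (induction I rule: infinite_finite_induct) (auto simp: 0 add)
qed (use assms in \<open>auto simp: cscaling_def\<close>)

lemma cscaling_mult: "cscaling ((*) :: complex \<Rightarrow> complex \<Rightarrow> complex)"
  by (auto simp: cscaling_def algebra_simps norm_mult)

lemma cscaling_scaleC: "cscaling (scaleC :: complex \<Rightarrow> 'h::complex_hilbert \<Rightarrow> 'h)"
  by (auto simp: cscaling_def scaleC_add_right norm_scaleC scaleC_scaleC)

lemma cscaling_scaleC_cnj: "cscaling (\<lambda>z. scaleC (cnj z) :: 'h::complex_hilbert \<Rightarrow> 'h)"
  by (auto simp: cscaling_def scaleC_add_right norm_scaleC scaleC_scaleC)

lemma cscaling_scaleB: "cscaling (scaleB :: complex \<Rightarrow> ('h::complex_hilbert \<Rightarrow>\<^sub>L 'h) \<Rightarrow> _)"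
proof -
  have le: "norm (scaleB z A) \<le> norm z * norm A" for z and A :: "'h \<Rightarrow>\<^sub>L 'h"
  proof (rule norm_blinfun_bound)
    show "norm (blinfun_apply (scaleB z A) x) \<le> norm z * norm A * norm x" for x
      using mult_left_mono[OF norm_blinfun[of A x], of "norm z"]
      by (simp add: scaleB_apply norm_scaleC mult_ac)
  qed auto
  have mult: "scaleB z (scaleB w A) = scaleB (z * w) A" for z w and A :: "'h \<Rightarrow>\<^sub>L 'h"
    by (rule blinfun_eqI) (simp add: scaleB_apply scaleC_scaleC)
  have one: "scaleB 1 A = A" for A :: "'h \<Rightarrow>\<^sub>L 'h"
    by (rule blinfun_eqI) (simp add: scaleB_apply)
  have "norm z * norm A \<le> norm (scaleB z A)" for z and A :: "'h \<Rightarrow>\<^sub>L 'h"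
  proof (cases "z = 0")
    case False
    have "norm A \<le> norm (1 / z) * norm (scaleB z A)"
      using le[of "1 / z" "scaleB z A"] False by (simp add: mult one)
    thus ?thesis using False by (simp add: norm_divide field_simps)
  qed simp
  hence norm: "norm (scaleB z A) = norm z * norm A" for z and A :: "'h \<Rightarrow>\<^sub>L 'h"
    using le by (metis antisym)
  show ?thesis unfolding cscaling_def
    by (intro conjI allI mult one norm blinfun_eqI)
      (simp add: scaleB_apply blinfun.add_left scaleC_add_right)
qed

text \<open>Uniformity in the index i is the point: the weights \<open>W j i\<close> record the
  polynomial growth of coefficients, and the expansion of a whole kernel becomes a single statement.
  The index ranges over exponents, vertices or pairs of vertices, and over \<open>unit\<close> for a
  single operator.\<close>

definition uexp :: "(complex \<Rightarrow> 'b \<Rightarrow> 'b) \<Rightarrow> nat \<Rightarrow> (nat \<Rightarrow> 'i \<Rightarrow> real) \<Rightarrow>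
    (complex \<Rightarrow> 'i \<Rightarrow> 'b::real_normed_vector) \<Rightarrow> (nat \<Rightarrow> 'i \<Rightarrow> 'b) \<Rightarrow> bool" where
  "uexp sc J W f c \<longleftrightarrow> (\<forall>j<J. \<exists>C. \<forall>i. norm (c j i) \<le> C * W j i) \<and>
     (\<exists>C. \<forall>\<^sub>F \<kappa> in rhp. \<forall>i. norm (f \<kappa> i - (\<Sum>j<J. sc (\<kappa> ^ j) (c j i))) \<le> C * norm \<kappa> ^ J * W J i)"

lemma uexp_coeff_bound:
  assumes "uexp sc J W f c" and W0: "\<And>j i. 0 \<le> W j i"
  obtains C where "C \<ge> 0" "\<And>j i. j < J \<Longrightarrow> norm (c j i) \<le> C * W j i"
proof -
  obtain C where C: "\<And>j i. j < J \<Longrightarrow> norm (c j i) \<le> C j * W j i"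
    using assms unfolding uexp_def by metis
  have "norm (c j i) \<le> (\<Sum>j<J. \<bar>C j\<bar>) * W j i" if "j < J" for j i
  proof -
    have "C j \<le> (\<Sum>j<J. \<bar>C j\<bar>)" 
      using member_le_sum[of j "{..<J}" "\<lambda>j. \<bar>C j\<bar>"] that by auto
    thus ?thesis using C[OF that, of i] W0[of j i] by (meson mult_right_mono order_trans)
  qed
  thus ?thesis by (intro that[of "\<Sum>j<J. \<bar>C j\<bar>"]) (auto intro: sum_nonneg)
qed

lemma uexp_remainder_bound:
  assumes "uexp sc J W f c" and W0: "\<And>j i. 0 \<le> W j i"
  obtains C where "C \<ge> 0"
    "\<forall>\<^sub>F \<kappa> in rhp. \<forall>i. norm (f \<kappa> i - (\<Sum>j<J. sc (\<kappa> ^ j) (c j i))) \<le> C * norm \<kappa> ^ J * W J i"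
proof -
  obtain C where C: "\<forall>\<^sub>F \<kappa> in rhp. \<forall>i.
      norm (f \<kappa> i - (\<Sum>j<J. sc (\<kappa> ^ j) (c j i))) \<le> C * norm \<kappa> ^ J * W J i"
    using assms unfolding uexp_def by blast
  have le: "C * norm \<kappa> ^ J * W J i \<le> \<bar>C\<bar> * norm \<kappa> ^ J * W J i" for \<kappa> i
    by (intro mult_right_mono W0) auto
  show ?thesis
  proof (rule that[of "\<bar>C\<bar>"])
    show "\<forall>\<^sub>F \<kappa> in rhp. \<forall>i.
        norm (f \<kappa> i - (\<Sum>j<J. sc (\<kappa> ^ j) (c j i))) \<le> \<bar>C\<bar> * norm \<kappa> ^ J * W J i"
      using C by eventually_elim (meson le order_trans)
  qed simp
qed

lemma uexp_reindex:
  "uexp sc J W f c \<Longrightarrow> uexp sc J (\<lambda>j i. W j (h i)) (\<lambda>\<kappa> i. f \<kappa> (h i)) (\<lambda>j i. c j (h i))"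
proof -
  assume f: "uexp sc J W f c"
  then obtain C where C: "\<forall>\<^sub>F \<kappa> in rhp. \<forall>i.
      norm (f \<kappa> i - (\<Sum>j<J. sc (\<kappa> ^ j) (c j i))) \<le> C * norm \<kappa> ^ J * W J i"
    unfolding uexp_def by blast
  have "\<forall>\<^sub>F \<kappa> in rhp. \<forall>i.
      norm (f \<kappa> (h i) - (\<Sum>j<J. sc (\<kappa> ^ j) (c j (h i)))) \<le> C * norm \<kappa> ^ J * W J (h i)"
    using C by eventually_elim blast
  moreover have "\<forall>j<J. \<exists>C. \<forall>i. norm (c j (h i)) \<le> C * W j (h i)"
    using f unfolding uexp_def by meson
  ultimately show ?thesis unfolding uexp_def by blast
qed

text \<open>The coefficients form the Cauchy product, and \<open>W3\<close> lets the two weights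
  combine. Compatibility with scaling in the second slot is asked of the coefficients
  \<open>c j\<close> only: when P is application or composition of operators it amounts to complex
  linearity, which is at hand for the coefficients.\<close>

lemma uexp_bilinear:
  fixes P :: "'b::real_normed_vector \<Rightarrow> 'c::real_normed_vector \<Rightarrow> 'd::real_normed_vector"
  assumes sb: "cscaling sb" and sc: "cscaling sc" and sd: "cscaling sd"
    and P: "bounded_bilinear P"
    and P1: "\<And>z x y. P (sb z x) y = sd z (P x y)"
    and P2: "\<And>j i z y. j < J \<Longrightarrow> P (c j i) (sc z y) = sd z (P (c j i) y)"
    and W0: "\<And>j i. 0 \<le> W j i" and W'0: "\<And>j i. 0 \<le> W' j i"
    and Wm: "\<And>j i. j \<le> J \<Longrightarrow> W j i \<le> W J i" and W'm: "\<And>j i. j \<le> J \<Longrightarrow> W' j i \<le> W' J i"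
    and W3: "\<And>a b j i. a \<le> j \<Longrightarrow> b \<le> j \<Longrightarrow> W a i * W' b i \<le> W'' j i"
    and f: "uexp sb J W f c" and g: "uexp sc J W' g d"
  shows "uexp sd J W'' (\<lambda>\<kappa> i. P (f \<kappa> i) (g \<kappa> i)) (\<lambda>j i. \<Sum>a\<le>j. P (c a i) (d (j - a) i))"
proof -
  interpret P: bounded_bilinear P by (rule P)
  obtain Cc where Cc: "Cc \<ge> 0" "\<And>j i. j < J \<Longrightarrow> norm (c j i) \<le> Cc * W j i"
    by (rule uexp_coeff_bound[OF f W0]) blast
  obtain Cd where Cd: "Cd \<ge> 0" "\<And>j i. j < J \<Longrightarrow> norm (d j i) \<le> Cd * W' j i"
    by (rule uexp_coeff_bound[OF g W'0]) blast
  obtain Cf where Cf: "Cf \<ge> 0" "\<forall>\<^sub>F \<kappa> in rhp. \<forall>i.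
      norm (f \<kappa> i - (\<Sum>j<J. sb (\<kappa> ^ j) (c j i))) \<le> Cf * norm \<kappa> ^ J * W J i"
    by (rule uexp_remainder_bound[OF f W0]) blast
  obtain Cg where Cg: "Cg \<ge> 0" "\<forall>\<^sub>F \<kappa> in rhp. \<forall>i.
      norm (g \<kappa> i - (\<Sum>j<J. sc (\<kappa> ^ j) (d j i))) \<le> Cg * norm \<kappa> ^ J * W' J i"
    by (rule uexp_remainder_bound[OF g W'0]) blast
  obtain K where K: "K \<ge> 0" "\<And>x y. norm (P x y) \<le> norm x * norm y * K"
    using P.nonneg_bounded by blast
  have Pb: "norm (P x y) \<le> X * Y * K" if "norm x \<le> X" "norm y \<le> Y" for x y X Y
  proof -
    have "norm x * norm y * K \<le> X * Y * K"
      using that K(1) by (intro mult_right_mono mult_mono) (auto intro: order_trans[OF norm_ge_zero])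
    thus ?thesis using K(2)[of x y] by linarith
  qed
  have Pcd: "norm (P (c a i) (d b i)) \<le> Cc * Cd * K * W'' j i" if "a < J" "b < J" "a \<le> j" "b \<le> j" for a b i j
  proof -
    have "norm (P (c a i) (d b i)) \<le> (Cc * W a i) * (Cd * W' b i) * K"
      using Cc Cd that by (intro Pb) auto
    also have "\<dots> = (Cc * Cd * K) * (W a i * W' b i)" by simp
    also have "\<dots> \<le> (Cc * Cd * K) * W'' j i"
      using Cc Cd K that by (intro mult_left_mono W3) auto
    finally show ?thesis .
  qed
  have coeff: "\<exists>C. \<forall>i. norm (\<Sum>a\<le>j. P (c a i) (d (j - a) i)) \<le> C * W'' j i" if "j < J" for j
  proof (intro exI allI)
    fix i
    have "norm (\<Sum>a\<le>j. P (c a i) (d (j - a) i)) \<le> (\<Sum>a\<le>j. Cc * Cd * K * W'' j i)"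
      using that by (intro sum_norm_le Pcd) auto
    thus "norm (\<Sum>a\<le>j. P (c a i) (d (j - a) i)) \<le> (real (Suc j) * (Cc * Cd * K)) * W'' j i"
      by (simp add: algebra_simps)
  qed
  define C where "C = Cf * (real J * Cd + Cg) * K + (real J * Cc) * Cg * K + real J * real J * (Cc * Cd * K)"
  have rem: "\<forall>\<^sub>F \<kappa> in rhp. \<forall>i. norm (P (f \<kappa> i) (g \<kappa> i) -
      (\<Sum>j<J. sd (\<kappa> ^ j) (\<Sum>a\<le>j. P (c a i) (d (j - a) i)))) \<le> C * norm \<kappa> ^ J * W'' J i"
    using Cf(2) Cg(2) eventually_rhp_small[OF zero_less_one]
  proof eventually_elim
    case (elim \<kappa>)
    show ?case
    proof
      fix i
      have k1: "norm \<kappa> ^ n \<le> 1" for n using elim(3) by (simp add: power_le_one)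
      define p where "p = (\<Sum>j<J. sb (\<kappa> ^ j) (c j i))"
      define q where "q = (\<Sum>j<J. sc (\<kappa> ^ j) (d j i))"
      let ?k = "norm \<kappa> ^ J"
      have fp: "norm (f \<kappa> i - p) \<le> Cf * ?k * W J i" using elim(1) by (simp add: p_def)
      have gq: "norm (g \<kappa> i - q) \<le> Cg * ?k * W' J i" using elim(2) by (simp add: q_def)
      have np: "norm p \<le> real J * Cc * W J i"
      proof -
        have "norm p \<le> (\<Sum>j<J. 1 * (Cc * W J i))" unfolding p_def
        proof (rule sum_norm_le)
          fix j assume j: "j \<in> {..<J}"
          have "norm (c j i) \<le> Cc * W J i"
            using Cc(2)[of j i] j mult_left_mono[OF Wm[of j i] Cc(1)] by simp
          thus "norm (sb (\<kappa> ^ j) (c j i)) \<le> 1 * (Cc * W J i)"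
            unfolding cscalingD(2)[OF sb] norm_power by (intro mult_mono k1) auto
        qed
        thus ?thesis by simp
      qed
      have nq: "norm q \<le> real J * Cd * W' J i"
      proof -
        have "norm q \<le> (\<Sum>j<J. 1 * (Cd * W' J i))" unfolding q_def
        proof (rule sum_norm_le)
          fix j assume j: "j \<in> {..<J}"
          have "norm (d j i) \<le> Cd * W' J i"
            using Cd(2)[of j i] j mult_left_mono[OF W'm[of j i] Cd(1)] by simp
          thus "norm (sc (\<kappa> ^ j) (d j i)) \<le> 1 * (Cd * W' J i)"
            unfolding cscalingD(2)[OF sc] norm_power by (intro mult_mono k1) auto
        qed
        thus ?thesis by simp
      qed
      have ng: "norm (g \<kappa> i) \<le> (real J * Cd + Cg) * W' J i"
      proof -
        have "Cg * ?k * W' J i \<le> Cg * 1 * W' J i"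
          by (intro mult_right_mono mult_left_mono k1 Cg W'0)
        moreover have "norm (g \<kappa> i) \<le> norm q + norm (g \<kappa> i - q)"
          by (metis add.commute diff_add_cancel norm_triangle_ineq)
        ultimately show ?thesis using gq nq by (simp add: algebra_simps)
      qed
      have WW: "W J i * W' J i \<le> W'' J i" by (rule W3) auto
      have t1: "norm (P (f \<kappa> i - p) (g \<kappa> i)) \<le> Cf * (real J * Cd + Cg) * K * ?k * W'' J i"
      proof -
        have "norm (P (f \<kappa> i - p) (g \<kappa> i)) \<le> (Cf * ?k * W J i) * ((real J * Cd + Cg) * W' J i) * K"
          by (rule Pb[OF fp ng])
        also have "\<dots> = (Cf * (real J * Cd + Cg) * K * ?k) * (W J i * W' J i)" by (simp add: mult_ac)
        also have "\<dots> \<le> (Cf * (real J * Cd + Cg) * K * ?k) * W'' J i"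
          using Cf Cd Cg K by (intro mult_left_mono[OF WW]) auto
        finally show ?thesis .
      qed
      have t2: "norm (P p (g \<kappa> i - q)) \<le> (real J * Cc) * Cg * K * ?k * W'' J i"
      proof -
        have "norm (P p (g \<kappa> i - q)) \<le> (real J * Cc * W J i) * (Cg * ?k * W' J i) * K"
          by (rule Pb[OF np gq])
        also have "\<dots> = (real J * Cc * Cg * K * ?k) * (W J i * W' J i)" by (simp add: mult_ac)
        also have "\<dots> \<le> (real J * Cc * Cg * K * ?k) * W'' J i"
          using Cc Cg K by (intro mult_left_mono[OF WW]) auto
        finally show ?thesis by (simp add: mult_ac)
      qed
      let ?s = "\<lambda>(a, b). sd (\<kappa> ^ (a + b)) (P (c a i) (d b i))"
      let ?T = "{(a, b). a + b < J}" and ?S = "{..<J} \<times> {..<J}"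
      have pq: "P p q = sum ?s ?S"
      proof -
        have "P p q = (\<Sum>a<J. \<Sum>b<J. P (sb (\<kappa> ^ a) (c a i)) (sc (\<kappa> ^ b) (d b i)))"
          unfolding p_def q_def P.sum_left unfolding P.sum_right ..
        also have "\<dots> = (\<Sum>a<J. \<Sum>b<J. ?s (a, b))"
          by (intro sum.cong refl) (simp add: P1 P2 cscalingD(3)[OF sd] power_add)
        finally show ?thesis by (simp add: sum.cartesian_product)
      qed
      have tri: "(\<Sum>j<J. sd (\<kappa> ^ j) (\<Sum>a\<le>j. P (c a i) (d (j - a) i))) = sum ?s ?T"
        using sum.triangle_reindex[of "\<lambda>a b. ?s (a, b)" J] by (simp add: cscalingD(8)[OF sd])
      have sub: "?T \<subseteq> ?S" by auto
      have t3: "norm (P p q - sum ?s ?T) \<le> real J * real J * (Cc * Cd * K) * ?k * W'' J i"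
      proof -
        have "P p q - sum ?s ?T = sum ?s (?S - ?T)"
          unfolding pq by (subst sum_diff[OF _ sub]) auto
        also have "norm \<dots> \<le> (\<Sum>x\<in>?S - ?T. ?k * (Cc * Cd * K * W'' J i))"
        proof (rule sum_norm_le)
          fix x assume "x \<in> ?S - ?T"
          then obtain a b where x: "x = (a, b)" "a < J" "b < J" "J \<le> a + b" by auto
          have "norm \<kappa> ^ (a + b) \<le> ?k" using elim(3) x by (intro power_decreasing) auto
          thus "norm (?s x) \<le> ?k * (Cc * Cd * K * W'' J i)"
            using x Pcd[of a b J i]
            by (simp add: cscalingD(2)[OF sd] norm_power mult_mono)
        qed
        also have "\<dots> \<le> (\<Sum>x\<in>?S. ?k * (Cc * Cd * K * W'' J i))"
        proof (rule sum_mono2)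
          have "0 \<le> W'' J i" by (rule order_trans[OF mult_nonneg_nonneg[OF W0 W'0] WW])
          thus "0 \<le> ?k * (Cc * Cd * K * W'' J i)" using Cc Cd K by auto
        qed auto
        finally show ?thesis by (simp add: mult_ac)
      qed
      \<comment> \<open>First f and then g is replaced by its truncation; the third difference
        collects the index pairs of the square outside the triangle a + b < J, each of size at most
        |\<kappa>|^J.\<close>
      have "P (f \<kappa> i) (g \<kappa> i) - sum ?s ?T =
          P (f \<kappa> i - p) (g \<kappa> i) + P p (g \<kappa> i - q) + (P p q - sum ?s ?T)"
        by (simp add: P.diff_left P.diff_right)
      also have "norm \<dots> \<le> Cf * (real J * Cd + Cg) * K * ?k * W'' J i
          + (real J * Cc) * Cg * K * ?k * W'' J i + real J * real J * (Cc * Cd * K) * ?k * W'' J i"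
        by (intro norm_triangle_mono t1 t2 t3)
      also have "\<dots> = C * ?k * W'' J i" by (simp add: C_def algebra_simps)
      finally show "norm (P (f \<kappa> i) (g \<kappa> i) -
        (\<Sum>j<J. sd (\<kappa> ^ j) (\<Sum>a\<le>j. P (c a i) (d (j - a) i)))) \<le> C * ?k * W'' J i"
        by (simp only: tri)
    qed
  qed
  show ?thesis unfolding uexp_def using coeff rem by blast
qed

text \<open>Division by \<kappa> when the leading coefficient vanishes: one order is lost, and the
  new coefficient j keeps the weight of the old index j + 1.\<close>

lemma uexp_shift:
  assumes sc: "cscaling sc" and f: "uexp sc (Suc J) W f c" and c0: "\<And>i. c 0 i = 0"
  shows "uexp sc J (\<lambda>j. W (Suc j)) (\<lambda>\<kappa> i. sc (1 / \<kappa>) (f \<kappa> i)) (\<lambda>j. c (Suc j))"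
proof -
  obtain C where C: "\<forall>\<^sub>F \<kappa> in rhp. \<forall>i.
      norm (f \<kappa> i - (\<Sum>j<Suc J. sc (\<kappa> ^ j) (c j i))) \<le> C * norm \<kappa> ^ Suc J * W (Suc J) i"
    using f unfolding uexp_def by blast
  have "\<forall>\<^sub>F \<kappa> in rhp. \<forall>i.
      norm (sc (1 / \<kappa>) (f \<kappa> i) - (\<Sum>j<J. sc (\<kappa> ^ j) (c (Suc j) i))) \<le> C * norm \<kappa> ^ J * W (Suc J) i"
    using C eventually_rhp
  proof eventually_elim
    case (elim \<kappa>)
    hence k0: "\<kappa> \<noteq> 0" by auto
    show ?case
    proof
      fix i
      have "(\<Sum>j<Suc J. sc (\<kappa> ^ j) (c j i)) = (\<Sum>j<J. sc (\<kappa> ^ Suc j) (c (Suc j) i))"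
        by (subst sum.lessThan_Suc_shift) (simp add: c0 cscalingD[OF sc])
      hence "sc (1 / \<kappa>) (f \<kappa> i - (\<Sum>j<Suc J. sc (\<kappa> ^ j) (c j i))) =
          sc (1 / \<kappa>) (f \<kappa> i) - (\<Sum>j<J. sc (\<kappa> ^ j) (c (Suc j) i))"
        using k0 by (simp add: cscalingD(3,7,8)[OF sc])
      moreover have "norm (sc (1 / \<kappa>) (f \<kappa> i - (\<Sum>j<Suc J. sc (\<kappa> ^ j) (c j i))))
          \<le> norm (1 / \<kappa>) * (C * norm \<kappa> ^ Suc J * W (Suc J) i)"
        unfolding cscalingD(2)[OF sc] using elim(1) by (intro mult_left_mono) auto
      moreover have "norm (1 / \<kappa>) * (C * norm \<kappa> ^ Suc J * W (Suc J) i) = C * norm \<kappa> ^ J * W (Suc J) i"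
        using k0 by (simp add: norm_divide)
      ultimately show "norm (sc (1 / \<kappa>) (f \<kappa> i) - (\<Sum>j<J. sc (\<kappa> ^ j) (c (Suc j) i)))
          \<le> C * norm \<kappa> ^ J * W (Suc J) i" by metis
    qed
  qed
  thus ?thesis using f unfolding uexp_def by blast
qed

section \<open>Inversion of operator-valued expansions\<close>

lemma clin_simps:
  "clin id_blinfun"
  "clin A \<Longrightarrow> clin B \<Longrightarrow> clin (A o\<^sub>L B)"
  "clin A \<Longrightarrow> clin B \<Longrightarrow> clin (A + B)"
  "clin A \<Longrightarrow> clin (- A)"
  "clin A \<Longrightarrow> clin (scaleB z A)"
  by (auto simp: clin_def blinfun.add_left blinfun.minus_left scaleC_add_right
      scaleC_minus_right scaleB_apply scaleC_scaleC mult.commute)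

lemma clin_0: "clin 0" by (simp add: clin_def)

lemma clin_sum: "(\<And>i. i \<in> I \<Longrightarrow> clin (f i)) \<Longrightarrow> clin (\<Sum>i\<in>I. f i)"
  by (induction I rule: infinite_finite_induct) (auto simp: clin_0 clin_simps)

text \<open>The formal reciprocal of a power series with leading coefficient 1: the recursion makes
  every Cauchy product coefficient of positive index vanish.\<close>

fun inv_coeff :: "(nat \<Rightarrow> 'h \<Rightarrow>\<^sub>L 'h::complex_hilbert) \<Rightarrow> nat \<Rightarrow> 'h \<Rightarrow>\<^sub>L 'h" where
  "inv_coeff y 0 = id_blinfun"
| "inv_coeff y (Suc n) = - (\<Sum>a\<le>n. y (Suc a) o\<^sub>L inv_coeff y (n - a))"

lemma clin_inv_coeff: "(\<And>j. clin (y j)) \<Longrightarrow> clin (inv_coeff y n)"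
proof (induction n rule: less_induct)
  case (less n)
  have "clin (id_blinfun :: 'a \<Rightarrow>\<^sub>L 'a)" by (simp add: clin_def)
  moreover have "clin (inv_coeff y (Suc m))" if "n = Suc m" for m
  proof -
    have "clin (y (Suc a) o\<^sub>L inv_coeff y (m - a))" for a
      using less that by (intro clin_simps) auto
    hence "clin (\<Sum>a\<le>m. y (Suc a) o\<^sub>L inv_coeff y (m - a))" by (rule clin_sum)
    thus ?thesis by (simp add: clin_simps)
  qed
  ultimately show ?case by (cases n) auto
qed

text \<open>Solving Y x = g means finding the fixed point of x \<mapsto> g - (Y x - x), a
  contraction with factor 1/2. The same estimate gives |Y x| \<ge> |x| / 2, hence the bound 2 for
  the inverse.\<close>

lemma near_identity_inverse:
  fixes Y :: "'h::complex_hilbert \<Rightarrow>\<^sub>L 'h"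
  assumes "norm (Y - id_blinfun) \<le> 1 / 2"
  shows "\<exists>Z. Y o\<^sub>L Z = id_blinfun \<and> Z o\<^sub>L Y = id_blinfun \<and> norm Z \<le> 2"
proof -
  have le: "norm (blinfun_apply Y x - x) \<le> 1 / 2 * norm x" for x
  proof -
    have "norm (blinfun_apply (Y - id_blinfun) x) \<le> norm (Y - id_blinfun) * norm x"
      by (rule norm_blinfun)
    also have "\<dots> \<le> 1 / 2 * norm x" by (intro mult_right_mono assms) auto
    finally show ?thesis by (simp add: blinfun.diff_left)
  qed
  have below: "1 / 2 * norm x \<le> norm (blinfun_apply Y x)" for x
    using le[of x] norm_triangle_sub[of x "blinfun_apply Y x"] by (simp add: norm_minus_commute)
  have "\<exists>x. blinfun_apply Y x = g" for g
  proof -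
    have "\<exists>!x. g - (blinfun_apply Y x - x) = x"
    proof (rule banach_fix_type[of "1/2"], simp, simp, intro allI)
      fix x y
      have "(g - (blinfun_apply Y x - x)) - (g - (blinfun_apply Y y - y)) =
          - (blinfun_apply Y (x - y) - (x - y))" by (simp add: blinfun.diff_right)
      thus "dist (g - (blinfun_apply Y x - x)) (g - (blinfun_apply Y y - y)) \<le> 1 / 2 * dist x y"
        unfolding dist_norm using le[of "x - y"] by (metis norm_minus_cancel)
    qed
    then obtain x where "g - (blinfun_apply Y x - x) = x" by blast
    thus ?thesis by (intro exI[of _ x]) (simp add: algebra_simps)
  qed
  hence "surj (blinfun_apply Y)" by (metis surjI)
  from blinfun_inverse_exists[OF _ below this] obtain Z where
    Z: "Y o\<^sub>L Z = id_blinfun" "Z o\<^sub>L Y = id_blinfun" "\<And>x. norm (blinfun_apply Z x) \<le> norm x / (1 / 2)"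
    by auto
  have "norm Z \<le> 2" using Z(3) by (intro norm_blinfun_bound) (auto simp: mult.commute)
  thus ?thesis using Z by blast
qed

lemma bounded_bilinear_o: "bounded_bilinear (blinfun_compose :: ('h \<Rightarrow>\<^sub>L 'h) \<Rightarrow> ('h \<Rightarrow>\<^sub>L 'h) \<Rightarrow> ('h::complex_hilbert \<Rightarrow>\<^sub>L 'h))"
  by (rule bounded_bilinear_blinfun_compose)

lemma scaleB_compose: "scaleB z A o\<^sub>L B = scaleB z (A o\<^sub>L B)"
  by (rule blinfun_eqI) (simp add: scaleB_apply)

lemma compose_scaleB: "clin A \<Longrightarrow> A o\<^sub>L scaleB z B = scaleB z (A o\<^sub>L B)"
  by (rule blinfun_eqI) (simp add: scaleB_apply clin_def)

abbreviation opexp :: "nat \<Rightarrow> (complex \<Rightarrow> 'h \<Rightarrow>\<^sub>L 'h::complex_hilbert) \<Rightarrow> (nat \<Rightarrow> 'h \<Rightarrow>\<^sub>L 'h) \<Rightarrow> bool" where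
  "opexp J f c \<equiv> uexp scaleB J (\<lambda>_ _. 1) (\<lambda>\<kappa> (_::unit). f \<kappa>) (\<lambda>j _. c j)"

lemma opexp_iff: "opexp J f c \<longleftrightarrow>
    (\<exists>C. \<forall>\<^sub>F \<kappa> in rhp. norm (f \<kappa> - (\<Sum>j<J. scaleB (\<kappa> ^ j) (c j))) \<le> C * norm \<kappa> ^ J)"
proof -
  have "\<exists>C. \<forall>i::unit. norm (c j) \<le> C * 1" for j by (rule exI[of _ "norm (c j)"]) simp
  thus ?thesis unfolding uexp_def by simp
qed

lemma opexp_compose:
  assumes "opexp J f c" "opexp J g d" "\<And>j. clin (c j)"
  shows "opexp J (\<lambda>\<kappa>. f \<kappa> o\<^sub>L g \<kappa>) (\<lambda>j. \<Sum>a\<le>j. c a o\<^sub>L d (j - a))"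
  by (rule uexp_bilinear[OF cscaling_scaleB cscaling_scaleB cscaling_scaleB bounded_bilinear_o
        _ _ _ _ _ _ _ assms(1,2)]) (auto simp: scaleB_compose compose_scaleB assms(3))

text \<open>Let Q be the truncated formal reciprocal. The product expansion gives Y Q = 1 +
  O(\<kappa>^J), and Z - Q = - Z (Y Q - 1) with |Z| \<le> 2 transfers this order to the true inverse
  Z.\<close>

lemma opexp_inverse:
  assumes Y: "opexp J Y y" and y0: "y 0 = id_blinfun" and clin: "\<And>j. clin (y j)" and J: "J > 0"
  shows "\<exists>Z. (\<forall>\<^sub>F \<kappa> in rhp. Y \<kappa> o\<^sub>L Z \<kappa> = id_blinfun \<and> Z \<kappa> o\<^sub>L Y \<kappa> = id_blinfun) \<and>
    opexp J Z (inv_coeff y)"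
proof -
  obtain C where C: "C \<ge> 0" "\<forall>\<^sub>F \<kappa> in rhp. norm (Y \<kappa> - (\<Sum>j<J. scaleB (\<kappa> ^ j) (y j))) \<le> C * norm \<kappa> ^ J"
    using uexp_remainder_bound[OF Y] by auto
  define S where "S = C + (\<Sum>j<J. norm (y j))"
  have S0: "S \<ge> 0" unfolding S_def using C(1) by (simp add: sum_nonneg)
  \<comment> \<open>For |\<kappa>| < 1 the norm of Y - 1 is at most S |\<kappa>|; the radius e
    brings this below 1/2.\<close>
  define e where "e = min 1 (1 / (2 * (S + 1)))"
  have e: "e > 0" "e \<le> 1" "S * e \<le> 1 / 2" using S0 by (auto simp: e_def min_def field_simps)
  have near: "\<forall>\<^sub>F \<kappa> in rhp. norm (Y \<kappa> - id_blinfun) \<le> 1 / 2"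
    using C(2) eventually_rhp_small[OF e(1)]
  proof eventually_elim
    case (elim \<kappa>)
    have kle: "norm \<kappa> ^ j \<le> norm \<kappa>" if "j > 0" for j
      using elim(2) e(2) that power_decreasing[of 1 j "norm \<kappa>"] by simp
    obtain m where m: "J = Suc m" using J gr0_conv_Suc by blast
    have "Y \<kappa> - id_blinfun = (Y \<kappa> - (\<Sum>j<J. scaleB (\<kappa> ^ j) (y j))) + (\<Sum>j<m. scaleB (\<kappa> ^ Suc j) (y (Suc j)))"
      unfolding m by (subst sum.lessThan_Suc_shift) (simp add: y0 cscalingD(4)[OF cscaling_scaleB])
    also have "norm \<dots> \<le> C * norm \<kappa> + (\<Sum>j<m. norm \<kappa> * norm (y (Suc j)))"
    proof (intro norm_triangle_mono sum_norm_le)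
      show "norm (Y \<kappa> - (\<Sum>j<J. scaleB (\<kappa> ^ j) (y j))) \<le> C * norm \<kappa>"
        using elim(1) mult_left_mono[OF kle[OF J] C(1)] by linarith
      show "norm (scaleB (\<kappa> ^ Suc j) (y (Suc j))) \<le> norm \<kappa> * norm (y (Suc j))" for j
        unfolding cscalingD(2)[OF cscaling_scaleB] norm_power by (intro mult_right_mono kle) auto
    qed
    also have "\<dots> \<le> S * norm \<kappa>"
    proof -
      have "S = C + norm (y 0) + (\<Sum>j<m. norm (y (Suc j)))"
        unfolding S_def m by (subst sum.lessThan_Suc_shift) simp
      thus ?thesis by (simp add: algebra_simps sum_distrib_left)
    qed
    also have "\<dots> \<le> S * e" using elim(2) S0 by (intro mult_left_mono) auto
    finally show ?case using e(3) by linarith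
  qed
  define Z where "Z \<kappa> = (SOME Z. Y \<kappa> o\<^sub>L Z = id_blinfun \<and> Z o\<^sub>L Y \<kappa> = id_blinfun \<and> norm Z \<le> 2)" for \<kappa>
  have Z: "\<forall>\<^sub>F \<kappa> in rhp. Y \<kappa> o\<^sub>L Z \<kappa> = id_blinfun \<and> Z \<kappa> o\<^sub>L Y \<kappa> = id_blinfun \<and> norm (Z \<kappa>) \<le> 2"
    using near
  proof eventually_elim
    case (elim \<kappa>)
    show ?case unfolding Z_def by (rule someI_ex[OF near_identity_inverse[OF elim]])
  qed
  define Q where "Q \<kappa> = (\<Sum>j<J. scaleB (\<kappa> ^ j) (inv_coeff y j))" for \<kappa>
  have "opexp J Q (inv_coeff y)"
    unfolding opexp_iff by (rule exI[of _ 0]) (simp add: Q_def)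
  from opexp_compose[OF Y this clin]
  have YQ: "opexp J (\<lambda>\<kappa>. Y \<kappa> o\<^sub>L Q \<kappa>) (\<lambda>j. \<Sum>a\<le>j. y a o\<^sub>L inv_coeff y (j - a))" .
  have cj: "(\<Sum>a\<le>j. y a o\<^sub>L inv_coeff y (j - a)) = (if j = 0 then id_blinfun else 0)" for j
  proof (cases j)
    case 0
    thus ?thesis by (auto simp: y0 intro: blinfun_eqI)
  next
    case (Suc n)
    have "y 0 o\<^sub>L inv_coeff y (Suc n) = inv_coeff y (Suc n)" unfolding y0 by (rule blinfun_eqI) simp
    thus ?thesis unfolding Suc by (subst sum.atMost_Suc_shift) simp
  qed
  have sm: "(\<Sum>j<J. scaleB (\<kappa> ^ j) (if j = 0 then id_blinfun else (0 :: 'a \<Rightarrow>\<^sub>L 'a))) = id_blinfun" for \<kappa>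
  proof -
    obtain m where m: "J = Suc m" using J gr0_conv_Suc by blast
    show ?thesis unfolding m
      by (subst sum.lessThan_Suc_shift) (simp add: cscalingD(4,5)[OF cscaling_scaleB])
  qed
  obtain C' where C': "\<forall>\<^sub>F \<kappa> in rhp. norm ((Y \<kappa> o\<^sub>L Q \<kappa>) - id_blinfun) \<le> C' * norm \<kappa> ^ J"
    using YQ unfolding opexp_iff cj sm by blast
  have "\<forall>\<^sub>F \<kappa> in rhp. norm (Z \<kappa> - (\<Sum>j<J. scaleB (\<kappa> ^ j) (inv_coeff y j))) \<le> (2 * C') * norm \<kappa> ^ J"
    using Z C'
  proof eventually_elim
    case (elim \<kappa>)
    have "Z \<kappa> - Q \<kappa> = - (Z \<kappa> o\<^sub>L ((Y \<kappa> o\<^sub>L Q \<kappa>) - id_blinfun))"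
    proof (rule blinfun_eqI)
      fix x
      have "blinfun_apply (Z \<kappa>) (blinfun_apply (Y \<kappa>) z) = z" for z
        using elim(1) by (metis blinfun_apply_blinfun_compose blinfun_apply_id_blinfun)
      thus "blinfun_apply (Z \<kappa> - Q \<kappa>) x = blinfun_apply (- (Z \<kappa> o\<^sub>L ((Y \<kappa> o\<^sub>L Q \<kappa>) - id_blinfun))) x"
        by (simp add: blinfun.diff_left blinfun.diff_right blinfun.minus_left)
    qed
    hence "norm (Z \<kappa> - Q \<kappa>) \<le> norm (Z \<kappa>) * norm ((Y \<kappa> o\<^sub>L Q \<kappa>) - id_blinfun)"
      by (metis norm_blinfun_compose norm_minus_cancel)
    also have "\<dots> \<le> 2 * (C' * norm \<kappa> ^ J)" using elim by (intro mult_mono) auto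
    finally show ?case by (simp add: Q_def)
  qed
  hence "opexp J Z (inv_coeff y)" unfolding opexp_iff by blast
  moreover have "\<forall>\<^sub>F \<kappa> in rhp. Y \<kappa> o\<^sub>L Z \<kappa> = id_blinfun \<and> Z \<kappa> o\<^sub>L Y \<kappa> = id_blinfun"
    using Z by eventually_elim blast
  ultimately show ?thesis by blast
qed

section \<open>The free resolvent on a half-line\<close>

lemma rhp_le_nhds: "rhp \<le> nhds 0"
  unfolding rhp_def by (rule at_within_le_nhds)

text \<open>The remainder is z^J times the evaluation of the shifted series, which is continuous and
  therefore bounded near 0.\<close>

lemma has_fps_expansion_remainder:
  fixes f :: "complex \<Rightarrow> complex"
  assumes "f has_fps_expansion F"
  shows "\<exists>C. \<forall>\<^sub>F z in nhds 0. norm (f z - (\<Sum>j<J. z ^ j * fps_nth F j)) \<le> C * norm z ^ J"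
proof -
  let ?G = "fps_shift J F"
  have r: "fps_conv_radius F > 0" and ev: "\<forall>\<^sub>F z in nhds 0. eval_fps F z = f z"
    using assms by (auto simp: has_fps_expansion_def)
  have "isCont (eval_fps ?G) 0"
    using has_fps_expansion_imp_continuous[of "eval_fps ?G" ?G UNIV] r
    by (simp add: has_fps_expansion_def)
  hence "((\<lambda>z. norm (eval_fps ?G z)) \<longlongrightarrow> norm (eval_fps ?G 0)) (nhds 0)"
    by (intro tendsto_norm) (metis isCont_def tendsto_at_iff_tendsto_nhds)
  from order_tendstoD(2)[OF this, of "norm (eval_fps ?G 0) + 1"]
  have bd: "\<forall>\<^sub>F z in nhds 0. norm (eval_fps ?G z) < norm (eval_fps ?G 0) + 1" by simp
  have "\<forall>\<^sub>F z in nhds 0. z \<in> eball 0 (fps_conv_radius F)"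
    using r by (intro eventually_nhds_in_open) (auto simp: zero_ereal_def)
  hence "\<forall>\<^sub>F z in nhds 0. norm (f z - (\<Sum>j<J. z ^ j * fps_nth F j))
      \<le> (norm (eval_fps ?G 0) + 1) * norm z ^ J"
    using ev bd
  proof eventually_elim
    case (elim z)
    have s: "summable (\<lambda>n. fps_nth F n * z ^ n)" "summable (\<lambda>n. fps_nth ?G n * z ^ n)"
      using elim(1) by (intro summable_fps; simp add: in_eball_iff)+
    have "f z = (\<Sum>n. fps_nth F (n + J) * z ^ (n + J)) + (\<Sum>j<J. fps_nth F j * z ^ j)"
      using suminf_split_initial_segment[OF s(1), of J] elim(2) by (simp add: eval_fps_def)
    also have "(\<lambda>n. fps_nth F (n + J) * z ^ (n + J)) = (\<lambda>n. z ^ J * (fps_nth ?G n * z ^ n))"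
      by (auto simp: power_add mult_ac)
    also have "(\<Sum>n. z ^ J * (fps_nth ?G n * z ^ n)) = z ^ J * eval_fps ?G z"
      using suminf_mult[OF s(2)] by (simp add: eval_fps_def)
    finally have "f z - (\<Sum>j<J. z ^ j * fps_nth F j) = z ^ J * eval_fps ?G z"
      by (simp add: mult.commute)
    hence "norm (f z - (\<Sum>j<J. z ^ j * fps_nth F j)) = norm (eval_fps ?G z) * norm z ^ J"
      by (simp add: norm_mult norm_power)
    also have "\<dots> \<le> (norm (eval_fps ?G 0) + 1) * norm z ^ J"
      using elim(3) by (intro mult_right_mono) auto
    finally show ?case .
  qed
  thus ?thesis by blast
qed

section \<open>The decaying solution on a half-line and its powers\<close>

definition zroot :: "complex \<Rightarrow> complex" where
  "zroot \<kappa> = csqrt (1 + \<kappa>\<^sup>2 / 4) - \<kappa> / 2"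

text \<open>The decaying solution of the difference equation on the half-line is \<open>n \<mapsto> zeta \<kappa> ^ n\<close>,
  where \<open>zeta \<kappa> + 1 / zeta \<kappa> = 2 + \<kappa>\<^sup>2\<close>.\<close>

definition zeta :: "complex \<Rightarrow> complex" where
  "zeta \<kappa> = 1 - \<kappa> * zroot \<kappa>"

text \<open>\<open>zroot \<kappa>\<close> solves z^2 + \<kappa> z = 1, so 1 - \<kappa> z = z^2. For
  small \<kappa> = 2 sinh \<theta> it is exp(-\<theta>), and \<open>zeta \<kappa>\<close> is
  exp(-2\<theta>).\<close>

lemma zeta_square: "zeta \<kappa> = (zroot \<kappa>)\<^sup>2"
proof -
  have "(csqrt (1 + \<kappa>\<^sup>2 / 4))\<^sup>2 = 1 + \<kappa>\<^sup>2 / 4" by (rule power2_csqrt)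
  thus ?thesis unfolding zeta_def zroot_def power2_diff
    by (simp add: field_simps power2_eq_square)
qed

lemma zeta_equation: "1 + (zeta \<kappa>)\<^sup>2 = (2 + \<kappa>\<^sup>2) * zeta \<kappa>"
proof -
  have "(1 - zeta \<kappa>)\<^sup>2 = \<kappa>\<^sup>2 * (zroot \<kappa>)\<^sup>2" by (simp add: zeta_def power_mult_distrib)
  hence "(1 - zeta \<kappa>)\<^sup>2 = \<kappa>\<^sup>2 * zeta \<kappa>" by (simp only: zeta_square[symmetric])
  thus ?thesis by (simp add: power2_eq_square algebra_simps)
qed

lemma zeta_nz: "zeta \<kappa> \<noteq> 0"
  using zeta_equation[of \<kappa>] by auto

lemma zeta_0 [simp]: "zeta 0 = 1"
  by (simp add: zeta_def)

text \<open>With s the square root in \<open>zroot\<close>, the numbers s - \<kappa>/2 and s +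
  \<kappa>/2 have product 1, so it suffices that the first is the smaller one, that is, Re s Re
  \<kappa> + Im s Im \<kappa> > 0. The bound |\<kappa>| < 2 gives Re s > 0, and comparing imaginary
  parts in s^2 = 1 + \<kappa>^2/4 shows that Im s and Im \<kappa> do not have opposite
  signs.\<close>

lemma norm_zeta_less_1:
  assumes "Re \<kappa> > 0" "norm \<kappa> < 2"
  shows "norm (zeta \<kappa>) < 1"
proof -
  define s where "s = csqrt (1 + \<kappa>\<^sup>2 / 4)"
  have s2: "s\<^sup>2 = 1 + \<kappa>\<^sup>2 / 4" unfolding s_def by (rule power2_csqrt)
  have "norm (\<kappa>\<^sup>2 / 4) < 1"
    using power_strict_mono[of "norm \<kappa>" 2 2] assms by (simp add: norm_divide norm_power)
  hence pos: "Re (1 + \<kappa>\<^sup>2 / 4) > 0"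
    using abs_Re_le_cmod[of "\<kappa>\<^sup>2 / 4"] by (simp add: abs_less_iff abs_le_iff)
  have Re_s: "Re s > 0"
  proof -
    have "Re s \<ge> 0" using csqrt_principal[of "1 + \<kappa>\<^sup>2 / 4"] unfolding s_def by auto
    moreover have "Re s \<noteq> 0"
    proof
      assume "Re s = 0"
      hence "Re (s\<^sup>2) \<le> 0" by (simp add: power2_eq_square)
      thus False using pos s2 by simp
    qed
    ultimately show ?thesis by simp
  qed
  have "Im (s\<^sup>2) = Im (1 + \<kappa>\<^sup>2 / 4)" by (simp only: s2)
  hence im: "Re s * Im s = Re \<kappa> * Im \<kappa> / 4" by (simp add: power2_eq_square mult.commute)
  have "Re s * (Im s * Im \<kappa>) = Re \<kappa> * (Im \<kappa>)\<^sup>2 / 4"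
    using arg_cong[OF im, of "\<lambda>x. x * Im \<kappa>"] by (simp add: power2_eq_square)
  also have "\<dots> \<ge> 0" using assms by simp
  finally have "Im s * Im \<kappa> \<ge> 0" using Re_s by (simp add: zero_le_mult_iff)
  moreover have "Re s * Re \<kappa> > 0" using Re_s assms by simp
  ultimately have re: "Re s * Re \<kappa> + Im s * Im \<kappa> > 0" by linarith
  let ?a = "s - \<kappa> / 2" and ?b = "s + \<kappa> / 2"
  have "?a * ?b = 1" using s2 by (simp add: power2_eq_square algebra_simps)
  hence ab: "norm ?a * norm ?b = 1" by (metis norm_mult norm_one)
  have "(norm ?a)\<^sup>2 < (norm ?b)\<^sup>2"
    using re unfolding cmod_power2 by (simp add: power2_eq_square algebra_simps)
  hence lt: "norm ?a < norm ?b" by (rule power2_less_imp_less) simp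
  have "norm ?a < 1"
  proof (rule ccontr)
    assume "\<not> norm ?a < 1"
    hence "norm ?a \<ge> 1" "norm ?b > 1" using lt by linarith+
    hence "norm ?a * norm ?b > 1 * 1" by (intro mult_le_less_imp_less) auto
    thus False using ab by simp
  qed
  thus ?thesis
    unfolding zeta_square zroot_def s_def[symmetric] norm_power by (simp add: power_less_one_iff)
qed

lemma analytic_zroot: "zroot analytic_on {0}"
proof -
  have "(\<lambda>\<kappa>::complex. 1 + \<kappa>\<^sup>2 / 4) ` {0} \<inter> \<real>\<^sub>\<le>\<^sub>0 = {}" by auto
  hence "csqrt \<circ> (\<lambda>\<kappa>. 1 + \<kappa>\<^sup>2 / 4) analytic_on {0}"
    by (intro analytic_on_compose_gen[where T = "- \<real>\<^sub>\<le>\<^sub>0"] analytic_intros)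
      (auto intro!: analytic_intros simp: analytic_on_open holomorphic_on_csqrt)
  thus ?thesis unfolding zroot_def o_def by (intro analytic_intros) auto
qed

text \<open>The coefficient of \<kappa>^j in (1 - zeta)^i. Since 1 - zeta is \<kappa> times an
  analytic function, it vanishes for j < i.\<close>

definition zcoef :: "nat \<Rightarrow> nat \<Rightarrow> complex" where
  "zcoef i j = fps_nth ((fps_X * fps_expansion zroot 0) ^ i) j"

lemma zcoef_expansion:
  "\<exists>C. \<forall>\<^sub>F \<kappa> in nhds 0. norm ((\<kappa> * zroot \<kappa>) ^ i - (\<Sum>j<J. \<kappa> ^ j * zcoef i j)) \<le> C * norm \<kappa> ^ J"
proof -
  have "zroot has_fps_expansion fps_expansion zroot 0"
    by (rule analytic_at_imp_has_fps_expansion_0[OF analytic_zroot])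
  hence "(\<lambda>\<kappa>. (\<kappa> * zroot \<kappa>) ^ i) has_fps_expansion (fps_X * fps_expansion zroot 0) ^ i"
    by (intro fps_expansion_intros)
  thus ?thesis unfolding zcoef_def by (rule has_fps_expansion_remainder)
qed

lemma zcoef_less: "j < i \<Longrightarrow> zcoef i j = 0"
  unfolding zcoef_def using startsby_zero_power_prefix[of "fps_X * fps_expansion zroot 0" i] by simp

lemma zcoef_0_0 [simp]: "zcoef 0 0 = 1"
  and zcoef_0_1 [simp]: "zcoef 0 (Suc 0) = 0"
  and zcoef_1_1 [simp]: "zcoef (Suc 0) (Suc 0) = 1"
proof -
  show "zcoef (Suc 0) (Suc 0) = 1"
    by (simp add: zcoef_def fps_expansion_def zroot_def)
qed (auto simp: zcoef_def)

text \<open>By Pascal's rule the remainder for p + 1 at order J is the remainder for p at J plus x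
  times the one at J - 1, and the claimed bounds add up in the same way. The condition |1 + x| \<le>
  1 settles order 0 and prevents exponential growth in p.\<close>

lemma binomial_remainder:
  fixes x :: complex
  assumes "norm (1 + x) \<le> 1"
  shows "norm ((1 + x) ^ p - (\<Sum>i<J. of_nat (p choose i) * x ^ i)) \<le> real (p choose J) * norm x ^ J"
proof (induction p arbitrary: J)
  case 0
  show ?case by (cases J) (auto simp: sum.lessThan_Suc_shift simp del: sum.lessThan_Suc)
next
  case (Suc p)
  show ?case
  proof (cases J)
    case 0
    thus ?thesis using assms by (simp add: norm_power power_le_one flip: power_Suc)
  next
    case (Suc J')
    let ?R = "\<lambda>J. (1 + x) ^ p - (\<Sum>i<J. of_nat (p choose i) * x ^ i)"
    have "(\<Sum>i<J. of_nat (Suc p choose i) * x ^ i) =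
        (\<Sum>i<J. of_nat (p choose i) * x ^ i) + x * (\<Sum>i<J'. of_nat (p choose i) * x ^ i)"
      unfolding Suc sum.lessThan_Suc_shift[of _ J']
      by (simp add: sum.distrib sum_distrib_left algebra_simps)
    hence "(1 + x) ^ Suc p - (\<Sum>i<J. of_nat (Suc p choose i) * x ^ i) = ?R J + x * ?R J'"
      by (simp add: algebra_simps)
    also have "norm \<dots> \<le> real (p choose J) * norm x ^ J + norm x * (real (p choose J') * norm x ^ J')"
      by (intro norm_triangle_mono Suc.IH) (simp add: norm_mult mult_left_mono Suc.IH)
    also have "\<dots> = real (Suc p choose J) * norm x ^ J"
      by (simp add: Suc algebra_simps)
    finally show ?thesis .
  qed
qed

lemma binomial_le_Suc_pow: "real (p choose i) \<le> (1 + real p) ^ i"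
proof (cases "i \<le> p")
  case True
  hence "real (p choose i) \<le> real (p ^ i)" using binomial_le_pow of_nat_mono by blast
  also have "\<dots> \<le> (1 + real p) ^ i" unfolding of_nat_power by (intro power_mono) auto
  finally show ?thesis .
qed (simp add: binomial_eq_0)

definition zpow_coef :: "nat \<Rightarrow> nat \<Rightarrow> complex" where
  "zpow_coef j p = (\<Sum>i\<le>j. of_nat (p choose i) * (- 1) ^ i * zcoef i j)"

lemma zpow_coef_0 [simp]: "zpow_coef 0 p = 1"
  and zpow_coef_1 [simp]: "zpow_coef (Suc 0) p = - of_nat p"
  by (auto simp: zpow_coef_def)

lemma eventually_norm_zeta: "\<forall>\<^sub>F \<kappa> in rhp. norm (zeta \<kappa>) < 1"
  using eventually_rhp_small[of 2] norm_zeta_less_1 by (auto elim!: eventually_mono)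

text \<open>zeta^p = (1 - \<kappa> zroot)^p is expanded binomially in \<kappa> zroot, and then each
  power of \<kappa> zroot in \<kappa>. A direct Taylor estimate would grow exponentially in p;
  |zeta| < 1, available for Re \<kappa> > 0, leaves only the polynomial factor (1 + p)^J.\<close>

lemma uexp_zeta_power:
  "uexp (*) J (\<lambda>j p. (1 + real p) ^ j) (\<lambda>\<kappa> p. zeta \<kappa> ^ p) zpow_coef"
proof -
  have coeff: "norm (zpow_coef j p) \<le> (\<Sum>i\<le>j. norm (zcoef i j)) * (1 + real p) ^ j" for j p
  proof -
    have "norm (zpow_coef j p) \<le> (\<Sum>i\<le>j. (1 + real p) ^ j * norm (zcoef i j))"
      unfolding zpow_coef_def
    proof (rule sum_norm_le)
      fix i assume "i \<in> {..j}"
      hence "real (p choose i) \<le> (1 + real p) ^ j"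
        using binomial_le_Suc_pow[of p i] power_increasing[of i j "1 + real p"] by auto
      thus "norm (of_nat (p choose i) * (- 1) ^ i * zcoef i j) \<le> (1 + real p) ^ j * norm (zcoef i j)"
        by (simp add: norm_mult norm_power mult_right_mono)
    qed
    thus ?thesis by (simp add: sum_distrib_left mult.commute)
  qed
  have "\<exists>C. \<forall>\<^sub>F \<kappa> in rhp. norm ((\<kappa> * zroot \<kappa>) ^ i - (\<Sum>j<J. \<kappa> ^ j * zcoef i j)) \<le> C * norm \<kappa> ^ J" for i
    using zcoef_expansion[of i J] filter_leD[OF rhp_le_nhds] by blast
  then obtain C where C: "\<And>i. \<forall>\<^sub>F \<kappa> in rhp.
      norm ((\<kappa> * zroot \<kappa>) ^ i - (\<Sum>j<J. \<kappa> ^ j * zcoef i j)) \<le> C i * norm \<kappa> ^ J"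
    using choice[of "\<lambda>i C. \<forall>\<^sub>F \<kappa> in rhp.
      norm ((\<kappa> * zroot \<kappa>) ^ i - (\<Sum>j<J. \<kappa> ^ j * zcoef i j)) \<le> C * norm \<kappa> ^ J"] by blast
  have "\<exists>C. \<forall>\<^sub>F z in rhp. norm (zroot z) \<le> C"
  proof -
    have "zroot has_fps_expansion fps_expansion zroot 0"
      by (rule analytic_at_imp_has_fps_expansion_0[OF analytic_zroot])
    from has_fps_expansion_remainder[OF this, of 0] show ?thesis
      using filter_leD[OF rhp_le_nhds] by simp blast
  qed
  then obtain B where B: "\<forall>\<^sub>F z in rhp. norm (zroot z) \<le> B" by blast
  let ?C = "\<bar>B\<bar> ^ J + (\<Sum>i<J. \<bar>C i\<bar>)"
  have "\<forall>\<^sub>F \<kappa> in rhp. \<forall>i\<in>{..<J}. norm ((\<kappa> * zroot \<kappa>) ^ i - (\<Sum>j<J. \<kappa> ^ j * zcoef i j)) \<le> C i * norm \<kappa> ^ J"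
    by (intro eventually_ball_finite) (use C in auto)
  hence "\<forall>\<^sub>F \<kappa> in rhp. \<forall>p. norm (zeta \<kappa> ^ p - (\<Sum>j<J. \<kappa> ^ j * zpow_coef j p)) \<le> ?C * norm \<kappa> ^ J * (1 + real p) ^ J"
    using B eventually_norm_zeta
  proof eventually_elim
    case (elim \<kappa>)
    show ?case
    proof
      fix p
      let ?x = "- (\<kappa> * zroot \<kappa>)" and ?w = "(1 + real p) ^ J"
      define b where "b i = (of_nat (p choose i) * (- 1) ^ i :: complex)" for i
      have "(\<Sum>j<J. \<kappa> ^ j * zpow_coef j p) = (\<Sum>j<J. \<Sum>i<J. b i * (\<kappa> ^ j * zcoef i j))"
      proof (intro sum.cong refl)
        fix j assume j: "j \<in> {..<J}"
        have "zpow_coef j p = (\<Sum>i<J. b i * zcoef i j)"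
          unfolding zpow_coef_def b_def
          by (rule sum.mono_neutral_left) (use j zcoef_less in auto)
        thus "\<kappa> ^ j * zpow_coef j p = (\<Sum>i<J. b i * (\<kappa> ^ j * zcoef i j))"
          by (simp add: sum_distrib_left mult_ac)
      qed
      also have "\<dots> = (\<Sum>i<J. b i * (\<Sum>j<J. \<kappa> ^ j * zcoef i j))"
        by (subst sum.swap) (simp add: sum_distrib_left)
      finally have "zeta \<kappa> ^ p - (\<Sum>j<J. \<kappa> ^ j * zpow_coef j p) =
          ((1 + ?x) ^ p - (\<Sum>i<J. of_nat (p choose i) * ?x ^ i)) +
          (\<Sum>i<J. b i * ((\<kappa> * zroot \<kappa>) ^ i - (\<Sum>j<J. \<kappa> ^ j * zcoef i j)))"
        by (simp add: zeta_def b_def right_diff_distrib sum_subtractf power_minus[of "\<kappa> * zroot \<kappa>"] mult.assoc)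
      also have "norm \<dots> \<le> \<bar>B\<bar> ^ J * norm \<kappa> ^ J * ?w + (\<Sum>i<J. ?w * (\<bar>C i\<bar> * norm \<kappa> ^ J))"
      proof (intro norm_triangle_mono sum_norm_le)
        have "norm ((1 + ?x) ^ p - (\<Sum>i<J. of_nat (p choose i) * ?x ^ i)) \<le> real (p choose J) * norm ?x ^ J"
          by (rule binomial_remainder) (use elim(3) in \<open>simp add: zeta_def\<close>)
        also have "\<dots> \<le> ?w * (norm \<kappa> * \<bar>B\<bar>) ^ J"
          using elim(2) by (intro mult_mono binomial_le_Suc_pow power_mono) (auto simp: norm_mult intro!: mult_left_mono)
        finally show "norm ((1 + ?x) ^ p - (\<Sum>i<J. of_nat (p choose i) * ?x ^ i)) \<le> \<bar>B\<bar> ^ J * norm \<kappa> ^ J * ?w"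
          by (simp add: power_mult_distrib mult_ac)
      next
        fix i assume i: "i \<in> {..<J}"
        have "real (p choose i) \<le> ?w"
          using binomial_le_Suc_pow[of p i] power_increasing[of i J "1 + real p"] i by auto
        hence "norm (b i) \<le> ?w" by (simp add: b_def norm_mult norm_power)
        moreover have "norm ((\<kappa> * zroot \<kappa>) ^ i - (\<Sum>j<J. \<kappa> ^ j * zcoef i j)) \<le> \<bar>C i\<bar> * norm \<kappa> ^ J"
          using elim(1) i by (meson abs_ge_self mult_right_mono norm_ge_zero order_trans zero_le_power)
        ultimately show "norm (b i * ((\<kappa> * zroot \<kappa>) ^ i - (\<Sum>j<J. \<kappa> ^ j * zcoef i j))) \<le> ?w * (\<bar>C i\<bar> * norm \<kappa> ^ J)"
          unfolding norm_mult by (intro mult_mono) auto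
      qed
      also have "\<dots> = ?C * norm \<kappa> ^ J * ?w"
        by (simp add: algebra_simps sum_distrib_left sum_distrib_right)
      finally show "norm (zeta \<kappa> ^ p - (\<Sum>j<J. \<kappa> ^ j * zpow_coef j p)) \<le> ?C * norm \<kappa> ^ J * ?w" .
    qed
  qed
  thus ?thesis unfolding uexp_def using coeff by blast
qed

text \<open>The Dirichlet Green function in the closed form \<open>(z^(n-m) - z^(n+m)) / (1/z - z)\<close>, \<open>n \<ge> m\<close>,
  expanded as a geometric sum so that it makes sense at \<open>z = 1\<close>.\<close>

definition ray_green :: "complex \<Rightarrow> nat \<Rightarrow> nat \<Rightarrow> complex" where
  "ray_green z a b = (\<Sum>i\<le>min a b. z ^ (max a b - min a b + 1 + 2 * i))"

lemma ray_green_commute: "ray_green z a b = ray_green z b a"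
  by (simp add: ray_green_def min.commute max.commute)

lemma ray_green_1: "ray_green 1 a b = of_nat (min a b + 1)"
  by (simp add: ray_green_def)

text \<open>After multiplication by z the hypothesis replaces (2 + w) z by 1 + z^2, and before, on
  and after the diagonal the claim becomes a polynomial identity. The point preceding the boundary
  carries the value 0, which is the Dirichlet condition.\<close>

lemma ray_green_equation:
  assumes "1 + z\<^sup>2 = (2 + w) * z" and z: "z \<noteq> 0"
  shows "h_ray (\<lambda>a. ray_green z a b) a + w * ray_green z a b = (if a = b then 1 else 0)"
proof -
  define A where "A m d = (\<Sum>i\<le>m. z ^ (d + 1 + 2 * i))" for m d
  have g1: "ray_green z a b = A a (b - a)" if "a \<le> b" for a b
    using that by (simp add: ray_green_def A_def)
  have g2: "ray_green z a b = A b (a - b)" if "b \<le> a" for a b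
    using that by (simp add: ray_green_def A_def)
  have A_Suc: "A (Suc m) d = A m d + z ^ (d + 2 * m + 3)" for m d
    by (simp add: A_def eval_nat_numeral)
  have A_d: "A m (Suc d) = z * A m d" for m d
    by (simp add: A_def sum_distrib_left)
  \<comment> \<open>The geometric sum is kept multiplied by 1 - z^2, so that z = 1 is
    covered.\<close>
  have A0: "(1 - z\<^sup>2) * A b 0 = z - z ^ (2 * b + 3)" for b
    by (induction b) (auto simp: A_Suc distrib_left, auto simp: A_def eval_nat_numeral algebra_simps)
  define k where "k a = ray_green z a b" for a
  define p where "p a = (case a of 0 \<Rightarrow> 0 | Suc m \<Rightarrow> k m)" for a
  have hk: "h_ray k a = 2 * k a - k (Suc a) - p a" for a
    by (cases a) (auto simp: p_def)
  have "(1 + z\<^sup>2) * k a - z * k (Suc a) - z * p a = z * (if a = b then 1 else 0)"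
  proof -
    consider "a < b" | "a = b" | "a > b" by linarith
    thus ?thesis
    proof cases
      case 1
      define d where "d = b - a - 1"
      have k: "k a = z * A a d" "k (Suc a) = A (Suc a) d"
        using 1 by (auto simp: k_def g1 d_def Suc_diff_Suc A_d[symmetric])
      have p: "z * p a = z ^ 3 * A a d - z ^ (d + 2 * a + 4)"
      proof (cases a)
        case 0
        thus ?thesis by (simp add: p_def A_def eval_nat_numeral)
      next
        case (Suc m)
        hence "b - m = Suc (Suc d)" using 1 by (simp add: d_def)
        hence "p a = z * (z * A m d)" using Suc 1 by (simp add: p_def k_def g1 A_d)
        thus ?thesis unfolding Suc A_Suc by (simp add: eval_nat_numeral algebra_simps)
      qed
      show ?thesis using 1 unfolding k p A_Suc
        by (simp add: eval_nat_numeral algebra_simps power_add)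
    next
      case 2
      have k: "k a = A b 0" "k (Suc a) = z * A b 0"
        using 2 by (auto simp: k_def g2 A_d[symmetric])
      have p: "p a = z * (A b 0 - z ^ (2 * b + 1))"
      proof (cases a)
        case 0
        thus ?thesis using 2 by (simp add: p_def A_def)
      next
        case (Suc m)
        hence "b - m = Suc 0" using 2 by simp
        hence "p a = z * A m 0" using Suc 2 by (simp add: p_def k_def g1 A_d)
        moreover have b: "b = Suc m" using 2 Suc by simp
        ultimately show ?thesis unfolding b A_Suc by (simp add: eval_nat_numeral)
      qed
      show ?thesis using 2 A0[of b] unfolding k p
        by (simp add: eval_nat_numeral algebra_simps)
    next
      case 3
      then obtain m where m: "a = Suc m" "m \<ge> b" by (cases a) auto
      have "k a = z * k m" "k (Suc a) = z * (z * k m)"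
        using m by (auto simp: k_def g2 Suc_diff_le A_d)
      thus ?thesis using 3 m by (simp add: p_def eval_nat_numeral algebra_simps)
    qed
  qed
  hence "z * (h_ray k a + w * k a) = z * (if a = b then 1 else 0)"
    unfolding hk assms(1) by (simp add: algebra_simps)
  hence "h_ray k a + w * k a = (if a = b then 1 else 0)" using z by simp
  thus ?thesis unfolding k_def .
qed

definition ray_coef :: "nat \<Rightarrow> nat \<Rightarrow> nat \<Rightarrow> complex" where
  "ray_coef j a b = (\<Sum>i\<le>min a b. zpow_coef j (max a b - min a b + 1 + 2 * i))"

lemma ray_coef_0: "ray_coef 0 a b = ray_green 1 a b"
  by (simp add: ray_coef_def ray_green_def)

text \<open>The exponents in the geometric sum add up to the product of the positions a + 1 and b +
  1. The first-order term thus has rank one on each ray, which is what turns M_1 into a form in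
  first moments.\<close>

lemma ray_coef_1: "ray_coef (Suc 0) a b = - (of_nat (a + 1) * of_nat (b + 1))"
proof -
  have "(\<Sum>i\<le>m. d + 1 + 2 * i) = (m + 1) * (m + d + 1)" for m d :: nat
    by (induction m) (auto simp: algebra_simps)
  from this[of "max a b - min a b" "min a b"]
  have "(\<Sum>i\<le>min a b. max a b - min a b + 1 + 2 * i) = (min a b + 1) * (max a b + 1)" by simp
  also have "\<dots> = (a + 1) * (b + 1)" by (simp add: min_def max_def)
  finally have eq: "(\<Sum>i\<le>min a b. max a b - min a b + 1 + 2 * i) = (a + 1) * (b + 1)" .
  have "ray_coef (Suc 0) a b = - of_nat (\<Sum>i\<le>min a b. max a b - min a b + 1 + 2 * i)"
    unfolding ray_coef_def zpow_coef_1 sum_negf of_nat_sum ..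
  thus ?thesis unfolding eq of_nat_mult .
qed

text \<open>The Green function is a sum of min a b + 1 powers of zeta; the number of terms costs one
  factor of the weight, whence the exponent j + 1 for coefficient j.\<close>

lemma uexp_ray_green:
  "uexp (*) J (\<lambda>j (a, b). ((real a + 1) * (real b + 1)) ^ Suc j)
     (\<lambda>\<kappa> (a, b). ray_green (zeta \<kappa>) a b) (\<lambda>j (a, b). ray_coef j a b)"
proof -
  let ?W = "\<lambda>a b. (real a + 1) * (real b + 1)"
  have sum_bound: "norm (\<Sum>i\<le>min a b. x i) \<le> C * (2 ^ j * ?W a b ^ Suc j)"
    if C: "C \<ge> 0" and x: "\<And>i. i \<le> min a b \<Longrightarrow>
      norm (x i) \<le> C * (1 + real (max a b - min a b + 1 + 2 * i)) ^ j"
    for C a b j and x :: "nat \<Rightarrow> complex"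
  proof -
    have "norm (\<Sum>i\<le>min a b. x i) \<le> (\<Sum>i\<le>min a b. C * (2 * ?W a b) ^ j)"
    proof (rule sum_norm_le)
      fix i assume i: "i \<in> {..min a b}"
      have "1 + real (max a b - min a b + 1 + 2 * i) \<le> real a + real b + 2"
        using i by (auto simp: min_def max_def split: if_splits)
      also have "\<dots> \<le> 2 * ?W a b"
        using mult_nonneg_nonneg[of "real a" "real b"] by (simp add: algebra_simps)
      finally have "(1 + real (max a b - min a b + 1 + 2 * i)) ^ j \<le> (2 * ?W a b) ^ j"
        by (intro power_mono) auto
      thus "norm (x i) \<le> C * (2 * ?W a b) ^ j"
        using x[of i] i C by (meson atMost_iff mult_left_mono order_trans)
    qed
    also have "\<dots> = (real (min a b) + 1) * (C * (2 * ?W a b) ^ j)" by simp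
    also have "\<dots> \<le> ?W a b * (C * (2 * ?W a b) ^ j)"
    proof (rule mult_right_mono)
      have "real (min a b) + 1 \<le> (real a + 1) * 1" by simp
      also have "\<dots> \<le> ?W a b" by (intro mult_left_mono) auto
      finally show "real (min a b) + 1 \<le> ?W a b" .
    qed (use C in auto)
    finally show ?thesis by (simp add: power_mult_distrib mult_ac)
  qed
  obtain C where C: "C \<ge> 0" "\<And>j p. j < J \<Longrightarrow> norm (zpow_coef j p) \<le> C * (1 + real p) ^ j"
    by (rule uexp_coeff_bound[OF uexp_zeta_power[of J]]) auto
  obtain C' where C': "C' \<ge> 0" "\<forall>\<^sub>F \<kappa> in rhp. \<forall>p.
      norm (zeta \<kappa> ^ p - (\<Sum>j<J. \<kappa> ^ j * zpow_coef j p)) \<le> C' * norm \<kappa> ^ J * (1 + real p) ^ J"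
    by (rule uexp_remainder_bound[OF uexp_zeta_power[of J]]) auto
  have "\<exists>C. \<forall>i. norm (case i of (a, b) \<Rightarrow> ray_coef j a b) \<le> C * (case i of (a, b) \<Rightarrow> ?W a b ^ Suc j)"
    if "j < J" for j
  proof (intro exI allI)
    fix i :: "nat \<times> nat"
    obtain a b where i: "i = (a, b)" by (cases i)
    have "norm (ray_coef j a b) \<le> C * (2 ^ j * ?W a b ^ Suc j)"
      unfolding ray_coef_def by (rule sum_bound[OF C(1)]) (rule C(2)[OF that])
    thus "norm (case i of (a, b) \<Rightarrow> ray_coef j a b) \<le> (C * 2 ^ j) * (case i of (a, b) \<Rightarrow> ?W a b ^ Suc j)"
      by (simp add: i mult_ac)
  qed
  moreover have "\<forall>\<^sub>F \<kappa> in rhp. \<forall>i. norm ((case i of (a, b) \<Rightarrow> ray_green (zeta \<kappa>) a b) -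
      (\<Sum>j<J. \<kappa> ^ j * (case i of (a, b) \<Rightarrow> ray_coef j a b)))
      \<le> (C' * 2 ^ J) * norm \<kappa> ^ J * (case i of (a, b) \<Rightarrow> ?W a b ^ Suc J)"
    using C'(2)
  proof eventually_elim
    case (elim \<kappa>)
    show ?case
    proof
      fix i :: "nat \<times> nat"
      obtain a b where i: "i = (a, b)" by (cases i)
      have "ray_green (zeta \<kappa>) a b - (\<Sum>j<J. \<kappa> ^ j * ray_coef j a b) =
        (\<Sum>i\<le>min a b. zeta \<kappa> ^ (max a b - min a b + 1 + 2 * i) -
          (\<Sum>j<J. \<kappa> ^ j * zpow_coef j (max a b - min a b + 1 + 2 * i)))"
        unfolding ray_green_def ray_coef_def sum_distrib_left sum_subtractf
        by (subst sum.swap) (rule refl)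
      also have "norm \<dots> \<le> (C' * norm \<kappa> ^ J) * (2 ^ J * ?W a b ^ Suc J)"
        by (rule sum_bound) (use C'(1) in simp, rule elim[rule_format])
      finally show "norm ((case i of (a, b) \<Rightarrow> ray_green (zeta \<kappa>) a b) -
        (\<Sum>j<J. \<kappa> ^ j * (case i of (a, b) \<Rightarrow> ray_coef j a b)))
        \<le> (C' * 2 ^ J) * norm \<kappa> ^ J * (case i of (a, b) \<Rightarrow> ?W a b ^ Suc J)"
        by (simp add: i mult_ac)
    qed
  qed
  ultimately show ?thesis unfolding uexp_def by blast
qed

text \<open>With r = |z|, an entry is at most r^|a - b| / (1 - r). Summing the geometric series over
  b on either side of a contributes 1 / (1 - r) twice.\<close>

lemma ray_green_sum_bound:
  assumes z: "norm z < 1" and B: "finite B"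
  shows "(\<Sum>b\<in>B. norm (ray_green z a b)) \<le> 2 / (1 - norm z)\<^sup>2"
proof -
  define r where "r = norm z"
  have r: "0 \<le> r" "r < 1" using z by (auto simp: r_def)
  have geo: "(\<Sum>i\<in>I. r ^ i) \<le> 1 / (1 - r)" if "finite I" for I
    using sum_le_suminf[of "\<lambda>i. r ^ i" I] r that by (simp add: summable_geometric suminf_geometric)
  define d where "d b = max a b - min a b" for b
  have g: "norm (ray_green z a b) \<le> r ^ d b * (1 / (1 - r))" for b
  proof -
    have "norm (ray_green z a b) \<le> (\<Sum>i\<le>min a b. r ^ d b * r ^ i)"
      unfolding ray_green_def
    proof (rule sum_norm_le)
      fix i
      have "r ^ (d b + 1 + 2 * i) \<le> r ^ (d b + i)" using r by (intro power_decreasing) auto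
      thus "norm (z ^ (max a b - min a b + 1 + 2 * i)) \<le> r ^ d b * r ^ i"
        unfolding norm_power r_def[symmetric] d_def[symmetric] power_add[symmetric] .
    qed
    also have "\<dots> \<le> r ^ d b * (1 / (1 - r))"
      unfolding sum_distrib_left[symmetric] using r by (intro mult_left_mono geo) auto
    finally show ?thesis .
  qed
  have 1: "(\<Sum>b\<in>B \<inter> {..a}. r ^ d b) \<le> 1 / (1 - r)"
  proof -
    have "(\<Sum>b\<in>B \<inter> {..a}. r ^ d b) = (\<Sum>i\<in>(\<lambda>b. a - b) ` (B \<inter> {..a}). r ^ i)"
      by (subst sum.reindex) (auto simp: inj_on_def d_def)
    also have "\<dots> \<le> 1 / (1 - r)" using B by (intro geo) auto
    finally show ?thesis .
  qed
  have 2: "(\<Sum>b\<in>B - {..a}. r ^ d b) \<le> 1 / (1 - r)"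
  proof -
    have "(\<Sum>b\<in>B - {..a}. r ^ d b) = (\<Sum>i\<in>(\<lambda>b. b - a) ` (B - {..a}). r ^ i)"
      by (subst sum.reindex) (auto simp: inj_on_def d_def intro!: sum.cong)
    also have "\<dots> \<le> 1 / (1 - r)" using B by (intro geo) auto
    finally show ?thesis .
  qed
  have "(\<Sum>b\<in>B. norm (ray_green z a b)) \<le> (\<Sum>b\<in>B. r ^ d b * (1 / (1 - r)))"
    by (intro sum_mono g)
  also have "\<dots> = ((\<Sum>b\<in>B \<inter> {..a}. r ^ d b) + (\<Sum>b\<in>B - {..a}. r ^ d b)) * (1 / (1 - r))"
    unfolding sum_distrib_right[symmetric] using B by (simp add: sum.Int_Diff[of B _ "{..a}"])
  also have "\<dots> \<le> (1 / (1 - r) + 1 / (1 - r)) * (1 / (1 - r))"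
    using r by (intro mult_right_mono add_mono 1 2) auto
  finally show ?thesis by (simp add: r_def power2_eq_square)
qed

no_notation fps_nth (infixl \<open>$\<close> 75)

section \<open>The free resolvent of the graph\<close>

lemma h_core_alt:
  "h_core E att u x = (\<Sum>y\<in>UNIV. (if E x y then 1 else 0) * (u x - u y)) +
     of_nat (card {\<alpha>. att \<alpha> = x}) * u x"
proof -
  have "(\<Sum>y | E x y. u x - u y) = (\<Sum>y\<in>UNIV. (if E x y then 1 else 0) * (u x - u y))"
    by (rule sum.mono_neutral_cong_left) auto
  moreover have "(\<Sum>\<alpha>\<in>UNIV. (if x = att \<alpha> then 1 else 0) * u x) = (\<Sum>\<alpha> | att \<alpha> = x. u x)"
    by (rule sum.mono_neutral_cong_right) auto
  ultimately show ?thesis by (simp add: h_core_def)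
qed

lemma h_core_symmetric:
  assumes "symp E"
  shows "(\<Sum>x\<in>UNIV. cnj (h_core E att u x) * w x) = (\<Sum>x\<in>UNIV. cnj (u x) * h_core E att w x)"
proof -
  define e where "e x y = (if E x y then 1 else 0 :: complex)" for x y
  have e: "e x y = e y x" "cnj (e x y) = e x y" for x y
    using assms by (auto simp: e_def dest: sympD)
  define s where "s x = (of_nat (card {\<alpha>. att \<alpha> = x}) :: complex)" for x
  have s: "cnj (s x) = s x" for x by (simp add: s_def)
  have h: "h_core E att u x = (\<Sum>y\<in>UNIV. e x y * (u x - u y)) + s x * u x" for u x
    by (simp add: h_core_alt e_def s_def)
  have "(\<Sum>x\<in>UNIV. \<Sum>y\<in>UNIV. e x y * cnj (u y) * w x) = (\<Sum>x\<in>UNIV. \<Sum>y\<in>UNIV. e x y * cnj (u x) * w y)"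
    by (subst sum.swap) (simp add: e(1))
  thus ?thesis
    by (simp add: h e(2) s algebra_simps sum.distrib sum_distrib_left sum_distrib_right sum_subtractf)
qed

text \<open>Twice the quadratic form <u, h_0 u> is \<Sum> e x y |u x - u y|^2 + 2 \<Sum> s x |u
  x|^2. If it vanishes, u is constant along edges, hence everywhere by connectedness, and it is 0 at
  an attachment vertex.\<close>

lemma h_core_injective:
  fixes E :: "'k::finite \<Rightarrow> 'k \<Rightarrow> bool" and att :: "'r::finite \<Rightarrow> 'k"
  assumes graph: "simple_connected_graph E" and h0: "\<And>x. h_core E att u x = 0"
  shows "u x = 0"
proof -
  have sym: "symp E" and conn: "E\<^sup>*\<^sup>* x y" for x y
    using graph by (auto simp: simple_connected_graph_def)
  define e where "e x y = (if E x y then 1 else 0 :: real)" for x y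
  have e: "e x y = e y x" "e x y \<ge> 0" for x y
    using sym by (auto simp: e_def dest: sympD)
  define s where "s x = real (card {\<alpha>. att \<alpha> = x})" for x
  have h: "h_core E att u x = (\<Sum>y\<in>UNIV. of_real (e x y) * (u x - u y)) + of_real (s x) * u x" for x
    unfolding h_core_alt e_def s_def by (auto intro!: sum.cong)
  define T where "T = (\<Sum>x\<in>UNIV. \<Sum>y\<in>UNIV. of_real (e x y) * (cnj (u x) * (u x - u y)))"
  have "T = (\<Sum>x\<in>UNIV. \<Sum>y\<in>UNIV. of_real (e x y) * (cnj (u y) * (u y - u x)))"
    unfolding T_def by (subst sum.swap) (simp add: e(1))
  hence "T + T = (\<Sum>x\<in>UNIV. \<Sum>y\<in>UNIV. of_real (e x y) * (cnj (u x) * (u x - u y)) +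
      of_real (e x y) * (cnj (u y) * (u y - u x)))"
    unfolding sum.distrib by (simp add: T_def)
  also have "\<dots> = (\<Sum>x\<in>UNIV. \<Sum>y\<in>UNIV. of_real (e x y * (norm (u x - u y))\<^sup>2))"
    by (intro sum.cong refl)
      (simp add: complex_norm_square algebra_simps flip: of_real_power)
  finally have T: "T + T = of_real (\<Sum>x\<in>UNIV. \<Sum>y\<in>UNIV. e x y * (norm (u x - u y))\<^sup>2)" by simp
  have "0 = (\<Sum>x\<in>UNIV. cnj (u x) * h_core E att u x)" by (simp add: h0)
  also have "\<dots> = T + (\<Sum>x\<in>UNIV. of_real (s x) * (cnj (u x) * u x))"
    unfolding h T_def by (simp add: distrib_left sum.distrib sum_distrib_left mult_ac)
  also have "(\<Sum>x\<in>UNIV. of_real (s x) * (cnj (u x) * u x)) = of_real (\<Sum>x\<in>UNIV. s x * (norm (u x))\<^sup>2)"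
    by (simp add: complex_norm_square mult.commute flip: of_real_power)
  finally have T0: "T + of_real (\<Sum>x\<in>UNIV. s x * (norm (u x))\<^sup>2) = 0" by simp
  have "(T + T) + of_real (2 * r) = (T + of_real r) + (T + of_real r)" for r by simp
  from this[of "\<Sum>x\<in>UNIV. s x * (norm (u x))\<^sup>2"]
  have "(T + T) + of_real (2 * (\<Sum>x\<in>UNIV. s x * (norm (u x))\<^sup>2)) = 0"
    unfolding T0 by simp
  hence z: "(\<Sum>x\<in>UNIV. \<Sum>y\<in>UNIV. e x y * (norm (u x - u y))\<^sup>2) + 2 * (\<Sum>x\<in>UNIV. s x * (norm (u x))\<^sup>2) = 0"
    unfolding T of_real_add[symmetric] by (simp only: of_real_eq_0_iff)
  have nn: "(\<Sum>x\<in>UNIV. \<Sum>y\<in>UNIV. e x y * (norm (u x - u y))\<^sup>2) \<ge> 0" "(\<Sum>x\<in>UNIV. s x * (norm (u x))\<^sup>2) \<ge> 0"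
    using e by (auto intro!: sum_nonneg simp: s_def)
  have z1: "(\<Sum>x\<in>UNIV. \<Sum>y\<in>UNIV. e x y * (norm (u x - u y))\<^sup>2) = 0"
    and z2: "(\<Sum>x\<in>UNIV. s x * (norm (u x))\<^sup>2) = 0" using z nn by linarith+
  have "(\<Sum>y\<in>UNIV. e x y * (norm (u x - u y))\<^sup>2) = 0" for x
    using z1 by (subst (asm) sum_nonneg_eq_0_iff) (auto intro!: sum_nonneg simp: e)
  hence z3: "e x y * (norm (u x - u y))\<^sup>2 = 0" for x y
    by (subst (asm) sum_nonneg_eq_0_iff) (auto simp: e)
  hence step: "u x = u y" if "E x y" for x y
    using z3[of x y] that by (simp add: e_def)
  have const: "u x = u y" for x y
    using conn[of x y] by (induction rule: rtranclp_induct) (auto dest: step)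
  \<comment> \<open>Any ray will do: the type of rays is non-empty, so some vertex has s >
    0.\<close>
  define \<alpha> :: 'r where "\<alpha> = undefined"
  have "s (att \<alpha>) * (norm (u (att \<alpha>)))\<^sup>2 = 0"
    using z2 by (subst (asm) sum_nonneg_eq_0_iff) (auto simp: s_def)
  moreover have "s (att \<alpha>) \<noteq> 0"
    by (auto simp: s_def card_eq_0_iff)
  ultimately have "u (att \<alpha>) = 0" by simp
  thus ?thesis using const by metis
qed

section \<open>The resolvent of the core\<close>

definition core_mat ::
    "('k::finite \<Rightarrow> 'k \<Rightarrow> bool) \<Rightarrow> ('r::finite \<Rightarrow> 'k) \<Rightarrow> complex \<Rightarrow> complex ^ 'k ^ 'k" where
  "core_mat E att w = (\<chi> x z. h_core E att (\<lambda>y. if y = z then 1 else 0) x + (if x = z then w else 0))"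

lemma core_mat_mult:
  "(core_mat E att w *v u) $ x = h_core E att (\<lambda>y. u $ y) x + w * u $ x"
proof -
  let ?d = "\<lambda>z y. if y = z then 1 else 0 :: complex"
  have "(\<Sum>z\<in>UNIV. h_core E att (?d z) x * u $ z) = h_core E att (\<lambda>y. u $ y) x"
  proof -
    have a: "(\<Sum>z\<in>UNIV. (?d z x - ?d z y) * u $ z) = u $ x - u $ y" for y
      by (simp add: left_diff_distrib sum_subtractf if_distrib[of "\<lambda>c. c * _"] cong: if_cong)
    have "(\<Sum>z\<in>UNIV. h_core E att (?d z) x * u $ z) =
        (\<Sum>y\<in>UNIV. (if E x y then 1 else 0) * (\<Sum>z\<in>UNIV. (?d z x - ?d z y) * u $ z)) +
        of_nat (card {\<alpha>. att \<alpha> = x}) * (\<Sum>z\<in>UNIV. ?d z x * u $ z)"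
      unfolding h_core_alt distrib_right sum.distrib sum_distrib_left sum_distrib_right
      by (subst sum.swap) (simp only: mult.assoc)
    also have "(\<Sum>z\<in>UNIV. ?d z x * u $ z) = u $ x"
      by (simp add: if_distrib[of "\<lambda>c. c * _"] cong: if_cong)
    finally show ?thesis unfolding a h_core_alt .
  qed
  thus ?thesis
    by (simp add: matrix_vector_mult_def core_mat_def distrib_right sum.distrib
        if_distrib[of "\<lambda>c. c * _"] cong: if_cong)
qed

lemma det_core_mat_0:
  assumes "simple_connected_graph E"
  shows "det (core_mat E att 0) \<noteq> 0"
proof -
  have "u = 0" if "core_mat E att 0 *v u = 0" for u
  proof -
    have "h_core E att (\<lambda>y. u $ y) x = 0" for x
      using arg_cong[OF that, of "\<lambda>v. v $ x"] by (simp add: core_mat_mult)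
    from h_core_injective[OF assms this] show ?thesis by (simp add: vec_eq_iff)
  qed
  hence "invertible (core_mat E att 0)"
    using invertible_left_inverse matrix_left_invertible_ker by blast
  thus ?thesis by (simp add: invertible_det_nz)
qed

lemma analytic_on_det:
  assumes "\<And>i j. (\<lambda>w. A w $ i $ j) analytic_on S"
  shows "(\<lambda>w. det (A w :: complex ^ 'k ^ 'k)) analytic_on S"
  unfolding det_def by (intro analytic_intros assms)

lemma analytic_core_mat: "(\<lambda>\<kappa>. core_mat E att (\<kappa>\<^sup>2) $ i $ j) analytic_on S"
  unfolding core_mat_def by (cases "i = j") (auto intro!: analytic_intros)

text \<open>The entries of the inverse matrix in the form given by Cramer's rule: as quotients of
  determinants they are visibly analytic in \<kappa>, and even.\<close>

definition core_res ::
    "('k::finite \<Rightarrow> 'k \<Rightarrow> bool) \<Rightarrow> ('r::finite \<Rightarrow> 'k) \<Rightarrow> complex \<Rightarrow> 'k \<Rightarrow> 'k \<Rightarrow> complex" where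
  "core_res E att \<kappa> x y =
     det (\<chi> i j. if j = x then axis y 1 $ i else core_mat E att (\<kappa>\<^sup>2) $ i $ j) / det (core_mat E att (\<kappa>\<^sup>2))"

lemma core_res_equation:
  assumes "det (core_mat E att (\<kappa>\<^sup>2)) \<noteq> 0"
  shows "h_core E att (\<lambda>z. core_res E att \<kappa> z y) x + \<kappa>\<^sup>2 * core_res E att \<kappa> x y = (if x = y then 1 else 0)"
proof -
  have "core_mat E att (\<kappa>\<^sup>2) *v (\<chi> z. core_res E att \<kappa> z y) = axis y 1"
    using cramer[OF assms, of "\<chi> z. core_res E att \<kappa> z y" "axis y 1"] by (simp add: core_res_def)
  from arg_cong[OF this, of "\<lambda>v. v $ x"] show ?thesis
    by (simp add: core_mat_mult axis_def)
qed

lemma core_res_0_hermitian: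
  fixes E :: "'k::finite \<Rightarrow> 'k \<Rightarrow> bool"
  assumes graph: "simple_connected_graph E"
  shows "core_res E att 0 y x = cnj (core_res E att 0 x y)"
proof -
  have sym: "symp E" using graph by (simp add: simple_connected_graph_def)
  have eq: "h_core E att (\<lambda>z. core_res E att 0 z y) x = (if x = y then 1 else 0)" for x y
    using core_res_equation[of E att 0 y x] det_core_mat_0[OF graph, of att] by simp
  have d: "(\<Sum>z\<in>UNIV. (if z = w then 1 else 0) * f z) = f w" "(\<Sum>z\<in>UNIV. f z * (if z = w then 1 else 0)) = f w"
    for w and f :: "'k \<Rightarrow> complex"
    by (simp_all add: if_distrib[of "\<lambda>c. c * _"] if_distrib[of "\<lambda>c. _ * c"] cong: if_cong)
  show ?thesis
    using h_core_symmetric[OF sym, of att "\<lambda>z. core_res E att 0 z y" "\<lambda>z. core_res E att 0 z x"]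
    by (simp add: eq if_distrib[of cnj] d cong: if_cong)
qed

lemma analytic_core_res:
  assumes "simple_connected_graph E"
  shows "(\<lambda>\<kappa>. core_res E att \<kappa> x y) analytic_on {0}"
  unfolding core_res_def
proof (intro analytic_on_divide analytic_on_det analytic_core_mat)
  show "(\<lambda>\<kappa>. (\<chi> i j. if j = x then axis y 1 $ i else core_mat E att (\<kappa>\<^sup>2) $ i $ j) $ i $ j) analytic_on {0}" for i j
    by (cases "j = x") (auto intro!: analytic_intros analytic_core_mat)
qed (use det_core_mat_0[OF assms] in auto)

lemma eventually_det_core_mat:
  assumes "simple_connected_graph E"
  shows "\<forall>\<^sub>F \<kappa> in nhds 0. det (core_mat E att (\<kappa>\<^sup>2)) \<noteq> 0"
proof -
  have "(\<lambda>\<kappa>. det (core_mat E att (\<kappa>\<^sup>2))) analytic_on {0}"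
    by (intro analytic_on_det analytic_core_mat)
  hence "isCont (\<lambda>\<kappa>. det (core_mat E att (\<kappa>\<^sup>2))) 0" by (simp add: analytic_at_imp_isCont)
  hence "((\<lambda>\<kappa>. det (core_mat E att (\<kappa>\<^sup>2))) \<longlongrightarrow> det (core_mat E att (0\<^sup>2))) (nhds 0)"
    unfolding isCont_def using tendsto_at_iff_tendsto_nhds[of "\<lambda>\<kappa>. det (core_mat E att (\<kappa>\<^sup>2))" 0] by blast
  from tendsto_imp_eventually_ne[OF this, of 0] show ?thesis
    using det_core_mat_0[OF assms, of att] by simp
qed

definition core_coef ::
    "('k::finite \<Rightarrow> 'k \<Rightarrow> bool) \<Rightarrow> ('r::finite \<Rightarrow> 'k) \<Rightarrow> nat \<Rightarrow> 'k \<Rightarrow> 'k \<Rightarrow> complex" where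
  "core_coef E att j x y = fps_nth (fps_expansion (\<lambda>\<kappa>. core_res E att \<kappa> x y) 0) j"

lemma core_res_remainder:
  assumes "simple_connected_graph E"
  shows "\<exists>C. \<forall>\<^sub>F \<kappa> in nhds 0.
    norm (core_res E att \<kappa> x y - (\<Sum>j<J. \<kappa> ^ j * core_coef E att j x y)) \<le> C * norm \<kappa> ^ J"
  unfolding core_coef_def
  by (intro has_fps_expansion_remainder analytic_at_imp_has_fps_expansion_0 analytic_core_res assms)

lemma core_coef_0: "core_coef E att 0 x y = core_res E att 0 x y"
  by (simp add: core_coef_def fps_expansion_def)

text \<open>The core resolvent depends on \<kappa>^2 only. Subtracting its expansions at t and -t
  isolates the linear term, which gives |c_1| \<le> C t for all small t > 0.\<close>

lemma core_coef_1:
  assumes "simple_connected_graph E"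
  shows "core_coef E att (Suc 0) x y = 0"
proof -
  let ?f = "\<lambda>\<kappa>. core_res E att \<kappa> x y" and ?c = "\<lambda>j. core_coef E att j x y"
  obtain C d where d: "d > 0" and
    C: "\<And>\<kappa>. norm \<kappa> < d \<Longrightarrow> norm (?f \<kappa> - (\<Sum>j<2. \<kappa> ^ j * ?c j)) \<le> C * norm \<kappa> ^ 2"
    using core_res_remainder[OF assms, of att x y 2] unfolding eventually_nhds_metric by auto
  have even: "?f (- \<kappa>) = ?f \<kappa>" for \<kappa> unfolding core_res_def power2_minus ..
  have bound: "norm (?c 1) \<le> C * t" if t: "0 < t" "t < d" for t
  proof -
    let ?k = "complex_of_real t"
    have "2 * ?k * ?c 1 = (?f (- ?k) - (\<Sum>j<2. (- ?k) ^ j * ?c j)) - (?f ?k - (\<Sum>j<2. ?k ^ j * ?c j))"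
      unfolding even by (simp add: numeral_2_eq_2)
    hence "norm (2 * ?k * ?c 1) \<le> C * norm (- ?k) ^ 2 + C * norm ?k ^ 2"
      using t by (simp only:) (intro order_trans[OF norm_triangle_ineq4] add_mono C; simp)
    hence "2 * t * norm (?c 1) \<le> 2 * t * (C * t)"
      using t by (simp add: norm_mult power2_eq_square mult_ac)
    thus ?thesis using t by simp
  qed
  have "norm (?c 1) \<le> 0"
  proof (rule tendsto_lowerbound)
    show "((\<lambda>t. C * t) \<longlongrightarrow> 0) (at_right (0::real))"
      by (rule tendsto_eq_intros | simp)+
    show "\<forall>\<^sub>F t in at_right 0. norm (?c 1) \<le> C * t"
      using bound d by (auto simp: eventually_at_right_field)
  qed simp
  thus ?thesis by simp
qed

section \<open>The free kernel on the whole graph\<close>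

fun free_res ::
    "('k::finite \<Rightarrow> 'k \<Rightarrow> bool) \<Rightarrow> ('r::finite \<Rightarrow> 'k) \<Rightarrow> complex \<Rightarrow>
      ('k, 'r) vertex \<Rightarrow> ('k, 'r) vertex \<Rightarrow> complex" where
  "free_res E att \<kappa> (Core x) (Core y) = core_res E att \<kappa> x y"
| "free_res E att \<kappa> (Ray \<alpha> a) (Ray \<beta> b) = (if \<alpha> = \<beta> then ray_green (zeta \<kappa>) a b else 0)"
| "free_res E att \<kappa> (Core x) (Ray \<beta> b) = 0"
| "free_res E att \<kappa> (Ray \<alpha> a) (Core y) = 0"

fun free_coef ::
    "('k::finite \<Rightarrow> 'k \<Rightarrow> bool) \<Rightarrow> ('r::finite \<Rightarrow> 'k) \<Rightarrow> nat \<Rightarrow>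
      ('k, 'r) vertex \<Rightarrow> ('k, 'r) vertex \<Rightarrow> complex" where
  "free_coef E att j (Core x) (Core y) = core_coef E att j x y"
| "free_coef E att j (Ray \<alpha> a) (Ray \<beta> b) = (if \<alpha> = \<beta> then ray_coef j a b else 0)"
| "free_coef E att j (Core x) (Ray \<beta> b) = 0"
| "free_coef E att j (Ray \<alpha> a) (Core y) = 0"

text \<open>Every weight is a power of this single function, which is at least 1; estimates in the
  weighted spaces thus become monotone in a natural exponent.\<close>

fun vsize :: "('k, 'r) vertex \<Rightarrow> real" where
  "vsize (Core x) = 1"
| "vsize (Ray \<alpha> m) = sqrt (1 + (real (m + 1))\<^sup>2)"

lemma vsize_ge_1: "vsize p \<ge> 1"
  by (cases p) auto

lemma vsize_pos: "vsize p > 0" "vsize p \<noteq> 0" "vsize p \<ge> 0"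
  using vsize_ge_1[of p] by linarith+

lemma vsize_ray_ge: "real a + 1 \<le> vsize (Ray \<alpha> a)"
  by (auto intro!: real_le_rsqrt simp: power2_eq_square algebra_simps)

lemma weight_eq: "weight s p = vsize p powr s"
proof (cases p)
  case (Ray \<alpha> m)
  have "1 + (1 + real m)\<^sup>2 \<noteq> 0" by (metis add_nonneg_eq_0_iff zero_le_one zero_le_power2 zero_neq_one)
  thus ?thesis by (simp add: Ray powr_half_sqrt[symmetric] powr_powr)
qed simp

lemma weight_nat: "weight (real n) p = vsize p ^ n"
  using vsize_pos[of p] by (simp add: weight_eq powr_realpow)

lemma uexp_free_res:
  fixes E :: "'k::finite \<Rightarrow> 'k \<Rightarrow> bool" and att :: "'r::finite \<Rightarrow> 'k"
  assumes graph: "simple_connected_graph E"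
  shows "uexp (*) J (\<lambda>j (p, q). (vsize p * vsize q) ^ Suc j)
    (\<lambda>\<kappa> (p, q). free_res E att \<kappa> p q) (\<lambda>j (p, q). free_coef E att j p q)"
proof -
  let ?W = "\<lambda>a b. (real a + 1) * (real b + 1)"
  have W: "?W a b ^ j \<le> (vsize (Ray \<alpha> a) * vsize (Ray \<beta> b)) ^ j" for a b j and \<alpha> \<beta> :: 'r
    by (intro power_mono mult_mono vsize_ray_ge vsize_pos) auto
  have W1: "(vsize p * vsize q) ^ j \<ge> 1" for p q :: "('k, 'r) vertex" and j
    using mult_mono[OF vsize_ge_1[of p] vsize_ge_1[of q]] vsize_ge_1[of p] by (intro one_le_power) auto
  obtain C where C: "C \<ge> 0"
    "\<And>j i. j < J \<Longrightarrow> norm (case i of (a, b) \<Rightarrow> ray_coef j a b) \<le> C * (case i of (a, b) \<Rightarrow> ?W a b ^ Suc j)"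
    by (rule uexp_coeff_bound[OF uexp_ray_green[of J]]) auto
  obtain C' where C': "C' \<ge> 0" "\<forall>\<^sub>F \<kappa> in rhp. \<forall>i.
      norm ((case i of (a, b) \<Rightarrow> ray_green (zeta \<kappa>) a b) - (\<Sum>j<J. \<kappa> ^ j * (case i of (a, b) \<Rightarrow> ray_coef j a b)))
      \<le> C' * norm \<kappa> ^ J * (case i of (a, b) \<Rightarrow> ?W a b ^ Suc J)"
    by (rule uexp_remainder_bound[OF uexp_ray_green[of J]]) auto
  have "\<forall>i. \<exists>C. \<forall>\<^sub>F \<kappa> in rhp. norm (core_res E att \<kappa> (fst i) (snd i) -
      (\<Sum>j<J. \<kappa> ^ j * core_coef E att j (fst i) (snd i))) \<le> C * norm \<kappa> ^ J"
    using core_res_remainder[OF graph] filter_leD[OF rhp_le_nhds] by blast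
  from choice[OF this] obtain B where B: "\<And>i. \<forall>\<^sub>F \<kappa> in rhp. norm (core_res E att \<kappa> (fst i) (snd i) -
      (\<Sum>j<J. \<kappa> ^ j * core_coef E att j (fst i) (snd i))) \<le> B i * norm \<kappa> ^ J" by blast
  define B' where "B' = (\<Sum>i\<in>UNIV. \<bar>B i\<bar>)"
  have B': "B i \<le> B'" for i
  proof -
    have "\<bar>B i\<bar> \<le> B'" unfolding B'_def by (rule member_le_sum) auto
    thus ?thesis by linarith
  qed
  have B'0: "B' \<ge> 0" unfolding B'_def by (rule sum_nonneg) auto
  have evB: "\<forall>\<^sub>F \<kappa> in rhp. \<forall>i\<in>UNIV. norm (core_res E att \<kappa> (fst i) (snd i) -
      (\<Sum>j<J. \<kappa> ^ j * core_coef E att j (fst i) (snd i))) \<le> B i * norm \<kappa> ^ J"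
    by (intro eventually_ball_finite) (use B in auto)
  have "norm (free_coef E att j p q) \<le> (C + (\<Sum>i\<in>UNIV. norm (core_coef E att j (fst i) (snd i)))) * (vsize p * vsize q) ^ Suc j"
    if j: "j < J" for j p q
  proof -
    let ?D = "\<Sum>i\<in>UNIV. norm (core_coef E att j (fst i) (snd i))"
    have D: "norm (core_coef E att j x y) \<le> ?D" for x y
      using member_le_sum[of "(x, y)" UNIV "\<lambda>i. norm (core_coef E att j (fst i) (snd i))"] by simp
    have D0: "?D \<ge> 0" by (rule sum_nonneg) auto
    show ?thesis
    proof (cases p; cases q)
      fix x y assume pq: "p = Core x" "q = Core y"
      have "norm (free_coef E att j p q) \<le> ?D" using D by (simp add: pq)
      also have "\<dots> \<le> (C + ?D) * 1" using C by simp
      also have "\<dots> \<le> (C + ?D) * (vsize p * vsize q) ^ Suc j"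
        using C D0 by (intro mult_left_mono W1) auto
      finally show ?thesis .
    next
      fix \<alpha> a \<beta> b assume pq: "p = Ray \<alpha> a" "q = Ray \<beta> b"
      have "norm (free_coef E att j p q) \<le> C * ?W a b ^ Suc j"
        using C(2)[OF j, of "(a, b)"] C(1) by (simp add: pq)
      also have "\<dots> \<le> (C + ?D) * (vsize p * vsize q) ^ Suc j"
        unfolding pq using C D0 by (intro mult_mono W) auto
      finally show ?thesis .
    qed (use C D0 W1[of p q "Suc j"] in \<open>auto intro!: mult_nonneg_nonneg add_nonneg_nonneg vsize_pos simp del: vsize.simps\<close>)
  qed
  hence coeff: "\<forall>j<J. \<exists>C. \<forall>i. norm (case i of (p, q) \<Rightarrow> free_coef E att j p q) \<le> C * (case i of (p, q) \<Rightarrow> (vsize p * vsize q) ^ Suc j)"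
    by (auto split: prod.splits simp del: power_Suc)
  have rem: "\<forall>\<^sub>F \<kappa> in rhp. \<forall>p q.
      norm (free_res E att \<kappa> p q - (\<Sum>j<J. \<kappa> ^ j * free_coef E att j p q))
      \<le> (C' + B') * norm \<kappa> ^ J * (vsize p * vsize q) ^ Suc J"
    using C'(2) evB
  proof eventually_elim
    case (elim \<kappa>)
    show ?case
    proof (intro allI)
      fix p q :: "('k, 'r) vertex"
      let ?R = "free_res E att \<kappa> p q - (\<Sum>j<J. \<kappa> ^ j * free_coef E att j p q)"
      have z: "0 \<le> (C' + B') * norm \<kappa> ^ J * (vsize p * vsize q) ^ Suc J"
        using C' B'0 by (intro mult_nonneg_nonneg zero_le_power vsize_pos) auto
      show "norm ?R \<le> (C' + B') * norm \<kappa> ^ J * (vsize p * vsize q) ^ Suc J"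
      proof (cases p; cases q)
        fix x y assume pq: "p = Core x" "q = Core y"
        have "norm ?R \<le> B (x, y) * norm \<kappa> ^ J"
          using elim(2)[rule_format, of "(x, y)"] by (simp add: pq)
        also have "\<dots> \<le> (C' + B') * norm \<kappa> ^ J"
          using B'[of "(x, y)"] C' by (intro mult_right_mono) auto
        also have "\<dots> \<le> (C' + B') * norm \<kappa> ^ J * (vsize p * vsize q) ^ Suc J"
          using mult_left_mono[OF W1[of p q "Suc J"], of "(C' + B') * norm \<kappa> ^ J"] C' B'0 by simp
        finally show ?thesis .
      next
        fix \<alpha> a \<beta> b assume pq: "p = Ray \<alpha> a" "q = Ray \<beta> b"
        show ?thesis
        proof (cases "\<alpha> = \<beta>")
          case True
          have "norm ?R \<le> C' * norm \<kappa> ^ J * ?W a b ^ Suc J"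
            using elim(1)[rule_format, of "(a, b)"] True by (simp add: pq)
          also have "\<dots> \<le> (C' + B') * norm \<kappa> ^ J * (vsize p * vsize q) ^ Suc J"
            unfolding pq using C' B'0 by (intro mult_mono W mult_right_mono) auto
          finally show ?thesis .
        qed (use z in \<open>simp add: pq\<close>)
      qed (use z in simp_all)
    qed
  qed
  have "\<forall>\<^sub>F \<kappa> in rhp. \<forall>i. norm ((case i of (p, q) \<Rightarrow> free_res E att \<kappa> p q) -
      (\<Sum>j<J. \<kappa> ^ j * (case i of (p, q) \<Rightarrow> free_coef E att j p q)))
      \<le> (C' + B') * norm \<kappa> ^ J * (case i of (p, q) \<Rightarrow> (vsize p * vsize q) ^ Suc J)"
    using rem by eventually_elim (simp add: split_paired_all)
  thus ?thesis unfolding uexp_def using coeff by blast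
qed

lemma h_ray_0 [simp]: "h_ray (\<lambda>_. 0) m = 0"
  by (cases m) auto

lemma free_res_equation:
  assumes "det (core_mat E att (\<kappa>\<^sup>2)) \<noteq> 0"
  shows "H0 E att (\<lambda>p. free_res E att \<kappa> p q) p + \<kappa>\<^sup>2 * free_res E att \<kappa> p q = (if p = q then 1 else 0)"
proof (cases p; cases q)
  fix x y assume "p = Core x" "q = Core y"
  thus ?thesis using core_res_equation[OF assms, of y x] by simp
next
  fix \<alpha> a \<beta> b assume pq: "p = Ray \<alpha> a" "q = Ray \<beta> b"
  thus ?thesis
    using ray_green_equation[OF zeta_equation zeta_nz, of \<kappa> b a] by (cases "\<alpha> = \<beta>") auto
qed (auto simp: h_core_def)

lemma free_coef_0: "free_coef E att 0 p q = free_res E att 0 p q"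
  by (cases p; cases q) (auto simp: core_coef_0 ray_coef_0)

lemma free_res_0_hermitian:
  assumes "simple_connected_graph E"
  shows "free_res E att 0 q p = cnj (free_res E att 0 p q)"
  using core_res_0_hermitian[OF assms]
  by (cases p; cases q) (auto simp: ray_green_1 min.commute)

text \<open>At \<kappa> = 0 the ray kernel is the smaller of the two positions, so the weight of q
  alone bounds it. Consequently the threshold free resolvent sends L^\<beta> to bounded functions,
  and the states built from it have no linear growth.\<close>

lemma free_res_0_bound:
  "\<exists>C\<ge>0. \<forall>p q. norm (free_res E att 0 p q) \<le> C * vsize q"
proof (intro exI conjI allI)
  let ?D = "\<Sum>i\<in>UNIV. norm (core_res E att 0 (fst i) (snd i))"
  have D: "norm (core_res E att 0 x y) \<le> ?D" for x y
    using member_le_sum[of "(x, y)" UNIV "\<lambda>i. norm (core_res E att 0 (fst i) (snd i))"] by simp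
  show D0: "?D + 1 \<ge> 0" by (intro add_nonneg_nonneg sum_nonneg) auto
  fix p q
  show "norm (free_res E att 0 p q) \<le> (?D + 1) * vsize q"
  proof (cases p; cases q)
    fix x y assume "p = Core x" "q = Core y"
    thus ?thesis using D[of x y] by simp
  next
    fix \<alpha> a \<beta> b assume pq: "p = Ray \<alpha> a" "q = Ray \<beta> b"
    have D1: "?D \<ge> 0" by (intro sum_nonneg) auto
    have "norm (ray_green 1 a b) = real (min a b + 1)" unfolding ray_green_1 norm_of_nat ..
    hence "norm (free_res E att 0 p q) \<le> real b + 1" by (simp add: pq)
    also have "\<dots> \<le> vsize q" unfolding pq by (rule vsize_ray_ge)
    also have "\<dots> \<le> (?D + 1) * vsize q" using D1 vsize_pos[of q] by simp
    finally show ?thesis .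
  qed (use D0 vsize_pos[of q] in \<open>auto intro!: mult_nonneg_nonneg simp del: vsize.simps\<close>)
qed

lemma sum_Core_le:
  fixes f :: "('k::finite, 'r::finite) vertex \<Rightarrow> real"
  assumes "finite Y" "\<And>p. f p \<ge> 0" "\<And>\<beta> b. f (Ray \<beta> b) = 0"
  shows "sum f Y \<le> (\<Sum>x\<in>UNIV. f (Core x))"
proof -
  have "sum f Y = sum f (Y \<inter> range Core)"
    using assms(1,3) by (intro sum.mono_neutral_right) (auto, metis vertex.exhaust rangeI)
  also have "\<dots> \<le> sum f (range Core)"
    using assms by (intro sum_mono2) auto
  also have "\<dots> = (\<Sum>x\<in>UNIV. f (Core x))" by (subst sum.reindex) (auto simp: inj_on_def)
  finally show ?thesis .
qed

text \<open>These are the row and column bounds for the Schur test. The constant blows up as zeta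
  tends to 1; this is harmless because it serves only at fixed \<kappa>.\<close>

lemma free_res_sum_bound:
  fixes E :: "'k::finite \<Rightarrow> 'k \<Rightarrow> bool" and att :: "'r::finite \<Rightarrow> 'k"
  assumes \<kappa>: "Re \<kappa> > 0" "norm \<kappa> < 2"
  shows "\<exists>K\<ge>0. \<forall>p Y. finite Y \<longrightarrow> (\<Sum>q\<in>Y. norm (free_res E att \<kappa> p q)) \<le> K \<and>
    (\<Sum>q\<in>Y. norm (free_res E att \<kappa> q p)) \<le> K"
proof -
  let ?z = "zeta \<kappa>"
  define D where "D = (\<Sum>x\<in>UNIV. \<Sum>y\<in>UNIV. norm (core_res E att \<kappa> x y))"
  define K where "K = D + 2 / (1 - norm ?z)\<^sup>2"
  have z: "norm ?z < 1" by (rule norm_zeta_less_1[OF \<kappa>])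
  have D0: "D \<ge> 0" unfolding D_def by (intro sum_nonneg) auto
  have KD: "D \<le> K" and Kz: "2 / (1 - norm ?z)\<^sup>2 \<le> K" using D0 by (auto simp: K_def)
  have 1: "(\<Sum>y\<in>UNIV. norm (core_res E att \<kappa> x y)) \<le> D" for x
    unfolding D_def by (rule member_le_sum) (auto intro: sum_nonneg)
  have 2: "(\<Sum>y\<in>UNIV. norm (core_res E att \<kappa> y x)) \<le> D" for x
    unfolding D_def by (subst sum.swap) (rule member_le_sum, auto intro: sum_nonneg)
  have ray: "(\<Sum>q\<in>Y. norm (free_res E att \<kappa> (Ray \<alpha> a) q)) \<le> 2 / (1 - norm ?z)\<^sup>2"
    if Y: "finite Y" for \<alpha> a and Y :: "('k, 'r) vertex set"
  proof -
    have fin: "finite {b. Ray \<alpha> b \<in> Y}"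
      using finite_vimageI[OF Y, of "Ray \<alpha>"] by (auto simp: inj_def vimage_def)
    have "(\<Sum>q\<in>Y. norm (free_res E att \<kappa> (Ray \<alpha> a) q)) = (\<Sum>q\<in>Ray \<alpha> ` {b. Ray \<alpha> b \<in> Y}. norm (free_res E att \<kappa> (Ray \<alpha> a) q))"
    proof (rule sum.mono_neutral_right[OF Y], blast, rule ballI)
      fix q assume "q \<in> Y - Ray \<alpha> ` {b. Ray \<alpha> b \<in> Y}"
      thus "norm (free_res E att \<kappa> (Ray \<alpha> a) q) = 0" by (cases q) auto
    qed
    also have "\<dots> = (\<Sum>b\<in>{b. Ray \<alpha> b \<in> Y}. norm (ray_green ?z a b))"
      by (subst sum.reindex) (auto simp: inj_on_def)
    also have "\<dots> \<le> 2 / (1 - norm ?z)\<^sup>2" by (rule ray_green_sum_bound[OF z fin])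
    finally show ?thesis .
  qed
  have comm: "free_res E att \<kappa> q (Ray \<alpha> a) = free_res E att \<kappa> (Ray \<alpha> a) q" for q \<alpha> a
    by (cases q) (auto simp: ray_green_commute)
  show ?thesis
  proof (intro exI[of _ K] conjI allI impI)
    show "0 \<le> K" using D0 by (simp add: K_def)
    fix p and Y :: "('k, 'r) vertex set" assume Y: "finite Y"
    show "(\<Sum>q\<in>Y. norm (free_res E att \<kappa> p q)) \<le> K"
    proof (cases p)
      case (Core x)
      show ?thesis using sum_Core_le[OF Y, of "\<lambda>q. norm (free_res E att \<kappa> p q)"] 1[of x] KD
        by (simp add: Core)
    next
      case (Ray \<alpha> a)
      thus ?thesis using ray[OF Y, of \<alpha> a] Kz by simp
    qed
    show "(\<Sum>q\<in>Y. norm (free_res E att \<kappa> q p)) \<le> K"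
    proof (cases p)
      case (Core x)
      show ?thesis using sum_Core_le[OF Y, of "\<lambda>q. norm (free_res E att \<kappa> q p)"] 2[of x] KD
        by (simp add: Core)
    next
      case (Ray \<alpha> a)
      thus ?thesis using ray[OF Y, of \<alpha> a] Kz by (simp add: comm)
    qed
  qed
qed

section \<open>Weighted sequence spaces on the graph\<close>

lemma dominated_summable:
  fixes f :: "'a \<Rightarrow> complex"
  assumes g: "g summable_on A" and le: "\<And>x. x \<in> A \<Longrightarrow> norm (f x) \<le> g x"
  shows "(\<lambda>x. norm (f x)) summable_on A" "f summable_on A" "norm (infsum f A) \<le> infsum g A"
proof -
  show 1: "(\<lambda>x. norm (f x)) summable_on A"
    by (rule summable_on_comparison_test[OF g le]) auto
  show 2: "f summable_on A" using 1 by (rule abs_summable_summable)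
  show "norm (infsum f A) \<le> infsum g A"
    by (rule norm_infsum_le[OF has_sum_infsum[OF 2] has_sum_infsum[OF g] le])
qed

lemma fubini_dominated:
  fixes f :: "'a \<Rightarrow> 'b \<Rightarrow> complex"
  assumes a: "a summable_on UNIV" "\<And>p. a p \<ge> (0::real)" and b: "b summable_on UNIV" "\<And>q. b q \<ge> (0::real)"
    and le: "\<And>p q. norm (f p q) \<le> a p * b q"
  shows "(\<Sum>\<^sub>\<infinity>p. \<Sum>\<^sub>\<infinity>q. f p q) = (\<Sum>\<^sub>\<infinity>q. \<Sum>\<^sub>\<infinity>p. f p q)"
proof -
  have "(\<lambda>(p, q). a p * b q) summable_on Sigma UNIV (\<lambda>_. UNIV)"
  proof (rule summable_on_SigmaI[where g = "\<lambda>p. a p * infsum b UNIV"])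
    show "((\<lambda>y. case (x, y) of (p, q) \<Rightarrow> a p * b q) has_sum a x * infsum b UNIV) UNIV" for x
      using has_sum_cmult_right[OF has_sum_infsum[OF b(1)]] by simp
    show "(\<lambda>p. a p * infsum b UNIV) summable_on UNIV" using a(1) by (rule summable_on_cmult_left)
  qed (use a b in auto)
  hence "(\<lambda>(p, q). f p q) summable_on UNIV \<times> UNIV"
    by (rule dominated_summable(2)) (use le in auto)
  thus ?thesis by (rule infsum_swap_banach)
qed

lemma L1_iff: "u \<in> L1 (real n) \<longleftrightarrow> (\<lambda>p. vsize p ^ n * norm (u p)) summable_on UNIV"
  by (simp add: L1_def weight_nat)

lemma L1_norm_eq: "L1_norm (real n) u = (\<Sum>\<^sub>\<infinity>p. vsize p ^ n * norm (u p))"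
  by (simp add: L1_norm_def weight_nat)

lemma L1_norm_nonneg: "L1_norm (real n) u \<ge> 0"
  unfolding L1_norm_eq by (intro infsum_nonneg mult_nonneg_nonneg zero_le_power vsize_pos) auto

lemma L1_pairing:
  assumes u: "u \<in> L1 (real n)" and f: "\<And>q. norm (f q) \<le> B * vsize q ^ n"
  shows "(\<lambda>q. norm (f q * u q)) summable_on UNIV" "(\<lambda>q. f q * u q) summable_on UNIV"
    "norm (\<Sum>\<^sub>\<infinity>q. f q * u q) \<le> B * L1_norm (real n) u"
proof -
  have s: "(\<lambda>q. B * (vsize q ^ n * norm (u q))) summable_on UNIV"
    using u unfolding L1_iff by (rule summable_on_cmult_right)
  have le: "norm (f q * u q) \<le> B * (vsize q ^ n * norm (u q))" for q
    using mult_right_mono[OF f[of q], of "norm (u q)"] by (simp add: norm_mult mult_ac)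
  show "(\<lambda>q. norm (f q * u q)) summable_on UNIV" "(\<lambda>q. f q * u q) summable_on UNIV"
    using dominated_summable[OF s le] by auto
  have "norm (\<Sum>\<^sub>\<infinity>q. f q * u q) \<le> (\<Sum>\<^sub>\<infinity>q. B * (vsize q ^ n * norm (u q)))"
    using dominated_summable[OF s le] by auto
  also have "\<dots> = B * L1_norm (real n) u" unfolding L1_norm_eq by (rule infsum_cmult_right')
  finally show "norm (\<Sum>\<^sub>\<infinity>q. f q * u q) \<le> B * L1_norm (real n) u" .
qed

lemma L1_dominated:
  assumes "u \<in> L1 (real n)" "\<And>p. vsize p ^ m * norm (w p) \<le> vsize p ^ n * norm (u p)"
  shows "w \<in> L1 (real m)" "L1_norm (real m) w \<le> L1_norm (real n) u"
proof -
  have s: "(\<lambda>p. vsize p ^ n * norm (u p)) summable_on UNIV" using assms(1) by (simp add: L1_iff)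
  have t: "(\<lambda>p. vsize p ^ m * norm (w p)) summable_on UNIV"
    by (rule summable_on_comparison_test[OF s assms(2)])
      (auto intro!: mult_nonneg_nonneg zero_le_power vsize_pos)
  thus "w \<in> L1 (real m)" by (simp add: L1_iff)
  show "L1_norm (real m) w \<le> L1_norm (real n) u"
    unfolding L1_norm_eq by (rule infsum_mono[OF t s assms(2)])
qed

lemma L1_mono:
  assumes "u \<in> L1 (real n)" "m \<le> n"
  shows "u \<in> L1 (real m)" "L1_norm (real m) u \<le> L1_norm (real n) u"
  by (rule L1_dominated[OF assms(1)], intro mult_right_mono power_increasing vsize_ge_1 assms, simp)+

lemma L1_lincomb:
  assumes u: "u \<in> L1 (real n)" and w: "w \<in> L1 (real n)"
  shows "(\<lambda>x. a * u x + b * w x) \<in> L1 (real n)"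
proof -
  have s: "(\<lambda>p. norm a * (vsize p ^ n * norm (u p)) + norm b * (vsize p ^ n * norm (w p))) summable_on UNIV"
    using u w unfolding L1_iff by (intro summable_on_add summable_on_cmult_right)
  have "vsize p ^ n * norm (a * u p + b * w p)
      \<le> norm a * (vsize p ^ n * norm (u p)) + norm b * (vsize p ^ n * norm (w p))" for p
  proof -
    have "norm (a * u p + b * w p) \<le> norm a * norm (u p) + norm b * norm (w p)"
      by (metis norm_mult norm_triangle_ineq)
    from mult_left_mono[OF this, of "vsize p ^ n"] show ?thesis
      using vsize_pos[of p] by (simp add: algebra_simps)
  qed
  thus ?thesis unfolding L1_iff
    by (intro summable_on_comparison_test[OF s]) (auto intro!: mult_nonneg_nonneg zero_le_power vsize_pos)
qed

definition point :: "'a \<Rightarrow> 'a \<Rightarrow> complex" where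
  "point y x = (if x = y then 1 else 0)"

lemma infsum_single:
  fixes f :: "'a \<Rightarrow> 'b::{topological_ab_group_add, t2_space}"
  shows "(\<And>x. x \<noteq> y \<Longrightarrow> f x = 0) \<Longrightarrow> (\<Sum>\<^sub>\<infinity>x. f x) = f y"
  using infsum_cong_neutral[of UNIV "{y}" f f] by simp

lemma point_L1: "point y \<in> L1 (real n)"
  unfolding L1_iff by (rule finite_nonzero_values_imp_summable_on) (simp add: point_def)

lemma pairing_point: "pairing u (point y) = cnj (u y)"
  unfolding pairing_def by (subst infsum_single[of y]) (auto simp: point_def)

subsection \<open>Kernel operators\<close>

definition kernel_op :: "('a \<Rightarrow> 'a \<Rightarrow> complex) \<Rightarrow> ('a \<Rightarrow> complex) \<Rightarrow> 'a \<Rightarrow> complex" where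
  "kernel_op K u x = (\<Sum>\<^sub>\<infinity>y. K x y * u y)"

lemma weight_uminus: "weight (- real n) p = 1 / vsize p ^ n"
  using vsize_pos[of p] by (simp add: weight_eq powr_minus powr_realpow field_simps)

lemma L1_dual_iff:
  "u \<in> L1_dual (real n) \<longleftrightarrow> (\<exists>B. \<forall>p. norm (u p) \<le> B * vsize p ^ n)"
proof -
  have "1 / vsize p ^ n * norm (u p) \<le> B \<longleftrightarrow> norm (u p) \<le> B * vsize p ^ n" for p B
    using vsize_pos[of p] by (simp add: field_simps)
  thus ?thesis unfolding L1_dual_def bdd_above_def weight_uminus by auto
qed

lemma L1_dual_norm_le:
  assumes "\<And>p. norm (u p) \<le> B * vsize p ^ n"
  shows "L1_dual_norm (real n) u \<le> B"
  unfolding L1_dual_norm_def weight_uminus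
proof (rule cSUP_least)
  show "1 / vsize p ^ n * norm (u p) \<le> B" for p
    using assms[of p] vsize_pos[of p] by (simp add: field_simps)
qed simp

lemma L1_dual_norm_nonneg:
  assumes "u \<in> L1_dual (real n)"
  shows "L1_dual_norm (real n) u \<ge> 0"
proof -
  have "0 \<le> weight (- real n) p * norm (u p)" for p
    using vsize_pos[of p] by (simp add: weight_uminus)
  also have "weight (- real n) p * norm (u p) \<le> L1_dual_norm (real n) u" for p
    unfolding L1_dual_norm_def using assms by (intro cSUP_upper) (auto simp: L1_dual_def)
  finally show ?thesis by blast
qed

lemma kernel_op_bound:
  assumes u: "u \<in> L1 (real n)" and K: "\<And>x y. norm (K x y) \<le> C * (vsize x * vsize y) ^ n"
  shows "norm (kernel_op K u x) \<le> C * L1_norm (real n) u * vsize x ^ n"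
proof -
  have "norm (K x y) \<le> (C * vsize x ^ n) * vsize y ^ n" for y
    using K[of x y] by (simp add: power_mult_distrib mult_ac)
  from L1_pairing(3)[OF u this] show ?thesis by (simp add: kernel_op_def mult_ac)
qed

lemma kernel_op_summable:
  assumes u: "u \<in> L1 (real n)" and K: "\<And>x y. norm (K x y) \<le> C * (vsize x * vsize y) ^ n"
  shows "(\<lambda>y. K x y * u y) summable_on UNIV"
proof -
  have "norm (K x y) \<le> (C * vsize x ^ n) * vsize y ^ n" for y
    using K[of x y] by (simp add: power_mult_distrib mult_ac)
  from L1_pairing(2)[OF u this] show ?thesis .
qed

lemma kernel_op_lincomb:
  assumes "(\<lambda>y. K x y * u y) summable_on UNIV" "(\<lambda>y. K x y * w y) summable_on UNIV"
  shows "kernel_op K (\<lambda>y. a * u y + b * w y) x = a * kernel_op K u x + b * kernel_op K w x"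
proof -
  have "kernel_op K (\<lambda>y. a * u y + b * w y) x = (\<Sum>\<^sub>\<infinity>y. a * (K x y * u y) + b * (K x y * w y))"
    unfolding kernel_op_def by (simp add: algebra_simps)
  also have "\<dots> = (\<Sum>\<^sub>\<infinity>y. a * (K x y * u y)) + (\<Sum>\<^sub>\<infinity>y. b * (K x y * w y))"
    by (intro infsum_add summable_on_cmult_right assms)
  finally show ?thesis by (simp add: kernel_op_def infsum_cmult_right')
qed

text \<open>The operator norm of \<open>\<B>\<^sup>s\<close> is the weighted supremum norm of the kernel.\<close>

lemma Bs_kernel_like:
  fixes T :: "('k, 'r) oper" and K :: "('k, 'r) vertex \<Rightarrow> ('k, 'r) vertex \<Rightarrow> complex"
  assumes K: "\<And>x y. norm (K x y) \<le> C * (vsize x * vsize y) ^ n" and C: "C \<ge> 0"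
    and T: "\<And>u. u \<in> L1 (real n) \<Longrightarrow> T u = kernel_op K u"
  shows "T \<in> Bs (real n)" "\<bar>Bs_norm (real n) T\<bar> \<le> C"
proof -
  have bd: "norm (T u x) \<le> C * L1_norm (real n) u * vsize x ^ n" if "u \<in> L1 (real n)" for u x
    using kernel_op_bound[OF that K] T[OF that] by simp
  have dual: "T u \<in> L1_dual (real n)" if "u \<in> L1 (real n)" for u
    unfolding L1_dual_iff using bd[OF that] by blast
  have nrm: "L1_dual_norm (real n) (T u) \<le> C * L1_norm (real n) u" if "u \<in> L1 (real n)" for u
    by (rule L1_dual_norm_le[OF bd[OF that]])
  have lin: "T (\<lambda>x. a * u x + b * w x) = (\<lambda>x. a * T u x + b * T w x)"
    if "u \<in> L1 (real n)" "w \<in> L1 (real n)" for u w a b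
    unfolding T[OF that(1)] T[OF that(2)] T[OF L1_lincomb[OF that]]
    by (rule ext) (rule kernel_op_lincomb; rule kernel_op_summable[OF _ K]; fact)
  show "T \<in> Bs (real n)"
    unfolding Bs_def bounded_ops_def using dual nrm lin by blast
  define S :: "('k, 'r) state set" where "S = {u \<in> L1 (real n). L1_norm (real n) u \<le> 1}"
  have zero: "(\<lambda>_. 0) \<in> S" by (simp add: S_def L1_iff L1_norm_eq)
  have le: "L1_dual_norm (real n) (T u) \<le> C" if "u \<in> S" for u
    using nrm[of u] that C mult_left_mono[of "L1_norm (real n) u" 1 C] by (auto simp: S_def)
  have up: "Bs_norm (real n) T \<le> C"
    unfolding Bs_norm_def S_def[symmetric] using zero le by (intro cSUP_least) auto
  have "0 \<le> L1_dual_norm (real n) (T (\<lambda>_. 0))"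
    using zero by (intro L1_dual_norm_nonneg dual) (auto simp: S_def)
  also have "\<dots> \<le> Bs_norm (real n) T"
    unfolding Bs_norm_def S_def[symmetric] using zero le
    by (intro cSUP_upper) (auto intro!: bdd_aboveI2[where M = C])
  finally show "\<bar>Bs_norm (real n) T\<bar> \<le> C" using up by simp
qed

subsection \<open>Square-summable functions\<close>

lemma ell2_norm_sq: "(ell2_norm u)\<^sup>2 = (\<Sum>\<^sub>\<infinity>x. (norm (u x))\<^sup>2)"
  unfolding ell2_norm_def by (intro real_sqrt_pow2 infsum_nonneg) auto

lemma ell2_norm_nonneg: "ell2_norm u \<ge> 0"
  unfolding ell2_norm_def by (intro real_sqrt_ge_zero infsum_nonneg) auto

lemma ell2I:
  assumes "C \<ge> 0" "\<And>X. finite X \<Longrightarrow> (\<Sum>x\<in>X. (norm (u x))\<^sup>2) \<le> C\<^sup>2"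
  shows "u \<in> ell2" "ell2_norm u \<le> C"
proof -
  have s: "(\<lambda>x. (norm (u x))\<^sup>2) summable_on UNIV"
    using assms(2) by (intro nonneg_bdd_above_summable_on) (auto intro!: bdd_aboveI2)
  thus "u \<in> ell2" by (simp add: ell2_def)
  have "(ell2_norm u)\<^sup>2 \<le> C\<^sup>2"
    unfolding ell2_norm_sq by (rule infsum_le_finite_sums[OF s]) (use assms in auto)
  thus "ell2_norm u \<le> C" using assms(1) by (rule power2_le_imp_le)
qed

lemma ell2_finite_sum:
  assumes "u \<in> ell2" "finite X"
  shows "(\<Sum>x\<in>X. (norm (u x))\<^sup>2) \<le> (ell2_norm u)\<^sup>2"
  unfolding ell2_norm_sq by (rule finite_sum_le_infsum) (use assms in \<open>auto simp: ell2_def\<close>)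

lemma ell2_point_bound: "u \<in> ell2 \<Longrightarrow> norm (u x) \<le> ell2_norm u"
  using ell2_finite_sum[of u "{x}"] by (auto intro: power2_le_imp_le ell2_norm_nonneg)

text \<open>The factor 2 comes from |a + b|^2 \<le> 2 |a|^2 + 2 |b|^2. Later only the boundedness of
  operators on \<open>ell2\<close> matters, not the size of the constants.\<close>

lemma ell2_add:
  assumes "u \<in> ell2" "w \<in> ell2"
  shows "(\<lambda>x. u x + w x) \<in> ell2" "ell2_norm (\<lambda>x. u x + w x) \<le> 2 * (ell2_norm u + ell2_norm w)"
proof -
  let ?C = "2 * (ell2_norm u + ell2_norm w)"
  have C: "?C \<ge> 0" using ell2_norm_nonneg[of u] ell2_norm_nonneg[of w] by simp
  have "(\<Sum>x\<in>X. (norm (u x + w x))\<^sup>2) \<le> ?C\<^sup>2" if X: "finite X" for X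
  proof -
    have "(norm (u x + w x))\<^sup>2 \<le> 2 * (norm (u x))\<^sup>2 + 2 * (norm (w x))\<^sup>2" for x
    proof -
      have "(norm (u x + w x))\<^sup>2 \<le> (norm (u x) + norm (w x))\<^sup>2"
        by (intro power_mono norm_triangle_ineq) auto
      also have "\<dots> \<le> 2 * (norm (u x))\<^sup>2 + 2 * (norm (w x))\<^sup>2"
        using sum_squares_bound[of "norm (u x)" "norm (w x)"] by (simp add: power2_sum)
      finally show ?thesis .
    qed
    hence "(\<Sum>x\<in>X. (norm (u x + w x))\<^sup>2) \<le> 2 * (\<Sum>x\<in>X. (norm (u x))\<^sup>2) + 2 * (\<Sum>x\<in>X. (norm (w x))\<^sup>2)"
      unfolding sum_distrib_left sum.distrib[symmetric] by (rule sum_mono)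
    also have "\<dots> \<le> 2 * (ell2_norm u)\<^sup>2 + 2 * (ell2_norm w)\<^sup>2"
      using ell2_finite_sum[OF assms(1) X] ell2_finite_sum[OF assms(2) X] by simp
    also have "\<dots> \<le> ?C\<^sup>2"
      using ell2_norm_nonneg[of u] ell2_norm_nonneg[of w]
      by (simp add: power2_sum power_mult_distrib)
    finally show ?thesis .
  qed
  from ell2I[OF C this] show "(\<lambda>x. u x + w x) \<in> ell2" "ell2_norm (\<lambda>x. u x + w x) \<le> ?C" by auto
qed

lemma ell2_scale:
  assumes "u \<in> ell2"
  shows "(\<lambda>x. a * u x) \<in> ell2"
  using assms summable_on_cmult_right[of "\<lambda>x. (norm (u x))\<^sup>2" UNIV "(norm a)\<^sup>2"]
  by (simp add: ell2_def norm_mult power_mult_distrib)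

lemma ell2_uminus:
  assumes "u \<in> ell2"
  shows "(\<lambda>x. - u x) \<in> ell2" "ell2_norm (\<lambda>x. - u x) = ell2_norm u"
  using assms by (auto simp: ell2_def ell2_norm_def)

lemma ell2_lincomb:
  assumes "u \<in> ell2" "w \<in> ell2"
  shows "(\<lambda>x. a * u x + b * w x) \<in> ell2"
  by (intro ell2_add ell2_scale assms)

lemma L1_ell2:
  assumes "u \<in> L1 (real n)"
  shows "u \<in> ell2" "ell2_norm u \<le> L1_norm (real n) u"
proof -
  have s: "(\<lambda>p. vsize p ^ n * norm (u p)) summable_on UNIV" using assms by (simp add: L1_iff)
  have "(\<Sum>x\<in>X. (norm (u x))\<^sup>2) \<le> (L1_norm (real n) u)\<^sup>2" if X: "finite X" for X
  proof -
    have "(\<Sum>x\<in>X. (norm (u x))\<^sup>2) \<le> (\<Sum>x\<in>X. norm (u x))\<^sup>2"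
      using power_mono[OF L2_set_le_sum[of X "\<lambda>x. norm (u x)"] L2_set_nonneg, of 2]
      by (simp add: L2_set_def sum_nonneg)
    also have "\<dots> \<le> (\<Sum>x\<in>X. vsize x ^ n * norm (u x))\<^sup>2"
    proof (intro power_mono sum_mono sum_nonneg)
      show "norm (u x) \<le> vsize x ^ n * norm (u x)" for x
        using mult_right_mono[OF one_le_power[OF vsize_ge_1[of x], of n], of "norm (u x)"] by simp
    qed auto
    also have "\<dots> \<le> (L1_norm (real n) u)\<^sup>2"
      unfolding L1_norm_eq using X
      by (intro power_mono finite_sum_le_infsum[OF s] sum_nonneg)
        (auto intro!: mult_nonneg_nonneg zero_le_power vsize_pos)
    finally show ?thesis .
  qed
  from ell2I[OF L1_norm_nonneg this] show "u \<in> ell2" "ell2_norm u \<le> L1_norm (real n) u" by auto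
qed

lemma ell2_product_summable:
  assumes "u \<in> ell2" "w \<in> ell2"
  shows "(\<lambda>x. u x * w x) summable_on UNIV"
proof (rule dominated_summable(2))
  show "(\<lambda>x. (norm (u x))\<^sup>2 + (norm (w x))\<^sup>2) summable_on UNIV"
    using assms by (intro summable_on_add) (auto simp: ell2_def)
  show "norm (u x * w x) \<le> (norm (u x))\<^sup>2 + (norm (w x))\<^sup>2" for x
  proof -
    have "2 * (norm (u x) * norm (w x)) \<le> (norm (u x))\<^sup>2 + (norm (w x))\<^sup>2"
      using sum_squares_bound[of "norm (u x)" "norm (w x)"] by simp
    moreover have "0 \<le> norm (u x) * norm (w x)" by simp
    ultimately show ?thesis unfolding norm_mult by linarith
  qed
qed

text \<open>Cauchy-Schwarz with |K| split as sqrt|K| times sqrt|K| uses the row bound once and the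
  column bound once. The estimate is made for finite sets of rows and columns and then passes to the
  limit, which also yields square summability of the image.\<close>

lemma schur_test:
  assumes K: "K0 \<ge> 0"
    and row: "\<And>x Y. finite Y \<Longrightarrow> (\<Sum>y\<in>Y. norm (K x y)) \<le> K0"
    and col: "\<And>y X. finite X \<Longrightarrow> (\<Sum>x\<in>X. norm (K x y)) \<le> K0"
    and u: "u \<in> ell2"
  shows "(\<lambda>y. K x y * u y) summable_on UNIV" "kernel_op K u \<in> ell2"
    "ell2_norm (kernel_op K u) \<le> K0 * ell2_norm u"
proof -
  show sm: "(\<lambda>y. K x y * u y) summable_on UNIV" for x
  proof (rule dominated_summable(2))
    have "(\<lambda>y. norm (K x y)) summable_on UNIV"
      using row by (intro nonneg_bdd_above_summable_on) (auto intro!: bdd_aboveI2)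
    thus "(\<lambda>y. norm (K x y) * ell2_norm u) summable_on UNIV" by (rule summable_on_cmult_left)
    show "norm (K x y * u y) \<le> norm (K x y) * ell2_norm u" for y
      unfolding norm_mult by (intro mult_left_mono ell2_point_bound u) auto
  qed
  have fin: "(\<Sum>x\<in>X. (norm (\<Sum>y\<in>Y. K x y * u y))\<^sup>2) \<le> (K0 * ell2_norm u)\<^sup>2"
    if X: "finite X" and Y: "finite Y" for X Y
  proof -
    have "(norm (\<Sum>y\<in>Y. K x y * u y))\<^sup>2 \<le> K0 * (\<Sum>y\<in>Y. norm (K x y) * (norm (u y))\<^sup>2)" for x
    proof -
      have "norm (\<Sum>y\<in>Y. K x y * u y) \<le> (\<Sum>y\<in>Y. sqrt (norm (K x y)) * (sqrt (norm (K x y)) * norm (u y)))"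
        by (rule order_trans[OF norm_sum]) (simp add: norm_mult mult.assoc[symmetric])
      hence "(norm (\<Sum>y\<in>Y. K x y * u y))\<^sup>2 \<le> (\<Sum>y\<in>Y. sqrt (norm (K x y)) * (sqrt (norm (K x y)) * norm (u y)))\<^sup>2"
        by (intro power_mono) auto
      also have "\<dots> \<le> (\<Sum>y\<in>Y. (sqrt (norm (K x y)))\<^sup>2) * (\<Sum>y\<in>Y. (sqrt (norm (K x y)) * norm (u y))\<^sup>2)"
        by (rule Cauchy_Schwarz_ineq_sum)
      also have "\<dots> = (\<Sum>y\<in>Y. norm (K x y)) * (\<Sum>y\<in>Y. norm (K x y) * (norm (u y))\<^sup>2)"
        by (simp add: power_mult_distrib)
      also have "\<dots> \<le> K0 * (\<Sum>y\<in>Y. norm (K x y) * (norm (u y))\<^sup>2)"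
        by (intro mult_right_mono row Y sum_nonneg) auto
      finally show ?thesis .
    qed
    hence "(\<Sum>x\<in>X. (norm (\<Sum>y\<in>Y. K x y * u y))\<^sup>2) \<le> (\<Sum>x\<in>X. K0 * (\<Sum>y\<in>Y. norm (K x y) * (norm (u y))\<^sup>2))"
      by (rule sum_mono)
    also have "\<dots> = K0 * (\<Sum>y\<in>Y. (\<Sum>x\<in>X. norm (K x y)) * (norm (u y))\<^sup>2)"
      unfolding sum_distrib_left[symmetric] sum_distrib_right by (subst sum.swap) (rule refl)
    also have "\<dots> \<le> K0 * (\<Sum>y\<in>Y. K0 * (norm (u y))\<^sup>2)"
      by (intro mult_left_mono sum_mono mult_right_mono col X K) auto
    also have "\<dots> = K0\<^sup>2 * (\<Sum>y\<in>Y. (norm (u y))\<^sup>2)"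
      by (simp add: sum_distrib_left[symmetric] power2_eq_square)
    also have "\<dots> \<le> K0\<^sup>2 * (ell2_norm u)\<^sup>2"
      by (intro mult_left_mono ell2_finite_sum u Y) auto
    finally show ?thesis by (simp add: power_mult_distrib)
  qed
  have "(\<Sum>x\<in>X. (norm (kernel_op K u x))\<^sup>2) \<le> (K0 * ell2_norm u)\<^sup>2" if X: "finite X" for X
  proof (rule tendsto_upperbound)
    show "((\<lambda>Y. \<Sum>x\<in>X. (norm (\<Sum>y\<in>Y. K x y * u y))\<^sup>2) \<longlongrightarrow> (\<Sum>x\<in>X. (norm (kernel_op K u x))\<^sup>2)) (finite_subsets_at_top UNIV)"
      unfolding kernel_op_def by (intro tendsto_intros infsum_tendsto sm)
    show "\<forall>\<^sub>F Y in finite_subsets_at_top UNIV. (\<Sum>x\<in>X. (norm (\<Sum>y\<in>Y. K x y * u y))\<^sup>2) \<le> (K0 * ell2_norm u)\<^sup>2"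
      using fin[OF X] by (auto intro: eventually_finite_subsets_at_top_weakI)
  qed simp
  from ell2I[OF mult_nonneg_nonneg[OF K ell2_norm_nonneg] this]
  show "kernel_op K u \<in> ell2" "ell2_norm (kernel_op K u) \<le> K0 * ell2_norm u" by auto
qed

section \<open>The factorized potential\<close>

locale factored_potential =
  fixes V :: "('k::finite, 'r::finite) oper" and v :: "'h::complex_hilbert \<Rightarrow> ('k, 'r) state"
    and U :: "'h \<Rightarrow> 'h" and \<beta> :: nat
  assumes A: "assumption_A (real \<beta>) V v U"
begin

lemma v_L1: "v k \<in> L1 (real \<beta>)"
  and v_add: "v (k + l) = (\<lambda>x. v k x + v l x)"
  and v_scale: "v (c *\<^sub>C k) = (\<lambda>x. c * v k x)"
  using A by (auto simp: assumption_A_def bounded_into_L1_def)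

definition Cv :: real where
  "Cv = (SOME C. C \<ge> 0 \<and> (\<forall>k. L1_norm (real \<beta>) (v k) \<le> C * norm k))"

lemma Cv: "Cv \<ge> 0" "L1_norm (real \<beta>) (v k) \<le> Cv * norm k"
proof -
  obtain C where C: "\<And>k. L1_norm (real \<beta>) (v k) \<le> C * norm k"
    using A by (auto simp: assumption_A_def bounded_into_L1_def)
  have "L1_norm (real \<beta>) (v k) \<le> \<bar>C\<bar> * norm k" for k
    using C[of k] mult_right_mono[OF abs_ge_self norm_ge_zero, of C k] by linarith
  hence "\<exists>C. C \<ge> 0 \<and> (\<forall>k. L1_norm (real \<beta>) (v k) \<le> C * norm k)" by (intro exI[of _ "\<bar>C\<bar>"]) auto
  from someI_ex[OF this] show "Cv \<ge> 0" "L1_norm (real \<beta>) (v k) \<le> Cv * norm k"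
    unfolding Cv_def by auto
qed

lemma U_add: "U (k + l) = U k + U l"
  and U_scale: "U (c *\<^sub>C k) = c *\<^sub>C U k"
  and U_sym: "cinner (U k) l = cinner k (U l)"
  and U_iso: "cinner (U k) (U l) = cinner k l"
  using A by (auto simp: assumption_A_def selfadjoint_unitary_def clinear_op_def)

text \<open>Self-adjointness followed by isometry: <U U k, l> = <U k, U l> = <k, l>. So U is its own
  inverse.\<close>

lemma U_U: "U (U k) = k"
  by (rule cinner_eqI) (subst U_sym, rule U_iso)

lemma norm_U: "norm (U k) = norm k"
  using Re_cinner_self[of "U k"] Re_cinner_self[of k] by (simp add: U_iso power2_eq_iff_nonneg)

text \<open>Membership in the dual of L^\<beta> with an explicit bound B for the norm; carrying B
  along makes estimates of the adjoint uniform in parameters.\<close>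

definition dom :: "real \<Rightarrow> ('k, 'r) state \<Rightarrow> bool" where
  "dom B u \<longleftrightarrow> (\<forall>p. norm (u p) \<le> B * vsize p ^ \<beta>)"

lemma dom_nonneg:
  assumes "dom B u"
  shows "B \<ge> 0"
proof -
  define p :: "('k, 'r) vertex" where "p = undefined"
  have "0 \<le> norm (u p)" by simp
  also have "\<dots> \<le> B * vsize p ^ \<beta>" using assms unfolding dom_def by blast
  finally show ?thesis using zero_less_power[OF vsize_pos(1)[of p], of \<beta>]
    by (simp add: zero_le_mult_iff)
qed

lemma dom_lincomb:
  assumes "dom B u" "dom C w"
  shows "dom (norm a * B + norm b * C) (\<lambda>x. a * u x + b * w x)"
  unfolding dom_def
proof
  fix p
  have "norm (a * u p + b * w p) \<le> norm a * norm (u p) + norm b * norm (w p)"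
    by (metis norm_mult norm_triangle_ineq)
  also have "\<dots> \<le> norm a * (B * vsize p ^ \<beta>) + norm b * (C * vsize p ^ \<beta>)"
    using assms unfolding dom_def by (intro add_mono mult_left_mono) auto
  finally show "norm (a * u p + b * w p) \<le> (norm a * B + norm b * C) * vsize p ^ \<beta>"
    by (simp add: algebra_simps)
qed

lemma dual_dom: "u \<in> L1_dual (real \<beta>) \<longleftrightarrow> (\<exists>B. dom B u)"
  by (simp add: L1_dual_iff dom_def)

lemma pairing_dom:
  assumes "dom B u" "w \<in> L1 (real \<beta>)"
  shows "(\<lambda>x. cnj (u x) * w x) summable_on UNIV" "norm (pairing u w) \<le> B * L1_norm (real \<beta>) w"
  unfolding pairing_def using assms(1)
  by (intro L1_pairing(2,3)[OF assms(2), of "\<lambda>x. cnj (u x)" B]; simp add: dom_def)+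

text \<open>The pairing with v k is a bounded functional of k with bound B * Cv, so Riesz supplies
  the vector that the definite description in \<open>adjoint_op\<close> refers to.\<close>

lemma adjoint_char:
  assumes u: "dom B u"
  shows "cinner (adjoint_op v u) k = pairing u (v k)"
proof -
  have "\<exists>y. \<forall>k. cinner y k = pairing u (v k)"
  proof (rule riesz_representation[where C = "B * Cv"])
    show "pairing u (v (x + y)) = pairing u (v x) + pairing u (v y)" for x y
    proof -
      have "pairing u (v (x + y)) = (\<Sum>\<^sub>\<infinity>p. cnj (u p) * v x p + cnj (u p) * v y p)"
        by (simp add: pairing_def v_add distrib_left)
      also have "\<dots> = pairing u (v x) + pairing u (v y)"
        unfolding pairing_def by (rule infsum_add; rule pairing_dom[OF u v_L1])
      finally show ?thesis .
    qed
    show "pairing u (v (c *\<^sub>C x)) = c * pairing u (v x)" for c x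
    proof -
      have "pairing u (v (c *\<^sub>C x)) = (\<Sum>\<^sub>\<infinity>p. c * (cnj (u p) * v x p))"
        by (simp add: pairing_def v_scale mult_ac)
      thus ?thesis by (simp add: pairing_def infsum_cmult_right')
    qed
    show "norm (pairing u (v x)) \<le> B * Cv * norm x" for x
      using pairing_dom(2)[OF u v_L1[of x]] mult_left_mono[OF Cv(2)[of x] dom_nonneg[OF u]] by simp
  qed
  then obtain y where y: "\<And>k. cinner y k = pairing u (v k)" by blast
  have "adjoint_op v u = y"
    unfolding adjoint_op_def
  proof (rule the_equality)
    show "z = y" if "\<forall>k. cinner z k = pairing u (v k)" for z
      by (rule cinner_eqI) (use that y in simp)
  qed (use y in simp)
  thus ?thesis by (simp add: y)
qed

lemma adjoint_norm:
  assumes u: "dom B u"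
  shows "norm (adjoint_op v u) \<le> B * Cv"
proof (cases "adjoint_op v u = 0")
  case True
  thus ?thesis using Cv(1) dom_nonneg[OF u] by simp
next
  case False
  let ?y = "adjoint_op v u"
  have "(norm ?y)\<^sup>2 = Re (pairing u (v ?y))" by (simp add: adjoint_char[OF u, symmetric] Re_cinner_self)
  also have "\<dots> \<le> norm (pairing u (v ?y))" by (rule complex_Re_le_cmod)
  also have "\<dots> \<le> B * (Cv * norm ?y)"
    using pairing_dom(2)[OF u v_L1[of ?y]] mult_left_mono[OF Cv(2)[of ?y] dom_nonneg[OF u]] by simp
  finally show ?thesis using False by (simp add: power2_eq_square)
qed

lemma adjoint_lincomb:
  assumes u: "dom B u" and w: "dom C w"
  shows "adjoint_op v (\<lambda>x. a * u x + b * w x) = a *\<^sub>C adjoint_op v u + b *\<^sub>C adjoint_op v w"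
proof (rule cinner_eqI)
  fix k
  have "cinner (adjoint_op v (\<lambda>x. a * u x + b * w x)) k = pairing (\<lambda>x. a * u x + b * w x) (v k)"
    by (rule adjoint_char[OF dom_lincomb[OF u w]])
  also have "\<dots> = (\<Sum>\<^sub>\<infinity>x. cnj a * (cnj (u x) * v k x) + cnj b * (cnj (w x) * v k x))"
    by (simp add: pairing_def algebra_simps)
  also have "\<dots> = cnj a * pairing u (v k) + cnj b * pairing w (v k)"
    unfolding pairing_def infsum_cmult_right'[symmetric]
    by (rule infsum_add; rule summable_on_cmult_right; rule pairing_dom[OF _ v_L1], fact)
  also have "\<dots> = cinner (a *\<^sub>C adjoint_op v u + b *\<^sub>C adjoint_op v w) k"
    by (simp add: cinner_add_left cinner_scaleC_left adjoint_char[OF u] adjoint_char[OF w])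
  finally show "cinner (adjoint_op v (\<lambda>x. a * u x + b * w x)) k = cinner (a *\<^sub>C adjoint_op v u + b *\<^sub>C adjoint_op v w) k" .
qed

lemma dom_zero: "dom 0 (\<lambda>_. 0)"
  by (simp add: dom_def)

lemma adjoint_scale: "dom B u \<Longrightarrow> adjoint_op v (\<lambda>x. a * u x) = a *\<^sub>C adjoint_op v u"
  using adjoint_lincomb[of B u 0 "\<lambda>_. 0" a 0] dom_zero by simp

lemma adjoint_add: "dom B u \<Longrightarrow> dom C w \<Longrightarrow> adjoint_op v (\<lambda>x. u x + w x) = adjoint_op v u + adjoint_op v w"
  using adjoint_lincomb[of B u C w 1 1] by simp

lemma adjoint_diff: "dom B u \<Longrightarrow> dom C w \<Longrightarrow> adjoint_op v (\<lambda>x. u x - w x) = adjoint_op v u - adjoint_op v w"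
  using adjoint_lincomb[of B u C w 1 "-1"] by (simp add: scaleC_minus_left)

lemma adjoint_zero: "adjoint_op v (\<lambda>_. 0) = 0"
  using adjoint_norm[OF dom_zero] by simp

lemma dom_sum:
  assumes "\<And>j. j \<in> J \<Longrightarrow> dom (B j) (u j)"
  shows "dom (\<Sum>j\<in>J. B j) (\<lambda>x. \<Sum>j\<in>J. u j x)"
  using assms
proof (induction J rule: infinite_finite_induct)
  case (insert j J)
  thus ?case using dom_lincomb[of "B j" "u j" "sum B J" "\<lambda>x. \<Sum>j\<in>J. u j x" 1 1] by simp
qed (auto simp: dom_zero)

lemma adjoint_sum:
  assumes "\<And>j. j \<in> J \<Longrightarrow> dom (B j) (u j)"
  shows "adjoint_op v (\<lambda>x. \<Sum>j\<in>J. u j x) = (\<Sum>j\<in>J. adjoint_op v (u j))"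
  using assms
proof (induction J rule: infinite_finite_induct)
  case (insert j J)
  thus ?case using adjoint_add[of "B j" "u j" "sum B J" "\<lambda>x. \<Sum>j\<in>J. u j x"] dom_sum[of J B u] by simp
qed (auto simp: adjoint_zero)

lemma dom_point: "dom 1 (point p)"
  unfolding dom_def point_def using one_le_power[OF vsize_ge_1, of _ \<beta>] by (auto intro: order_trans[OF zero_le_one])

text \<open>A weakly unconditionally convergent series in a Hilbert space converges unconditionally:
  otherwise one could choose disjoint blocks of norm at least \<open>\<epsilon>\<close> and, by the parallelogram law,
  signs for which the partial sums grow without bound. This is what makes \<open>V\<close> compact.\<close>

lemma adjoint_tail:
  assumes \<epsilon>: "\<epsilon> > 0"
  shows "\<exists>F. finite F \<and> (\<forall>u. dom 1 u \<longrightarrow> (\<forall>p\<in>F. u p = 0) \<longrightarrow> norm (adjoint_op v u) \<le> \<epsilon>)"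
proof (rule ccontr)
  assume not_ex: "\<not> ?thesis"
  have neg: "\<exists>u. dom 1 u \<and> (\<forall>p\<in>F. u p = 0) \<and> norm (adjoint_op v u) > \<epsilon>" if "finite F" for F
  proof (rule ccontr)
    assume "\<not> ?thesis"
    hence "\<forall>u. dom 1 u \<longrightarrow> (\<forall>p\<in>F. u p = 0) \<longrightarrow> norm (adjoint_op v u) \<le> \<epsilon>"
      using not_less by blast
    thus False using that not_ex by blast
  qed
  \<comment> \<open>A bad u can be cut off to finite support. With k = v^* u, the sum for the
    pairing with v k converges to |k|^2 > \<epsilon> |k|, so some finite partial sum already exceeds
    \<epsilon> |k|, and by Cauchy-Schwarz the truncated state has an adjoint of norm at least
    \<epsilon>.\<close>
  have fin: "\<exists>w. dom 1 w \<and> (\<forall>p\<in>F. w p = 0) \<and> norm (adjoint_op v w) \<ge> \<epsilon> \<and> finite {p. w p \<noteq> 0}"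
    if F: "finite F" for F
  proof -
    obtain u where u: "dom 1 u" "\<forall>p\<in>F. u p = 0" "norm (adjoint_op v u) > \<epsilon>" using neg[OF F] by blast
    let ?k = "adjoint_op v u"
    have kk: "norm (pairing u (v ?k)) = norm ?k * norm ?k"
      unfolding adjoint_char[OF u(1), symmetric] cinner_self by (simp add: power2_eq_square norm_mult)
    have k0: "norm ?k > 0" using u(3) \<epsilon> by linarith
    have "((\<lambda>G. norm (\<Sum>p\<in>G. cnj (u p) * v ?k p)) \<longlongrightarrow> norm (pairing u (v ?k))) (finite_subsets_at_top UNIV)"
      unfolding pairing_def by (intro tendsto_norm infsum_tendsto pairing_dom[OF u(1) v_L1])
    moreover have "\<epsilon> * norm ?k < norm (pairing u (v ?k))" unfolding kk using u(3) k0 by simp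
    ultimately have "\<forall>\<^sub>F G in finite_subsets_at_top UNIV. \<epsilon> * norm ?k < norm (\<Sum>p\<in>G. cnj (u p) * v ?k p)"
      by (rule order_tendstoD)
    then obtain G where G: "finite G" "\<epsilon> * norm ?k < norm (\<Sum>p\<in>G. cnj (u p) * v ?k p)"
      unfolding eventually_finite_subsets_at_top by blast
    define w where "w p = (if p \<in> G then u p else 0)" for p
    have w: "dom 1 w" unfolding dom_def
    proof
      show "norm (w p) \<le> 1 * vsize p ^ \<beta>" for p
        using u(1) vsize_pos[of p] by (simp add: w_def dom_def)
    qed
    have "(\<Sum>p\<in>G. cnj (u p) * v ?k p) = pairing w (v ?k)"
    proof -
      have "pairing w (v ?k) = (\<Sum>\<^sub>\<infinity>p\<in>G. cnj (u p) * v ?k p)"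
        unfolding pairing_def by (rule infsum_cong_neutral) (auto simp: w_def)
      thus ?thesis using G(1) by simp
    qed
    also have "norm \<dots> \<le> norm (adjoint_op v w) * norm ?k"
      unfolding adjoint_char[OF w, symmetric] by (rule norm_cinner_le)
    finally have "\<epsilon> * norm ?k < norm (adjoint_op v w) * norm ?k" using G(2) by linarith
    hence "norm (adjoint_op v w) \<ge> \<epsilon>" using k0 by simp
    moreover have "finite {p. w p \<noteq> 0}" using G(1) by (rule finite_subset[rotated]) (auto simp: w_def)
    ultimately show ?thesis using w u(2) by (intro exI[of _ w]) (auto simp: w_def)
  qed
  have grow: "\<exists>w. dom 1 w \<and> finite {p. w p \<noteq> 0} \<and> real n * \<epsilon>\<^sup>2 \<le> (norm (adjoint_op v w))\<^sup>2" for n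
  proof (induction n)
    case 0
    show ?case by (rule exI[of _ "\<lambda>_. 0"]) (simp add: dom_def vsize_pos)
  next
    case (Suc n)
    then obtain s where s: "dom 1 s" "finite {p. s p \<noteq> 0}" "real n * \<epsilon>\<^sup>2 \<le> (norm (adjoint_op v s))\<^sup>2" by blast
    obtain w where w: "dom 1 w" "\<And>p. s p \<noteq> 0 \<Longrightarrow> w p = 0" "norm (adjoint_op v w) \<ge> \<epsilon>" "finite {p. w p \<noteq> 0}"
      using fin[OF s(2)] by auto
    have disj: "s p = 0 \<or> w p = 0" for p using w(2) by blast
    let ?a = "adjoint_op v s" and ?b = "adjoint_op v w"
    have "\<epsilon>\<^sup>2 \<le> (norm ?b)\<^sup>2" using w(3) \<epsilon> by (intro power_mono) auto
    hence tot: "real (Suc n) * \<epsilon>\<^sup>2 \<le> (norm ?a)\<^sup>2 + (norm ?b)\<^sup>2" using s(3) by (simp add: algebra_simps)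
    have dp: "dom 1 (\<lambda>x. s x + w x)" and dm: "dom 1 (\<lambda>x. s x - w x)"
      unfolding dom_def
    proof (safe)
      fix p
      show "norm (s p + w p) \<le> 1 * vsize p ^ \<beta>" "norm (s p - w p) \<le> 1 * vsize p ^ \<beta>"
        using s(1) w(1) disj[of p] by (auto simp: dom_def)
    qed
    have fp: "finite {p. s p + w p \<noteq> 0}" "finite {p. s p - w p \<noteq> 0}"
      by (rule finite_subset[OF _ finite_UnI[OF s(2) w(4)]], auto)+
    show ?case
    proof (cases "Re (cinner ?a ?b) \<ge> 0")
      case True
      hence "real (Suc n) * \<epsilon>\<^sup>2 \<le> (norm (adjoint_op v (\<lambda>x. s x + w x)))\<^sup>2"
        using tot unfolding adjoint_add[OF s(1) w(1)] norm_add_sq by simp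
      thus ?thesis using dp fp by blast
    next
      case False
      hence "real (Suc n) * \<epsilon>\<^sup>2 \<le> (norm (adjoint_op v (\<lambda>x. s x - w x)))\<^sup>2"
        using tot unfolding adjoint_diff[OF s(1) w(1)] norm_diff_sq by simp
      thus ?thesis using dm fp by blast
    qed
  qed
  \<comment> \<open>A state bounded by the weight has adjoint of norm at most \<open>Cv\<close>,
    which is incompatible with n \<epsilon>^2 for this n.\<close>
  obtain n where n: "Cv\<^sup>2 / \<epsilon>\<^sup>2 < real n" using reals_Archimedean2 by blast
  obtain w where w: "dom 1 w" "real n * \<epsilon>\<^sup>2 \<le> (norm (adjoint_op v w))\<^sup>2" using grow[of n] by blast
  have "(norm (adjoint_op v w))\<^sup>2 \<le> Cv\<^sup>2"
    using adjoint_norm[OF w(1)] by (intro power_mono) auto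
  thus False using w(2) n \<epsilon> by (simp add: field_simps)
qed

end

section \<open>The reduced operator on the auxiliary Hilbert space\<close>

locale threshold_setting = factored_potential V v U \<beta>
  for V :: "('k::finite, 'r::finite) oper" and v :: "'h::complex_hilbert \<Rightarrow> ('k, 'r) state"
    and U :: "'h \<Rightarrow> 'h" and \<beta> :: nat +
  fixes E :: "'k \<Rightarrow> 'k \<Rightarrow> bool" and att :: "'r \<Rightarrow> 'k"
  assumes graph: "simple_connected_graph E" and beta: "\<beta> \<ge> 3"
begin

section \<open>Kernels sandwiched between v and its adjoint\<close>

definition adm :: "real \<Rightarrow> (('k, 'r) vertex \<Rightarrow> ('k, 'r) vertex \<Rightarrow> complex) \<Rightarrow> bool" where
  "adm B g \<longleftrightarrow> (\<forall>p q. norm (g p q) \<le> B * (vsize p * vsize q) ^ \<beta>)"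

lemma adm_dom:
  assumes "adm B g"
  shows "dom (B * vsize q ^ \<beta>) (\<lambda>p. g p q)" "dom (B * vsize p ^ \<beta>) (\<lambda>q. g p q)"
proof -
  have le: "norm (g p q) \<le> B * (vsize p * vsize q) ^ \<beta>" for p q using assms by (simp add: adm_def)
  show "dom (B * vsize q ^ \<beta>) (\<lambda>p. g p q)" "dom (B * vsize p ^ \<beta>) (\<lambda>q. g p q)"
    unfolding dom_def using le[of _ q] le[of p] by (simp_all add: power_mult_distrib mult_ac)
qed

lemma adm_nonneg:
  assumes "adm B g"
  shows "B \<ge> 0"
proof -
  obtain q :: "('k, 'r) vertex" where True by simp
  show ?thesis using dom_nonneg[OF adm_dom(1)[OF assms, of q]] zero_less_power[OF vsize_pos(1)[of q], of \<beta>]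
    by (simp add: zero_le_mult_iff)
qed

lemma adm_lincomb:
  assumes "adm B g" "adm C h"
  shows "adm (norm a * B + norm b * C) (\<lambda>p q. a * g p q + b * h p q)"
  unfolding adm_def
proof (intro allI)
  fix p q
  have "norm (a * g p q + b * h p q) \<le> norm a * norm (g p q) + norm b * norm (h p q)"
    by (metis norm_mult norm_triangle_ineq)
  also have "\<dots> \<le> norm a * (B * (vsize p * vsize q) ^ \<beta>) + norm b * (C * (vsize p * vsize q) ^ \<beta>)"
    using assms unfolding adm_def by (intro add_mono mult_left_mono) auto
  finally show "norm (a * g p q + b * h p q) \<le> (norm a * B + norm b * C) * (vsize p * vsize q) ^ \<beta>"
    by (simp add: algebra_simps)
qed

lemma kernel_summable:
  assumes "adm B g"
  shows "(\<lambda>q. g p q * v k q) summable_on UNIV"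
  by (rule kernel_op_summable[OF v_L1, where C = B]) (use assms in \<open>simp add: adm_def\<close>)

lemma kernel_dom:
  assumes "adm B g"
  shows "dom (B * Cv * norm k) (kernel_op g (v k))"
  unfolding dom_def
proof
  fix p
  have "norm (kernel_op g (v k) p) \<le> B * L1_norm (real \<beta>) (v k) * vsize p ^ \<beta>"
    by (rule kernel_op_bound[OF v_L1]) (use assms in \<open>simp add: adm_def\<close>)
  also have "\<dots> \<le> B * (Cv * norm k) * vsize p ^ \<beta>"
    by (intro mult_right_mono mult_left_mono Cv adm_nonneg[OF assms] zero_le_power vsize_pos)
  finally show "norm (kernel_op g (v k) p) \<le> B * Cv * norm k * vsize p ^ \<beta>" by simp
qed

text \<open>This is v^* g v. The condition \<open>adm\<close> says that the kernel g is bounded from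
  L^\<beta> to its dual, exactly what v on the right and its adjoint on the left can absorb.\<close>

definition Theta :: "(('k, 'r) vertex \<Rightarrow> ('k, 'r) vertex \<Rightarrow> complex) \<Rightarrow> 'h \<Rightarrow>\<^sub>L 'h" where
  "Theta g = Blinfun (\<lambda>k. adjoint_op v (kernel_op g (v k)))"

lemma kernel_v_lincomb:
  assumes "adm B g"
  shows "kernel_op g (v (a *\<^sub>C k + b *\<^sub>C l)) = (\<lambda>p. a * kernel_op g (v k) p + b * kernel_op g (v l) p)"
  unfolding v_add v_scale
  by (rule ext) (rule kernel_op_lincomb; rule kernel_summable[OF assms])

lemma adjoint_kernel_norm:
  assumes "adm B g"
  shows "norm (adjoint_op v (kernel_op g (v k))) \<le> B * Cv\<^sup>2 * norm k"
  using adjoint_norm[OF kernel_dom[OF assms, of k]] by (simp add: power2_eq_square mult_ac)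

lemma adjoint_kernel_lincomb:
  assumes "adm B g"
  shows "adjoint_op v (kernel_op g (v (a *\<^sub>C k + b *\<^sub>C l))) =
    a *\<^sub>C adjoint_op v (kernel_op g (v k)) + b *\<^sub>C adjoint_op v (kernel_op g (v l))"
  unfolding kernel_v_lincomb[OF assms] by (rule adjoint_lincomb; rule kernel_dom[OF assms])

lemma Theta_apply:
  assumes "adm B g"
  shows "blinfun_apply (Theta g) k = adjoint_op v (kernel_op g (v k))"
proof -
  have "bounded_linear (\<lambda>k. adjoint_op v (kernel_op g (v k)))"
  proof (rule bounded_linear_intro[where K = "B * Cv\<^sup>2"])
    show "adjoint_op v (kernel_op g (v (k + l))) = adjoint_op v (kernel_op g (v k)) + adjoint_op v (kernel_op g (v l))" for k l
      using adjoint_kernel_lincomb[OF assms, of 1 k 1 l] by simp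
    show "adjoint_op v (kernel_op g (v (r *\<^sub>R k))) = r *\<^sub>R adjoint_op v (kernel_op g (v k))" for r k
      using adjoint_kernel_lincomb[OF assms, of "of_real r" k 0 0] by (simp add: scaleC_of_real)
    show "norm (adjoint_op v (kernel_op g (v k))) \<le> norm k * (B * Cv\<^sup>2)" for k
      using adjoint_kernel_norm[OF assms, of k] by (simp add: mult_ac)
  qed
  thus ?thesis by (simp add: Theta_def bounded_linear_Blinfun_apply)
qed

lemma norm_Theta:
  assumes "adm B g"
  shows "norm (Theta g) \<le> B * Cv\<^sup>2"
  by (rule norm_blinfun_bound)
    (use adm_nonneg[OF assms] adjoint_kernel_norm[OF assms] in \<open>auto simp: Theta_apply[OF assms]\<close>)

lemma clin_Theta:
  assumes "adm B g"
  shows "clin (Theta g)"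
  unfolding clin_def Theta_apply[OF assms]
  using adjoint_kernel_lincomb[OF assms, of _ _ 0 0] by simp

lemma Theta_lincomb:
  assumes g: "adm B g" and h: "adm C h"
  shows "Theta (\<lambda>p q. a * g p q + b * h p q) = scaleB a (Theta g) + scaleB b (Theta h)"
proof (rule blinfun_eqI)
  fix k
  have "kernel_op (\<lambda>p q. a * g p q + b * h p q) (v k) = (\<lambda>p. a * kernel_op g (v k) p + b * kernel_op h (v k) p)"
  proof
    fix p
    have "kernel_op (\<lambda>p q. a * g p q + b * h p q) (v k) p = (\<Sum>\<^sub>\<infinity>q. a * (g p q * v k q) + b * (h p q * v k q))"
      by (simp add: kernel_op_def algebra_simps)
    also have "\<dots> = a * kernel_op g (v k) p + b * kernel_op h (v k) p"
      unfolding kernel_op_def infsum_cmult_right'[symmetric]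
      by (intro infsum_add summable_on_cmult_right kernel_summable[OF g] kernel_summable[OF h])
    finally show "kernel_op (\<lambda>p q. a * g p q + b * h p q) (v k) p = a * kernel_op g (v k) p + b * kernel_op h (v k) p" .
  qed
  thus "blinfun_apply (Theta (\<lambda>p q. a * g p q + b * h p q)) k = blinfun_apply (scaleB a (Theta g) + scaleB b (Theta h)) k"
    by (simp add: Theta_apply[OF adm_lincomb[OF g h]] Theta_apply[OF g] Theta_apply[OF h]
        blinfun.add_left scaleB_apply adjoint_lincomb[OF kernel_dom[OF g] kernel_dom[OF h]])
qed

lemma adm_0: "adm 0 (\<lambda>_ _. 0)"
  by (simp add: adm_def)

lemma Theta_0: "Theta (\<lambda>_ _. 0) = 0"
  using norm_Theta[OF adm_0] by simp

lemma Theta_poly: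
  fixes J :: nat
  assumes "\<And>j. j < J \<Longrightarrow> \<exists>B. adm B (g j)"
  shows "(\<exists>B. adm B (\<lambda>p q. \<Sum>j<J. z j * g j p q)) \<and>
    Theta (\<lambda>p q. \<Sum>j<J. z j * g j p q) = (\<Sum>j<J. scaleB (z j) (Theta (g j)))"
  using assms
proof (induction J)
  case 0
  show ?case using adm_0 by (auto simp: Theta_0)
next
  case (Suc J)
  hence IH: "(\<exists>B. adm B (\<lambda>p q. \<Sum>j<J. z j * g j p q)) \<and>
      Theta (\<lambda>p q. \<Sum>j<J. z j * g j p q) = (\<Sum>j<J. scaleB (z j) (Theta (g j)))"
    using less_Suc_eq by blast
  then obtain B where B: "adm B (\<lambda>p q. \<Sum>j<J. z j * g j p q)" by blast
  obtain C where C: "adm C (g J)" using Suc.prems by blast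
  have eq: "Theta (\<lambda>p q. \<Sum>j<J. z j * g j p q) = (\<Sum>j<J. scaleB (z j) (Theta (g j)))"
    using IH by blast
  show ?case
    using adm_lincomb[OF B C, of 1 "z J"] Theta_lincomb[OF B C, of 1 "z J"] eq
    by (auto simp: cscalingD(4)[OF cscaling_scaleB])
qed

lemma Theta_form:
  assumes "adm B g"
  shows "cinner (blinfun_apply (Theta g) k) l = (\<Sum>\<^sub>\<infinity>p. \<Sum>\<^sub>\<infinity>q. cnj (g p q) * cnj (v k q) * v l p)"
  unfolding Theta_apply[OF assms] adjoint_char[OF kernel_dom[OF assms]] pairing_def kernel_op_def
proof (rule infsum_cong)
  fix p
  have "cnj (\<Sum>\<^sub>\<infinity>q. g p q * v k q) = (\<Sum>\<^sub>\<infinity>q. cnj (g p q) * cnj (v k q))"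
    unfolding infsum_cnj[symmetric] by simp
  thus "cnj (\<Sum>\<^sub>\<infinity>q. g p q * v k q) * v l p = (\<Sum>\<^sub>\<infinity>q. cnj (g p q) * cnj (v k q) * v l p)"
    unfolding infsum_cmult_left' by simp
qed

lemma Theta_form_swap:
  assumes "adm B g" and f: "f \<in> L1 (real \<beta>)" and h: "h \<in> L1 (real \<beta>)"
  shows "(\<Sum>\<^sub>\<infinity>p. \<Sum>\<^sub>\<infinity>q. g p q * f q * h p) = (\<Sum>\<^sub>\<infinity>q. \<Sum>\<^sub>\<infinity>p. g p q * f q * h p)"
proof (rule fubini_dominated)
  show "(\<lambda>p. B * (vsize p ^ \<beta> * norm (h p))) summable_on UNIV"
    using h unfolding L1_iff by (rule summable_on_cmult_right)
  show "(\<lambda>q. vsize q ^ \<beta> * norm (f q)) summable_on UNIV"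
    using f unfolding L1_iff .
  show "0 \<le> B * (vsize p ^ \<beta> * norm (h p))" for p
    using adm_nonneg[OF assms(1)] vsize_pos[of p] by simp
  show "0 \<le> vsize q ^ \<beta> * norm (f q)" for q using vsize_pos[of q] by simp
  show "norm (g p q * f q * h p) \<le> B * (vsize p ^ \<beta> * norm (h p)) * (vsize q ^ \<beta> * norm (f q))" for p q
  proof -
    have "norm (g p q) * (norm (f q) * norm (h p)) \<le> B * (vsize p * vsize q) ^ \<beta> * (norm (f q) * norm (h p))"
      using assms(1) unfolding adm_def by (intro mult_right_mono) auto
    thus ?thesis by (simp add: norm_mult power_mult_distrib mult_ac)
  qed
qed

lemma L1_cnj: "f \<in> L1 (real n) \<Longrightarrow> (\<lambda>x. cnj (f x)) \<in> L1 (real n)"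
  by (simp add: L1_iff)

lemma Theta_hermitian:
  assumes g: "adm B g" and herm: "\<And>p q. g q p = cnj (g p q)"
  shows "cinner (blinfun_apply (Theta g) k) l = cinner k (blinfun_apply (Theta g) l)"
proof -
  have "cinner k (blinfun_apply (Theta g) l) = cnj (cinner (blinfun_apply (Theta g) l) k)"
    by (rule cinner_commute)
  also have "\<dots> = (\<Sum>\<^sub>\<infinity>p. \<Sum>\<^sub>\<infinity>q. g p q * v l q * cnj (v k p))"
    unfolding Theta_form[OF g] by (simp flip: infsum_cnj)
  also have "\<dots> = (\<Sum>\<^sub>\<infinity>q. \<Sum>\<^sub>\<infinity>p. g p q * v l q * cnj (v k p))"
    by (rule Theta_form_swap[OF g v_L1 L1_cnj[OF v_L1]])
  also have "\<dots> = (\<Sum>\<^sub>\<infinity>q. \<Sum>\<^sub>\<infinity>p. cnj (g q p) * cnj (v k p) * v l q)"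
    by (subst herm) (simp add: mult_ac)
  also have "\<dots> = cinner (blinfun_apply (Theta g) k) l" by (rule Theta_form[OF g, symmetric])
  finally show ?thesis by simp
qed

section \<open>The operator M and its expansion\<close>

definition Uop :: "'h \<Rightarrow>\<^sub>L 'h" where
  "Uop = Blinfun U"

lemma Uop_apply [simp]: "blinfun_apply Uop k = U k"
proof -
  have "bounded_linear U"
    by (rule bounded_linear_intro[where K = 1]) (auto simp: U_add U_scale norm_U simp flip: scaleC_of_real)
  thus ?thesis by (simp add: Uop_def bounded_linear_Blinfun_apply)
qed

lemma clin_Uop: "clin Uop"
  by (simp add: clin_def U_scale)

definition Mop :: "complex \<Rightarrow> 'h \<Rightarrow>\<^sub>L 'h" where
  "Mop \<kappa> = Uop + Theta (free_res E att \<kappa>)"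

text \<open>Coefficient j of the free kernel has growth exponent j + 1, so its sandwich is
  meaningful for j < \<beta>. The value 0 beyond that range is a convention that keeps all
  coefficients complex-linear.\<close>

definition Mcoef :: "nat \<Rightarrow> 'h \<Rightarrow>\<^sub>L 'h" where
  "Mcoef j = (if j < \<beta> then (if j = 0 then Uop else 0) + Theta (free_coef E att j) else 0)"

lemma vprod_mono: "m \<le> n \<Longrightarrow> (vsize p * vsize q) ^ m \<le> (vsize p * vsize q) ^ n"
  using mult_mono[OF vsize_ge_1[of p] vsize_ge_1[of q]] vsize_ge_1[of p]
  by (intro power_increasing) auto

lemma vprod_pos: "(vsize p * vsize q) ^ n > 0"
  by (simp add: vsize_pos)

lemma free_coef_bound: "\<exists>C\<ge>0. \<forall>p q. norm (free_coef E att j p q) \<le> C * (vsize p * vsize q) ^ Suc j"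
proof -
  obtain C where "C \<ge> 0" "\<And>i x. i < Suc j \<Longrightarrow> norm (case x of (p, q) \<Rightarrow> free_coef E att i p q) \<le>
      C * (case x of (p, q) \<Rightarrow> (vsize p * vsize q) ^ Suc i)"
    by (rule uexp_coeff_bound[OF uexp_free_res[OF graph, of "Suc j" att]]) (auto simp: vprod_pos less_imp_le simp del: power_Suc split: prod.splits)
  hence "norm (free_coef E att j p q) \<le> C * (vsize p * vsize q) ^ Suc j" for p q
    by (metis case_prod_conv lessI)
  thus ?thesis using \<open>C \<ge> 0\<close> by blast
qed

lemma adm_free_coef:
  assumes "j < \<beta>"
  shows "\<exists>B. adm B (free_coef E att j)"
proof -
  obtain C where C: "C \<ge> 0" "\<And>p q. norm (free_coef E att j p q) \<le> C * (vsize p * vsize q) ^ Suc j"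
    using free_coef_bound by blast
  have "norm (free_coef E att j p q) \<le> C * (vsize p * vsize q) ^ \<beta>" for p q
    using C(2)[of p q] mult_left_mono[OF vprod_mono[of "Suc j" \<beta> p q] C(1)] assms by linarith
  thus ?thesis unfolding adm_def by blast
qed

lemma free_res_remainder:
  "\<exists>C\<ge>0. \<forall>\<^sub>F \<kappa> in rhp. \<forall>p q. norm (free_res E att \<kappa> p q - (\<Sum>j<J. \<kappa> ^ j * free_coef E att j p q))
    \<le> C * norm \<kappa> ^ J * (vsize p * vsize q) ^ Suc J"
proof -
  obtain C where C: "C \<ge> 0" "\<forall>\<^sub>F \<kappa> in rhp. \<forall>x. norm ((case x of (p, q) \<Rightarrow> free_res E att \<kappa> p q) -
      (\<Sum>j<J. \<kappa> ^ j * (case x of (p, q) \<Rightarrow> free_coef E att j p q))) \<le>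
      C * norm \<kappa> ^ J * (case x of (p, q) \<Rightarrow> (vsize p * vsize q) ^ Suc J)"
    by (rule uexp_remainder_bound[OF uexp_free_res[OF graph, of J att]]) (auto simp: vprod_pos less_imp_le simp del: power_Suc split: prod.splits)
  have "\<forall>\<^sub>F \<kappa> in rhp. \<forall>p q. norm (free_res E att \<kappa> p q - (\<Sum>j<J. \<kappa> ^ j * free_coef E att j p q))
    \<le> C * norm \<kappa> ^ J * (vsize p * vsize q) ^ Suc J"
    using C(2) by eventually_elim (simp add: split_paired_all)
  thus ?thesis using C(1) by blast
qed

lemma eventually_adm_free_res: "\<forall>\<^sub>F \<kappa> in rhp. \<exists>B. adm B (free_res E att \<kappa>)"
proof -
  obtain C where C: "C \<ge> 0" "\<forall>\<^sub>F \<kappa> in rhp. \<forall>p q. norm (free_res E att \<kappa> p q) \<le> C * (vsize p * vsize q) ^ 1"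
    using free_res_remainder[of 0] by auto
  have "C * (vsize p * vsize q) ^ 1 \<le> C * (vsize p * vsize q) ^ \<beta>" for p q :: "('k, 'r) vertex"
    using beta by (intro mult_left_mono vprod_mono C) auto
  hence "\<forall>p q. norm (free_res E att \<kappa> p q) \<le> C * (vsize p * vsize q) ^ 1 \<Longrightarrow> adm C (free_res E att \<kappa>)" for \<kappa>
    unfolding adm_def by (meson order_trans)
  thus ?thesis using C(2) by (auto elim!: eventually_mono)
qed

lemma clin_Mcoef: "clin (Mcoef j)"
proof (cases "j < \<beta>")
  case True
  then obtain B where "adm B (free_coef E att j)" using adm_free_coef by blast
  hence "clin (Theta (free_coef E att j))" by (rule clin_Theta)
  thus ?thesis using True by (auto simp: Mcoef_def clin_Uop clin_0 clin_simps)
qed (simp add: Mcoef_def clin_0)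

text \<open>The remainder of order J in the free kernel comes with weight exponent J + 1, which v
  and its adjoint absorb as long as J + 1 \<le> \<beta>.\<close>

lemma opexp_Mop:
  assumes J: "J < \<beta>" "J > 0"
  shows "opexp J Mop Mcoef"
proof -
  obtain C where C: "C \<ge> 0" "\<forall>\<^sub>F \<kappa> in rhp. \<forall>p q.
      norm (free_res E att \<kappa> p q - (\<Sum>j<J. \<kappa> ^ j * free_coef E att j p q)) \<le> C * norm \<kappa> ^ J * (vsize p * vsize q) ^ Suc J"
    using free_res_remainder by blast
  have "\<forall>\<^sub>F \<kappa> in rhp. norm (Mop \<kappa> - (\<Sum>j<J. scaleB (\<kappa> ^ j) (Mcoef j))) \<le> (C * Cv\<^sup>2) * norm \<kappa> ^ J"
    using C(2) eventually_adm_free_res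
  proof eventually_elim
    case (elim \<kappa>)
    obtain B where B: "adm B (free_res E att \<kappa>)" using elim(2) by blast
    let ?p = "\<lambda>p q. \<Sum>j<J. \<kappa> ^ j * free_coef E att j p q"
    obtain B' where B': "adm B' ?p" and T: "Theta ?p = (\<Sum>j<J. scaleB (\<kappa> ^ j) (Theta (free_coef E att j)))"
      using Theta_poly[of J "free_coef E att" "\<lambda>j. \<kappa> ^ j"] adm_free_coef J by auto
    obtain m where m: "J = Suc m" using J gr0_conv_Suc by blast
    have "(\<Sum>j<J. scaleB (\<kappa> ^ j) (Mcoef j)) = Uop + Theta ?p"
    proof -
      have "(\<Sum>j<J. scaleB (\<kappa> ^ j) (Mcoef j)) =
          (\<Sum>j<J. scaleB (\<kappa> ^ j) (if j = 0 then Uop else 0) + scaleB (\<kappa> ^ j) (Theta (free_coef E att j)))"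
        using J by (intro sum.cong refl) (auto simp: Mcoef_def cscalingD(1,5)[OF cscaling_scaleB])
      also have "\<dots> = (\<Sum>j<J. scaleB (\<kappa> ^ j) (if j = 0 then Uop else 0)) + Theta ?p"
        unfolding T by (rule sum.distrib)
      also have "(\<Sum>j<J. scaleB (\<kappa> ^ j) (if j = 0 then Uop else 0)) = Uop"
        unfolding m by (subst sum.lessThan_Suc_shift) (simp add: cscalingD(4,5)[OF cscaling_scaleB])
      finally show ?thesis .
    qed
    hence "Mop \<kappa> - (\<Sum>j<J. scaleB (\<kappa> ^ j) (Mcoef j)) = Theta (free_res E att \<kappa>) - Theta ?p"
      by (simp add: Mop_def)
    also have "\<dots> = Theta (\<lambda>p q. 1 * free_res E att \<kappa> p q + (-1) * ?p p q)"
      unfolding Theta_lincomb[OF B B'] by (intro blinfun_eqI) (simp add: scaleB_apply blinfun.diff_left blinfun.add_left scaleC_minus_left)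
    also have "norm \<dots> \<le> (C * norm \<kappa> ^ J) * Cv\<^sup>2"
    proof (rule norm_Theta)
      show "adm (C * norm \<kappa> ^ J) (\<lambda>p q. 1 * free_res E att \<kappa> p q + (-1) * ?p p q)"
        unfolding adm_def
      proof (intro allI)
        fix p q :: "('k, 'r) vertex"
        have "norm (free_res E att \<kappa> p q - ?p p q) \<le> C * norm \<kappa> ^ J * (vsize p * vsize q) ^ Suc J"
          using elim(1) by blast
        also have "\<dots> \<le> C * norm \<kappa> ^ J * (vsize p * vsize q) ^ \<beta>"
          using J C(1) by (intro mult_left_mono vprod_mono) auto
        finally show "norm (1 * free_res E att \<kappa> p q + (-1) * ?p p q) \<le> C * norm \<kappa> ^ J * (vsize p * vsize q) ^ \<beta>"
          by simp
      qed
    qed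
    finally show ?case by (simp add: mult_ac)
  qed
  thus ?thesis unfolding opexp_iff by blast
qed

section \<open>Rows and columns of the free kernel under the adjoint of v\<close>

lemma uexp_adjoint:
  fixes g :: "complex \<Rightarrow> 'i \<Rightarrow> ('k, 'r) state"
  assumes s: "cscaling (\<lambda>z. scaleC (s z) :: 'h \<Rightarrow> 'h)"
    and coef: "\<And>j. j < J \<Longrightarrow> \<exists>C. \<forall>i. dom (C * W j i) (c j i)"
    and rem: "\<forall>\<^sub>F \<kappa> in rhp. \<forall>i. dom (C * norm \<kappa> ^ J * W J i) (\<lambda>p. g \<kappa> i p - (\<Sum>j<J. s (\<kappa> ^ j) * c j i p))"
  shows "uexp (\<lambda>z. scaleC (s z)) J W (\<lambda>\<kappa> i. adjoint_op v (g \<kappa> i)) (\<lambda>j i. adjoint_op v (c j i))"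
  unfolding uexp_def
proof (intro conjI allI impI)
  fix j assume "j < J"
  then obtain C where C: "\<And>i. dom (C * W j i) (c j i)" using coef by blast
  show "\<exists>C. \<forall>i. norm (adjoint_op v (c j i)) \<le> C * W j i"
    using adjoint_norm[OF C] by (intro exI[of _ "C * Cv"]) (simp add: mult_ac)
next
  obtain D where D: "\<And>j i. j < J \<Longrightarrow> dom (D j * W j i) (c j i)" using coef by metis
  have "\<forall>\<^sub>F \<kappa> in rhp. \<forall>i. norm (adjoint_op v (g \<kappa> i) - (\<Sum>j<J. s (\<kappa> ^ j) *\<^sub>C adjoint_op v (c j i)))
      \<le> (C * Cv) * norm \<kappa> ^ J * W J i"
    using rem
  proof eventually_elim
    case (elim \<kappa>)
    show ?case
    proof
      fix i
      let ?r = "\<lambda>p. g \<kappa> i p - (\<Sum>j<J. s (\<kappa> ^ j) * c j i p)" and ?q = "\<lambda>p. \<Sum>j<J. s (\<kappa> ^ j) * c j i p"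
      have sc: "dom (norm (s (\<kappa> ^ j)) * (D j * W j i)) (\<lambda>p. s (\<kappa> ^ j) * c j i p)" if "j < J" for j
        using dom_lincomb[OF D[OF that, of i] dom_zero, of "s (\<kappa> ^ j)" 0] by simp
      have q: "dom (\<Sum>j<J. norm (s (\<kappa> ^ j)) * (D j * W j i)) ?q"
        by (rule dom_sum) (use sc in auto)
      have "adjoint_op v ?q = (\<Sum>j<J. adjoint_op v (\<lambda>p. s (\<kappa> ^ j) * c j i p))"
        by (rule adjoint_sum) (use sc in auto)
      also have "\<dots> = (\<Sum>j<J. s (\<kappa> ^ j) *\<^sub>C adjoint_op v (c j i))"
        by (intro sum.cong refl adjoint_scale[OF D]) auto
      finally have aq: "adjoint_op v ?q = (\<Sum>j<J. s (\<kappa> ^ j) *\<^sub>C adjoint_op v (c j i))" .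
      have r: "dom (C * norm \<kappa> ^ J * W J i) ?r" using elim by blast
      have "adjoint_op v (g \<kappa> i) = adjoint_op v ?r + adjoint_op v ?q"
        using adjoint_add[OF r q] by simp
      hence "adjoint_op v (g \<kappa> i) - (\<Sum>j<J. s (\<kappa> ^ j) *\<^sub>C adjoint_op v (c j i)) = adjoint_op v ?r"
        unfolding aq by simp
      thus "norm (adjoint_op v (g \<kappa> i) - (\<Sum>j<J. s (\<kappa> ^ j) *\<^sub>C adjoint_op v (c j i)))
          \<le> (C * Cv) * norm \<kappa> ^ J * W J i"
        using adjoint_norm[OF r] by (simp only: mult.assoc mult.left_commute[of _ Cv] mult.commute[of _ Cv])
    qed
  qed
  thus "\<exists>C. \<forall>\<^sub>F \<kappa> in rhp. \<forall>i. norm (adjoint_op v (g \<kappa> i) - (\<Sum>j<J. s (\<kappa> ^ j) *\<^sub>C adjoint_op v (c j i)))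
      \<le> C * norm \<kappa> ^ J * W J i" by blast
qed

definition acol :: "complex \<Rightarrow> ('k, 'r) vertex \<Rightarrow> 'h" where
  "acol \<kappa> q = adjoint_op v (\<lambda>p. free_res E att \<kappa> p q)"

text \<open>The conjugation makes \<open>cinner (arow \<kappa> p) k\<close> the value at p of R_0 v
  k. In return, the expansion of the rows is one in powers of the conjugate of \<kappa>.\<close>

definition arow :: "complex \<Rightarrow> ('k, 'r) vertex \<Rightarrow> 'h" where
  "arow \<kappa> p = adjoint_op v (\<lambda>q. cnj (free_res E att \<kappa> p q))"

definition acol_coef :: "nat \<Rightarrow> ('k, 'r) vertex \<Rightarrow> 'h" where
  "acol_coef j q = adjoint_op v (\<lambda>p. free_coef E att j p q)"

definition arow_coef :: "nat \<Rightarrow> ('k, 'r) vertex \<Rightarrow> 'h" where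
  "arow_coef j p = adjoint_op v (\<lambda>q. cnj (free_coef E att j p q))"

lemma vprod_split:
  assumes "n \<le> \<beta>" "C \<ge> 0"
  shows "C * (vsize p * vsize q) ^ n \<le> C * vsize q ^ n * vsize p ^ \<beta>"
    "C * (vsize p * vsize q) ^ n \<le> C * vsize p ^ n * vsize q ^ \<beta>"
proof -
  have "vsize p ^ n \<le> vsize p ^ \<beta>" "vsize q ^ n \<le> vsize q ^ \<beta>"
    by (intro power_increasing assms vsize_ge_1)+
  from mult_left_mono[OF this(1), of "C * vsize q ^ n"] mult_left_mono[OF this(2), of "C * vsize p ^ n"]
  show "C * (vsize p * vsize q) ^ n \<le> C * vsize q ^ n * vsize p ^ \<beta>"
    "C * (vsize p * vsize q) ^ n \<le> C * vsize p ^ n * vsize q ^ \<beta>"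
    using assms(2) vsize_pos[of p] vsize_pos[of q] by (simp_all add: power_mult_distrib mult_ac)
qed

lemma uexp_acol:
  assumes J: "J < \<beta>"
  shows "uexp scaleC J (\<lambda>j q. vsize q ^ Suc j) acol acol_coef"
proof -
  obtain C where C: "C \<ge> 0" "\<forall>\<^sub>F \<kappa> in rhp. \<forall>p q.
      norm (free_res E att \<kappa> p q - (\<Sum>j<J. \<kappa> ^ j * free_coef E att j p q)) \<le> C * norm \<kappa> ^ J * (vsize p * vsize q) ^ Suc J"
    using free_res_remainder by blast
  have "\<exists>C. \<forall>q. dom (C * vsize q ^ Suc j) (\<lambda>p. free_coef E att j p q)" if j: "j < J" for j
  proof -
    obtain C where C: "C \<ge> 0" "\<And>p q. norm (free_coef E att j p q) \<le> C * (vsize p * vsize q) ^ Suc j"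
      using free_coef_bound by blast
    have "dom (C * vsize q ^ Suc j) (\<lambda>p. free_coef E att j p q)" for q
      unfolding dom_def using C(2) vprod_split(1)[OF _ C(1), of "Suc j" _ q] j J
      by (meson Suc_leI less_trans order_trans)
    thus ?thesis by blast
  qed
  moreover have "\<forall>\<^sub>F \<kappa> in rhp. \<forall>q. dom (C * norm \<kappa> ^ J * vsize q ^ Suc J)
      (\<lambda>p. free_res E att \<kappa> p q - (\<Sum>j<J. \<kappa> ^ j * free_coef E att j p q))"
    using C(2)
  proof eventually_elim
    case (elim \<kappa>)
    show ?case unfolding dom_def
      using elim vprod_split(1)[of "Suc J" "C * norm \<kappa> ^ J"] C(1) J
      by (meson Suc_leI mult_nonneg_nonneg norm_ge_zero order_trans zero_le_power)
  qed
  ultimately show ?thesis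
    unfolding acol_def acol_coef_def by (intro uexp_adjoint[where s = "\<lambda>z. z"] cscaling_scaleC) auto
qed

lemma uexp_arow:
  assumes J: "J < \<beta>"
  shows "uexp (\<lambda>z. scaleC (cnj z)) J (\<lambda>j q. vsize q ^ Suc j) arow arow_coef"
proof -
  obtain C where C: "C \<ge> 0" "\<forall>\<^sub>F \<kappa> in rhp. \<forall>p q.
      norm (free_res E att \<kappa> p q - (\<Sum>j<J. \<kappa> ^ j * free_coef E att j p q)) \<le> C * norm \<kappa> ^ J * (vsize p * vsize q) ^ Suc J"
    using free_res_remainder by blast
  have "\<exists>C. \<forall>p. dom (C * vsize p ^ Suc j) (\<lambda>q. cnj (free_coef E att j p q))" if j: "j < J" for j
  proof -
    obtain C where C: "C \<ge> 0" "\<And>p q. norm (free_coef E att j p q) \<le> C * (vsize p * vsize q) ^ Suc j"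
      using free_coef_bound by blast
    have "dom (C * vsize p ^ Suc j) (\<lambda>q. cnj (free_coef E att j p q))" for p
      unfolding dom_def complex_mod_cnj using C(2) vprod_split(2)[OF _ C(1), of "Suc j" p] j J
      by (meson Suc_leI less_trans order_trans)
    thus ?thesis by blast
  qed
  moreover have "\<forall>\<^sub>F \<kappa> in rhp. \<forall>p. dom (C * norm \<kappa> ^ J * vsize p ^ Suc J)
      (\<lambda>q. cnj (free_res E att \<kappa> p q) - (\<Sum>j<J. cnj (\<kappa> ^ j) * cnj (free_coef E att j p q)))"
    using C(2)
  proof eventually_elim
    case (elim \<kappa>)
    have eq: "norm (cnj (free_res E att \<kappa> p q) - (\<Sum>j<J. cnj (\<kappa> ^ j) * cnj (free_coef E att j p q))) =
        norm (free_res E att \<kappa> p q - (\<Sum>j<J. \<kappa> ^ j * free_coef E att j p q))" for p q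
      unfolding complex_cnj_mult[symmetric] cnj_sum[symmetric] complex_cnj_diff[symmetric] complex_mod_cnj ..
    have le: "C * norm \<kappa> ^ J * (vsize p * vsize q) ^ Suc J \<le> C * norm \<kappa> ^ J * vsize p ^ Suc J * vsize q ^ \<beta>"
      for p q :: "('k, 'r) vertex"
      by (rule vprod_split(2)) (use J C(1) in auto)
    show ?case unfolding dom_def
      by (intro allI, subst eq) (rule order_trans[OF elim[rule_format] le])
  qed
  ultimately show ?thesis
    unfolding arow_def arow_coef_def by (intro uexp_adjoint[where s = cnj] cscaling_scaleC_cnj) auto
qed

section \<open>Fredholm theory at the threshold and inversion of M\<close>

definition rank1 :: "'h \<Rightarrow> 'h \<Rightarrow> 'h \<Rightarrow>\<^sub>L 'h" where
  "rank1 x y = Blinfun (\<lambda>k. cinner y k *\<^sub>C x)"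

lemma rank1_apply: "blinfun_apply (rank1 x y) k = cinner y k *\<^sub>C x"
proof -
  have "bounded_linear (\<lambda>k. cinner y k *\<^sub>C x)"
  proof (rule bounded_linear_intro[where K = "norm y * norm x"])
    show "cinner y (r *\<^sub>R k) *\<^sub>C x = r *\<^sub>R (cinner y k *\<^sub>C x)" for r k
      by (simp add: cinner_scaleC_right scaleC_scaleC flip: scaleC_of_real)
    show "norm (cinner y k *\<^sub>C x) \<le> norm k * (norm y * norm x)" for k
      using mult_right_mono[OF norm_cinner_le[of y k], of "norm x"] by (simp add: norm_scaleC mult_ac)
  qed (simp add: cinner_add_right scaleC_add_left)
  thus ?thesis by (simp add: rank1_def bounded_linear_Blinfun_apply)
qed

lemma clin_rank1: "clin (rank1 x y)"
  by (simp add: clin_def rank1_apply cinner_scaleC_right scaleC_scaleC)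

lemma Mcoef_0_hermitian: "cinner (blinfun_apply (Mcoef 0) k) l = cinner k (blinfun_apply (Mcoef 0) l)"
proof -
  obtain B where B: "adm B (free_coef E att 0)" using adm_free_coef[of 0] beta by auto
  have "cinner (blinfun_apply (Theta (free_coef E att 0)) k) l = cinner k (blinfun_apply (Theta (free_coef E att 0)) l)"
    by (rule Theta_hermitian[OF B]) (unfold free_coef_0, rule free_res_0_hermitian[OF graph])
  thus ?thesis using beta by (simp add: Mcoef_def blinfun.add_left cinner_add_left cinner_add_right U_sym)
qed

text \<open>\<open>Mcoef 0\<close> is a self-adjoint unitary plus a compact operator, so Fredholm theory applies.\<close>

lemma finite_rank_correction_bounded_below:
  assumes I: "finite I"
    and D: "D = Mcoef 0 + (\<Sum>\<gamma>\<in>I. rank1 (b \<gamma>) (b \<gamma>))"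
    and inj: "\<And>k. blinfun_apply D k = 0 \<Longrightarrow> k = 0"
  shows "\<exists>c>0. \<forall>k. c * norm k \<le> norm (blinfun_apply D k)"
proof -
  let ?g = "free_coef E att 0"
  obtain B where B: "adm B ?g" using adm_free_coef[of 0] beta by auto
  have B0: "B \<ge> 0" by (rule adm_nonneg[OF B])
  \<comment> \<open>This size makes the contribution of rows outside a finite set F at most |k| / 2,
    while U is isometric.\<close>
  define \<epsilon> where "\<epsilon> = 1 / (2 * (B * Cv + 1))"
  have BC: "B * Cv \<ge> 0" using B0 Cv(1) by simp
  have \<epsilon>: "\<epsilon> > 0" "\<epsilon> * (B * Cv) \<le> 1 / 2" using BC by (auto simp: \<epsilon>_def field_simps)
  obtain F where F: "finite F" "\<And>u. dom 1 u \<Longrightarrow> (\<forall>p\<in>F. u p = 0) \<Longrightarrow> norm (adjoint_op v u) \<le> \<epsilon>"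
    using adjoint_tail[OF \<epsilon>(1)] by blast
  have tail: "norm (adjoint_op v u) \<le> \<epsilon> * C" if u: "dom C u" "\<forall>p\<in>F. u p = 0" for C u
  proof (cases "C = 0")
    case True
    thus ?thesis using adjoint_norm[OF u(1)] by simp
  next
    case False
    hence C: "C > 0" using dom_nonneg[OF u(1)] by simp
    have "dom (norm (complex_of_real (1 / C)) * C + norm (0::complex) * 0) (\<lambda>p. of_real (1 / C) * u p + 0 * 0)"
      by (rule dom_lincomb[OF u(1) dom_zero])
    hence d1: "dom 1 (\<lambda>p. of_real (1 / C) * u p)" using C by (simp add: norm_divide)
    have "norm (adjoint_op v (\<lambda>p. of_real (1 / C) * u p)) \<le> \<epsilon>" by (rule F(2)[OF d1]) (use u(2) in simp)
    hence "norm (1 / C) * norm (adjoint_op v u) \<le> \<epsilon>"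
      unfolding adjoint_scale[OF u(1)] norm_scaleC norm_of_real by simp
    thus ?thesis using C by (simp add: field_simps)
  qed
  \<comment> \<open>With the rows in F deleted, what remains is a perturbation of U bounded below by
    1/2. The deleted rows form a finite-rank operator whose range is spanned by adjoints of point
    masses.\<close>
  define gX where "gX p q = (if p \<in> F then 0 else ?g p q)" for p q
  have gX: "adm B gX"
    using B by (auto simp: adm_def gX_def intro!: mult_nonneg_nonneg B0 less_imp_le[OF vprod_pos])
  define w where "w k = kernel_op ?g (v k)" for k
  have wd: "dom (B * Cv * norm k) (w k)" for k unfolding w_def by (rule kernel_dom[OF B])
  have gXw: "kernel_op gX (v k) p = (if p \<in> F then 0 else w k p)" for k p
    by (simp add: kernel_op_def gX_def w_def)
  define X where "X = Uop + Theta gX"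
  have X: "1 / 2 * norm k \<le> norm (blinfun_apply X k)" for k
  proof -
    have "norm (adjoint_op v (kernel_op gX (v k))) \<le> \<epsilon> * (B * Cv * norm k)"
      by (rule tail[OF kernel_dom[OF gX]]) (simp add: gXw)
    also have "\<dots> \<le> 1 / 2 * norm k" using mult_right_mono[OF \<epsilon>(2), of "norm k"] by simp
    finally have "norm (adjoint_op v (kernel_op gX (v k))) \<le> 1 / 2 * norm k" .
    moreover have "norm (U k) \<le> norm (blinfun_apply X k) + norm (adjoint_op v (kernel_op gX (v k)))"
      unfolding X_def blinfun.add_left Uop_apply Theta_apply[OF gX]
      by (metis add_diff_cancel norm_triangle_ineq4)
    ultimately show ?thesis unfolding norm_U by linarith
  qed
  \<comment> \<open>Left summands index the deleted rows, right summands the rank-one corrections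
    contained in D.\<close>
  define \<phi> where "\<phi> i k = (case i of Inl p \<Rightarrow> w k p | Inr \<gamma> \<Rightarrow> cinner (b \<gamma>) k)" for i k
  define e where "e i = (case i of Inl p \<Rightarrow> adjoint_op v (point p) | Inr \<gamma> \<Rightarrow> b \<gamma>)" for i
  define Ci where "Ci i = (case i of Inl p \<Rightarrow> B * Cv * vsize (p :: ('k, 'r) vertex) ^ \<beta> | Inr \<gamma> \<Rightarrow> norm (b \<gamma>))" for i
  show ?thesis
  proof (rule finite_rank_perturbation_bounded_below[where I = "F <+> I" and X = X and \<phi> = \<phi> and e = e and C = Ci and a = "1/2"])
    show "finite (F <+> I)" using F(1) I by simp
    show "norm (\<phi> i k) \<le> Ci i * norm k" if "i \<in> F <+> I" for i k
    proof (cases i)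
      case (Inl p)
      thus ?thesis using wd[of k] by (simp add: \<phi>_def Ci_def dom_def mult_ac)
    next
      case (Inr \<gamma>)
      thus ?thesis by (simp add: \<phi>_def Ci_def norm_cinner_le)
    qed
    show "blinfun_apply D k = blinfun_apply X k + (\<Sum>i\<in>F <+> I. \<phi> i k *\<^sub>C e i)" for k
    proof -
      have dF: "dom 1 (\<lambda>x. point p x)" for p by (rule dom_point)
      have "w k = (\<lambda>x. kernel_op gX (v k) x + (\<Sum>p\<in>F. w k p * point p x))"
      proof
        fix x
        have "(\<Sum>p\<in>F. w k p * point p x) = (\<Sum>p\<in>F. if p = x then w k x else 0)"
          by (intro sum.cong refl) (auto simp: point_def)
        also have "\<dots> = (if x \<in> F then w k x else 0)" using F(1) by simp
        finally show "w k x = kernel_op gX (v k) x + (\<Sum>p\<in>F. w k p * point p x)" by (simp add: gXw)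
      qed
      hence "adjoint_op v (w k) = adjoint_op v (\<lambda>x. kernel_op gX (v k) x + (\<Sum>p\<in>F. w k p * point p x))" by simp
      also have "\<dots> = adjoint_op v (kernel_op gX (v k)) + adjoint_op v (\<lambda>x. \<Sum>p\<in>F. w k p * point p x)"
      proof (rule adjoint_add[OF kernel_dom[OF gX]])
        show "dom (\<Sum>p\<in>F. norm (w k p) * 1) (\<lambda>x. \<Sum>p\<in>F. w k p * point p x)"
          by (rule dom_sum) (use dom_lincomb[OF dF dom_zero, of "w k _" 0] in simp)
      qed
      also have "adjoint_op v (\<lambda>x. \<Sum>p\<in>F. w k p * point p x) = (\<Sum>p\<in>F. adjoint_op v (\<lambda>x. w k p * point p x))"
        by (rule adjoint_sum[where B = "\<lambda>p. norm (w k p) * 1"]) (use dom_lincomb[OF dF dom_zero, of "w k _" 0] in simp)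
      also have "\<dots> = (\<Sum>p\<in>F. w k p *\<^sub>C adjoint_op v (point p))"
        using adjoint_scale[OF dF] by simp
      finally have "blinfun_apply (Mcoef 0) k = blinfun_apply X k + (\<Sum>p\<in>F. w k p *\<^sub>C adjoint_op v (point p))"
        using beta by (simp add: Mcoef_def X_def blinfun.add_left Theta_apply[OF B] Theta_apply[OF gX] w_def)
      thus ?thesis
        unfolding D by (simp add: sum.Plus[OF F(1) I] \<phi>_def e_def blinfun.add_left blinfun.sum_left rank1_apply)
    qed
  qed (use X inj in auto)
qed

lemma opexp_linear:
  fixes T0 T1 :: "'h \<Rightarrow>\<^sub>L 'h"
  assumes "J > 0"
  shows "opexp J (\<lambda>\<kappa>. T0 + scaleB \<kappa> T1) (\<lambda>j. if j = 0 then T0 else if j = 1 then T1 else 0)"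
proof -
  let ?t = "\<lambda>j::nat. if j = 0 then T0 else if j = 1 then T1 else (0 :: 'h \<Rightarrow>\<^sub>L 'h)"
  show ?thesis
  \<comment> \<open>For J = 1, which occurs when \<beta> = 3, the linear term belongs to the
    remainder.\<close>
  proof (cases "J = 1")
    case True
    show ?thesis unfolding opexp_iff True
      by (rule exI[of _ "norm T1"]) (simp add: cscalingD(2,4)[OF cscaling_scaleB] mult.commute)
  next
    case False
    then obtain m where m: "J = Suc (Suc m)" using assms by (metis One_nat_def not0_implies_Suc not_gr0)
    have "(\<Sum>j<J. scaleB (\<kappa> ^ j) (?t j)) = T0 + scaleB \<kappa> T1" for \<kappa>
      unfolding m sum.lessThan_Suc_shift[of _ "Suc m"] sum.lessThan_Suc_shift[of _ m]
      by (simp add: cscalingD(4,5)[OF cscaling_scaleB])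
    thus ?thesis unfolding opexp_iff by (intro exI[of _ 0]) simp
  qed
qed

text \<open>The Laurent expansion of \<open>M(\<kappa>)\<^sup>-\<^sup>1\<close>: with \<open>D = M\<^sub>0 + \<Sum>|b\<^sub>\<gamma>\<rangle>\<langle>b\<^sub>\<gamma>|\<close>, \<open>b\<^sub>\<gamma> = -M\<^sub>1 k\<^sub>\<gamma>\<close>,
  \<open>T\<^sub>1 = D\<^sup>-\<^sup>1\<close> and \<open>T\<^sub>0 = -\<Sum>|k\<^sub>\<gamma>\<rangle>\<langle>k\<^sub>\<gamma>|\<close> one has \<open>M(\<kappa>) (T\<^sub>0 + \<kappa> T\<^sub>1) = \<kappa> (1 + O(\<kappa>))\<close>.\<close>

lemma Mop_inverse_expansion:
  fixes kv :: "'i \<Rightarrow> 'h"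
  assumes I: "finite I"
    and ker: "\<And>\<gamma>. \<gamma> \<in> I \<Longrightarrow> blinfun_apply (Mcoef 0) (kv \<gamma>) = 0"
    and span: "\<And>w. blinfun_apply (Mcoef 0) w = 0 \<Longrightarrow> \<exists>a. w = (\<Sum>\<gamma>\<in>I. a \<gamma> *\<^sub>C kv \<gamma>)"
    and orth: "\<And>\<delta> \<gamma>. \<delta> \<in> I \<Longrightarrow> \<gamma> \<in> I \<Longrightarrow>
      cinner (kv \<delta>) (blinfun_apply (Mcoef 1) (kv \<gamma>)) = - (if \<delta> = \<gamma> then 1 else 0)"
  shows "\<exists>L l. (\<forall>\<^sub>F \<kappa> in rhp. Mop \<kappa> o\<^sub>L L \<kappa> = id_blinfun \<and> clin (L \<kappa>)) \<and>
    opexp (\<beta> - 2) (\<lambda>\<kappa>. scaleB \<kappa> (L \<kappa>)) l \<and> (\<forall>j. clin (l j)) \<and> l 0 = - (\<Sum>\<gamma>\<in>I. rank1 (kv \<gamma>) (kv \<gamma>))"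
proof -
  define b where "b \<gamma> = - blinfun_apply (Mcoef 1) (kv \<gamma>)" for \<gamma>
  have kb: "cinner (kv \<delta>) (b \<gamma>) = (if \<delta> = \<gamma> then 1 else 0)" if "\<delta> \<in> I" "\<gamma> \<in> I" for \<delta> \<gamma>
    using orth[OF that] by (simp add: b_def cinner_minus_right)
  have bk: "cinner (b \<gamma>) (kv \<delta>) = (if \<delta> = \<gamma> then 1 else 0)" if "\<delta> \<in> I" "\<gamma> \<in> I" for \<delta> \<gamma>
    using kb[OF that] by (subst cinner_commute) simp
  \<comment> \<open>The b are biorthogonal to the k, so the correction detects every kernel vector
    of M_0, and D is injective.\<close>
  define D where "D = Mcoef 0 + (\<Sum>\<gamma>\<in>I. rank1 (b \<gamma>) (b \<gamma>))"
  have D: "blinfun_apply D k = blinfun_apply (Mcoef 0) k + (\<Sum>\<gamma>\<in>I. cinner (b \<gamma>) k *\<^sub>C b \<gamma>)" for k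
    by (simp add: D_def blinfun.add_left blinfun.sum_left rank1_apply)
  have Dsym: "cinner (blinfun_apply D k) l = cinner k (blinfun_apply D l)" for k l
    unfolding D cinner_add_left cinner_add_right Mcoef_0_hermitian cinner_sum_left cinner_sum_right
      cinner_scaleC_left cinner_scaleC_right
    by (simp flip: cinner_commute add: mult.commute)
  have delta: "(\<Sum>\<gamma>\<in>I. f \<gamma> * (if \<delta> = \<gamma> then 1 else 0)) = f \<delta>" if "\<delta> \<in> I" for f :: "'i \<Rightarrow> complex" and \<delta>
    using I that by (simp add: if_distrib[of "\<lambda>c. _ * c"] cong: if_cong)
  \<comment> \<open>As D is symmetric, this says that D maps k to b, hence T_1 maps b to k.\<close>
  have kD: "cinner (kv \<delta>) (blinfun_apply D w) = cinner (b \<delta>) w" if d: "\<delta> \<in> I" for \<delta> w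
  proof -
    have "cinner (kv \<delta>) (blinfun_apply D w) = cinner (blinfun_apply (Mcoef 0) (kv \<delta>)) w + (\<Sum>\<gamma>\<in>I. cinner (b \<gamma>) w * cinner (kv \<delta>) (b \<gamma>))"
      by (simp add: D cinner_add_right Mcoef_0_hermitian cinner_sum_right cinner_scaleC_right)
    also have "\<dots> = (\<Sum>\<gamma>\<in>I. cinner (b \<gamma>) w * (if \<delta> = \<gamma> then 1 else 0))"
      using ker[OF d] kb[OF d] by simp
    finally show ?thesis unfolding delta[OF d] .
  qed
  have inj: "w = 0" if w: "blinfun_apply D w = 0" for w
  proof -
    have bw: "cinner (b \<delta>) w = 0" if "\<delta> \<in> I" for \<delta> using kD[OF that, of w] w by simp
    hence "blinfun_apply (Mcoef 0) w = 0" using w by (simp add: D)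
    then obtain a where a: "w = (\<Sum>\<gamma>\<in>I. a \<gamma> *\<^sub>C kv \<gamma>)" using span by blast
    have "a \<delta> = 0" if d: "\<delta> \<in> I" for \<delta>
    proof -
      have "cinner (b \<delta>) w = (\<Sum>\<gamma>\<in>I. a \<gamma> * (if \<delta> = \<gamma> then 1 else 0))"
        unfolding a cinner_sum_right cinner_scaleC_right using bk[OF _ d] by (intro sum.cong refl) auto
      thus ?thesis unfolding delta[OF d] using bw[OF d] by simp
    qed
    thus ?thesis by (simp add: a)
  qed
  obtain c where c: "c > 0" "\<And>k. c * norm k \<le> norm (blinfun_apply D k)"
    using finite_rank_correction_bounded_below[OF I D_def inj] by blast
  have "surj (blinfun_apply D)" by (rule selfadjoint_bounded_below_surj[OF c Dsym])
  from blinfun_inverse_exists[OF c this] obtain T1 where T1: "D o\<^sub>L T1 = id_blinfun" "T1 o\<^sub>L D = id_blinfun" by blast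
  have DT: "blinfun_apply D (blinfun_apply T1 g) = g" for g
    using arg_cong[OF T1(1), of "\<lambda>A. blinfun_apply A g"] by simp
  have TD: "blinfun_apply T1 (blinfun_apply D g) = g" for g
    using arg_cong[OF T1(2), of "\<lambda>A. blinfun_apply A g"] by simp
  have clinD: "clin D" unfolding D_def by (intro clin_simps clin_sum clin_Mcoef clin_rank1)
  have clinT1: "clin T1" unfolding clin_def
  proof (intro allI)
    fix z x
    have "blinfun_apply D (z *\<^sub>C blinfun_apply T1 x) = z *\<^sub>C x" using clinD by (simp add: clin_def DT)
    thus "blinfun_apply T1 (z *\<^sub>C x) = z *\<^sub>C blinfun_apply T1 x" using TD by metis
  qed
  define T0 where "T0 = - (\<Sum>\<gamma>\<in>I. rank1 (kv \<gamma>) (kv \<gamma>))"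
  have T0: "blinfun_apply T0 g = - (\<Sum>\<gamma>\<in>I. cinner (kv \<gamma>) g *\<^sub>C kv \<gamma>)" for g
    by (simp add: T0_def blinfun.minus_left blinfun.sum_left rank1_apply)
  have cs: "clin (\<Sum>\<gamma>\<in>I. rank1 (kv \<gamma>) (kv \<gamma>))" by (intro clin_sum clin_rank1)
  have clinT0: "clin T0" unfolding T0_def by (rule clin_simps(4)[OF cs])
  have M0T0: "Mcoef 0 o\<^sub>L T0 = 0"
  proof (rule blinfun_eqI)
    fix g
    have "blinfun_apply (Mcoef 0) (cinner (kv \<gamma>) g *\<^sub>C kv \<gamma>) = 0" if "\<gamma> \<in> I" for \<gamma>
      using clin_Mcoef[of 0] ker[OF that] by (simp add: clin_def)
    thus "blinfun_apply (Mcoef 0 o\<^sub>L T0) g = blinfun_apply 0 g"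
      by (simp add: T0 blinfun.minus_right blinfun.sum_right)
  qed
  \<comment> \<open>Subtracting the correction from D gives M_0 T_1 = 1 - \<Sum> |b><k|, and M_1 T_0
    = \<Sum> |b><k| because b = - M_1 k.\<close>
  have M1: "(Mcoef 0 o\<^sub>L T1) + (Mcoef 1 o\<^sub>L T0) = id_blinfun"
  proof (rule blinfun_eqI)
    fix g
    have "blinfun_apply (Mcoef 0) (blinfun_apply T1 g) = g - (\<Sum>\<gamma>\<in>I. cinner (b \<gamma>) (blinfun_apply T1 g) *\<^sub>C b \<gamma>)"
      using D[of "blinfun_apply T1 g"] DT[of g] by (simp add: algebra_simps)
    also have "(\<Sum>\<gamma>\<in>I. cinner (b \<gamma>) (blinfun_apply T1 g) *\<^sub>C b \<gamma>) = (\<Sum>\<gamma>\<in>I. cinner (kv \<gamma>) g *\<^sub>C b \<gamma>)"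
      using kD[of _ "blinfun_apply T1 g"] by (intro sum.cong refl) (simp add: DT)
    finally have 1: "blinfun_apply (Mcoef 0) (blinfun_apply T1 g) = g - (\<Sum>\<gamma>\<in>I. cinner (kv \<gamma>) g *\<^sub>C b \<gamma>)" .
    have "blinfun_apply (Mcoef 1) (blinfun_apply T0 g) = (\<Sum>\<gamma>\<in>I. cinner (kv \<gamma>) g *\<^sub>C b \<gamma>)"
      using clin_Mcoef[of 1]
      by (simp add: T0 blinfun.minus_right blinfun.sum_right clin_def b_def scaleC_minus_right sum_negf)
    with 1 show "blinfun_apply ((Mcoef 0 o\<^sub>L T1) + (Mcoef 1 o\<^sub>L T0)) g = blinfun_apply id_blinfun g"
      by (simp add: blinfun.add_left)
  qed
  define t where "t j = (if j = 0 then T0 else if j = 1 then T1 else 0)" for j :: nat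
  have clint: "clin (t j)" for j by (simp add: t_def clinT0 clinT1 clin_0)
  define P where "P \<kappa> = Mop \<kappa> o\<^sub>L (T0 + scaleB \<kappa> T1)" for \<kappa>
  define p where "p j = (\<Sum>a\<le>j. Mcoef a o\<^sub>L t (j - a))" for j
  \<comment> \<open>Order \<beta> - 1 is the highest to which M expands. The coefficient of
    \<kappa>^0 in P vanishes, so division by \<kappa> leaves an expansion of order \<beta> - 2 with
    leading coefficient 1.\<close>
  have "opexp (\<beta> - 1) (\<lambda>\<kappa>. T0 + scaleB \<kappa> T1) t"
    unfolding t_def by (rule opexp_linear) (use beta in simp)
  hence "opexp (\<beta> - 1) P p" unfolding P_def p_def using beta
    by (intro opexp_compose opexp_Mop clin_Mcoef) auto
  moreover have b1: "\<beta> - 1 = Suc (\<beta> - 2)" using beta by simp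
  ultimately have "opexp (Suc (\<beta> - 2)) P p" by simp
  moreover have p0: "p 0 = 0" by (simp add: p_def t_def M0T0)
  ultimately have Y: "opexp (\<beta> - 2) (\<lambda>\<kappa>. scaleB (1 / \<kappa>) (P \<kappa>)) (\<lambda>j. p (Suc j))"
    by (intro uexp_shift[OF cscaling_scaleB]) auto
  have "p (Suc 0) = id_blinfun" using M1 by (simp add: p_def t_def)
  moreover have "clin (p j)" for j unfolding p_def by (intro clin_sum clin_simps clin_Mcoef clint)
  ultimately obtain Z where Z: "\<forall>\<^sub>F \<kappa> in rhp. scaleB (1 / \<kappa>) (P \<kappa>) o\<^sub>L Z \<kappa> = id_blinfun \<and> Z \<kappa> o\<^sub>L scaleB (1 / \<kappa>) (P \<kappa>) = id_blinfun"
    and Zexp: "opexp (\<beta> - 2) Z (inv_coeff (\<lambda>j. p (Suc j)))"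
    using opexp_inverse[OF Y] beta by auto
  have clinz: "clin (inv_coeff (\<lambda>j. p (Suc j)) j)" for j
    by (rule clin_inv_coeff) (use \<open>\<And>j. clin (p j)\<close> in blast)
  \<comment> \<open>M Q = P Z, and Z inverts P / \<kappa>; thus M Q = \<kappa> and Q / \<kappa> is a
    right inverse of M. The factor T_0 in Q is the residue.\<close>
  define Q where "Q \<kappa> = (T0 + scaleB \<kappa> T1) o\<^sub>L Z \<kappa>" for \<kappa>
  define L where "L \<kappa> = scaleB (1 / \<kappa>) (Q \<kappa>)" for \<kappa>
  define l where "l j = (\<Sum>a\<le>j. t a o\<^sub>L inv_coeff (\<lambda>j. p (Suc j)) (j - a))" for j
  have kL: "scaleB \<kappa> (L \<kappa>) = Q \<kappa>" if "\<kappa> \<noteq> 0" for \<kappa>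
    using that by (simp add: L_def cscalingD(3,4)[OF cscaling_scaleB])
  have "opexp (\<beta> - 2) (\<lambda>\<kappa>. T0 + scaleB \<kappa> T1) t"
    unfolding t_def by (rule opexp_linear) (use beta in simp)
  from opexp_compose[OF this Zexp clint] have Qexp: "opexp (\<beta> - 2) Q l"
    unfolding Q_def l_def .
  have "opexp (\<beta> - 2) (\<lambda>\<kappa>. scaleB \<kappa> (L \<kappa>)) l"
  proof -
    obtain C where C: "\<forall>\<^sub>F \<kappa> in rhp. norm (Q \<kappa> - (\<Sum>j<\<beta> - 2. scaleB (\<kappa> ^ j) (l j))) \<le> C * norm \<kappa> ^ (\<beta> - 2)"
      using Qexp unfolding opexp_iff by blast
    have "\<forall>\<^sub>F \<kappa> in rhp. norm (scaleB \<kappa> (L \<kappa>) - (\<Sum>j<\<beta> - 2. scaleB (\<kappa> ^ j) (l j))) \<le> C * norm \<kappa> ^ (\<beta> - 2)"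
      using C eventually_rhp
    proof eventually_elim
      case (elim \<kappa>)
      hence "\<kappa> \<noteq> 0" by auto
      thus ?case using elim(1) kL by simp
    qed
    thus ?thesis unfolding opexp_iff by blast
  qed
  moreover have "\<forall>\<^sub>F \<kappa> in rhp. Mop \<kappa> o\<^sub>L L \<kappa> = id_blinfun \<and> clin (L \<kappa>)"
    using Z eventually_adm_free_res
  proof eventually_elim
    case (elim \<kappa>)
    then obtain B where "adm B (free_res E att \<kappa>)" by blast
    hence cT: "clin (Theta (free_res E att \<kappa>))" by (rule clin_Theta)
    have cM: "clin (Mop \<kappa>)" unfolding Mop_def by (rule clin_simps(3)[OF clin_Uop cT])
    have "Mop \<kappa> o\<^sub>L L \<kappa> = scaleB (1 / \<kappa>) (P \<kappa>) o\<^sub>L Z \<kappa>"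
      unfolding L_def compose_scaleB[OF cM] scaleB_compose P_def Q_def
      by (rule arg_cong[where f = "scaleB (1 / \<kappa>)"]) (rule blinfun_eqI, simp)
    hence 1: "Mop \<kappa> o\<^sub>L L \<kappa> = id_blinfun" using elim(1) by simp
    have cS: "clin (T0 + scaleB \<kappa> T1)" by (intro clin_simps clinT0 clinT1)
    let ?Y = "scaleB (1 / \<kappa>) (P \<kappa>)"
    have cY: "clin ?Y" unfolding P_def by (intro clin_simps cM cS)
    have YZ: "blinfun_apply ?Y (blinfun_apply (Z \<kappa>) x) = x" and ZY: "blinfun_apply (Z \<kappa>) (blinfun_apply ?Y x) = x" for x
      using elim(1) by (metis blinfun_apply_blinfun_compose blinfun_apply_id_blinfun)+
    have "clin (Z \<kappa>)" unfolding clin_def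
    proof (intro allI)
      fix z x
      have "blinfun_apply ?Y (z *\<^sub>C blinfun_apply (Z \<kappa>) x) = z *\<^sub>C x" using cY by (simp add: clin_def YZ)
      thus "blinfun_apply (Z \<kappa>) (z *\<^sub>C x) = z *\<^sub>C blinfun_apply (Z \<kappa>) x" using ZY by metis
    qed
    hence "clin (L \<kappa>)" unfolding L_def Q_def by (intro clin_simps cS)
    with 1 show ?case by blast
  qed
  moreover have "clin (l j)" for j
    unfolding l_def by (intro clin_sum clin_simps(2) clint clinz)
  moreover have "l 0 = - (\<Sum>\<gamma>\<in>I. rank1 (kv \<gamma>) (kv \<gamma>))"
  proof -
    have "l 0 = t 0" unfolding l_def by (simp, rule blinfun_eqI, simp)
    thus ?thesis by (simp add: t_def T0_def)
  qed
  ultimately show ?thesis by blast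
qed

end

section \<open>Threshold resonances\<close>

lemma h_core_lincomb:
  "h_core E att (\<lambda>x. a * u x + b * w x) x = a * h_core E att u x + b * h_core E att w x"
proof -
  have "(if E x y then 1 else 0) * ((a * u x + b * w x) - (a * u y + b * w y)) =
      a * ((if E x y then 1 else 0) * (u x - u y)) + b * ((if E x y then 1 else 0) * (w x - w y))" for y
    by (simp add: algebra_simps)
  hence "(\<Sum>y\<in>UNIV. (if E x y then 1 else 0) * ((a * u x + b * w x) - (a * u y + b * w y))) =
      a * (\<Sum>y\<in>UNIV. (if E x y then 1 else 0) * (u x - u y)) + b * (\<Sum>y\<in>UNIV. (if E x y then 1 else 0) * (w x - w y))"
    by (simp only: sum.distrib sum_distrib_left)
  thus ?thesis unfolding h_core_alt by (simp add: distrib_left mult_ac)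
qed

lemma H0_lincomb:
  "H0 E att (\<lambda>x. a * u x + b * w x) p = a * H0 E att u p + b * H0 E att w p"
proof (cases p)
  case (Core x)
  thus ?thesis by (simp add: h_core_lincomb)
next
  case (Ray \<alpha> m)
  thus ?thesis by (cases m) (auto simp: algebra_simps)
qed

lemma has_sum_sum_finite:
  fixes f :: "'i \<Rightarrow> 'a \<Rightarrow> 'b::topological_comm_monoid_add"
  assumes "finite I" "\<And>i. i \<in> I \<Longrightarrow> (f i has_sum s i) A"
  shows "((\<lambda>x. \<Sum>i\<in>I. f i x) has_sum (\<Sum>i\<in>I. s i)) A"
  using assms by (induction I) (auto intro!: has_sum_add)

lemma has_sum_diff_complex:
  fixes f g :: "'a \<Rightarrow> complex"
  assumes "(f has_sum a) A" "(g has_sum b) A"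
  shows "((\<lambda>x. f x - g x) has_sum (a - b)) A"
  using has_sum_add[OF assms(1) has_sum_cmult_right[OF assms(2), of "-1"]] by simp

text \<open>Each value of H_0 u involves finitely many values of u, so H_0 acts term by term on
  pointwise convergent sums of columns.\<close>

lemma has_sum_H0:
  assumes F: "\<And>p. ((\<lambda>q. F p q) has_sum u p) UNIV"
  shows "((\<lambda>q. H0 E att (\<lambda>p. F p q) p) has_sum H0 E att u p) UNIV"
proof (cases p)
  case (Core x)
  have "((\<lambda>q. h_core E att (\<lambda>y. F (Core y) q) x) has_sum h_core E att (\<lambda>y. u (Core y)) x) UNIV"
    unfolding h_core_alt
    by (intro has_sum_add has_sum_sum_finite has_sum_cmult_right has_sum_diff_complex F finite)
  thus ?thesis by (simp add: Core)
next
  case (Ray \<alpha> m)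
  show ?thesis
  proof (cases m)
    case 0
    have "((\<lambda>q. 2 * F (Ray \<alpha> 0) q - F (Ray \<alpha> 1) q) has_sum (2 * u (Ray \<alpha> 0) - u (Ray \<alpha> 1))) UNIV"
      by (intro has_sum_diff_complex has_sum_cmult_right F)
    thus ?thesis by (simp add: Ray 0)
  next
    case (Suc n)
    have "((\<lambda>q. 2 * F (Ray \<alpha> (Suc n)) q - F (Ray \<alpha> (Suc (Suc n))) q - F (Ray \<alpha> n) q) has_sum
        (2 * u (Ray \<alpha> (Suc n)) - u (Ray \<alpha> (Suc (Suc n))) - u (Ray \<alpha> n))) UNIV"
      by (intro has_sum_diff_complex has_sum_cmult_right F)
    thus ?thesis by (simp add: Ray Suc)
  qed
qed

lemma H0_kernel_op:
  assumes det: "det (core_mat E att (\<kappa>\<^sup>2)) \<noteq> 0"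
    and sm: "\<And>p. (\<lambda>q. free_res E att \<kappa> p q * f q) summable_on UNIV"
  shows "H0 E att (kernel_op (free_res E att \<kappa>) f) p + \<kappa>\<^sup>2 * kernel_op (free_res E att \<kappa>) f p = f p"
proof -
  let ?u = "kernel_op (free_res E att \<kappa>) f"
  have hs: "((\<lambda>q. free_res E att \<kappa> p q * f q) has_sum ?u p) UNIV" for p
    unfolding kernel_op_def using sm by (rule has_sum_infsum)
  have "((\<lambda>q. H0 E att (\<lambda>p. free_res E att \<kappa> p q * f q) p + \<kappa>\<^sup>2 * (free_res E att \<kappa> p q * f q)) has_sum
      (H0 E att ?u p + \<kappa>\<^sup>2 * ?u p)) UNIV"
    by (intro has_sum_add has_sum_H0 has_sum_cmult_right hs)
  moreover have "H0 E att (\<lambda>p. free_res E att \<kappa> p q * f q) p + \<kappa>\<^sup>2 * (free_res E att \<kappa> p q * f q)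
      = point p q * f p" for q
  proof -
    have "H0 E att (\<lambda>p. free_res E att \<kappa> p q * f q) p = f q * H0 E att (\<lambda>p. free_res E att \<kappa> p q) p"
      using H0_lincomb[of E att "f q" "\<lambda>p. free_res E att \<kappa> p q" 0 "\<lambda>_. 0" p] by (simp add: mult.commute)
    hence "H0 E att (\<lambda>p. free_res E att \<kappa> p q * f q) p + \<kappa>\<^sup>2 * (free_res E att \<kappa> p q * f q)
        = f q * (H0 E att (\<lambda>p. free_res E att \<kappa> p q) p + \<kappa>\<^sup>2 * free_res E att \<kappa> p q)"
      by (simp add: algebra_simps)
    thus ?thesis unfolding free_res_equation[OF det] by (auto simp: point_def)
  qed
  ultimately have "((\<lambda>q. point p q * f p) has_sum (H0 E att ?u p + \<kappa>\<^sup>2 * ?u p)) UNIV" by simp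
  hence "H0 E att ?u p + \<kappa>\<^sup>2 * ?u p = (\<Sum>\<^sub>\<infinity>q. point p q * f p)" by (metis infsumI)
  also have "\<dots> = f p" by (subst infsum_single[of p]) (auto simp: point_def)
  finally show ?thesis .
qed

text \<open>On a ray the Dirichlet condition makes w a multiple of the position, and boundedness
  forces the multiple to be 0; the core is covered by \<open>h_core_injective\<close>.\<close>

lemma bounded_harmonic_zero:
  fixes E :: "'k::finite \<Rightarrow> 'k \<Rightarrow> bool" and att :: "'r::finite \<Rightarrow> 'k"
  assumes graph: "simple_connected_graph E" and H: "\<And>p. H0 E att w p = 0"
    and bd: "\<And>p. norm (w p) \<le> C"
  shows "w p = 0"
proof (cases p)
  case (Core x)
  have "h_core E att (\<lambda>y. w (Core y)) x = 0" for x using H[of "Core x"] by simp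
  from h_core_injective[OF graph this] show ?thesis by (simp add: Core)
next
  case (Ray \<alpha> a)
  let ?u = "\<lambda>m. w (Ray \<alpha> m)"
  have lin: "?u m = of_nat (Suc m) * ?u 0 \<and> ?u (Suc m) = of_nat (Suc (Suc m)) * ?u 0" for m
  proof (induction m)
    case 0
    show ?case using H[of "Ray \<alpha> 0"] by simp
  next
    case (Suc m)
    have "?u (Suc (Suc m)) = 2 * ?u (Suc m) - ?u m" using H[of "Ray \<alpha> (Suc m)"] by (simp add: algebra_simps)
    thus ?case using Suc.IH by (simp add: algebra_simps)
  qed
  have "?u 0 = 0"
  proof (rule ccontr)
    assume "?u 0 \<noteq> 0"
    then obtain m :: nat where m: "C / norm (?u 0) < real m" using reals_Archimedean2 by blast
    have "real (Suc m) * norm (?u 0) \<le> C"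
      using bd[of "Ray \<alpha> m"] lin[of m] by (metis norm_mult norm_of_nat)
    moreover have "C < real m * norm (?u 0)" using m \<open>?u 0 \<noteq> 0\<close> by (simp add: field_simps)
    ultimately show False using mult_right_mono[of "real m" "real (Suc m)" "norm (?u 0)"] by simp
  qed
  thus ?thesis using lin[of a] by (simp add: Ray)
qed

lemma sum_ray_indicator [simp]:
  "(\<Sum>\<beta>\<in>UNIV. c \<beta> * ray_indicator \<beta> (Ray \<alpha> a)) = (c \<alpha> :: complex)" for \<alpha> :: "'r::finite"
  by (simp add: if_distrib[of "\<lambda>x. _ * x"] cong: if_cong)

lemma L1_ray_limit:
  assumes "u \<in> L1 (real n)"
  shows "(\<lambda>a. u (Ray \<alpha> a)) \<longlonglongrightarrow> 0"
proof -
  have "(\<lambda>p. norm (u p)) summable_on UNIV"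
    using L1_mono(1)[OF assms, of 0] L1_iff[of u 0] by simp
  hence "(\<lambda>p. norm (u p)) summable_on (range (Ray \<alpha>))" by (rule summable_on_subset_banach) simp
  hence "((\<lambda>p. norm (u p)) \<circ> Ray \<alpha>) summable_on UNIV" by (subst (asm) summable_on_reindex) (auto simp: inj_on_def)
  hence "summable (\<lambda>a. norm (u (Ray \<alpha> a)))" using summable_on_imp_summable by (fastforce simp: o_def)
  thus ?thesis using summable_LIMSEQ_zero tendsto_norm_zero_iff by blast
qed

lemma resonance_limit:
  fixes \<alpha> :: "'r::finite"
  assumes "(\<lambda>x. \<Psi> x - (\<Sum>\<alpha>\<in>UNIV. c \<alpha> * ray_indicator \<alpha> x)) \<in> L1 (real n)"
  shows "(\<lambda>a. \<Psi> (Ray \<alpha> a)) \<longlonglongrightarrow> c \<alpha>"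
proof -
  have "(\<lambda>a. \<Psi> (Ray \<alpha> a) - c \<alpha>) \<longlonglongrightarrow> 0"
    using L1_ray_limit[OF assms, of \<alpha>] by (simp only: sum_ray_indicator)
  thus ?thesis by (rule LIM_zero_cancel)
qed

section \<open>Linear growth and first moments on the rays\<close>

fun ray_pos :: "'r \<Rightarrow> ('k, 'r) vertex \<Rightarrow> complex" where
  "ray_pos \<alpha> (Core x) = 0"
| "ray_pos \<alpha> (Ray \<gamma> a) = (if \<gamma> = \<alpha> then of_nat (a + 1) else 0)"

definition moment :: "'r \<Rightarrow> ('k, 'r) state \<Rightarrow> complex" where
  "moment \<alpha> f = (\<Sum>\<^sub>\<infinity>q. ray_pos \<alpha> q * f q)"

lemma norm_ray_pos: "norm (ray_pos \<alpha> q) \<le> vsize q"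
proof (cases q)
  case (Ray \<gamma> a)
  have "norm (of_nat (a + 1) :: complex) = real a + 1" unfolding norm_of_nat by simp
  thus ?thesis using vsize_ray_ge[of a \<gamma>] vsize_pos[of "Ray \<gamma> a"] by (auto simp: Ray simp del: vsize.simps)
qed simp

lemma vsize_le_power: "n \<ge> 1 \<Longrightarrow> vsize q \<le> vsize q ^ n"
  using power_increasing[of 1 n "vsize q"] vsize_ge_1[of q] by simp

lemma cnj_ray_pos [simp]: "cnj (ray_pos \<alpha> q) = ray_pos \<alpha> q"
  by (cases q) auto

lemma moment_summable:
  fixes f :: "('k, 'r) state"
  assumes "f \<in> L1 (real n)" "n \<ge> 1"
  shows "(\<lambda>q. ray_pos \<alpha> q * f q) summable_on UNIV"
proof (rule L1_pairing(2)[OF assms(1), where B = 1])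
  show "norm (ray_pos \<alpha> q) \<le> 1 * vsize q ^ n" for q :: "('k, 'r) vertex"
    using norm_ray_pos[of \<alpha> q] vsize_le_power[OF assms(2), of q] by simp
qed

text \<open>The core block is even in \<kappa> and drops out; on each ray the coefficient is minus
  the product of positions. The whole term is minus a sum of one rank-one kernel per ray.\<close>

lemma free_coef_1:
  fixes E :: "'k::finite \<Rightarrow> 'k \<Rightarrow> bool" and att :: "'r::finite \<Rightarrow> 'k"
  assumes "simple_connected_graph E"
  shows "free_coef E att 1 p q = - (\<Sum>\<alpha>\<in>UNIV. ray_pos \<alpha> p * ray_pos \<alpha> q)"
proof (cases p; cases q)
  fix \<alpha> a \<gamma> b assume pq: "p = Ray \<alpha> a" "q = Ray \<gamma> b"
  have "(\<Sum>\<delta>\<in>UNIV. ray_pos \<delta> p * ray_pos \<delta> q) = (\<Sum>\<delta>\<in>UNIV. if \<alpha> = \<delta> then of_nat (a + 1) * ray_pos \<delta> q else 0)"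
    unfolding pq by (intro sum.cong refl) auto
  also have "\<dots> = of_nat (a + 1) * ray_pos \<alpha> q" by simp
  finally show ?thesis by (simp add: pq ray_coef_1)
qed (auto simp: core_coef_1[OF assms])

context threshold_setting
begin

abbreviation G0 :: "('k, 'r) state \<Rightarrow> ('k, 'r) state" where
  "G0 \<equiv> kernel_op (free_res E att 0)"

lemma b2: "real \<beta> - 2 = real (\<beta> - 2)" and b1: "real \<beta> - 1 = real (\<beta> - 1)"
  using beta by auto

lemma G0_bound: "\<exists>C\<ge>0. \<forall>f\<in>L1 (real \<beta>). \<forall>p. norm (G0 f p) \<le> C * L1_norm (real \<beta>) f"
proof -
  obtain C where C: "C \<ge> 0" "\<And>p q. norm (free_res E att 0 p q) \<le> C * vsize q"
    using free_res_0_bound by metis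
  have le: "norm (free_res E att 0 p q) \<le> C * vsize q ^ \<beta>" for p q
    using C(2)[of p q] mult_left_mono[OF vsize_le_power[of \<beta> q] C(1)] beta by simp
  have "norm (G0 f p) \<le> C * L1_norm (real \<beta>) f" if "f \<in> L1 (real \<beta>)" for f p
    unfolding kernel_op_def by (rule L1_pairing(3)[OF that le])
  thus ?thesis using C(1) by (intro exI[of _ C]) simp
qed

lemma free_coef_0_fun: "free_coef E att 0 = free_res E att 0"
  by (intro ext) (rule free_coef_0)

lemma adm_free_res_0: "\<exists>B. adm B (free_res E att 0)"
  using adm_free_coef[of 0] beta by (simp add: free_coef_0_fun)

lemma G0_summable:
  assumes "f \<in> L1 (real \<beta>)"
  shows "(\<lambda>q. free_res E att 0 p q * f q) summable_on UNIV"
proof -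
  obtain B where B: "adm B (free_res E att 0)" using adm_free_res_0 by blast
  show ?thesis by (rule kernel_op_summable[OF assms, where C = B]) (use B in \<open>simp add: adm_def\<close>)
qed

lemma H0_G0:
  assumes "f \<in> L1 (real \<beta>)"
  shows "H0 E att (G0 f) p = f p"
  using H0_kernel_op[of E att 0 f p] det_core_mat_0[OF graph, of att] G0_summable[OF assms] by simp

lemma bounded_dom:
  assumes "\<And>p. norm (u p) \<le> C"
  shows "dom C u"
  unfolding dom_def
proof
  fix p
  have "0 \<le> C" using assms[of p] norm_ge_zero order_trans by blast
  thus "norm (u p) \<le> C * vsize p ^ \<beta>"
    using assms[of p] mult_left_mono[OF one_le_power[OF vsize_ge_1[of p], of \<beta>], of C] by simp
qed

text \<open>The moment condition separates resonances from bound states: \<open>G\<^sub>0 f\<close> is asymptotically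
  the first moment of \<open>f\<close> along each ray.\<close>

lemma G0_asymptotics:
  assumes f: "f \<in> L1 (real \<beta>)"
  shows "(\<lambda>x. G0 f x - (\<Sum>\<alpha>\<in>UNIV. moment \<alpha> f * ray_indicator \<alpha> x)) \<in> L1 (real (\<beta> - 2))"
proof -
  define w where "w x = G0 f x - (\<Sum>\<alpha>\<in>UNIV. moment \<alpha> f * ray_indicator \<alpha> x)" for x
  define t where "t q = vsize q ^ \<beta> * norm (f q)" for q
  have t: "t summable_on UNIV" using f unfolding L1_iff t_def .
  have t0: "t q \<ge> 0" for q unfolding t_def by (intro mult_nonneg_nonneg zero_le_power vsize_pos) auto
  \<comment> \<open>The threshold kernel is the smaller of the two positions on a common ray. It
    agrees with the position of q, the integrand of the moment, unless q lies beyond p on the same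
    ray; only such q enter the difference.\<close>
  define later where "later p q = (case p of Core _ \<Rightarrow> False | Ray \<alpha> a \<Rightarrow> (case q of Core _ \<Rightarrow> False | Ray \<gamma> b \<Rightarrow> \<gamma> = \<alpha> \<and> a < b))"
    for p q :: "('k, 'r) vertex"
  define S where "S p q = (if later p q then vsize q * norm (f q) else 0)" for p q
  have S_sum: "S p summable_on UNIV" for p
  proof (rule summable_on_comparison_test[OF t])
    show "S p q \<le> t q" for q
      using mult_right_mono[OF vsize_le_power[of \<beta> q], of "norm (f q)"] beta t0[of q]
      by (auto simp: S_def t_def)
    show "0 \<le> S p q" for q using vsize_pos[of q] by (auto simp: S_def)
  qed
  have ray: "norm (w (Ray \<alpha> a)) \<le> (\<Sum>\<^sub>\<infinity>q. S (Ray \<alpha> a) q)" for \<alpha> a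
  proof -
    have "w (Ray \<alpha> a) = G0 f (Ray \<alpha> a) - moment \<alpha> f" by (simp only: w_def sum_ray_indicator)
    also have "\<dots> = (\<Sum>\<^sub>\<infinity>q. free_res E att 0 (Ray \<alpha> a) q * f q - ray_pos \<alpha> q * f q)"
      unfolding kernel_op_def moment_def
      by (intro infsumI[symmetric] has_sum_diff_complex has_sum_infsum G0_summable[OF f] moment_summable[OF f])
        (use beta in simp)
    also have "norm \<dots> \<le> (\<Sum>\<^sub>\<infinity>q. S (Ray \<alpha> a) q)"
    proof (rule dominated_summable(3)[OF S_sum])
      fix q
      show "norm (free_res E att 0 (Ray \<alpha> a) q * f q - ray_pos \<alpha> q * f q) \<le> S (Ray \<alpha> a) q"
      proof (cases q)
        case (Core x)
        thus ?thesis by (simp add: S_def later_def)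
      next
        case (Ray \<gamma> b)
        show ?thesis
        proof (cases "\<gamma> = \<alpha> \<and> a < b")
          case True
          have diff: "free_res E att 0 (Ray \<alpha> a) q - ray_pos \<alpha> q = - of_nat (b - a)"
            using True by (simp add: Ray ray_green_1 of_nat_diff)
          have "norm (free_res E att 0 (Ray \<alpha> a) q - ray_pos \<alpha> q) \<le> vsize q"
          proof -
            have "norm (- of_nat (b - a) :: complex) = real (b - a)" by (simp only: norm_minus_cancel norm_of_nat)
            moreover have "real (b - a) \<le> real b + 1" by simp
            moreover have "real b + 1 \<le> vsize q" unfolding Ray by (rule vsize_ray_ge)
            ultimately show ?thesis unfolding diff by linarith
          qed
          thus ?thesis using True
            by (simp add: S_def later_def Ray left_diff_distrib[symmetric] norm_mult mult_right_mono del: vsize.simps free_res.simps ray_pos.simps)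
        next
          case False
          hence "free_res E att 0 (Ray \<alpha> a) q = ray_pos \<alpha> q" by (auto simp: Ray ray_green_1)
          thus ?thesis using vsize_pos[of q] by (simp add: S_def)
        qed
      qed
    qed
    finally show ?thesis .
  qed
  \<comment> \<open>Here two powers of the weight are spent: the kernel difference costs one power
    of \<open>vsize q\<close>, and the number of points p before q costs another. This is why the
    exponent drops from \<beta> to \<beta> - 2.\<close>
  have count: "(\<Sum>p\<in>X. vsize p ^ (\<beta> - 2) * S p q) \<le> t q" if X: "finite X" "X \<inter> range Core = {}"
    for X :: "('k, 'r) vertex set" and q
  proof (cases q)
    case (Core x)
    have "S p q = 0" for p by (cases p) (auto simp: S_def later_def Core)
    thus ?thesis using t0 by simp
  next
    case (Ray \<gamma> b)
    have sub: "{p \<in> X. later p q} \<subseteq> Ray \<gamma> ` {..<b}"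
    proof
      fix p assume "p \<in> {p \<in> X. later p q}"
      thus "p \<in> Ray \<gamma> ` {..<b}" by (cases p) (auto simp: later_def Ray)
    qed
    have "card {p \<in> X. later p q} \<le> card (Ray \<gamma> ` {..<b} :: ('k, 'r) vertex set)"
      by (rule card_mono[OF _ sub]) auto
    also have "\<dots> \<le> b" using card_image_le[of "{..<b}" "Ray \<gamma>"] by simp
    finally have card: "card {p \<in> X. later p q} \<le> b" .
    have "(\<Sum>p\<in>X. vsize p ^ (\<beta> - 2) * S p q) = (\<Sum>p\<in>{p \<in> X. later p q}. vsize p ^ (\<beta> - 2) * (vsize q * norm (f q)))"
      using X(1) by (intro sum.mono_neutral_cong_right) (auto simp: S_def)
    also have "\<dots> \<le> (\<Sum>p\<in>{p \<in> X. later p q}. vsize q ^ (\<beta> - 2) * (vsize q * norm (f q)))"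
    proof (intro sum_mono mult_right_mono power_mono)
      fix p assume "p \<in> {p \<in> X. later p q}"
      then obtain a where "p = Ray \<gamma> a" "a < b" using sub by auto
      thus "vsize p \<le> vsize q" by (auto simp: Ray intro!: power_mono)
    qed (auto intro!: mult_nonneg_nonneg vsize_pos)
    also have "\<dots> = real (card {p \<in> X. later p q}) * (vsize q ^ (\<beta> - 2) * (vsize q * norm (f q)))" by simp
    also have "\<dots> \<le> vsize q * (vsize q ^ (\<beta> - 2) * (vsize q * norm (f q)))"
    proof (rule mult_right_mono)
      show "real (card {p \<in> X. later p q}) \<le> vsize q"
      proof -
        have "real (card {p \<in> X. later p q}) \<le> real b + 1" using of_nat_mono[OF card, where 'a = real] by simp
        also have "\<dots> \<le> vsize q" unfolding Ray by (rule vsize_ray_ge)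
        finally show ?thesis .
      qed
    qed (intro mult_nonneg_nonneg zero_le_power vsize_pos norm_ge_zero)
    also have "\<dots> = vsize q ^ (Suc (Suc (\<beta> - 2))) * norm (f q)" by simp
    also have "Suc (Suc (\<beta> - 2)) = \<beta>" using beta by simp
    finally show ?thesis by (simp add: t_def)
  qed
  define K1 where "K1 = (\<Sum>x\<in>UNIV. norm (w (Core x)))"
  have "(\<Sum>p\<in>X. vsize p ^ (\<beta> - 2) * norm (w p)) \<le> K1 + infsum t UNIV" if X: "finite X" for X
  proof -
    let ?X = "X - range Core"
    have "(\<Sum>p\<in>X. vsize p ^ (\<beta> - 2) * norm (w p)) =
        (\<Sum>p\<in>X \<inter> range Core. vsize p ^ (\<beta> - 2) * norm (w p)) + (\<Sum>p\<in>?X. vsize p ^ (\<beta> - 2) * norm (w p))"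
      by (rule sum.Int_Diff[OF X])
    also have "(\<Sum>p\<in>X \<inter> range Core. vsize p ^ (\<beta> - 2) * norm (w p)) \<le> (\<Sum>p\<in>range Core. norm (w p))"
    proof -
      have "(\<Sum>p\<in>X \<inter> range Core. vsize p ^ (\<beta> - 2) * norm (w p)) = (\<Sum>p\<in>X \<inter> range Core. norm (w p))"
        by (intro sum.cong refl) auto
      also have "\<dots> \<le> (\<Sum>p\<in>range Core. norm (w p))" by (intro sum_mono2) auto
      finally show ?thesis .
    qed
    also have "(\<Sum>p\<in>range Core. norm (w p)) = K1" unfolding K1_def by (subst sum.reindex) (auto simp: inj_on_def)
    also have "(\<Sum>p\<in>?X. vsize p ^ (\<beta> - 2) * norm (w p)) \<le> (\<Sum>p\<in>?X. vsize p ^ (\<beta> - 2) * (\<Sum>\<^sub>\<infinity>q. S p q))"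
    proof (intro sum_mono mult_left_mono zero_le_power vsize_pos)
      fix p assume "p \<in> ?X"
      then obtain \<alpha> a where "p = Ray \<alpha> a" by (cases p) auto
      thus "norm (w p) \<le> (\<Sum>\<^sub>\<infinity>q. S p q)" using ray by simp
    qed
    also have "\<dots> = (\<Sum>\<^sub>\<infinity>q. \<Sum>p\<in>?X. vsize p ^ (\<beta> - 2) * S p q)"
      unfolding infsum_cmult_right'[symmetric]
      by (intro infsumI[symmetric] has_sum_sum_finite has_sum_infsum summable_on_cmult_right S_sum) (use X in simp)
    also have "\<dots> \<le> infsum t UNIV"
    proof (rule infsum_mono[OF _ t])
      show "(\<lambda>q. \<Sum>p\<in>?X. vsize p ^ (\<beta> - 2) * S p q) summable_on UNIV"
        by (rule summable_on_comparison_test[OF t count])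
          (use X in \<open>auto intro!: sum_nonneg mult_nonneg_nonneg zero_le_power vsize_pos simp: S_def\<close>)
      show "(\<Sum>p\<in>?X. vsize p ^ (\<beta> - 2) * S p q) \<le> t q" for q by (rule count) (use X in auto)
    qed
    finally show ?thesis by simp
  qed
  hence "(\<lambda>p. vsize p ^ (\<beta> - 2) * norm (w p)) summable_on UNIV"
    by (intro nonneg_bdd_above_summable_on)
      (auto intro!: bdd_aboveI2 mult_nonneg_nonneg zero_le_power vsize_pos)
  thus ?thesis unfolding w_def[symmetric] L1_iff .
qed

section \<open>Zero-energy states and the kernel of M at the threshold\<close>

abbreviation H :: "('k, 'r) oper" where
  "H \<equiv> H_op E att V"

lemma V_eq: "dom B u \<Longrightarrow> V u = v (U (adjoint_op v u))"
  using A dual_dom unfolding assumption_A_def by blast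

lemma H_lincomb:
  assumes u: "dom B u" and w: "dom C w"
  shows "H (\<lambda>x. a * u x + b * w x) = (\<lambda>x. a * H u x + b * H w x)"
  unfolding H_op_def H0_lincomb V_eq[OF dom_lincomb[OF u w]] V_eq[OF u] V_eq[OF w]
    adjoint_lincomb[OF u w] U_add U_scale v_add v_scale
  by (simp add: algebra_simps)

text \<open>Keeps the vector c of limits along the rays together with the state. The vector is
  unique and depends linearly on the state, and bound states are those with c = 0.\<close>

definition is_res :: "('k, 'r) state \<Rightarrow> ('r \<Rightarrow> complex) \<Rightarrow> bool" where
  "is_res \<Psi> c \<longleftrightarrow> \<Psi> \<in> gen_eigenspace (real \<beta>) H \<and>
     (\<lambda>x. \<Psi> x - (\<Sum>\<alpha>\<in>UNIV. c \<alpha> * ray_indicator \<alpha> x)) \<in> L1 (real (\<beta> - 2))"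

lemma resonance_space_iff: "\<Psi> \<in> resonance_space (real \<beta>) H \<longleftrightarrow> (\<exists>c. is_res \<Psi> c)"
  unfolding resonance_space_def is_res_def b2 by blast

lemma bound_space_iff: "\<Psi> \<in> bound_space (real \<beta>) H \<longleftrightarrow> is_res \<Psi> (\<lambda>_. 0)"
  unfolding bound_space_def is_res_def b2 by simp

lemma is_res_lincomb:
  assumes "is_res \<Psi> c" "is_res \<Phi> d"
  shows "is_res (\<lambda>x. a * \<Psi> x + b * \<Phi> x) (\<lambda>\<alpha>. a * c \<alpha> + b * d \<alpha>)"
proof -
  obtain B C where B: "dom B \<Psi>" "dom C \<Phi>"
    using assms unfolding is_res_def gen_eigenspace_def dual_dom by blast
  have H0: "H \<Psi> = (\<lambda>x. 0)" "H \<Phi> = (\<lambda>x. 0)" using assms unfolding is_res_def gen_eigenspace_def by auto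
  have "(\<lambda>x. a * \<Psi> x + b * \<Phi> x) \<in> gen_eigenspace (real \<beta>) H"
    unfolding gen_eigenspace_def using dom_lincomb[OF B] H_lincomb[OF B, of a b] H0 by (auto simp: dual_dom)
  moreover have "(\<lambda>x. a * (\<Psi> x - (\<Sum>\<alpha>\<in>UNIV. c \<alpha> * ray_indicator \<alpha> x)) + b * (\<Phi> x - (\<Sum>\<alpha>\<in>UNIV. d \<alpha> * ray_indicator \<alpha> x))) \<in> L1 (real (\<beta> - 2))"
    using assms unfolding is_res_def by (intro L1_lincomb) auto
  moreover have "a * (\<Psi> x - (\<Sum>\<alpha>\<in>UNIV. c \<alpha> * ray_indicator \<alpha> x)) + b * (\<Phi> x - (\<Sum>\<alpha>\<in>UNIV. d \<alpha> * ray_indicator \<alpha> x)) =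
      (a * \<Psi> x + b * \<Phi> x) - (\<Sum>\<alpha>\<in>UNIV. (a * c \<alpha> + b * d \<alpha>) * ray_indicator \<alpha> x)" for x
    by (simp add: algebra_simps sum.distrib sum_distrib_left)
  ultimately show ?thesis unfolding is_res_def by simp
qed

lemma is_res_zero: "is_res (\<lambda>_. 0) (\<lambda>_. 0)"
proof -
  have "H (\<lambda>_. 0) = (\<lambda>_. 0)" using H_lincomb[OF dom_zero dom_zero, of 0 0] by simp
  thus ?thesis using dom_zero unfolding is_res_def gen_eigenspace_def by (auto simp: dual_dom L1_iff)
qed

lemma is_res_sum:
  assumes "finite I" "\<And>i. i \<in> I \<Longrightarrow> is_res (\<Psi> i) (c i)"
  shows "is_res (\<lambda>x. \<Sum>i\<in>I. a i * \<Psi> i x) (\<lambda>\<alpha>. \<Sum>i\<in>I. a i * c i \<alpha>)"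
  using assms
proof (induction I)
  case (insert i I)
  thus ?case using is_res_lincomb[of "\<Psi> i" "c i" "\<lambda>x. \<Sum>i\<in>I. a i * \<Psi> i x" "\<lambda>\<alpha>. \<Sum>i\<in>I. a i * c i \<alpha>" "a i" 1] by simp
qed (simp add: is_res_zero)

lemma is_res_unique:
  assumes "is_res \<Psi> c" "is_res \<Psi> d"
  shows "c = d"
proof
  fix \<alpha>
  show "c \<alpha> = d \<alpha>"
    using assms unfolding is_res_def by (blast intro: LIMSEQ_unique resonance_limit)
qed

lemma is_res_bounded:
  assumes "is_res \<Psi> c"
  shows "\<exists>C. \<forall>p. norm (\<Psi> p) \<le> C"
proof -
  let ?w = "\<lambda>x. \<Psi> x - (\<Sum>\<alpha>\<in>UNIV. c \<alpha> * ray_indicator \<alpha> x)"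
  have w: "?w \<in> L1 (real (\<beta> - 2))" using assms by (simp add: is_res_def)
  have "norm (\<Psi> p) \<le> ell2_norm ?w + (\<Sum>\<alpha>\<in>UNIV. norm (c \<alpha>))" for p
  proof -
    have "norm (\<Sum>\<alpha>\<in>UNIV. c \<alpha> * ray_indicator \<alpha> p) \<le> (\<Sum>\<alpha>\<in>UNIV. norm (c \<alpha>))"
    proof (rule sum_norm_le)
      fix \<alpha>
      have "norm (ray_indicator \<alpha> p) \<le> 1" by (cases p) auto
      thus "norm (c \<alpha> * ray_indicator \<alpha> p) \<le> norm (c \<alpha>)" by (simp add: norm_mult mult_left_le)
    qed
    moreover have "norm (?w p) \<le> ell2_norm ?w" by (rule ell2_point_bound[OF L1_ell2(1)[OF w]])
    ultimately show ?thesis using norm_triangle_sub[of "\<Psi> p" "\<Sum>\<alpha>\<in>UNIV. c \<alpha> * ray_indicator \<alpha> p"] by linarith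
  qed
  thus ?thesis by blast
qed

lemma Mcoef_0_apply: "blinfun_apply (Mcoef 0) k = U k + adjoint_op v (G0 (v k))"
proof -
  obtain B where B: "adm B (free_coef E att 0)" using adm_free_coef[of 0] beta by auto
  show ?thesis using beta
    by (simp add: Mcoef_def blinfun.add_left Theta_apply[OF B[unfolded free_coef_0_fun]] free_coef_0_fun)
qed

lemma G0_v_dom: "\<exists>B. dom B (G0 (v k))"
  using kernel_dom adm_free_res_0 by blast

text \<open>Put k = U v^* \<Psi>, so that V \<Psi> = v k. Then \<Psi> + G0 (v k) is bounded and
  annihilated by H_0, hence zero. Applying v^* to \<Psi> = - G0 (v k) and using U U = 1 gives M_0 k
  = 0; the limits of G0 (v k) along the rays identify c.\<close>

lemma resonance_to_kernel:
  assumes "is_res \<Psi> c"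
  shows "\<Psi> = (\<lambda>x. - G0 (v (U (adjoint_op v \<Psi>))) x)" "blinfun_apply (Mcoef 0) (U (adjoint_op v \<Psi>)) = 0"
    "c \<alpha> = - moment \<alpha> (v (U (adjoint_op v \<Psi>)))"
proof -
  let ?k = "U (adjoint_op v \<Psi>)"
  obtain C where C: "\<And>p. norm (\<Psi> p) \<le> C" using is_res_bounded[OF assms] by blast
  have d: "dom C \<Psi>" by (rule bounded_dom[OF C])
  have "H \<Psi> = (\<lambda>x. 0)" using assms by (simp add: is_res_def gen_eigenspace_def)
  hence H0: "H0 E att \<Psi> x = - v ?k x" for x
    unfolding H_op_def V_eq[OF d] by (metis add_eq_0_iff2)
  obtain D where D: "\<And>p. norm (G0 (v ?k) p) \<le> D" using G0_bound v_L1 by blast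
  have "1 * \<Psi> p + 1 * G0 (v ?k) p = 0" for p
  proof (rule bounded_harmonic_zero[OF graph])
    show "H0 E att (\<lambda>p. 1 * \<Psi> p + 1 * G0 (v ?k) p) q = 0" for q
      unfolding H0_lincomb by (simp add: H0 H0_G0[OF v_L1])
    show "norm (1 * \<Psi> p + 1 * G0 (v ?k) p) \<le> C + D" for p
      using C[of p] D[of p] norm_triangle_ineq[of "\<Psi> p" "G0 (v ?k) p"] by simp
  qed
  thus eq: "\<Psi> = (\<lambda>x. - G0 (v ?k) x)" by (auto simp: eq_neg_iff_add_eq_0)
  obtain B where B: "dom B (G0 (v ?k))" using G0_v_dom by blast
  have "adjoint_op v \<Psi> = - adjoint_op v (G0 (v ?k))"
    using adjoint_scale[OF B, of "-1"] eq by (simp add: scaleC_minus_left)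
  thus "blinfun_apply (Mcoef 0) ?k = 0"
    unfolding Mcoef_0_apply U_U eq_neg_iff_add_eq_0[symmetric] .
  have "is_res \<Psi> (\<lambda>\<alpha>. - moment \<alpha> (v ?k))"
  proof -
    have "(\<lambda>x. (-1) * (G0 (v ?k) x - (\<Sum>\<alpha>\<in>UNIV. moment \<alpha> (v ?k) * ray_indicator \<alpha> x)) + 0 * 0) \<in> L1 (real (\<beta> - 2))"
      by (intro L1_lincomb G0_asymptotics v_L1) (simp add: L1_iff)
    moreover have "(-1) * (G0 (v ?k) x - (\<Sum>\<alpha>\<in>UNIV. moment \<alpha> (v ?k) * ray_indicator \<alpha> x)) + 0 * 0 =
        \<Psi> x - (\<Sum>\<alpha>\<in>UNIV. - moment \<alpha> (v ?k) * ray_indicator \<alpha> x)" for x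
      by (subst (2) eq) (simp add: sum_negf)
    ultimately show ?thesis using assms by (simp add: is_res_def)
  qed
  from is_res_unique[OF assms this] show "c \<alpha> = - moment \<alpha> (v ?k)" by (rule fun_cong)
qed

text \<open>The converse passage. For \<Psi> = - G0 (v k) the equation M_0 k = 0 reads v^* \<Psi> =
  U k, so V \<Psi> = v k cancels H_0 \<Psi> = - v k. Together with
  \<open>resonance_to_kernel\<close> this makes resonances and kernel vectors correspond one to
  one.\<close>

lemma kernel_to_resonance:
  assumes "blinfun_apply (Mcoef 0) k = 0"
  shows "is_res (\<lambda>x. - G0 (v k) x) (\<lambda>\<alpha>. - moment \<alpha> (v k))"
    "U (adjoint_op v (\<lambda>x. - G0 (v k) x)) = k"
proof -
  let ?\<Psi> = "\<lambda>x. - G0 (v k) x"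
  obtain B where B: "dom B (G0 (v k))" using G0_v_dom by blast
  have d: "dom B ?\<Psi>" using B by (simp add: dom_def)
  have "adjoint_op v ?\<Psi> = - adjoint_op v (G0 (v k))"
    using adjoint_scale[OF B, of "-1"] by (simp add: scaleC_minus_left)
  also have "\<dots> = U k" using assms unfolding Mcoef_0_apply eq_neg_iff_add_eq_0[symmetric] by simp
  finally show uk: "U (adjoint_op v ?\<Psi>) = k" by (simp add: U_U)
  have "H ?\<Psi> = (\<lambda>x. 0)"
  proof
    fix x
    have "H0 E att ?\<Psi> x = - v k x"
      using H0_lincomb[of E att "-1" "G0 (v k)" 0 "\<lambda>_. 0" x] H0_G0[OF v_L1, of k x] by simp
    thus "H ?\<Psi> x = 0" by (simp add: H_op_def V_eq[OF d] uk)
  qed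
  moreover have L: "(\<lambda>x. (-1) * (G0 (v k) x - (\<Sum>\<alpha>\<in>UNIV. moment \<alpha> (v k) * ray_indicator \<alpha> x)) + 0 * 0) \<in> L1 (real (\<beta> - 2))"
    by (intro L1_lincomb G0_asymptotics v_L1) (simp add: L1_iff)
  have eq: "(-1) * (G0 (v k) x - (\<Sum>\<alpha>\<in>UNIV. moment \<alpha> (v k) * ray_indicator \<alpha> x)) + 0 * 0 =
      ?\<Psi> x - (\<Sum>\<alpha>\<in>UNIV. - moment \<alpha> (v k) * ray_indicator \<alpha> x)" for x
    by (simp add: sum_negf)
  have "?\<Psi> \<in> L1_dual (real \<beta>)" using d dual_dom by blast
  ultimately show "is_res ?\<Psi> (\<lambda>\<alpha>. - moment \<alpha> (v k))"
    using L[unfolded eq] unfolding is_res_def gen_eigenspace_def by blast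
qed

text \<open>Tested against v k and v l, each rank-one term of \<open>free_coef_1\<close> becomes a
  product of moments. On kernel vectors the moments are the asymptotic values up to sign, so M_1 is
  minus their Gram matrix.\<close>

lemma Mcoef_1_form:
  "cinner k (blinfun_apply (Mcoef 1) l) = - (\<Sum>\<alpha>\<in>UNIV. cnj (moment \<alpha> (v k)) * moment \<alpha> (v l))"
proof -
  obtain B where B: "adm B (free_coef E att 1)" using adm_free_coef[of 1] beta by auto
  have K: "kernel_op (free_coef E att 1) (v l) p = - (\<Sum>\<alpha>\<in>UNIV. ray_pos \<alpha> p * moment \<alpha> (v l))" for p
  proof -
    have "((\<lambda>q. \<Sum>\<alpha>\<in>UNIV. ray_pos \<alpha> p * (ray_pos \<alpha> q * v l q)) has_sum (\<Sum>\<alpha>\<in>UNIV. ray_pos \<alpha> p * moment \<alpha> (v l))) UNIV"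
      unfolding moment_def
      by (intro has_sum_sum_finite has_sum_cmult_right has_sum_infsum moment_summable[OF v_L1]) (use beta in auto)
    hence "((\<lambda>q. - (\<Sum>\<alpha>\<in>UNIV. ray_pos \<alpha> p * (ray_pos \<alpha> q * v l q))) has_sum - (\<Sum>\<alpha>\<in>UNIV. ray_pos \<alpha> p * moment \<alpha> (v l))) UNIV"
      by (rule has_sum_uminusI)
    moreover have "- (\<Sum>\<alpha>\<in>UNIV. ray_pos \<alpha> p * (ray_pos \<alpha> q * v l q)) = free_coef E att 1 p q * v l q" for q
      unfolding free_coef_1[OF graph] by (simp add: sum_distrib_right sum_distrib_left mult_ac)
    ultimately show ?thesis unfolding kernel_op_def by (metis (no_types, lifting) has_sum_cong infsumI)
  qed
  have "cinner (blinfun_apply (Mcoef 1) l) k = pairing (kernel_op (free_coef E att 1) (v l)) (v k)"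
    using beta by (simp add: Mcoef_def Theta_apply[OF B[unfolded One_nat_def]] adjoint_char[OF kernel_dom[OF B[unfolded One_nat_def]]])
  also have "\<dots> = - (\<Sum>\<alpha>\<in>UNIV. cnj (moment \<alpha> (v l)) * moment \<alpha> (v k))"
  proof -
    have "((\<lambda>p. \<Sum>\<alpha>\<in>UNIV. cnj (moment \<alpha> (v l)) * (ray_pos \<alpha> p * v k p)) has_sum (\<Sum>\<alpha>\<in>UNIV. cnj (moment \<alpha> (v l)) * moment \<alpha> (v k))) UNIV"
      unfolding moment_def[of _ "v k"]
      by (intro has_sum_sum_finite has_sum_cmult_right has_sum_infsum moment_summable[OF v_L1]) (use beta in auto)
    hence "((\<lambda>p. - (\<Sum>\<alpha>\<in>UNIV. cnj (moment \<alpha> (v l)) * (ray_pos \<alpha> p * v k p))) has_sum - (\<Sum>\<alpha>\<in>UNIV. cnj (moment \<alpha> (v l)) * moment \<alpha> (v k))) UNIV"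
      by (rule has_sum_uminusI)
    moreover have "- (\<Sum>\<alpha>\<in>UNIV. cnj (moment \<alpha> (v l)) * (ray_pos \<alpha> p * v k p)) = cnj (kernel_op (free_coef E att 1) (v l) p) * v k p" for p
      unfolding K by (simp add: sum_distrib_right sum_distrib_left mult_ac)
    ultimately show ?thesis unfolding pairing_def by (metis (no_types, lifting) has_sum_cong infsumI)
  qed
  finally have "cinner k (blinfun_apply (Mcoef 1) l) = cnj (- (\<Sum>\<alpha>\<in>UNIV. cnj (moment \<alpha> (v l)) * moment \<alpha> (v k)))"
    by (subst cinner_commute) simp
  thus ?thesis by (simp add: mult.commute)
qed

end

section \<open>Orthonormal resonance bases\<close>

definition ip :: "('r::finite \<Rightarrow> complex) \<Rightarrow> ('r \<Rightarrow> complex) \<Rightarrow> complex" where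
  "ip c d = (\<Sum>\<alpha>\<in>UNIV. cnj (c \<alpha>) * d \<alpha>)"

definition orthonormal :: "('r::finite \<Rightarrow> complex) set \<Rightarrow> bool" where
  "orthonormal S \<longleftrightarrow> (\<forall>c\<in>S. \<forall>d\<in>S. ip c d = (if c = d then 1 else 0))"

lemma ip_lincomb: "ip c (\<lambda>\<alpha>. a * d \<alpha> + b * e \<alpha>) = a * ip c d + b * ip c e"
  by (simp add: ip_def sum.distrib sum_distrib_left algebra_simps)

lemma ip_sum: "ip c (\<lambda>\<alpha>. \<Sum>i\<in>I. a i * d i \<alpha>) = (\<Sum>i\<in>I. a i * ip c (d i))"
proof -
  have "ip c (\<lambda>\<alpha>. \<Sum>i\<in>I. a i * d i \<alpha>) = (\<Sum>\<alpha>\<in>UNIV. \<Sum>i\<in>I. a i * (cnj (c \<alpha>) * d i \<alpha>))"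
    by (simp add: ip_def sum_distrib_left mult_ac)
  also have "\<dots> = (\<Sum>i\<in>I. \<Sum>\<alpha>\<in>UNIV. a i * (cnj (c \<alpha>) * d i \<alpha>))" by (rule sum.swap)
  finally show ?thesis by (simp add: ip_def sum_distrib_left)
qed

lemma ip_commute: "ip d c = cnj (ip c d)"
  by (simp add: ip_def mult.commute)

lemma ip_self: "ip c c = complex_of_real (\<Sum>\<alpha>\<in>UNIV. (norm (c \<alpha>))\<^sup>2)"
  by (simp add: ip_def complex_norm_square mult.commute flip: of_real_power)

text \<open>The Euclidean inner product is the real part of \<open>ip\<close>, so an orthonormal set
  becomes a set of pairwise orthogonal nonzero vectors. The real dimension is a crude bound,
  sufficient for a set of largest cardinality to exist.\<close>

lemma orthonormal_card:
  fixes S :: "('r::finite \<Rightarrow> complex) set"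
  assumes "orthonormal S"
  shows "finite S \<and> card S \<le> DIM(complex ^ 'r)"
proof -
  define f :: "('r \<Rightarrow> complex) \<Rightarrow> complex ^ 'r" where "f c = (\<chi> \<alpha>. c \<alpha>)" for c
  have inj: "inj f" by (auto simp: inj_def f_def vec_eq_iff)
  have inner: "inner (f c) (f d) = Re (ip c d)" for c d
    by (simp add: inner_vec_def f_def ip_def inner_complex_def)
  have "0 \<notin> f ` S"
  proof
    assume "0 \<in> f ` S"
    then obtain c where "c \<in> S" "f c = 0" by auto
    thus False using inner[of c c] assms by (simp add: orthonormal_def)
  qed
  moreover have "pairwise orthogonal (f ` S)"
    using assms by (auto simp: pairwise_def orthogonal_def inner orthonormal_def)
  ultimately have "independent (f ` S)" using pairwise_orthogonal_independent by blast
  hence "finite (f ` S)" "card (f ` S) \<le> DIM(complex ^ 'r)" using independent_bound[of "f ` S"] by auto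
  thus ?thesis using inj by (simp add: finite_image_iff card_image inj_on_subset)
qed

context threshold_setting
begin

text \<open>S is an orthonormal set of largest cardinality among the asymptotic vectors of
  resonances. A vector outside its span would leave a Gram-Schmidt residue, again the vector of a
  resonance, which after normalisation enlarges S. Resonances with vectors in S are then a basis
  modulo states with vanishing vector, the bound states; since these are trivial, orthogonality to
  them is automatic.\<close>

lemma orthonormal_resonance_basis_exists:
  assumes bs: "\<And>\<Psi>. is_res \<Psi> (\<lambda>_. 0) \<Longrightarrow> \<Psi> = (\<lambda>_. 0)"
  shows "\<exists>B. orthonormal_resonance_basis (real \<beta>) H B"
proof -
  define C where "C = {c. \<exists>\<Psi>. is_res \<Psi> c}"
  have "\<exists>S. (S \<subseteq> C \<and> orthonormal S) \<and> (\<forall>T. T \<subseteq> C \<and> orthonormal T \<longrightarrow> card T \<le> card S)"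
  proof (rule ex_has_greatest_nat[where k = "{}" and b = "Suc DIM(complex ^ 'r)"])
    show "{} \<subseteq> C \<and> orthonormal {}" by (simp add: orthonormal_def)
    show "\<forall>T. T \<subseteq> C \<and> orthonormal T \<longrightarrow> card T < Suc DIM(complex ^ 'r)"
      using orthonormal_card le_imp_less_Suc by blast
  qed
  then obtain S where S: "S \<subseteq> C" "orthonormal S" and max: "\<And>T. T \<subseteq> C \<Longrightarrow> orthonormal T \<Longrightarrow> card T \<le> card S"
    by blast
  have fin: "finite S" using orthonormal_card[OF S(2)] by blast
  have ipS: "ip o1 o2 = (if o1 = o2 then 1 else 0)" if "o1 \<in> S" "o2 \<in> S" for o1 o2
    using S(2) that by (auto simp: orthonormal_def)
  have delta: "(\<Sum>o'\<in>S. a o' * ip o1 o') = a o1" if "o1 \<in> S" for a o1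
  proof -
    have "(\<Sum>o'\<in>S. a o' * ip o1 o') = (\<Sum>o'\<in>S. if o1 = o' then a o1 else 0)"
      using ipS[OF that] by (intro sum.cong refl) auto
    thus ?thesis using fin that by simp
  qed
  obtain P where P: "\<And>c. c \<in> S \<Longrightarrow> is_res (P c) c" using S(1) unfolding C_def by (auto simp: subset_iff) metis
  have injP: "inj_on P S" by (rule inj_onI) (metis P is_res_unique)
  define cc where "cc \<Psi> = (THE c. is_res \<Psi> c)" for \<Psi>
  have cc: "cc (P c) = c" if "c \<in> S" for c
    unfolding cc_def using P[OF that] is_res_unique by blast
  have span: "c = (\<lambda>\<alpha>. \<Sum>o'\<in>S. ip o' c * o' \<alpha>)" if c: "is_res \<Phi> c" for \<Phi> c
  proof (rule ccontr)
    assume ne: "c \<noteq> (\<lambda>\<alpha>. \<Sum>o'\<in>S. ip o' c * o' \<alpha>)"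
    define d where "d \<alpha> = 1 * c \<alpha> + (-1) * (\<Sum>o'\<in>S. ip o' c * o' \<alpha>)" for \<alpha>
    have dC: "is_res (\<lambda>x. 1 * \<Phi> x + (-1) * (\<Sum>o'\<in>S. ip o' c * P o' x)) d"
      unfolding d_def by (rule is_res_lincomb[OF c is_res_sum[OF fin P]])
    have od: "ip o1 d = 0" if "o1 \<in> S" for o1
      unfolding d_def ip_lincomb ip_sum delta[OF that] by simp
    have "d \<noteq> (\<lambda>_. 0)" using ne by (auto simp: d_def fun_eq_iff)
    then obtain \<alpha> where "d \<alpha> \<noteq> 0" by auto
    define n where "n = (\<Sum>\<alpha>\<in>UNIV. (norm (d \<alpha>))\<^sup>2)"
    have n: "n > 0" unfolding n_def by (rule sum_pos2[of _ \<alpha>]) (use \<open>d \<alpha> \<noteq> 0\<close> in auto)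
    \<comment> \<open>The zero second term puts the scaling into the shape of
      \<open>is_res_lincomb\<close>.\<close>
    define e where "e \<alpha> = of_real (1 / sqrt n) * d \<alpha> + 0 * d \<alpha>" for \<alpha>
    have eC: "e \<in> C" unfolding C_def e_def using is_res_lincomb[OF dC dC, of "of_real (1 / sqrt n)" 0] by blast
    have oe: "ip o1 e = 0" if "o1 \<in> S" for o1
      unfolding e_def ip_lincomb using od[OF that] by simp
    have "(norm (e \<alpha>))\<^sup>2 = (norm (d \<alpha>))\<^sup>2 / n" for \<alpha>
      using n by (simp add: e_def norm_mult norm_divide power_divide)
    hence "ip e e = complex_of_real (n / n)"
      unfolding ip_self by (simp add: sum_divide_distrib[symmetric] n_def[symmetric])
    hence ee: "ip e e = 1" using n by simp
    have "e \<notin> S" using oe[of e] ee by auto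
    moreover have "ip e o1 = 0" if "o1 \<in> S" for o1 using oe[OF that] ip_commute[of e o1] by simp
    hence "orthonormal (insert e S)" using ipS oe ee \<open>e \<notin> S\<close> unfolding orthonormal_def by auto
    ultimately show False using max[of "insert e S"] eC S(1) fin by simp
  qed
  let ?B = "P ` S"
  have comb: "(\<lambda>x. \<Sum>\<Psi>\<in>?B. a \<Psi> * \<Psi> x) = (\<lambda>x. \<Sum>c\<in>S. a (P c) * P c x)" for a
    by (rule ext) (simp add: sum.reindex[OF injP])
  have "orthonormal_resonance_basis (real \<beta>) H ?B"
    unfolding orthonormal_resonance_basis_def
  proof (intro conjI allI impI ballI)
    show "finite ?B" using fin by simp
    show "?B \<subseteq> resonance_space (real \<beta>) H" using P resonance_space_iff by blast
    fix a \<Psi> assume a: "(\<lambda>x. \<Sum>\<Psi>\<in>?B. a \<Psi> * \<Psi> x) \<in> bound_space (real \<beta>) H" and "\<Psi> \<in> ?B"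
    then obtain c where c: "c \<in> S" "\<Psi> = P c" by blast
    have "is_res (\<lambda>x. \<Sum>c\<in>S. a (P c) * P c x) (\<lambda>_. 0)" using a unfolding bound_space_iff comb .
    from is_res_unique[OF this is_res_sum[OF fin P]]
    have "(\<lambda>\<alpha>. \<Sum>c\<in>S. a (P c) * c \<alpha>) = (\<lambda>_. 0)" by simp
    hence "ip c (\<lambda>\<alpha>. \<Sum>c\<in>S. a (P c) * c \<alpha>) = 0" by (simp add: ip_def)
    thus "a \<Psi> = 0" unfolding ip_sum delta[OF c(1)] c(2) .
  next
    fix \<Phi> assume "\<Phi> \<in> resonance_space (real \<beta>) H"
    then obtain c where c: "is_res \<Phi> c" using resonance_space_iff by blast
    have "is_res (\<lambda>x. 1 * \<Phi> x + (-1) * (\<Sum>o'\<in>S. ip o' c * P o' x)) (\<lambda>\<alpha>. 1 * c \<alpha> + (-1) * (\<Sum>o'\<in>S. ip o' c * o' \<alpha>))"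
      by (rule is_res_lincomb[OF c is_res_sum[OF fin P]])
    also have "(\<lambda>\<alpha>. 1 * c \<alpha> + (-1) * (\<Sum>o'\<in>S. ip o' c * o' \<alpha>)) = (\<lambda>_. 0)"
      using fun_cong[OF span[OF c]] by (intro ext) simp
    finally have "(\<lambda>x. \<Phi> x - (\<Sum>o'\<in>S. ip o' c * P o' x)) \<in> bound_space (real \<beta>) H"
      by (simp add: bound_space_iff)
    moreover have "(\<Sum>o'\<in>S. ip o' c * P o' x) = (\<Sum>\<Psi>\<in>?B. ip (cc \<Psi>) c * \<Psi> x)" for x
      unfolding sum.reindex[OF injP] by (intro sum.cong refl) (simp add: cc)
    ultimately show "\<exists>a. (\<lambda>x. \<Phi> x - (\<Sum>\<Psi>\<in>?B. a \<Psi> * \<Psi> x)) \<in> bound_space (real \<beta>) H"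
      by (intro exI[of _ "\<lambda>\<Psi>. ip (cc \<Psi>) c"]) simp
  next
    fix \<Phi> \<Psi> assume "\<Psi> \<in> bound_space (real \<beta>) H"
    hence "\<Psi> = (\<lambda>_. 0)" using bs bound_space_iff by blast
    thus "(\<lambda>x. cnj (\<Psi> x) * \<Phi> x) \<in> L1 0" "pairing \<Psi> \<Phi> = 0" by (auto simp: L1_def pairing_def)
  next
    have "\<forall>\<Phi>\<in>?B. \<forall>\<Psi>\<in>?B. (\<Sum>\<alpha>\<in>UNIV. cnj (cc \<Phi> \<alpha>) * cc \<Psi> \<alpha>) = (if \<Phi> = \<Psi> then 1 else 0)"
    proof (intro ballI)
      fix \<Phi> \<Psi> assume "\<Phi> \<in> ?B" "\<Psi> \<in> ?B"
      then obtain c d where cd: "c \<in> S" "d \<in> S" "\<Phi> = P c" "\<Psi> = P d" by blast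
      have "ip c d = (if P c = P d then 1 else 0)" using ipS[OF cd(1,2)] injP cd by (simp add: inj_on_eq_iff)
      thus "(\<Sum>\<alpha>\<in>UNIV. cnj (cc \<Phi> \<alpha>) * cc \<Psi> \<alpha>) = (if \<Phi> = \<Psi> then 1 else 0)"
        using cd by (simp add: cc ip_def)
    qed
    moreover have "\<forall>\<Psi>\<in>?B. (\<lambda>x. \<Psi> x - (\<Sum>\<alpha>\<in>UNIV. cc \<Psi> \<alpha> * ray_indicator \<alpha> x)) \<in> L1 (real \<beta> - 2)"
      using P cc unfolding b2 is_res_def by auto
    ultimately show "\<exists>c. (\<forall>\<Phi>\<in>?B. \<forall>\<Psi>\<in>?B. (\<Sum>\<alpha>\<in>UNIV. cnj (c \<Phi> \<alpha>) * c \<Psi> \<alpha>) = (if \<Phi> = \<Psi> then 1 else 0)) \<and>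
        (\<forall>\<Psi>\<in>?B. (\<lambda>x. \<Psi> x - (\<Sum>\<alpha>\<in>UNIV. c \<Psi> \<alpha> * ray_indicator \<alpha> x)) \<in> L1 (real \<beta> - 2))" by blast
  qed
  thus ?thesis by blast
qed

text \<open>The projection refers to some chosen bound basis, so the empty one must be shown to be
  the only candidate: over the zero space the other subset, {0}, is linearly dependent.\<close>

lemma bound_projection_zero:
  assumes bs: "bound_space (real \<beta>) H = {\<lambda>x. 0}"
  shows "bound_projection (real \<beta>) H u = (\<lambda>x. 0)"
proof -
  have "orthonormal_bound_basis (real \<beta>) H {}"
    unfolding orthonormal_bound_basis_def bs by auto
  hence "orthonormal_bound_basis (real \<beta>) H (SOME B. orthonormal_bound_basis (real \<beta>) H B)" by (rule someI)
  moreover have "B = {}" if "orthonormal_bound_basis (real \<beta>) H B" for B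
  proof (rule ccontr)
    assume "B \<noteq> {}"
    moreover have "B \<subseteq> {\<lambda>x. 0}" using that bs unfolding orthonormal_bound_basis_def by blast
    ultimately have B: "B = {\<lambda>x. 0}" by blast
    have "\<forall>a. (\<lambda>x. \<Sum>\<Psi>\<in>B. a \<Psi> * \<Psi> x) = (\<lambda>x. 0) \<longrightarrow> (\<forall>\<Psi>\<in>B. a \<Psi> = 0)"
      using that unfolding orthonormal_bound_basis_def by blast
    from this[rule_format, of "\<lambda>_. 1"] show False by (simp add: B)
  qed
  ultimately have "(SOME B. orthonormal_bound_basis (real \<beta>) H B) = {}" by blast
  thus ?thesis by (simp add: bound_projection_def rank_sum_def)
qed

end

section \<open>Self-adjointness on square-summable functions\<close>

lemma ell2_reindex:
  assumes u: "u \<in> ell2" and w: "\<And>p. w p \<noteq> 0 \<Longrightarrow> w p = u (g p)" and inj: "inj_on g {p. w p \<noteq> 0}"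
  shows "w \<in> ell2"
proof (rule ell2I(1)[OF ell2_norm_nonneg[of u]])
  fix X :: "('c, 'd) vertex set" assume X: "finite X"
  let ?X = "{p \<in> X. w p \<noteq> 0}"
  have "(\<Sum>p\<in>X. (norm (w p))\<^sup>2) = (\<Sum>p\<in>?X. (norm (u (g p)))\<^sup>2)"
    using X w by (intro sum.mono_neutral_cong_right) auto
  also have "\<dots> = (\<Sum>q\<in>g ` ?X. (norm (u q))\<^sup>2)"
    by (subst sum.reindex) (auto intro: inj_on_subset[OF inj])
  also have "\<dots> \<le> (ell2_norm u)\<^sup>2" by (rule ell2_finite_sum[OF u]) (use X in simp)
  finally show "(\<Sum>p\<in>X. (norm (w p))\<^sup>2) \<le> (ell2_norm u)\<^sup>2" .
qed

fun ray_succ :: "('k, 'r) vertex \<Rightarrow> ('k, 'r) vertex" where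
  "ray_succ (Core x) = Core x"
| "ray_succ (Ray \<alpha> m) = Ray \<alpha> (Suc m)"

fun shift_up :: "('k, 'r) oper" where
  "shift_up u (Core x) = 0"
| "shift_up u (Ray \<alpha> m) = u (Ray \<alpha> (Suc m))"

fun ray_pred :: "('k, 'r) vertex \<Rightarrow> ('k, 'r) vertex" where
  "ray_pred (Core x) = Core x"
| "ray_pred (Ray \<alpha> m) = Ray \<alpha> (m - 1)"

fun shift_down :: "('k, 'r) oper" where
  "shift_down u (Core x) = 0"
| "shift_down u (Ray \<alpha> 0) = 0"
| "shift_down u (Ray \<alpha> (Suc m)) = u (Ray \<alpha> m)"

text \<open>The subtracted 2 u compensates the diagonal term 2 u, which
  \<open>H0_decomposition\<close> applies at every vertex and not only on the rays.\<close>

fun core_part :: "('k::finite \<Rightarrow> 'k \<Rightarrow> bool) \<Rightarrow> ('r::finite \<Rightarrow> 'k) \<Rightarrow> ('k, 'r) oper" where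
  "core_part E att u (Core x) = h_core E att (\<lambda>y. u (Core y)) x - 2 * u (Core x)"
| "core_part E att u (Ray \<alpha> m) = 0"

lemma H0_decomposition:
  "H0 E att u p = ((2 * u p + (-1) * shift_up u p) + (-1) * shift_down u p) + core_part E att u p"
proof (cases p)
  case (Ray \<alpha> m)
  thus ?thesis by (cases m) auto
qed simp

lemma shift_up_ell2: "u \<in> ell2 \<Longrightarrow> shift_up u \<in> ell2"
proof (rule ell2_reindex[where g = ray_succ])
  show "shift_up u p \<noteq> 0 \<Longrightarrow> shift_up u p = u (ray_succ p)" for p by (cases p) auto
  show "inj_on ray_succ {p. shift_up u p \<noteq> 0}"
  proof (rule inj_onI)
    show "ray_succ p = ray_succ q \<Longrightarrow> p = q" for p q :: "('a, 'b) vertex" by (cases p; cases q) auto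
  qed
qed

lemma shift_down_nz: "shift_down u p \<noteq> 0 \<Longrightarrow> \<exists>\<alpha> m. p = Ray \<alpha> (Suc m)"
  by (cases "(u, p)" rule: shift_down.cases) auto

lemma shift_down_ell2: "u \<in> ell2 \<Longrightarrow> shift_down u \<in> ell2"
proof (rule ell2_reindex[where g = ray_pred])
  show "shift_down u p \<noteq> 0 \<Longrightarrow> shift_down u p = u (ray_pred p)" for p
    using shift_down_nz[of u p] by auto
  show "inj_on ray_pred {p. shift_down u p \<noteq> 0}"
    by (rule inj_onI) (auto dest!: shift_down_nz)
qed

lemma core_part_ell2: "core_part E att u \<in> ell2"
  unfolding ell2_def mem_Collect_eq
proof (rule finite_nonzero_values_imp_summable_on)
  have "{p \<in> UNIV. (norm (core_part E att u p))\<^sup>2 \<noteq> 0} \<subseteq> range Core"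
  proof
    fix p assume "p \<in> {p \<in> UNIV. (norm (core_part E att u p))\<^sup>2 \<noteq> 0}"
    thus "p \<in> range Core" by (cases p) auto
  qed
  thus "finite {p \<in> UNIV. (norm (core_part E att u p))\<^sup>2 \<noteq> 0}" by (rule finite_subset) simp
qed

lemma H0_ell2:
  assumes "u \<in> ell2"
  shows "H0 E att u \<in> ell2"
  unfolding H0_decomposition[abs_def]
  by (intro ell2_add(1) ell2_scale core_part_ell2 shift_up_ell2 shift_down_ell2 assms)

lemma pairing_lincomb:
  assumes "w \<in> ell2" "u \<in> ell2" "u' \<in> ell2"
  shows "pairing w (\<lambda>x. a * u x + b * u' x) = a * pairing w u + b * pairing w u'"
    "pairing (\<lambda>x. a * u x + b * u' x) w = cnj a * pairing u w + cnj b * pairing u' w"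
proof -
  have c: "(\<lambda>x. cnj (f x)) \<in> ell2" if "f \<in> ell2" for f :: "('a, 'b) state"
    using that by (simp add: ell2_def)
  have s: "(\<lambda>x. cnj (f x) * g x) summable_on UNIV" if "f \<in> ell2" "g \<in> ell2" for f g :: "('a, 'b) state"
    using ell2_product_summable[OF c[OF that(1)] that(2)] .
  have "pairing w (\<lambda>x. a * u x + b * u' x) = (\<Sum>\<^sub>\<infinity>x. a * (cnj (w x) * u x) + b * (cnj (w x) * u' x))"
    by (simp add: pairing_def algebra_simps)
  also have "\<dots> = a * pairing w u + b * pairing w u'"
    unfolding pairing_def infsum_cmult_right'[symmetric]
    by (intro infsum_add summable_on_cmult_right s assms)
  finally show "pairing w (\<lambda>x. a * u x + b * u' x) = a * pairing w u + b * pairing w u'" .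
  have "pairing (\<lambda>x. a * u x + b * u' x) w = (\<Sum>\<^sub>\<infinity>x. cnj a * (cnj (u x) * w x) + cnj b * (cnj (u' x) * w x))"
    by (simp add: pairing_def algebra_simps)
  also have "\<dots> = cnj a * pairing u w + cnj b * pairing u' w"
    unfolding pairing_def infsum_cmult_right'[symmetric]
    by (intro infsum_add summable_on_cmult_right s assms)
  finally show "pairing (\<lambda>x. a * u x + b * u' x) w = cnj a * pairing u w + cnj b * pairing u' w" .
qed

lemma pairing_commute: "pairing w u = cnj (pairing u w)"
  by (simp add: pairing_def mult.commute flip: infsum_cnj)

lemma pairing_shift: "pairing (shift_up u) w = pairing u (shift_down w)"
proof -
  let ?R = "range (\<lambda>(\<alpha>, m). Ray \<alpha> m) :: ('a, 'b) vertex set"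
  have inj: "inj_on ray_succ ?R" by (rule inj_onI) auto
  have "pairing (shift_up u) w = (\<Sum>\<^sub>\<infinity>p\<in>?R. cnj (u (ray_succ p)) * w p)"
    unfolding pairing_def
  proof (rule infsum_cong_neutral)
    show "cnj (shift_up u p) * w p = 0" if "p \<in> UNIV - ?R" for p
      using that by (cases p) (auto simp: image_iff)
  qed auto
  also have "\<dots> = (\<Sum>\<^sub>\<infinity>q\<in>ray_succ ` ?R. cnj (u q) * shift_down w q)"
    by (subst infsum_reindex[OF inj]) (auto simp: o_def intro!: infsum_cong)
  also have "\<dots> = pairing u (shift_down w)"
    unfolding pairing_def
  proof (rule infsum_cong_neutral)
    show "cnj (u p) * shift_down w p = 0" if "p \<in> UNIV - ray_succ ` ?R" for p
    proof (rule ccontr)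
      assume "cnj (u p) * shift_down w p \<noteq> 0"
      hence "shift_down w p \<noteq> 0" by simp
      then obtain \<alpha> m where "p = Ray \<alpha> (Suc m)" using shift_down_nz by blast
      hence "p = ray_succ (Ray \<alpha> m)" "Ray \<alpha> m \<in> ?R" by auto
      thus False using that by blast
    qed
  qed auto
  finally show ?thesis .
qed

lemma pairing_core_part:
  fixes E :: "'k::finite \<Rightarrow> 'k \<Rightarrow> bool" and att :: "'r::finite \<Rightarrow> 'k"
  assumes "symp E"
  shows "pairing (core_part E att u) w = pairing u (core_part E att w)"
proof -
  have core: "(\<Sum>\<^sub>\<infinity>p. f p) = (\<Sum>x\<in>UNIV. f (Core x))" if "\<And>\<alpha> m. f (Ray \<alpha> m) = 0"
    for f :: "('k, 'r) vertex \<Rightarrow> complex"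
  proof -
    have "(\<Sum>\<^sub>\<infinity>p. f p) = (\<Sum>\<^sub>\<infinity>p\<in>range Core. f p)"
    proof (rule infsum_cong_neutral)
      show "f p = 0" if "p \<in> UNIV - range Core" for p
        using that \<open>\<And>\<alpha> m. f (Ray \<alpha> m) = 0\<close> by (cases p) auto
    qed auto
    also have "\<dots> = (\<Sum>p\<in>range Core. f p)" by simp
    also have "\<dots> = (\<Sum>x\<in>UNIV. f (Core x))" by (subst sum.reindex) (auto simp: inj_on_def)
    finally show ?thesis .
  qed
  let ?u = "\<lambda>x. u (Core x)" and ?w = "\<lambda>x. w (Core x)"
  have "pairing (core_part E att u) w = (\<Sum>x\<in>UNIV. cnj (h_core E att ?u x) * ?w x) - (\<Sum>x\<in>UNIV. 2 * (cnj (?u x) * ?w x))"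
    unfolding pairing_def by (subst core) (auto simp: left_diff_distrib right_diff_distrib sum_subtractf mult_ac)
  also have "(\<Sum>x\<in>UNIV. cnj (h_core E att ?u x) * ?w x) = (\<Sum>x\<in>UNIV. cnj (?u x) * h_core E att ?w x)"
    by (rule h_core_symmetric[OF assms])
  also have "\<dots> - (\<Sum>x\<in>UNIV. 2 * (cnj (?u x) * ?w x)) = pairing u (core_part E att w)"
    unfolding pairing_def by (subst core) (auto simp: left_diff_distrib right_diff_distrib sum_subtractf mult_ac)
  finally show ?thesis .
qed

lemma H0_symmetric:
  assumes sym: "symp E" and u: "u \<in> ell2" and w: "w \<in> ell2"
  shows "pairing (H0 E att u) w = pairing u (H0 E att w)"
proof -
  note e = ell2_lincomb ell2_add(1) ell2_scale shift_up_ell2 shift_down_ell2 core_part_ell2 u w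
  have right: "pairing f (H0 E att g) = 2 * pairing f g - pairing f (shift_up g) - pairing f (shift_down g) + pairing f (core_part E att g)"
    if "f \<in> ell2" "g \<in> ell2" for f g
  proof -
    have 1: "pairing f (\<lambda>x. 2 * g x + (-1) * shift_up g x) = 2 * pairing f g + (-1) * pairing f (shift_up g)"
      by (intro pairing_lincomb e that)
    have 2: "pairing f (\<lambda>x. 1 * (2 * g x + (-1) * shift_up g x) + (-1) * shift_down g x) =
        1 * pairing f (\<lambda>x. 2 * g x + (-1) * shift_up g x) + (-1) * pairing f (shift_down g)"
      by (intro pairing_lincomb e that)
    have 3: "pairing f (\<lambda>x. 1 * (1 * (2 * g x + (-1) * shift_up g x) + (-1) * shift_down g x) + 1 * core_part E att g x) =
        1 * pairing f (\<lambda>x. 1 * (2 * g x + (-1) * shift_up g x) + (-1) * shift_down g x) + 1 * pairing f (core_part E att g)"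
      by (intro pairing_lincomb e that)
    have "H0 E att g = (\<lambda>x. 1 * (1 * (2 * g x + (-1) * shift_up g x) + (-1) * shift_down g x) + 1 * core_part E att g x)"
      by (rule ext) (simp only: H0_decomposition mult_1)
    thus ?thesis by (simp only: 1 2 3) simp
  qed
  have "pairing (H0 E att u) w = cnj (pairing w (H0 E att u))" by (rule pairing_commute)
  also have "\<dots> = 2 * cnj (pairing w u) - cnj (pairing w (shift_up u)) - cnj (pairing w (shift_down u)) + cnj (pairing w (core_part E att u))"
    unfolding right[OF w u] by simp
  also have "cnj (pairing w u) = pairing u w" by (rule pairing_commute[symmetric])
  also have "cnj (pairing w (shift_up u)) = pairing (shift_up u) w" by (rule pairing_commute[symmetric])
  also have "pairing (shift_up u) w = pairing u (shift_down w)" by (rule pairing_shift)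
  also have "pairing w (shift_down u) = pairing (shift_up w) u" by (rule pairing_shift[symmetric])
  also have "cnj (pairing (shift_up w) u) = pairing u (shift_up w)" by (rule pairing_commute[symmetric])
  also have "cnj (pairing w (core_part E att u)) = pairing (core_part E att u) w" by (rule pairing_commute[symmetric])
  also have "pairing (core_part E att u) w = pairing u (core_part E att w)" by (rule pairing_core_part[OF sym])
  finally show ?thesis unfolding right[OF u w] by simp
qed

section \<open>The resolvent\<close>

context threshold_setting
begin

text \<open>\<open>L\<close> enters as a function of the parameter because these conditions are
  imposed at \<kappa> and at its conjugate simultaneously.\<close>

definition good :: "(complex \<Rightarrow> 'h \<Rightarrow>\<^sub>L 'h) \<Rightarrow> complex \<Rightarrow> bool" where
  "good L \<kappa> \<longleftrightarrow> Re \<kappa> > 0 \<and> norm \<kappa> < 2 \<and> det (core_mat E att (\<kappa>\<^sup>2)) \<noteq> 0 \<and>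
     (\<exists>B. adm B (free_res E att \<kappa>)) \<and> Mop \<kappa> o\<^sub>L L \<kappa> = id_blinfun"

definition res_op :: "(complex \<Rightarrow> 'h \<Rightarrow>\<^sub>L 'h) \<Rightarrow> complex \<Rightarrow> ('k, 'r) oper" where
  "res_op L \<kappa> f = (\<lambda>p. kernel_op (free_res E att \<kappa>) f p -
     kernel_op (free_res E att \<kappa>) (v (blinfun_apply (L \<kappa>) (adjoint_op v (kernel_op (free_res E att \<kappa>) f)))) p)"

lemma free_kernel:
  assumes \<kappa>: "Re \<kappa> > 0" "norm \<kappa> < 2"
  shows "\<exists>K\<ge>0. (\<forall>f\<in>ell2. (\<forall>p. (\<lambda>q. free_res E att \<kappa> p q * f q) summable_on UNIV) \<and>
      kernel_op (free_res E att \<kappa>) f \<in> ell2 \<and> ell2_norm (kernel_op (free_res E att \<kappa>) f) \<le> K * ell2_norm f) \<and>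
      (\<forall>p q. norm (free_res E att \<kappa> p q) \<le> K)"
proof -
  obtain K where K: "K \<ge> 0" "\<And>p Y. finite Y \<Longrightarrow> (\<Sum>q\<in>Y. norm (free_res E att \<kappa> p q)) \<le> K"
    "\<And>p Y. finite Y \<Longrightarrow> (\<Sum>q\<in>Y. norm (free_res E att \<kappa> q p)) \<le> K"
    using free_res_sum_bound[OF \<kappa>, of E att] by blast
  have "norm (free_res E att \<kappa> p q) \<le> K" for p q using K(2)[of "{q}" p] by simp
  thus ?thesis using schur_test[of K "free_res E att \<kappa>", OF K] K(1) by blast
qed

lemma v_ell2: "v k \<in> ell2" "ell2_norm (v k) \<le> Cv * norm k"
  using L1_ell2[OF v_L1, of k] Cv(2)[of k] by auto

lemma ell2_dom: "f \<in> ell2 \<Longrightarrow> dom (ell2_norm f) f"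
  using bounded_dom ell2_point_bound by blast

lemma V_ell2: "u \<in> ell2 \<Longrightarrow> V u \<in> ell2"
  using V_eq[OF ell2_dom] v_ell2 by simp

lemma H_ell2: "u \<in> ell2 \<Longrightarrow> H u \<in> ell2"
  unfolding H_op_def by (intro ell2_add H0_ell2 V_ell2)

lemma V_symmetric: "u \<in> ell2 \<Longrightarrow> w \<in> ell2 \<Longrightarrow> pairing (V u) w = pairing u (V w)"
  using A unfolding assumption_A_def selfadjoint_ell2_def by blast

lemma H_symmetric:
  assumes u: "u \<in> ell2" and w: "w \<in> ell2"
  shows "pairing (H u) w = pairing u (H w)"
proof -
  have sym: "symp E" using graph by (simp add: simple_connected_graph_def)
  have "pairing (H u) w = pairing (\<lambda>x. 1 * H0 E att u x + 1 * V u x) w" by (simp add: H_op_def)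
  also have "\<dots> = pairing (H0 E att u) w + pairing (V u) w"
    by (subst pairing_lincomb(2)[OF w H0_ell2[OF u] V_ell2[OF u]]) simp
  also have "\<dots> = pairing u (H0 E att w) + pairing u (V w)"
    by (simp add: H0_symmetric[OF sym u w] V_symmetric[OF u w])
  also have "\<dots> = pairing u (\<lambda>x. 1 * H0 E att w x + 1 * V w x)"
    by (subst pairing_lincomb(1)[OF u H0_ell2[OF w] V_ell2[OF w]]) simp
  finally show ?thesis by (simp add: H_op_def)
qed

text \<open>Let k = L v^* R_0 f and u = R_0 f - R_0 v k. The equation M k = v^* R_0 f says v^* u = U
  k, so V u = v U U k = v k. This cancels the term - v k left over by (H_0 + \<kappa>^2) u = f - v
  k.\<close>

lemma res_op_solves:
  assumes g: "good L \<kappa>" and f: "f \<in> ell2"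
  shows "H (res_op L \<kappa> f) p + \<kappa>\<^sup>2 * res_op L \<kappa> f p = f p"
proof -
  let ?R = "kernel_op (free_res E att \<kappa>)"
  have \<kappa>: "Re \<kappa> > 0" "norm \<kappa> < 2" and det: "det (core_mat E att (\<kappa>\<^sup>2)) \<noteq> 0"
    and M: "Mop \<kappa> o\<^sub>L L \<kappa> = id_blinfun" using g by (auto simp: good_def)
  obtain B where B: "adm B (free_res E att \<kappa>)" using g by (auto simp: good_def)
  obtain K where K: "\<And>f p. f \<in> ell2 \<Longrightarrow> (\<lambda>q. free_res E att \<kappa> p q * f q) summable_on UNIV"
    "\<And>f. f \<in> ell2 \<Longrightarrow> ?R f \<in> ell2" using free_kernel[OF \<kappa>] by blast
  define h where "h = adjoint_op v (?R f)"
  define k where "k = blinfun_apply (L \<kappa>) h"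
  have u: "res_op L \<kappa> f = (\<lambda>p. 1 * ?R f p + (-1) * ?R (v k) p)"
    by (simp add: res_op_def h_def k_def)
  have d1: "dom (ell2_norm (?R f)) (?R f)" and d2: "dom (ell2_norm (?R (v k))) (?R (v k))"
    by (intro ell2_dom K f v_ell2)+
  have "blinfun_apply (Mop \<kappa>) k = h"
    using arg_cong[OF M, of "\<lambda>A. blinfun_apply A h"] by (simp add: k_def)
  hence Uk: "U k = h - adjoint_op v (?R (v k))"
    by (simp add: Mop_def blinfun.add_left Theta_apply[OF B] algebra_simps)
  have "adjoint_op v (res_op L \<kappa> f) = U k"
    unfolding u adjoint_lincomb[OF d1 d2] Uk h_def by (simp add: scaleC_minus_left)
  hence V: "V (res_op L \<kappa> f) = v k"
    using V_eq[OF dom_lincomb[OF d1 d2], of 1 "-1"] by (simp add: u U_U)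
  have 1: "H0 E att (?R f) p + \<kappa>\<^sup>2 * ?R f p = f p" by (rule H0_kernel_op[OF det K(1)[OF f]])
  have 2: "H0 E att (?R (v k)) p + \<kappa>\<^sup>2 * ?R (v k) p = v k p" by (rule H0_kernel_op[OF det K(1)[OF v_ell2(1)]])
  have "H0 E att (res_op L \<kappa> f) p = 1 * H0 E att (?R f) p + (-1) * H0 E att (?R (v k)) p"
    unfolding u by (rule H0_lincomb)
  hence "H (res_op L \<kappa> f) p + \<kappa>\<^sup>2 * res_op L \<kappa> f p =
      (H0 E att (?R f) p + \<kappa>\<^sup>2 * ?R f p) - (H0 E att (?R (v k)) p + \<kappa>\<^sup>2 * ?R (v k) p) + v k p"
    unfolding H_op_def V by (simp add: u algebra_simps)
  thus ?thesis unfolding 1 2 by simp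
qed

lemma res_op_bounded:
  assumes g: "good L \<kappa>"
  shows "\<exists>C. \<forall>f\<in>ell2. res_op L \<kappa> f \<in> ell2 \<and> ell2_norm (res_op L \<kappa> f) \<le> C * ell2_norm f"
proof -
  let ?R = "kernel_op (free_res E att \<kappa>)"
  have \<kappa>: "Re \<kappa> > 0" "norm \<kappa> < 2" using g by (auto simp: good_def)
  obtain K where K: "K \<ge> 0" "\<And>f. f \<in> ell2 \<Longrightarrow> ?R f \<in> ell2" "\<And>f. f \<in> ell2 \<Longrightarrow> ell2_norm (?R f) \<le> K * ell2_norm f"
    using free_kernel[OF \<kappa>] by blast
  have "res_op L \<kappa> f \<in> ell2 \<and> ell2_norm (res_op L \<kappa> f) \<le> (2 * (K + K * (Cv * (norm (L \<kappa>) * (K * Cv))))) * ell2_norm f"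
    if f: "f \<in> ell2" for f
  proof -
    define h where "h = adjoint_op v (?R f)"
    define k where "k = blinfun_apply (L \<kappa>) h"
    have u: "res_op L \<kappa> f = (\<lambda>p. ?R f p + - ?R (v k) p)"
      by (simp add: res_op_def h_def k_def)
    have e: "?R f \<in> ell2" "(\<lambda>p. - ?R (v k) p) \<in> ell2" "ell2_norm (\<lambda>p. - ?R (v k) p) = ell2_norm (?R (v k))"
      by (intro K f ell2_uminus v_ell2)+
    have "norm h \<le> ell2_norm (?R f) * Cv" unfolding h_def by (rule adjoint_norm[OF ell2_dom[OF e(1)]])
    also have "\<dots> \<le> K * ell2_norm f * Cv" by (intro mult_right_mono K f Cv)
    finally have h: "norm h \<le> (K * Cv) * ell2_norm f" by (simp add: mult_ac)
    have "norm k \<le> norm (L \<kappa>) * norm h" unfolding k_def by (rule norm_blinfun)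
    also have "\<dots> \<le> norm (L \<kappa>) * ((K * Cv) * ell2_norm f)" by (intro mult_left_mono h) simp
    finally have k: "norm k \<le> norm (L \<kappa>) * (K * Cv) * ell2_norm f" by simp
    have "ell2_norm (?R (v k)) \<le> K * ell2_norm (v k)" by (intro K v_ell2)
    also have "\<dots> \<le> K * (Cv * (norm (L \<kappa>) * (K * Cv) * ell2_norm f))"
      using v_ell2(2)[of k] mult_left_mono[OF k Cv(1)] by (intro mult_left_mono K) linarith
    finally have R: "ell2_norm (?R (v k)) \<le> K * (Cv * (norm (L \<kappa>) * (K * Cv))) * ell2_norm f" by (simp add: mult_ac)
    have "ell2_norm (res_op L \<kappa> f) \<le> 2 * (ell2_norm (?R f) + ell2_norm (?R (v k)))"
      unfolding u using ell2_add(2)[OF e(1,2)] by (simp add: e(3))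
    also have "\<dots> \<le> 2 * (K * ell2_norm f + K * (Cv * (norm (L \<kappa>) * (K * Cv))) * ell2_norm f)"
      using R K(3)[OF f] by simp
    finally have "ell2_norm (res_op L \<kappa> f) \<le> (2 * (K + K * (Cv * (norm (L \<kappa>) * (K * Cv))))) * ell2_norm f"
      by (simp add: algebra_simps)
    moreover have "res_op L \<kappa> f \<in> ell2" unfolding u by (rule ell2_add(1)[OF e(1,2)])
    ultimately show ?thesis by blast
  qed
  thus ?thesis by blast
qed

lemma injective_on_ell2:
  assumes g: "good L (cnj \<kappa>)" and u: "u \<in> ell2" and z: "\<And>x. H u x + \<kappa>\<^sup>2 * u x = 0"
  shows "u = (\<lambda>_. 0)"
proof -
  define w where "w = res_op L (cnj \<kappa>) u"
  have w: "w \<in> ell2" unfolding w_def using res_op_bounded[OF g] u by blast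
  have eq: "(\<lambda>x. 1 * H w x + (cnj \<kappa>)\<^sup>2 * w x) = u"
    unfolding w_def using res_op_solves[OF g u] by (intro ext) simp
  \<comment> \<open>u is written as H + cnj(\<kappa>)^2 applied to w. Moving the operator to the
    antilinear slot conjugates the parameter back to \<kappa>^2, for which u is annihilated.\<close>
  have "pairing u u = pairing u (\<lambda>x. 1 * H w x + (cnj \<kappa>)\<^sup>2 * w x)" by (simp only: eq)
  also have "\<dots> = pairing (H u) w + (cnj \<kappa>)\<^sup>2 * pairing u w"
    by (subst pairing_lincomb(1)[OF u H_ell2[OF w] w]) (simp add: H_symmetric[OF u w])
  also have "\<dots> = pairing (\<lambda>x. 1 * H u x + \<kappa>\<^sup>2 * u x) w"
    by (subst pairing_lincomb(2)[OF w H_ell2[OF u] u]) simp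
  also have "(\<lambda>x. 1 * H u x + \<kappa>\<^sup>2 * u x) = (\<lambda>_. 0)" using z by simp
  finally have "pairing u u = 0" by (simp add: pairing_def)
  moreover have "pairing u u = of_real ((ell2_norm u)\<^sup>2)"
  proof -
    have "((\<lambda>x. (norm (u x))\<^sup>2) has_sum (ell2_norm u)\<^sup>2) UNIV"
      unfolding ell2_norm_sq using u by (intro has_sum_infsum) (simp add: ell2_def)
    hence "((\<lambda>x. complex_of_real ((norm (u x))\<^sup>2)) has_sum of_real ((ell2_norm u)\<^sup>2)) UNIV"
      by (rule has_sum_of_real)
    moreover have "complex_of_real ((norm (u x))\<^sup>2) = cnj (u x) * u x" for x
      by (simp add: complex_norm_square mult.commute flip: of_real_power)
    ultimately show ?thesis unfolding pairing_def by (simp add: infsumI)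
  qed
  ultimately have "ell2_norm u = 0" by simp
  thus ?thesis using ell2_point_bound[OF u] by (intro ext) simp
qed

lemma resolvent_eq:
  assumes g: "good L \<kappa>" and g': "good L (cnj \<kappa>)"
  shows "- \<kappa>\<^sup>2 \<notin> ell2_spectrum H" "f \<in> ell2 \<Longrightarrow> resolvent H \<kappa> f = res_op L \<kappa> f"
proof -
  define T where "T u x = H u x + \<kappa>\<^sup>2 * u x" for u x
  have T: "T = (\<lambda>u x. H u x - (- \<kappa>\<^sup>2) * u x)" "T = (\<lambda>u x. H u x + \<kappa>\<^sup>2 * u x)" by (auto simp: T_def fun_eq_iff)
  obtain C where C: "\<And>f. f \<in> ell2 \<Longrightarrow> res_op L \<kappa> f \<in> ell2" "\<And>f. f \<in> ell2 \<Longrightarrow> ell2_norm (res_op L \<kappa> f) \<le> C * ell2_norm f"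
    using res_op_bounded[OF g] by blast
  have solve: "T (res_op L \<kappa> f) = f" if "f \<in> ell2" for f
    unfolding T_def using res_op_solves[OF g that] by (intro ext)
  have Tlin: "T (\<lambda>x. a * u x + b * w x) = (\<lambda>x. a * T u x + b * T w x)" if "u \<in> ell2" "w \<in> ell2" for a b u w
    unfolding T_def H_lincomb[OF ell2_dom[OF that(1)] ell2_dom[OF that(2)]] by (simp add: algebra_simps)
  have inj: "inj_on T ell2"
  proof (rule inj_onI)
    fix u w assume uw: "u \<in> ell2" "w \<in> ell2" "T u = T w"
    have "(\<lambda>x. 1 * u x + (-1) * w x) = (\<lambda>_. 0)"
    proof (rule injective_on_ell2[OF g'])
      show "(\<lambda>x. 1 * u x + (-1) * w x) \<in> ell2" by (rule ell2_lincomb[OF uw(1,2)])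
      show "H (\<lambda>x. 1 * u x + (-1) * w x) x + \<kappa>\<^sup>2 * (1 * u x + (-1) * w x) = 0" for x
        using fun_cong[OF Tlin[OF uw(1,2), of 1 "-1"], of x] uw(3) by (simp add: T_def)
    qed
    thus "u = w" by (simp add: fun_eq_iff)
  qed
  have maps: "T u \<in> ell2" if "u \<in> ell2" for u
    unfolding T_def by (intro ell2_add ell2_scale H_ell2 that)
  have bij: "bij_betw T ell2 ell2"
    unfolding bij_betw_def using inj maps solve C(1) by (auto simp: image_iff) metis
  have inv: "inv_into ell2 T f = res_op L \<kappa> f" if "f \<in> ell2" for f
    using inv_into_f_f[OF inj C(1)[OF that]] solve[OF that] by simp
  have "inv_into ell2 T \<in> ell2_ops"
    unfolding bounded_ops_def
  proof (intro CollectI conjI ballI allI)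
    show "inv_into ell2 T u \<in> ell2" if "u \<in> ell2" for u using that by (simp add: inv C)
    show "\<exists>C. \<forall>u\<in>ell2. ell2_norm (inv_into ell2 T u) \<le> C * ell2_norm u"
      using C(2) by (auto simp: inv)
    fix u w :: "('k, 'r) state" and a b assume uw: "u \<in> ell2" "w \<in> ell2"
    let ?s = "\<lambda>x. a * res_op L \<kappa> u x + b * res_op L \<kappa> w x"
    have s: "?s \<in> ell2" by (intro ell2_lincomb C uw)
    have "T ?s = (\<lambda>x. a * u x + b * w x)" by (simp only: Tlin[OF C(1)[OF uw(1)] C(1)[OF uw(2)]] solve uw)
    hence "inv_into ell2 T (\<lambda>x. a * u x + b * w x) = ?s" using inv_into_f_f[OF inj s] by simp
    thus "inv_into ell2 T (\<lambda>x. a * u x + b * w x) = (\<lambda>x. a * inv_into ell2 T u x + b * inv_into ell2 T w x)"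
      by (simp add: inv uw)
  qed
  with bij show "- \<kappa>\<^sup>2 \<notin> ell2_spectrum H" by (simp add: ell2_spectrum_def Let_def flip: T(2))
  show "f \<in> ell2 \<Longrightarrow> resolvent H \<kappa> f = res_op L \<kappa> f"
    unfolding resolvent_def T(2)[symmetric] by (rule inv)
qed

section \<open>The kernel of the resolvent and its expansion\<close>

definition res_kernel :: "(complex \<Rightarrow> 'h \<Rightarrow>\<^sub>L 'h) \<Rightarrow> complex \<Rightarrow> ('k, 'r) vertex \<Rightarrow> ('k, 'r) vertex \<Rightarrow> complex" where
  "res_kernel L \<kappa> p q = free_res E att \<kappa> p q - cinner (arow \<kappa> p) (blinfun_apply (L \<kappa>) (acol \<kappa> q))"

lemma kernel_v_cinner:
  assumes B: "adm B (free_res E att \<kappa>)"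
  shows "kernel_op (free_res E att \<kappa>) (v k) p = cinner (arow \<kappa> p) k"
proof -
  have "dom (B * vsize p ^ \<beta>) (\<lambda>q. cnj (free_res E att \<kappa> p q))"
    using adm_dom(2)[OF B, of p] by (simp add: dom_def)
  from adjoint_char[OF this, of k] show ?thesis by (simp add: arow_def kernel_op_def pairing_def)
qed

text \<open>The issue is to move v^* and L through the sum over q. For fixed \<kappa> the vectors
  \<open>acol \<kappa> q\<close> are bounded, so \<Sum> u q acol q converges absolutely in the
  Hilbert space; testing against k and exchanging sums identifies its value as v^* R_0 u. Complex
  linearity of \<open>L \<kappa>\<close> then pulls the scalars u q out.\<close>

lemma res_op_kernel:
  assumes g: "good L \<kappa>" and clin: "clin (L \<kappa>)" and u: "u \<in> L1 (real n)"
  shows "res_op L \<kappa> u p = kernel_op (res_kernel L \<kappa>) u p" "(\<lambda>q. res_kernel L \<kappa> p q * u q) summable_on UNIV"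
proof -
  let ?R = "kernel_op (free_res E att \<kappa>)"
  have \<kappa>: "Re \<kappa> > 0" "norm \<kappa> < 2" using g by (auto simp: good_def)
  obtain B where B: "adm B (free_res E att \<kappa>)" using g by (auto simp: good_def)
  have u2: "u \<in> ell2" by (rule L1_ell2[OF u])
  obtain K where K: "K \<ge> 0" "(\<lambda>q. free_res E att \<kappa> p q * u q) summable_on UNIV" "?R u \<in> ell2"
    "\<And>p q. norm (free_res E att \<kappa> p q) \<le> K"
    using free_kernel[OF \<kappa>] u2 by blast
  have dcol: "dom K (\<lambda>p. free_res E att \<kappa> p q)" for q by (rule bounded_dom[OF K(4)])
  have l1: "(\<lambda>q. norm (u q)) summable_on UNIV" using L1_mono(1)[OF u, of 0] L1_iff[of u 0] by simp
  have nac: "norm (acol \<kappa> q) \<le> K * Cv" for q unfolding acol_def by (rule adjoint_norm[OF dcol])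
  have "(\<lambda>q. norm (u q *\<^sub>C acol \<kappa> q)) summable_on UNIV"
  proof (rule summable_on_comparison_test)
    show "(\<lambda>q. norm (u q) * (K * Cv)) summable_on UNIV" by (intro summable_on_cmult_left l1)
    show "norm (u q *\<^sub>C acol \<kappa> q) \<le> norm (u q) * (K * Cv)" for q
      unfolding norm_scaleC by (intro mult_left_mono nac) simp
  qed simp
  hence sm: "(\<lambda>q. u q *\<^sub>C acol \<kappa> q) summable_on UNIV" by (rule abs_summable_summable)
  define h where "h = (\<Sum>\<^sub>\<infinity>q. u q *\<^sub>C acol \<kappa> q)"
  have hs: "((\<lambda>q. u q *\<^sub>C acol \<kappa> q) has_sum h) UNIV" unfolding h_def using sm by (rule has_sum_infsum)
  have col: "cinner k (acol \<kappa> q) = (\<Sum>\<^sub>\<infinity>p. free_res E att \<kappa> p q * cnj (v k p))" for k q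
  proof -
    have "cinner k (acol \<kappa> q) = cnj (pairing (\<lambda>p. free_res E att \<kappa> p q) (v k))"
      by (subst cinner_commute) (simp add: acol_def adjoint_char[OF dcol])
    thus ?thesis unfolding pairing_def infsum_cnj[symmetric] by simp
  qed
  have h: "h = adjoint_op v (?R u)"
  proof (rule cinner_eqI)
    fix k
    have "cinner k h = (\<Sum>\<^sub>\<infinity>q. cinner k (u q *\<^sub>C acol \<kappa> q))"
      using has_sum_bounded_linear[OF bounded_linear_cinner_right hs, of k] by (simp add: infsumI o_def)
    also have "\<dots> = (\<Sum>\<^sub>\<infinity>q. \<Sum>\<^sub>\<infinity>p. free_res E att \<kappa> p q * u q * cnj (v k p))"
      unfolding cinner_scaleC_right col infsum_cmult_right'[symmetric] by (simp add: mult_ac)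
    also have "\<dots> = (\<Sum>\<^sub>\<infinity>p. \<Sum>\<^sub>\<infinity>q. free_res E att \<kappa> p q * u q * cnj (v k p))"
    proof (rule fubini_dominated[OF l1])
      show "(\<lambda>p. K * norm (v k p)) summable_on UNIV"
        using L1_mono(1)[OF v_L1, of 0 k] L1_iff[of "v k" 0] by (intro summable_on_cmult_right) simp
      show "norm (free_res E att \<kappa> p q * u q * cnj (v k p)) \<le> norm (u q) * (K * norm (v k p))" for p q
        using mult_right_mono[OF K(4)[of p q], of "norm (u q) * norm (v k p)"] by (simp add: norm_mult mult_ac)
    qed (use K(1) in auto)
    also have "\<dots> = (\<Sum>\<^sub>\<infinity>p. ?R u p * cnj (v k p))"
      unfolding kernel_op_def infsum_cmult_left' ..
    also have "\<dots> = cnj (pairing (?R u) (v k))"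
      unfolding pairing_def infsum_cnj[symmetric] by simp
    also have "\<dots> = cinner k (adjoint_op v (?R u))"
      by (subst cinner_commute) (simp add: adjoint_char[OF ell2_dom[OF K(3)]])
    finally have "cinner k h = cinner k (adjoint_op v (?R u))" .
    thus "cinner h k = cinner (adjoint_op v (?R u)) k"
      by (metis cinner_commute)
  qed
  let ?c = "\<lambda>q. cinner (arow \<kappa> p) (blinfun_apply (L \<kappa>) (acol \<kappa> q))"
  have "bounded_linear (\<lambda>x. cinner (arow \<kappa> p) (blinfun_apply (L \<kappa>) x))"
    by (intro bounded_linear_compose[OF bounded_linear_cinner_right] blinfun.bounded_linear_right)
  from has_sum_bounded_linear[OF this hs]
  have c: "((\<lambda>q. ?c q * u q) has_sum cinner (arow \<kappa> p) (blinfun_apply (L \<kappa>) h)) UNIV"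
    using clin by (simp add: o_def clin_def cinner_scaleC_right mult.commute)
  have "((\<lambda>q. free_res E att \<kappa> p q * u q - ?c q * u q) has_sum
      (?R u p - cinner (arow \<kappa> p) (blinfun_apply (L \<kappa>) h))) UNIV"
    unfolding kernel_op_def[of _ u] by (intro has_sum_diff_complex c has_sum_infsum K(2))
  hence hs2: "((\<lambda>q. res_kernel L \<kappa> p q * u q) has_sum res_op L \<kappa> u p) UNIV"
    by (simp add: res_kernel_def left_diff_distrib res_op_def kernel_v_cinner[OF B] h)
  thus "res_op L \<kappa> u p = kernel_op (res_kernel L \<kappa>) u p" unfolding kernel_op_def by (simp add: infsumI)
  show "(\<lambda>q. res_kernel L \<kappa> p q * u q) summable_on UNIV" using hs2 by (rule has_sum_imp_summable)
qed

lemma eventually_good: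
  assumes "\<forall>\<^sub>F \<kappa> in rhp. Mop \<kappa> o\<^sub>L L \<kappa> = id_blinfun"
  shows "\<forall>\<^sub>F \<kappa> in rhp. good L \<kappa> \<and> good L (cnj \<kappa>)"
proof -
  have "\<forall>\<^sub>F \<kappa> in rhp. det (core_mat E att (\<kappa>\<^sup>2)) \<noteq> 0"
    by (rule filter_leD[OF rhp_le_nhds eventually_det_core_mat[OF graph]])
  moreover have "\<forall>\<^sub>F \<kappa> in rhp. Re \<kappa> > 0 \<and> norm \<kappa> < 2" by (rule eventually_rhp_small) simp
  ultimately have "\<forall>\<^sub>F \<kappa> in rhp. good L \<kappa>"
    using eventually_adm_free_res assms by eventually_elim (simp add: good_def)
  then obtain d where d: "d > 0" "\<And>\<kappa>. Re \<kappa> > 0 \<Longrightarrow> norm \<kappa> < d \<Longrightarrow> good L \<kappa>"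
    unfolding eventually_rhp_iff by blast
  \<comment> \<open>The half-disc is invariant under conjugation, so one radius serves both
    parameters.\<close>
  thus ?thesis unfolding eventually_rhp_iff by (intro exI[of _ d]) auto
qed

text \<open>The expansions of row, \<kappa> L and column are multiplied and then divided by
  \<kappa>, so index i stands for the power i - 1. To match the resulting order, the free kernel
  contributes J' = J - 1 terms, shifted by one index; the term i = 0 comes from the pole
  alone.\<close>

lemma kernel_expansion:
  assumes L: "opexp J (\<lambda>\<kappa>. scaleB \<kappa> (L \<kappa>)) l" and clinl: "\<And>j. clin (l j)" and J: "J = Suc J'" "J < \<beta>"
  shows "\<exists>g. (\<forall>i<J. \<exists>C\<ge>0. \<forall>p q. norm (g i p q) \<le> C * (vsize p * vsize q) ^ Suc i) \<and>
    (\<exists>C\<ge>0. \<forall>\<^sub>F \<kappa> in rhp. \<forall>p q. norm (res_kernel L \<kappa> p q - (\<Sum>i<J. \<kappa> powi (int i - 1) * g i p q))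
        \<le> C * norm \<kappa> ^ J' * (vsize p * vsize q) ^ Suc J) \<and>
    (\<forall>p q. g 0 p q = - cinner (arow_coef 0 p) (blinfun_apply (l 0) (acol_coef 0 q)))"
proof -
  let ?W = "\<lambda>j (q :: ('k, 'r) vertex). vsize q ^ Suc j"
  have W0: "0 \<le> ?W j q" for j q by (intro zero_le_power vsize_pos)
  have Wm: "?W i q \<le> ?W j q" if "i \<le> j" for i j q using that by (intro power_increasing vsize_ge_1) auto
  have Lr: "uexp scaleB J (\<lambda>_ _. 1) (\<lambda>\<kappa> (q :: ('k, 'r) vertex). scaleB \<kappa> (L \<kappa>)) (\<lambda>j _. l j)"
    by (rule uexp_reindex[OF L])
  have 1: "uexp scaleC J ?W (\<lambda>\<kappa> q. blinfun_apply (scaleB \<kappa> (L \<kappa>)) (acol \<kappa> q))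
      (\<lambda>j q. \<Sum>a\<le>j. blinfun_apply (l a) (acol_coef (j - a) q))"
    by (rule uexp_bilinear[OF cscaling_scaleB cscaling_scaleC cscaling_scaleC bounded_bilinear_blinfun_apply
          _ _ _ _ _ _ _ Lr uexp_acol[OF J(2)]])
      (use clinl W0 Wm in \<open>auto simp: scaleB_apply clin_def simp del: power_Suc\<close>)
  have bc: "bounded_bilinear (cinner :: 'h \<Rightarrow> 'h \<Rightarrow> complex)"
  proof (rule bounded_bilinear.intro)
    show "cinner (a + a') b = cinner a b + cinner a' b" for a a' b :: 'h by (rule cinner_add_left)
    show "cinner a (b + b') = cinner a b + cinner a b'" for a b b' :: 'h by (rule cinner_add_right)
    show "cinner (r *\<^sub>R a) b = r *\<^sub>R cinner a b" for r and a b :: 'h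
      by (simp flip: scaleC_of_real add: cinner_scaleC_left scaleR_conv_of_real)
    show "cinner a (r *\<^sub>R b) = r *\<^sub>R cinner a b" for r and a b :: 'h
      by (simp flip: scaleC_of_real add: cinner_scaleC_right scaleR_conv_of_real)
    show "\<exists>K. \<forall>a b :: 'h. norm (cinner a b) \<le> norm a * norm b * K"
      by (rule exI[of _ 1]) (simp add: norm_cinner_le)
  qed
  define qc where "qc j x = (\<Sum>a\<le>j. cinner (arow_coef a (fst x)) (\<Sum>b\<le>j - a. blinfun_apply (l b) (acol_coef (j - a - b) (snd x))))"
    for j and x :: "('k, 'r) vertex \<times> ('k, 'r) vertex"
  have 2: "uexp (*) J (\<lambda>j x. (vsize (fst x) * vsize (snd x)) ^ Suc j)
      (\<lambda>\<kappa> x. cinner (arow \<kappa> (fst x)) (blinfun_apply (scaleB \<kappa> (L \<kappa>)) (acol \<kappa> (snd x)))) qc"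
    unfolding qc_def[abs_def]
  proof (rule uexp_bilinear[OF cscaling_scaleC_cnj cscaling_scaleC cscaling_mult bc
        _ _ _ _ _ _ _ uexp_reindex[OF uexp_arow[OF J(2)], of fst] uexp_reindex[OF 1, of snd]])
    fix a b j :: nat and x :: "('k, 'r) vertex \<times> ('k, 'r) vertex" assume "a \<le> j" "b \<le> j"
    thus "?W a (fst x) * ?W b (snd x) \<le> (vsize (fst x) * vsize (snd x)) ^ Suc j"
      unfolding power_mult_distrib by (intro mult_mono Wm W0)
  qed (use W0 Wm in \<open>auto simp: cinner_scaleC_left cinner_scaleC_right simp del: power_Suc\<close>)
  have Wx: "0 \<le> (vsize (fst x) * vsize (snd x)) ^ Suc j" for j and x :: "('k, 'r) vertex \<times> ('k, 'r) vertex"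
    by (intro zero_le_power mult_nonneg_nonneg vsize_pos)
  obtain Cq where Cq: "Cq \<ge> 0" "\<And>j x. j < J \<Longrightarrow> norm (qc j x) \<le> Cq * (vsize (fst x) * vsize (snd x)) ^ Suc j"
    by (rule uexp_coeff_bound[OF 2 Wx]) blast
  obtain Cr where Cr: "Cr \<ge> 0" "\<forall>\<^sub>F \<kappa> in rhp. \<forall>x. norm (cinner (arow \<kappa> (fst x)) (blinfun_apply (scaleB \<kappa> (L \<kappa>)) (acol \<kappa> (snd x))) -
      (\<Sum>j<J. \<kappa> ^ j * qc j x)) \<le> Cr * norm \<kappa> ^ J * (vsize (fst x) * vsize (snd x)) ^ Suc J"
    by (rule uexp_remainder_bound[OF 2 Wx]) blast
  obtain Cf where Cf: "Cf \<ge> 0" "\<forall>\<^sub>F \<kappa> in rhp. \<forall>p q. norm (free_res E att \<kappa> p q - (\<Sum>j<J'. \<kappa> ^ j * free_coef E att j p q))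
    \<le> Cf * norm \<kappa> ^ J' * (vsize p * vsize q) ^ Suc J'"
    using free_res_remainder by blast
  define g where "g i p q = (if i = 0 then 0 else free_coef E att (i - 1) p q) - qc i (p, q)" for i p q
  have coef: "\<exists>C\<ge>0. \<forall>p q. norm (g i p q) \<le> C * (vsize p * vsize q) ^ Suc i" if i: "i < J" for i
  proof -
    obtain C where C: "C \<ge> 0" "\<And>p q. norm (free_coef E att (i - 1) p q) \<le> C * (vsize p * vsize q) ^ Suc (i - 1)"
      using free_coef_bound by blast
    have "norm (g i p q) \<le> (C + Cq) * (vsize p * vsize q) ^ Suc i" for p q
    proof -
      have "norm (if i = 0 then 0 else free_coef E att (i - 1) p q) \<le> C * (vsize p * vsize q) ^ Suc i"
        using C(2)[of p q] mult_left_mono[OF vprod_mono[of "Suc (i - 1)" "Suc i" p q] C(1)] vprod_pos[of p q "Suc i"] C(1)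
        by (auto simp del: power_Suc)
      moreover have "norm (qc i (p, q)) \<le> Cq * (vsize p * vsize q) ^ Suc i" using Cq(2)[OF i, of "(p, q)"] by simp
      ultimately show ?thesis unfolding g_def distrib_right by (intro order_trans[OF norm_triangle_ineq4] add_mono)
    qed
    thus ?thesis using C(1) Cq(1) by (intro exI[of _ "C + Cq"]) simp
  qed
  have rem: "\<forall>\<^sub>F \<kappa> in rhp. \<forall>p q. norm (res_kernel L \<kappa> p q - (\<Sum>i<J. \<kappa> powi (int i - 1) * g i p q))
        \<le> (Cf + Cr) * norm \<kappa> ^ J' * (vsize p * vsize q) ^ Suc J"
    using Cr(2) Cf(2) eventually_rhp
  proof eventually_elim
    case (elim \<kappa>)
    hence k0: "\<kappa> \<noteq> 0" by auto
    show ?case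
    proof (intro allI)
      fix p q :: "('k, 'r) vertex"
      let ?c = "cinner (arow \<kappa> p) (blinfun_apply (scaleB \<kappa> (L \<kappa>)) (acol \<kappa> q))"
      have pw: "\<kappa> powi (int i - 1) = \<kappa> ^ i / \<kappa>" for i
        using k0 by (simp add: power_int_diff)
      have "(\<Sum>i<J. \<kappa> powi (int i - 1) * (if i = 0 then 0 else free_coef E att (i - 1) p q)) = (\<Sum>j<J'. \<kappa> ^ j * free_coef E att j p q)"
        unfolding J(1) sum.lessThan_Suc_shift by (simp add: pw k0)
      hence "(\<Sum>i<J. \<kappa> powi (int i - 1) * g i p q) =
          (\<Sum>j<J'. \<kappa> ^ j * free_coef E att j p q) - (\<Sum>i<J. \<kappa> ^ i * qc i (p, q)) / \<kappa>"
        unfolding g_def right_diff_distrib sum_subtractf by (simp add: pw sum_divide_distrib)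
      moreover have "?c / \<kappa> = cinner (arow \<kappa> p) (blinfun_apply (L \<kappa>) (acol \<kappa> q))"
        using k0 by (simp add: scaleB_apply cinner_scaleC_right)
      ultimately have "res_kernel L \<kappa> p q - (\<Sum>i<J. \<kappa> powi (int i - 1) * g i p q) =
          (free_res E att \<kappa> p q - (\<Sum>j<J'. \<kappa> ^ j * free_coef E att j p q)) - (?c - (\<Sum>i<J. \<kappa> ^ i * qc i (p, q))) / \<kappa>"
        by (simp add: res_kernel_def diff_divide_distrib)
      also have "norm \<dots> \<le> Cf * norm \<kappa> ^ J' * (vsize p * vsize q) ^ Suc J + Cr * norm \<kappa> ^ J' * (vsize p * vsize q) ^ Suc J"
      proof (rule order_trans[OF norm_triangle_ineq4 add_mono])
        have "norm (free_res E att \<kappa> p q - (\<Sum>j<J'. \<kappa> ^ j * free_coef E att j p q)) \<le> Cf * norm \<kappa> ^ J' * (vsize p * vsize q) ^ Suc J'"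
          using elim(2) by blast
        also have "\<dots> \<le> Cf * norm \<kappa> ^ J' * (vsize p * vsize q) ^ Suc J"
          using Cf(1) J by (intro mult_left_mono vprod_mono) auto
        finally show "norm (free_res E att \<kappa> p q - (\<Sum>j<J'. \<kappa> ^ j * free_coef E att j p q)) \<le> Cf * norm \<kappa> ^ J' * (vsize p * vsize q) ^ Suc J" .
        have "norm (?c - (\<Sum>i<J. \<kappa> ^ i * qc i (p, q))) \<le> Cr * norm \<kappa> ^ J * (vsize p * vsize q) ^ Suc J"
          using elim(1)[rule_format, of "(p, q)"] by simp
        hence "norm ((?c - (\<Sum>i<J. \<kappa> ^ i * qc i (p, q))) / \<kappa>) \<le> Cr * norm \<kappa> ^ J * (vsize p * vsize q) ^ Suc J / norm \<kappa>"
          unfolding norm_divide by (rule divide_right_mono) simp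
        thus "norm ((?c - (\<Sum>i<J. \<kappa> ^ i * qc i (p, q))) / \<kappa>) \<le> Cr * norm \<kappa> ^ J' * (vsize p * vsize q) ^ Suc J"
          using k0 unfolding J(1) power_Suc[of "norm \<kappa>"] by (simp add: mult_ac)
      qed
      finally show "norm (res_kernel L \<kappa> p q - (\<Sum>i<J. \<kappa> powi (int i - 1) * g i p q))
        \<le> (Cf + Cr) * norm \<kappa> ^ J' * (vsize p * vsize q) ^ Suc J" by (simp only: distrib_right)
    qed
  qed
  have g0: "g 0 p q = - cinner (arow_coef 0 p) (blinfun_apply (l 0) (acol_coef 0 q))" for p q
    by (simp add: g_def qc_def)
  have "Cf + Cr \<ge> 0" using Cf(1) Cr(1) by simp
  thus ?thesis using coef rem g0 by blast
qed

end

section \<open>The expansion at an exceptional point of the first kind\<close>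

context threshold_setting
begin

lemma U_sum: "U (\<Sum>i\<in>I. a i *\<^sub>C f i) = (\<Sum>i\<in>I. a i *\<^sub>C U (f i))"
proof -
  have "U 0 = 0" using U_scale[of 0 0] by simp
  thus ?thesis by (induction I rule: infinite_finite_induct) (auto simp: U_add U_scale)
qed

lemma powi_sum_reindex:
  assumes "\<beta> - 2 = J"
  shows "(\<Sum>j\<in>{-1..int \<beta> - 4}. f j) = (\<Sum>i<J. f (int i - 1))"
proof -
  have "{-1..int \<beta> - 4} = (\<lambda>i. int i - 1) ` {..<J}"
  proof (intro set_eqI iffI)
    fix j assume "j \<in> {-1..int \<beta> - 4}"
    hence "j = int (nat (j + 1)) - 1" "nat (j + 1) < J" using assms beta by auto
    thus "j \<in> (\<lambda>i. int i - 1) ` {..<J}" by blast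
  qed (use assms beta in auto)
  thus ?thesis by (simp add: sum.reindex inj_on_def)
qed

text \<open>A resonance basis feeds \<open>Mop_inverse_expansion\<close>: orthonormality of the
  asymptotic vectors is its condition \<open>orth\<close>, and absence of bound states makes the
  vectors k span the kernel of M_0. The residue - \<Sum> |k><k| then turns into the projection,
  because R_0(0) v k = - \<Psi>.\<close>

theorem resolvent_expansion_first_kind:
  assumes fk: "exceptional_first_kind (real \<beta>) H"
  shows "\<exists>G :: int \<Rightarrow> ('k, 'r) oper.
    (\<forall>\<^sub>F \<kappa> in at 0 within {\<kappa>. Re \<kappa> > 0}.
        - \<kappa>\<^sup>2 \<notin> ell2_spectrum H \<and>
        expansion_remainder H G (int \<beta> - 4) \<kappa> \<in> Bs (real \<beta> - 1)) \<and>
    (\<lambda>\<kappa>. Bs_norm (real \<beta> - 1) (expansion_remainder H G (int \<beta> - 4) \<kappa>))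
        \<in> O[at 0 within {\<kappa>. Re \<kappa> > 0}](\<lambda>\<kappa>. norm \<kappa> ^ (\<beta> - 3)) \<and>
    (\<forall>j\<in>{-1..int \<beta> - 4}. G j \<in> Bs (of_int (if even j then j + 3 else j + 2))) \<and>
    (\<forall>j. j \<notin> {-1..int \<beta> - 4} \<longrightarrow> G j = (\<lambda>u x. 0)) \<and>
    (\<forall>u\<in>L1 1. G (-2) u = bound_projection (real \<beta>) H u \<and>
              bound_projection (real \<beta>) H u = (\<lambda>x. 0)) \<and>
    (\<forall>u\<in>L1 1. G (-1) u = resonance_projection (real \<beta>) H u) \<and>
    (\<exists>u\<in>L1 1. resonance_projection (real \<beta>) H u \<noteq> (\<lambda>x. 0))"
proof -
  have b0: "bound_space (real \<beta>) H = {\<lambda>x. 0}" and ne: "bound_space (real \<beta>) H \<subset> resonance_space (real \<beta>) H"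
    using fk unfolding exceptional_first_kind_def by blast+
  have bs: "\<Psi> = (\<lambda>_. 0)" if "is_res \<Psi> (\<lambda>_. 0)" for \<Psi>
    using that b0 unfolding bound_space_iff[symmetric] by blast
  define B where "B = (SOME B. orthonormal_resonance_basis (real \<beta>) H B)"
  have onb: "orthonormal_resonance_basis (real \<beta>) H B"
    unfolding B_def by (rule someI_ex[OF orthonormal_resonance_basis_exists[OF bs]])
  have fin: "finite B" and Bres: "B \<subseteq> resonance_space (real \<beta>) H"
    and Bspan: "\<And>\<Phi>. \<Phi> \<in> resonance_space (real \<beta>) H \<Longrightarrow> \<exists>a. (\<lambda>x. \<Phi> x - (\<Sum>\<Psi>\<in>B. a \<Psi> * \<Psi> x)) \<in> bound_space (real \<beta>) H"
    using onb unfolding orthonormal_resonance_basis_def by blast+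
  obtain c :: "('k, 'r) state \<Rightarrow> 'r \<Rightarrow> complex" where
    c1: "\<And>\<Phi> \<Psi>. \<Phi> \<in> B \<Longrightarrow> \<Psi> \<in> B \<Longrightarrow> (\<Sum>\<alpha>\<in>UNIV. cnj (c \<Phi> \<alpha>) * c \<Psi> \<alpha>) = (if \<Phi> = \<Psi> then 1 else 0)"
    and c2: "\<And>\<Psi>. \<Psi> \<in> B \<Longrightarrow> (\<lambda>x. \<Psi> x - (\<Sum>\<alpha>\<in>UNIV. c \<Psi> \<alpha> * ray_indicator \<alpha> x)) \<in> L1 (real \<beta> - 2)"
    using onb unfolding orthonormal_resonance_basis_def by blast
  have res: "is_res \<Psi> (c \<Psi>)" if "\<Psi> \<in> B" for \<Psi>
    using Bres c2[OF that] that unfolding is_res_def resonance_space_def b2 by blast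
  define kv where "kv \<Psi> = U (adjoint_op v \<Psi>)" for \<Psi>
  have Psi: "\<Psi> x = - G0 (v (kv \<Psi>)) x" if "\<Psi> \<in> B" for \<Psi> x
    unfolding kv_def by (rule fun_cong[OF resonance_to_kernel(1)[OF res[OF that]]])
  have domB: "\<exists>C. dom C \<Psi>" if "\<Psi> \<in> B" for \<Psi>
    using is_res_bounded[OF res[OF that]] bounded_dom by blast
  have ker: "blinfun_apply (Mcoef 0) (kv \<Psi>) = 0" if "\<Psi> \<in> B" for \<Psi>
    unfolding kv_def by (rule resonance_to_kernel(2)[OF res[OF that]])
  have mom: "moment \<alpha> (v (kv \<Psi>)) = - c \<Psi> \<alpha>" if "\<Psi> \<in> B" for \<Psi> \<alpha>
    using resonance_to_kernel(3)[OF res[OF that], of \<alpha>] by (simp add: kv_def)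
  have orth: "cinner (kv \<Phi>) (blinfun_apply (Mcoef 1) (kv \<Psi>)) = - (if \<Phi> = \<Psi> then 1 else 0)"
    if "\<Phi> \<in> B" "\<Psi> \<in> B" for \<Phi> \<Psi>
    unfolding Mcoef_1_form mom[OF that(1)] mom[OF that(2)] using c1[OF that] by simp
  \<comment> \<open>A kernel vector gives a resonance, which the basis represents modulo bound
    states, that is exactly; applying U v^* returns to kernel vectors.\<close>
  have span: "\<exists>a. w = (\<Sum>\<Psi>\<in>B. a \<Psi> *\<^sub>C kv \<Psi>)" if w: "blinfun_apply (Mcoef 0) w = 0" for w
  proof -
    let ?\<Phi> = "\<lambda>x. - G0 (v w) x"
    have "?\<Phi> \<in> resonance_space (real \<beta>) H" using kernel_to_resonance(1)[OF w] resonance_space_iff by blast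
    then obtain a where "(\<lambda>x. ?\<Phi> x - (\<Sum>\<Psi>\<in>B. a \<Psi> * \<Psi> x)) \<in> bound_space (real \<beta>) H" using Bspan by blast
    hence "(\<lambda>x. ?\<Phi> x - (\<Sum>\<Psi>\<in>B. a \<Psi> * \<Psi> x)) = (\<lambda>_. 0)" using b0 by blast
    hence Phi: "?\<Phi> = (\<lambda>x. \<Sum>\<Psi>\<in>B. a \<Psi> * \<Psi> x)" by (intro ext) (metis (no_types, lifting) eq_iff_diff_eq_0)
    obtain C where C: "\<And>\<Psi>. \<Psi> \<in> B \<Longrightarrow> dom (C \<Psi>) \<Psi>" using domB by metis
    have "adjoint_op v ?\<Phi> = (\<Sum>\<Psi>\<in>B. adjoint_op v (\<lambda>x. a \<Psi> * \<Psi> x))"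
      unfolding Phi
    proof (rule adjoint_sum)
      show "dom (norm (a \<Psi>) * C \<Psi> + norm (0 :: complex) * 0) (\<lambda>x. a \<Psi> * \<Psi> x)" if "\<Psi> \<in> B" for \<Psi>
        using dom_lincomb[OF C[OF that] dom_zero, of "a \<Psi>" 0] by simp
    qed
    also have "\<dots> = (\<Sum>\<Psi>\<in>B. a \<Psi> *\<^sub>C adjoint_op v \<Psi>)"
      by (intro sum.cong refl adjoint_scale[OF C])
    finally have "U (adjoint_op v ?\<Phi>) = (\<Sum>\<Psi>\<in>B. a \<Psi> *\<^sub>C kv \<Psi>)" by (simp add: U_sum kv_def)
    thus ?thesis unfolding kernel_to_resonance(2)[OF w] by blast
  qed
  obtain L l where L1': "\<forall>\<^sub>F \<kappa> in rhp. Mop \<kappa> o\<^sub>L L \<kappa> = id_blinfun \<and> clin (L \<kappa>)"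
    and Lexp: "opexp (\<beta> - 2) (\<lambda>\<kappa>. scaleB \<kappa> (L \<kappa>)) l" and clinl: "\<And>j. clin (l j)"
    and l0: "l 0 = - (\<Sum>\<Psi>\<in>B. rank1 (kv \<Psi>) (kv \<Psi>))"
    using Mop_inverse_expansion[OF fin ker span orth] by blast
  have J: "\<beta> - 2 = Suc (\<beta> - 3)" "\<beta> - 2 < \<beta>" using beta by auto
  have Sb: "Suc (\<beta> - 2) = \<beta> - 1" using beta by simp
  obtain g Cr where gb: "\<And>i. i < \<beta> - 2 \<Longrightarrow> \<exists>C\<ge>0. \<forall>p q. norm (g i p q) \<le> C * (vsize p * vsize q) ^ Suc i"
    and Cr: "Cr \<ge> 0" "\<forall>\<^sub>F \<kappa> in rhp. \<forall>p q. norm (res_kernel L \<kappa> p q - (\<Sum>i<\<beta> - 2. \<kappa> powi (int i - 1) * g i p q))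
        \<le> Cr * norm \<kappa> ^ (\<beta> - 3) * (vsize p * vsize q) ^ (\<beta> - 1)"
    and g0: "\<And>p q. g 0 p q = - cinner (arow_coef 0 p) (blinfun_apply (l 0) (acol_coef 0 q))"
    using kernel_expansion[OF Lexp clinl J] unfolding Sb by blast
  \<comment> \<open>The kernels \<open>g\<close> are numbered from 0, so power j uses
    \<open>g\<close> at j + 1. The zero default implements the convention for absent powers, in
    particular for j = -2.\<close>
  define G where "G j = (if j \<in> {-1..int \<beta> - 4} then kernel_op (g (nat (j + 1))) else (\<lambda>u x. 0))" for j :: int
  have Gi: "G (int i - 1) = kernel_op (g i)" if "i < \<beta> - 2" for i
    using that beta by (auto simp: G_def)
  have g_sum: "(\<lambda>q. g i p q * u q) summable_on UNIV" if i: "i < \<beta> - 2" and u: "u \<in> L1 (real (\<beta> - 1))" for i p u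
  proof -
    obtain C where C: "C \<ge> 0" "\<And>p q. norm (g i p q) \<le> C * (vsize p * vsize q) ^ Suc i" using gb[OF i] by blast
    have "u \<in> L1 (real (Suc i))" by (rule L1_mono[OF u]) (use i in simp)
    from kernel_op_summable[OF this C(2)] show ?thesis .
  qed
  define Ek where "Ek \<kappa> p q = res_kernel L \<kappa> p q - (\<Sum>i<\<beta> - 2. \<kappa> powi (int i - 1) * g i p q)" for \<kappa> p q
  have good: "\<forall>\<^sub>F \<kappa> in rhp. good L \<kappa> \<and> good L (cnj \<kappa>)"
    by (rule eventually_good, rule eventually_mono[OF L1']) blast
  have ev: "\<forall>\<^sub>F \<kappa> in rhp. - \<kappa>\<^sup>2 \<notin> ell2_spectrum H \<and> expansion_remainder H G (int \<beta> - 4) \<kappa> \<in> Bs (real (\<beta> - 1)) \<and>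
      \<bar>Bs_norm (real (\<beta> - 1)) (expansion_remainder H G (int \<beta> - 4) \<kappa>)\<bar> \<le> Cr * norm \<kappa> ^ (\<beta> - 3)"
    using good L1' Cr(2)
  proof eventually_elim
    case (elim \<kappa>)
    have gd: "good L \<kappa>" "good L (cnj \<kappa>)" and cl: "clin (L \<kappa>)" using elim by auto
    have "expansion_remainder H G (int \<beta> - 4) \<kappa> u = kernel_op (Ek \<kappa>) u" if u: "u \<in> L1 (real (\<beta> - 1))" for u
    proof
      fix x
      have "resolvent H \<kappa> u x = kernel_op (res_kernel L \<kappa>) u x"
        using resolvent_eq(2)[OF gd L1_ell2(1)[OF u]] res_op_kernel(1)[OF gd(1) cl u] by simp
      moreover have "(\<Sum>j\<in>{-1..int \<beta> - 4}. \<kappa> powi j * G j u x) = (\<Sum>i<\<beta> - 2. \<kappa> powi (int i - 1) * kernel_op (g i) u x)"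
        unfolding powi_sum_reindex[OF refl] by (intro sum.cong refl) (simp add: Gi)
      ultimately have "expansion_remainder H G (int \<beta> - 4) \<kappa> u x =
          kernel_op (res_kernel L \<kappa>) u x - (\<Sum>i<\<beta> - 2. \<kappa> powi (int i - 1) * kernel_op (g i) u x)"
        by (simp add: expansion_remainder_def)
      moreover have "((\<lambda>q. res_kernel L \<kappa> x q * u q - (\<Sum>i<\<beta> - 2. \<kappa> powi (int i - 1) * (g i x q * u q))) has_sum
          (kernel_op (res_kernel L \<kappa>) u x - (\<Sum>i<\<beta> - 2. \<kappa> powi (int i - 1) * kernel_op (g i) u x))) UNIV"
        unfolding kernel_op_def
        by (intro has_sum_diff_complex has_sum_sum_finite has_sum_cmult_right has_sum_infsum
            res_op_kernel(2)[OF gd(1) cl u] g_sum[OF _ u]) auto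
      moreover have "res_kernel L \<kappa> x q * u q - (\<Sum>i<\<beta> - 2. \<kappa> powi (int i - 1) * (g i x q * u q)) = Ek \<kappa> x q * u q" for q
        by (simp add: Ek_def left_diff_distrib sum_distrib_right mult.assoc)
      ultimately show "expansion_remainder H G (int \<beta> - 4) \<kappa> u x = kernel_op (Ek \<kappa>) u x"
        by (simp add: kernel_op_def infsumI)
    qed
    moreover have "norm (Ek \<kappa> p q) \<le> (Cr * norm \<kappa> ^ (\<beta> - 3)) * (vsize p * vsize q) ^ (\<beta> - 1)" for p q
      using elim(3) unfolding Ek_def by blast
    ultimately have "expansion_remainder H G (int \<beta> - 4) \<kappa> \<in> Bs (real (\<beta> - 1))"
      "\<bar>Bs_norm (real (\<beta> - 1)) (expansion_remainder H G (int \<beta> - 4) \<kappa>)\<bar> \<le> Cr * norm \<kappa> ^ (\<beta> - 3)"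
      using Bs_kernel_like[of "Ek \<kappa>" "Cr * norm \<kappa> ^ (\<beta> - 3)" "\<beta> - 1" "expansion_remainder H G (int \<beta> - 4) \<kappa>"] Cr(1)
      by auto
    thus ?case using resolvent_eq(1)[OF gd] by blast
  qed
  have P1: "\<forall>\<^sub>F \<kappa> in at 0 within {\<kappa>. Re \<kappa> > 0}. - \<kappa>\<^sup>2 \<notin> ell2_spectrum H \<and>
      expansion_remainder H G (int \<beta> - 4) \<kappa> \<in> Bs (real \<beta> - 1)"
    using ev unfolding rhp_def b1 by (rule eventually_mono) blast
  have P2: "(\<lambda>\<kappa>. Bs_norm (real \<beta> - 1) (expansion_remainder H G (int \<beta> - 4) \<kappa>))
      \<in> O[at 0 within {\<kappa>. Re \<kappa> > 0}](\<lambda>\<kappa>. norm \<kappa> ^ (\<beta> - 3))"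
    unfolding b1 using ev unfolding rhp_def
    by (intro bigoI[where c = Cr]) (erule eventually_mono, simp)
  have P3: "G j \<in> Bs (of_int (if even j then j + 3 else j + 2))" if j: "j \<in> {-1..int \<beta> - 4}" for j
  proof -
    define i where "i = nat (j + 1)"
    define n where "n = nat (if even j then j + 3 else j + 2)"
    have i: "i < \<beta> - 2" "int i = j + 1" using j beta by (auto simp: i_def)
    \<comment> \<open>The available exponent is i + 1 = j + 2 for all j; for even j the target space
      has the larger exponent j + 3.\<close>
    have n: "real_of_int (if even j then j + 3 else j + 2) = real n" "Suc i \<le> n" using j i by (auto simp: n_def)
    obtain C where C: "C \<ge> 0" "\<And>p q. norm (g i p q) \<le> C * (vsize p * vsize q) ^ Suc i" using gb[OF i(1)] by blast
    have "norm (g i p q) \<le> C * (vsize p * vsize q) ^ n" for p q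
      by (rule order_trans[OF C(2) mult_left_mono[OF vprod_mono[OF n(2)] C(1)]])
    from Bs_kernel_like(1)[OF this C(1), of "G j"] show ?thesis
      unfolding n(1) using j by (simp add: G_def i_def)
  qed
  have P4: "G j = (\<lambda>u x. 0)" if "j \<notin> {-1..int \<beta> - 4}" for j using that unfolding G_def by auto
  have bp: "bound_projection (real \<beta>) H u = (\<lambda>x. 0)" for u by (rule bound_projection_zero[OF b0])
  have Gm2: "G (-2) = (\<lambda>u x. 0)" by (rule P4) simp
  \<comment> \<open>Pairing k with row p gives - \<Psi> p and with column q gives - cnj (\<Psi> q),
    the latter by hermitian symmetry of the threshold kernel. These signs cancel each other, and the
    sign of \<open>l 0\<close> cancels the one in \<open>g0\<close>.\<close>
  have leading: "g 0 p q = (\<Sum>\<Psi>\<in>B. \<Psi> p * cnj (\<Psi> q))" for p q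
  proof -
    obtain D where D: "adm D (free_res E att 0)" using adm_free_res_0 by blast
    have r: "cinner (arow_coef 0 p) (kv \<Psi>) = - \<Psi> p" if "\<Psi> \<in> B" for \<Psi>
    proof -
      have "arow_coef 0 p = arow 0 p" by (simp add: arow_coef_def arow_def free_coef_0_fun)
      thus ?thesis using kernel_v_cinner[OF D, of "kv \<Psi>" p] Psi[OF that, of p] by simp
    qed
    have s: "cinner (kv \<Psi>) (acol_coef 0 q) = - cnj (\<Psi> q)" if "\<Psi> \<in> B" for \<Psi>
    proof -
      have "cinner (kv \<Psi>) (acol_coef 0 q) = cnj (cinner (acol_coef 0 q) (kv \<Psi>))" by (rule cinner_commute)
      also have "cinner (acol_coef 0 q) (kv \<Psi>) = (\<Sum>\<^sub>\<infinity>p. cnj (free_res E att 0 p q) * v (kv \<Psi>) p)"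
        unfolding acol_coef_def free_coef_0_fun adjoint_char[OF adm_dom(1)[OF D]] pairing_def ..
      also have "\<dots> = G0 (v (kv \<Psi>)) q"
        unfolding kernel_op_def free_res_0_hermitian[OF graph, symmetric] ..
      finally show ?thesis using Psi[OF that, of q] by simp
    qed
    have "g 0 p q = (\<Sum>\<Psi>\<in>B. cinner (kv \<Psi>) (acol_coef 0 q) * cinner (arow_coef 0 p) (kv \<Psi>))"
      unfolding g0 l0 by (simp add: blinfun.minus_left blinfun.sum_left rank1_apply cinner_minus_right
          cinner_sum_right cinner_scaleC_right)
    also have "\<dots> = (\<Sum>\<Psi>\<in>B. \<Psi> p * cnj (\<Psi> q))"
      by (intro sum.cong refl) (simp add: r s)
    finally show ?thesis .
  qed
  have rp: "resonance_projection (real \<beta>) H = rank_sum B" by (simp add: resonance_projection_def B_def)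
  have Gm1: "G (-1) = kernel_op (g 0)" using Gi[of 0] beta by simp
  have P6: "G (-1) u = resonance_projection (real \<beta>) H u" if u: "u \<in> L1 1" for u
  proof
    fix p
    have u0: "u \<in> L1 (real 0)" using L1_mono(1)[of u 1 0] u by simp
    have sm: "((\<lambda>q. cnj (\<Psi> q) * u q) has_sum pairing \<Psi> u) UNIV" if \<Psi>: "\<Psi> \<in> B" for \<Psi>
    proof -
      obtain C where C: "\<And>p. norm (\<Psi> p) \<le> C" using is_res_bounded[OF res[OF \<Psi>]] by blast
      have "(\<lambda>q. cnj (\<Psi> q) * u q) summable_on UNIV"
        by (rule L1_pairing(2)[OF u0, where B = C]) (use C in simp)
      thus ?thesis unfolding pairing_def by (rule has_sum_infsum)
    qed
    have "((\<lambda>q. \<Sum>\<Psi>\<in>B. \<Psi> p * (cnj (\<Psi> q) * u q)) has_sum (\<Sum>\<Psi>\<in>B. \<Psi> p * pairing \<Psi> u)) UNIV"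
      by (intro has_sum_sum_finite has_sum_cmult_right sm fin)
    moreover have "(\<Sum>\<Psi>\<in>B. \<Psi> p * (cnj (\<Psi> q) * u q)) = g 0 p q * u q" for q
      unfolding leading by (simp add: sum_distrib_right mult.assoc)
    ultimately have "kernel_op (g 0) u p = (\<Sum>\<Psi>\<in>B. \<Psi> p * pairing \<Psi> u)"
      unfolding kernel_op_def by (simp add: infsumI)
    thus "G (-1) u p = resonance_projection (real \<beta>) H u p"
      unfolding Gm1 rp rank_sum_def by (simp add: mult.commute)
  qed
  have P7: "\<exists>u\<in>L1 1. resonance_projection (real \<beta>) H u \<noteq> (\<lambda>x. 0)"
  proof -
    obtain \<Phi> where \<Phi>: "\<Phi> \<in> resonance_space (real \<beta>) H" "\<Phi> \<notin> bound_space (real \<beta>) H" using ne by blast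
    have "\<exists>\<Psi>\<in>B. \<exists>p. \<Psi> p \<noteq> 0"
    proof (rule ccontr)
      assume "\<not> ?thesis"
      hence z: "(\<Sum>\<Psi>\<in>B. a \<Psi> * \<Psi> x) = 0" for a x
        by (intro sum.neutral) auto
      obtain a where "(\<lambda>x. \<Phi> x - (\<Sum>\<Psi>\<in>B. a \<Psi> * \<Psi> x)) \<in> bound_space (real \<beta>) H" using Bspan[OF \<Phi>(1)] by blast
      thus False using \<Phi>(2) by (simp add: z)
    qed
    then obtain \<Psi> p where \<Psi>: "\<Psi> \<in> B" "\<Psi> p \<noteq> 0" by blast
    \<comment> \<open>Evaluated at p on the point mass at p, the projection gives the diagonal entry
      of its kernel, a sum of squares.\<close>
    have "resonance_projection (real \<beta>) H (point p) p = (\<Sum>\<Psi>\<in>B. complex_of_real ((norm (\<Psi> p))\<^sup>2))"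
      unfolding rp rank_sum_def pairing_point
      by (intro sum.cong refl) (simp add: complex_norm_square mult.commute flip: of_real_power)
    also have "\<dots> = complex_of_real (\<Sum>\<Psi>\<in>B. (norm (\<Psi> p))\<^sup>2)" by simp
    also have "(\<Sum>\<Psi>\<in>B. (norm (\<Psi> p))\<^sup>2) > 0" by (rule sum_pos2[OF fin \<Psi>(1)]) (use \<Psi>(2) in auto)
    hence "complex_of_real (\<Sum>\<Psi>\<in>B. (norm (\<Psi> p))\<^sup>2) \<noteq> 0" by (simp only: of_real_eq_0_iff)
    finally have "resonance_projection (real \<beta>) H (point p) \<noteq> (\<lambda>x. 0)" by metis
    thus ?thesis using point_L1[of p 1] by auto
  qed
  show ?thesis
    by (intro exI[of _ G] conjI ballI allI impI P1 P2 P3 P4 P6 P7 bp) (simp_all only: Gm2 bp not_False_eq_True)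
qed

end

theorem theorem3p6:
  fixes E0 :: "'k::finite \<Rightarrow> 'k \<Rightarrow> bool"
    and att :: "'r::finite \<Rightarrow> 'k"
    and V H :: "('k, 'r) oper"
    and v :: "'h::complex_hilbert \<Rightarrow> ('k, 'r) state"
    and U :: "'h \<Rightarrow> 'h"
    and \<beta> :: nat
  assumes graph: "simple_connected_graph E0"
    and beta: "\<beta> \<ge> 3"
    and V: "assumption_A (real \<beta>) V v U"
    and H: "H = H_op E0 att V"
    and first_kind: "exceptional_first_kind (real \<beta>) H"
  shows "\<exists>G :: int \<Rightarrow> ('k, 'r) oper.
    (\<forall>\<^sub>F \<kappa> in at 0 within {\<kappa>. Re \<kappa> > 0}.
        - \<kappa>\<^sup>2 \<notin> ell2_spectrum H \<and>
        expansion_remainder H G (int \<beta> - 4) \<kappa> \<in> Bs (real \<beta> - 1)) \<and>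
    (\<lambda>\<kappa>. Bs_norm (real \<beta> - 1) (expansion_remainder H G (int \<beta> - 4) \<kappa>))
        \<in> O[at 0 within {\<kappa>. Re \<kappa> > 0}](\<lambda>\<kappa>. norm \<kappa> ^ (\<beta> - 3)) \<and>
    (\<forall>j\<in>{-1..int \<beta> - 4}. G j \<in> Bs (of_int (if even j then j + 3 else j + 2))) \<and>
    (\<forall>j. j \<notin> {-1..int \<beta> - 4} \<longrightarrow> G j = (\<lambda>u x. 0)) \<and>
    (\<forall>u\<in>L1 1. G (-2) u = bound_projection (real \<beta>) H u \<and>
              bound_projection (real \<beta>) H u = (\<lambda>x. 0)) \<and>
    (\<forall>u\<in>L1 1. G (-1) u = resonance_projection (real \<beta>) H u) \<and>
    (\<exists>u\<in>L1 1. resonance_projection (real \<beta>) H u \<noteq> (\<lambda>x. 0))"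
proof -
  interpret threshold_setting V v U \<beta> E0 att
    using V graph beta by unfold_locales
  show ?thesis
    using resolvent_expansion_first_kind first_kind unfolding H .
qed

end
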